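(* For $\lambda\ge0$ let $\mathbf{B}(\lambda)\in\mathbb{R}^{n\times n}$ be symmetric with $\{B_{ij}\}_{i\le j}$ independent, $B_{ij}\sim\mathsf{N}(\lambda/n,1/n)$ for $i<j$ and $B_{ii}\sim\mathsf{N}(\lambda/n,2/n)$. Then: (a) If $\lambda\in[0,1]$, then for every $\varepsilon>0$, $\mathrm{SDP}(\mathbf{B}(\lambda))/n\in[2-\varepsilon,2+\varepsilon]$ with probability converging to one as $n\to\infty$. (b) If $\lambda>1$, then there exists $\Delta(\lambda)>0$ such that $\mathrm{SDP}(\mathbf{B}(\lambda))/n\ge2+\Delta(\lambda)$ with probability converging to one as $n\to\infty$.
   Context: $\mathrm{SDP}(\mathbf{M})=\max\{\mathrm{Tr}(\mathbf{M}\mathbf{X}):\ \mathbf{X}\succeq0,\ X_{ii}=1\ \forall i\in[n]\}$ for symmetric $\mathbf{M}$. *)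

theory Defs
  imports "HOL-Probability.Probability" "Jordan_Normal_Form.Matrix"
begin

text \<open>Matrices are those of the AFP entry Jordan_Normal_Form, with rows and columns indexed
  from 0. The vector operations below are written in prefix form because their infix symbols
  clash with those of HOL-Analysis.\<close>

definition mat_trace :: "real mat \<Rightarrow> real" where
  "mat_trace A = (\<Sum>i<dim_row A. A $$ (i, i))"

definition psd_mat :: "nat \<Rightarrow> real mat \<Rightarrow> bool" where
  "psd_mat n X \<longleftrightarrow> X \<in> carrier_mat n n \<and> transpose_mat X = X \<and>
     (\<forall>v \<in> carrier_vec n. scalar_prod v (mult_mat_vec X v) \<ge> 0)"

definition elliptope :: "nat \<Rightarrow> real mat set" where
  "elliptope n = {X. psd_mat n X \<and> (\<forall>i<n. X $$ (i, i) = 1)}"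

text \<open>The supremum is a maximum; see \<open>sdp_is_max\<close> below.\<close>

definition sdp :: "real mat \<Rightarrow> real" where
  "sdp A = (SUP X \<in> elliptope (dim_row A). mat_trace (A * X))"

lemma quadratic_form_eq:
  assumes "X \<in> carrier_mat n n" "v \<in> carrier_vec n"
  shows "scalar_prod v (mult_mat_vec X v) = (\<Sum>i<n. \<Sum>j<n. vec_index v i * X $$ (i, j) * vec_index v j)"
  using assms
  by (auto simp: scalar_prod_def lessThan_atLeast0 sum_distrib_left mult.assoc intro!: sum.cong)

lemma elliptope_symmetric:
  assumes "X \<in> elliptope n" "i < n" "j < n"
  shows "X $$ (j, i) = X $$ (i, j)"
proof -
  have X: "X \<in> carrier_mat n n" "transpose_mat X = X"
    using assms by (auto simp: elliptope_def psd_mat_def)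
  have "transpose_mat X $$ (i, j) = X $$ (j, i)"
    using X(1) assms by auto
  then show ?thesis using X by simp
qed

lemma elliptope_entry_bound:
  assumes X: "X \<in> elliptope n" and ij: "i < n" "j < n"
  shows "\<bar>X $$ (i, j)\<bar> \<le> 1"
proof (cases "i = j")
  case True
  then show ?thesis using X ij by (auto simp: elliptope_def)
next
  case False
  have C: "X \<in> carrier_mat n n" and D: "X $$ (i, i) = 1" "X $$ (j, j) = 1"
    using X ij by (auto simp: elliptope_def psd_mat_def)
  have "0 \<le> 2 + 2 * s * X $$ (i, j)" if s: "s * s = 1" for s :: real
  proof -
    define w where "w k = (if k = i then 1 else 0) + (if k = j then s else 0)" for k
    define v where "v = Matrix.vec n w"
    have v: "v \<in> carrier_vec n" by (simp add: v_def)
    have row: "(\<Sum>l<n. f l * w l) = f i + s * f j" for f :: "nat \<Rightarrow> real"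
      using ij by (simp add: w_def distrib_left sum.distrib if_distrib[where f = "(*) _"]
          cong: if_cong)
    have "0 \<le> scalar_prod v (mult_mat_vec X v)"
      using X v by (auto simp: elliptope_def psd_mat_def)
    also have "\<dots> = (\<Sum>k<n. \<Sum>l<n. (w k * X $$ (k, l)) * w l)"
      unfolding quadratic_form_eq[OF C v] by (intro sum.cong) (auto simp: v_def)
    also have "\<dots> = (\<Sum>k<n. (X $$ (k, i) + s * X $$ (k, j)) * w k)"
      by (intro sum.cong refl, subst row) (simp add: algebra_simps)
    also have "\<dots> = X $$ (i, i) + s * X $$ (i, j) + s * (X $$ (j, i) + s * X $$ (j, j))"
      by (rule row)
    also have "\<dots> = 2 + 2 * s * X $$ (i, j)"
      using D s elliptope_symmetric[OF X ij] by (simp add: algebra_simps)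
    finally show ?thesis .
  qed
  from this[of 1] this[of "-1"] show ?thesis by (simp add: abs_le_iff)
qed

lemma sdp_is_max:
  assumes A: "A \<in> carrier_mat n n"
  shows "\<exists>X \<in> elliptope n. sdp A = mat_trace (A * X) \<and>
           (\<forall>Y \<in> elliptope n. mat_trace (A * Y) \<le> mat_trace (A * X))"
proof -
  define Q where "Q w f = (\<Sum>i<n. \<Sum>j<n. w i * f (i, j) * w j)"
    for w :: "nat \<Rightarrow> real" and f :: "nat \<times> nat \<Rightarrow> real"
  define S where "S = {f. (\<forall>p. \<bar>f p\<bar> \<le> 1) \<and> (\<forall>i<n. f (i, i) = 1)
      \<and> (\<forall>i<n. \<forall>j<n. f (j, i) = f (i, j)) \<and> (\<forall>w. 0 \<le> Q w f)}"
  define T where "T f = (\<Sum>i<n. \<Sum>j<n. A $$ (i, j) * f (j, i))" for f :: "nat \<times> nat \<Rightarrow> real"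
  have coord: "continuous_on UNIV (\<lambda>f :: nat \<times> nat \<Rightarrow> real. f p)" for p
    by (rule continuous_on_product_coordinates)
  have "closed S"
    unfolding S_def Q_def
    by (intro closed_Collect_conj closed_Collect_all closed_Collect_imp open_Collect_const
        closed_Collect_le closed_Collect_eq continuous_intros coord)
  have "compactin (product_topology (\<lambda>_. euclidean) UNIV)
      (PiE (UNIV :: (nat \<times> nat) set) (\<lambda>_. {-1..1 :: real}))"
    by (subst compactin_PiE) (simp add: compactin_euclidean_iff)
  then have "compact (PiE (UNIV :: (nat \<times> nat) set) (\<lambda>_. {-1..1 :: real}))"
    by (simp add: euclidean_product_topology compactin_euclidean_iff)
  moreover have "S \<subseteq> PiE UNIV (\<lambda>_. {-1..1})"
    by (auto simp: S_def PiE_UNIV_domain abs_le_iff)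
  ultimately have "compact S"
    using \<open>closed S\<close> by (metis compact_Int_closed inf.absorb_iff2)
  have TM: "mat_trace (A * X) = T (\<lambda>p. X $$ p)" if "X \<in> carrier_mat n n" for X
    using A that by (auto simp: mat_trace_def T_def scalar_prod_def lessThan_atLeast0)
  have S_mat: "Matrix.mat n n f \<in> elliptope n \<and> mat_trace (A * Matrix.mat n n f) = T f" if "f \<in> S" for f
  proof -
    have "0 \<le> scalar_prod v (mult_mat_vec (Matrix.mat n n f) v)" if v: "v \<in> carrier_vec n" for v
    proof -
      have "0 \<le> Q (\<lambda>i. vec_index v i) f" using \<open>f \<in> S\<close> by (simp add: S_def)
      also have "\<dots> = scalar_prod v (mult_mat_vec (Matrix.mat n n f) v)"
        by (subst quadratic_form_eq[of _ n]) (use v in \<open>auto simp: Q_def\<close>)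
      finally show ?thesis .
    qed
    moreover have "T (\<lambda>p. Matrix.mat n n f $$ p) = T f"
      by (auto simp: T_def intro!: sum.cong)
    ultimately show ?thesis using that
      by (auto simp: elliptope_def psd_mat_def S_def TM intro!: eq_matI)
  qed
  have mat_S: "\<exists>f \<in> S. mat_trace (A * X) = T f" if X: "X \<in> elliptope n" for X
  proof -
    define f where "f = (\<lambda>(i, j). if i < n \<and> j < n then X $$ (i, j) else 0)"
    have C: "X \<in> carrier_mat n n" using X by (auto simp: elliptope_def psd_mat_def)
    have "0 \<le> Q w f" for w
    proof -
      have "0 \<le> scalar_prod (Matrix.vec n w) (mult_mat_vec X (Matrix.vec n w))"
        using X by (auto simp: elliptope_def psd_mat_def)
      also have "\<dots> = Q w f"
        by (subst quadratic_form_eq[OF C]) (auto simp: Q_def f_def intro!: sum.cong)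
      finally show ?thesis .
    qed
    moreover have "\<bar>f p\<bar> \<le> 1" for p
      using elliptope_entry_bound[OF X] by (auto simp: f_def split: prod.split)
    ultimately have "f \<in> S"
      using X elliptope_symmetric[OF X] elliptope_entry_bound[OF X]
      by (auto simp: S_def f_def elliptope_def)
    moreover have "mat_trace (A * X) = T f"
      unfolding TM[OF C] by (auto simp: T_def f_def intro!: sum.cong)
    ultimately show ?thesis by blast
  qed
  have "1\<^sub>m n \<in> elliptope n"
  proof -
    have "scalar_prod v v \<ge> 0" if "v \<in> carrier_vec n" for v :: "real vec"
      by (auto simp: scalar_prod_def intro: sum_nonneg)
    then show ?thesis by (auto simp: elliptope_def psd_mat_def)
  qed
  then have "S \<noteq> {}" using mat_S by blast
  moreover have "continuous_on S T"
    unfolding T_def by (intro continuous_intros continuous_on_subset[OF coord]) auto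
  ultimately obtain f where f: "f \<in> S" "\<And>g. g \<in> S \<Longrightarrow> T g \<le> T f"
    using continuous_attains_sup[OF \<open>compact S\<close>] by blast
  define X where "X = Matrix.mat n n f"
  have X: "X \<in> elliptope n" "mat_trace (A * X) = T f"
    using S_mat[OF f(1)] by (auto simp: X_def)
  have max: "mat_trace (A * Y) \<le> mat_trace (A * X)" if "Y \<in> elliptope n" for Y
    using mat_S[OF that] f(2) X(2) by auto
  have "sdp A = mat_trace (A * X)"
    using A X max by (auto simp: sdp_def intro!: cSup_eq_maximum rev_image_eqI[OF X(1)])
  then show ?thesis using X max by blast
qed

text \<open>The second parameter of \<^const>\<open>normal_density\<close> is the standard deviation, hence the
  square roots of the variances \<open>1/n\<close> and \<open>2/n\<close>.\<close>

definition deformed_goe :: "real \<Rightarrow> nat \<Rightarrow> 'a measure \<Rightarrow> ('a \<Rightarrow> real mat) \<Rightarrow> bool" where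
  "deformed_goe lam n M B \<longleftrightarrow>
     prob_space M \<and>
     (\<forall>\<omega> \<in> space M. B \<omega> \<in> carrier_mat n n \<and> transpose_mat (B \<omega>) = B \<omega>) \<and>
     prob_space.indep_vars M (\<lambda>_. borel) (\<lambda>p \<omega>. B \<omega> $$ p) {(i, j). i \<le> j \<and> j < n} \<and>
     (\<forall>i j. i < j \<and> j < n \<longrightarrow>
        distributed M lborel (\<lambda>\<omega>. B \<omega> $$ (i, j)) (normal_density (lam / n) (sqrt (1 / n)))) \<and>
     (\<forall>i<n.
        distributed M lborel (\<lambda>\<omega>. B \<omega> $$ (i, i)) (normal_density (lam / n) (sqrt (2 / n))))"

end

theory Submission
imports Defs "HOL-Real_Asymp.Real_Asymp" "Jordan_Normal_Form.Determinant"
begin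

text \<open>
  Write \<open>B = W + (\<lambda>/n) 1 1\<^sup>T\<close> with \<open>W\<close> a GOE matrix.

  Upper bound: \<open>SDP(B) \<le> n c\<close> as soon as \<open>\<langle>v, B v\<rangle> \<le> c |v|\<^sup>2\<close> for all \<open>v\<close>. Slepian's inequality compares
  \<open>\<langle>x, W x\<rangle> + \<xi> (2/n)\<^sup>1\<^sup>/\<^sup>2\<close> on the unit sphere, with \<open>\<xi>\<close> an independent standard normal that equalises the
  variances, to \<open>2 n\<^sup>-\<^sup>1\<^sup>/\<^sup>2 \<langle>h, x\<rangle>\<close>. If \<open>t\<close> is the squared overlap of \<open>x\<close> with the normalised all-ones vector,
  the comparison process plus the spike is asymptotically at most \<open>2 (1 - t)\<^sup>1\<^sup>/\<^sup>2 + \<lambda> t\<close>, which is at most \<open>2\<close>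
  exactly when \<open>\<lambda> \<le> 1\<close>.

  Lower bound: let \<open>G = (W - z)\<^sup>-\<^sup>1\<close> with \<open>z = 2 + \<i> \<eta>\<close>. The matrix \<open>Im G\<close> is positive semidefinite and
  \<open>W Im G = 2 Im G + \<eta> Re G\<close>. The Schur complement formula gives \<open>G\<^sub>i\<^sub>i \<approx> m\<close> for the root \<open>m\<close> of
  \<open>m\<^sup>2 + z m + 1 = 0\<close> in the upper half plane, and \<open>Im m\<close> is of order \<open>\<eta>\<^sup>1\<^sup>/\<^sup>2\<close>. So \<open>Im G\<close>, normalised to unit
  diagonal, has value \<open>2 n\<close> up to an error of relative order \<open>\<eta>\<^sup>1\<^sup>/\<^sup>4\<close>. For \<open>\<lambda> > 1\<close> one adds a small multiple
  \<open>\<alpha>\<^sup>2 Re (\<phi> \<phi>\<^sup>*)\<close> with \<open>\<phi> = (W - 2 - \<i> \<eta>')\<^sup>-\<^sup>1 1\<close>. If \<open>n q\<close> is the sum of the entries of \<open>\<phi>\<close>, then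
  \<open>\<langle>\<phi>, (B - 2) \<phi>\<rangle> = n (Re q + \<lambda> |q|\<^sup>2)\<close>, and \<open>q \<approx> -1\<close> for small \<open>\<eta>'\<close>, so this gains \<open>\<alpha>\<^sup>2 (\<lambda> - 1) n\<close>, while
  renormalising the diagonal only costs \<open>O(\<alpha>\<^sup>4 n)\<close>.

  The lower bounds are proved with probability at least \<open>1/4\<close>. This suffices because \<open>SDP(B)/n\<close> is Lipschitz
  in each entry with constant \<open>O(n\<^sup>-\<^sup>1)\<close>, hence has variance \<open>O(n\<^sup>-\<^sup>1)\<close>.
\<close>

section \<open>Standard Gaussian vectors\<close>

text \<open>No eigenvalue or eigenvector is used. Spectral information enters through quadratic
  forms and through resolvents at a fixed distance \<eta> from the real axis. Since \<eta> is chosen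
  before n grows, every power of 1/\<eta> is a constant and only the order in n has to be tracked.
  Im G acts as a smooth substitute for a spectral projector at the edge 2. Its diagonal is
  computable from the Schur complement, so normalising it is cheap, whereas a point built from top
  eigenvectors would require their delocalisation. In the supercritical case the order of choices is
  forced: the fourth moments of \<phi> blow up as \<eta>' shrinks, so \<eta>' is fixed first, then
  \<alpha>, whose fourth power must lose against its square, and \<eta> last. Only second moments
  and Markov's inequality with fixed thresholds are used for the resolvent. Several such events have
  to hold together, which is why the lower bounds stop at a constant probability.\<close>

abbreviation "N01 \<equiv> std_normal_distribution"
abbreviation "gauss J \<equiv> Pi\<^sub>M J (\<lambda>_. N01)"

lemma prob_space_N01: "prob_space N01"
  using real_dist_normal_dist by (simp add: real_distribution_def)

interpretation N01: prob_space N01 by (rule prob_space_N01)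

lemma product_sigma_finite_N01: "product_sigma_finite (\<lambda>_. N01)"
  by standard

lemma product_prob_space_N01: "product_prob_space (\<lambda>_. N01)"
  by standard

lemma prob_space_gauss: "prob_space (gauss J)"
  by (rule prob_space_PiM) (rule prob_space_N01)

section \<open>Gaussian integration by parts and moments up to order four\<close>

text \<open>The density times \<open>f\<close> has derivative density times
  \<open>f' y - y * f y\<close> and vanishes at both infinities, so the fundamental theorem of
  calculus on the real line applies. Growth up to the cube covers the cubic monomials that fourth
  moments require.\<close>

lemma N01_stein:
  fixes f f' :: "real \<Rightarrow> real"
  assumes d: "\<And>y. (f has_real_derivative f' y) (at y)"
    and c: "continuous_on UNIV f'"
    and b: "\<And>y. \<bar>f y\<bar> \<le> C * (1 + \<bar>y\<bar>^3)" and b': "\<And>y. \<bar>f' y\<bar> \<le> C * (1 + \<bar>y\<bar>^3)"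
  shows "(\<integral>y. y * f y \<partial>N01) = (\<integral>y. f' y \<partial>N01)"
    "integrable N01 (\<lambda>y. y * f y)" "integrable N01 f'"
proof -
  have cf: "continuous_on UNIV f"
    using d by (auto intro!: DERIV_continuous_on)
  have m[measurable]: "f \<in> borel_measurable borel" "f' \<in> borel_measurable borel"
    using c cf by (auto intro: borel_measurable_continuous_onI)
  have i1: "integrable lborel (\<lambda>y. std_normal_density y * (C * (\<bar>y\<bar>^k + \<bar>y\<bar>^(k+3))))" for k
    using integrable_std_normal_moment_abs[of k] integrable_std_normal_moment_abs[of "k+3"]
    by (auto simp: algebra_simps intro!: integrable_add integrable_mult_right)
  have I1: "integrable lborel (\<lambda>y. std_normal_density y * (y * f y))"
  proof (rule Bochner_Integration.integrable_bound[OF i1[of 1]])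
    show "AE y in lborel. norm (std_normal_density y * (y * f y)) \<le> norm (std_normal_density y * (C * (\<bar>y\<bar>^1 + \<bar>y\<bar>^(1+3))))"
    proof (rule AE_I2)
      fix y :: real
      have "\<bar>y\<bar> * \<bar>f y\<bar> \<le> \<bar>y\<bar> * (C * (1 + \<bar>y\<bar>^3))"
        by (intro mult_left_mono b) auto
      also have "\<dots> \<le> \<bar>C * (\<bar>y\<bar>^1 + \<bar>y\<bar>^(1+3))\<bar>"
        by (rule order_trans[OF _ abs_ge_self]) (simp add: algebra_simps power_add numeral_eq_Suc)
      finally show "norm (std_normal_density y * (y * f y)) \<le> norm (std_normal_density y * (C * (\<bar>y\<bar>^1 + \<bar>y\<bar>^(1+3))))"
        by (simp add: abs_mult mult_left_mono)
    qed
  qed simp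
  have I2: "integrable lborel (\<lambda>y. std_normal_density y * f' y)"
  proof (rule Bochner_Integration.integrable_bound[OF i1[of 0]])
    show "AE y in lborel. norm (std_normal_density y * f' y) \<le> norm (std_normal_density y * (C * (\<bar>y\<bar>^0 + \<bar>y\<bar>^(0+3))))"
    proof (rule AE_I2)
      fix y :: real
      have "\<bar>f' y\<bar> \<le> \<bar>C * (\<bar>y\<bar>^0 + \<bar>y\<bar>^(0+3))\<bar>" using b'[of y] by auto
      then show "norm (std_normal_density y * f' y) \<le> norm (std_normal_density y * (C * (\<bar>y\<bar>^0 + \<bar>y\<bar>^(0+3))))"
        unfolding real_norm_def abs_mult[of "std_normal_density y"]
        by (intro mult_left_mono) auto
    qed
  qed simp
  have D: "((\<lambda>y. std_normal_density y * f y) has_real_derivative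
      (std_normal_density y * f' y - std_normal_density y * (y * f y))) (at y)" for y
  proof -
    have "((\<lambda>y. c * exp (- y\<^sup>2 / 2) * f y) has_real_derivative
      (c * exp (- y\<^sup>2 / 2) * f' y - c * exp (- y\<^sup>2 / 2) * (y * f y))) (at y)" for c
      by (auto intro!: derivative_eq_intros d simp: algebra_simps)
    then show ?thesis unfolding std_normal_density_def .
  qed
  have lim: "((\<lambda>y. std_normal_density y * f y) \<longlongrightarrow> 0) F"
    if F: "F = at_top \<or> F = at_bot" for F
  proof (rule Lim_null_comparison)
    show "\<forall>\<^sub>F y in F. norm (std_normal_density y * f y) \<le> std_normal_density y * (C * (1 + \<bar>y\<bar>^3))"
      using b by (intro always_eventually) (auto simp: abs_mult intro!: mult_left_mono)
    show "((\<lambda>y. std_normal_density y * (C * (1 + \<bar>y\<bar>^3))) \<longlongrightarrow> 0) F"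
      using F unfolding std_normal_density_def
      by (elim disjE; simp only:; real_asymp)
  qed
  have "(LBINT y=-\<infinity>..\<infinity>. std_normal_density y * f' y - std_normal_density y * (y * f y)) = 0 - 0"
  proof (rule interval_integral_FTC_integrable)
    show "set_integrable lborel (einterval (-\<infinity>) \<infinity>) (\<lambda>y. std_normal_density y * f' y - std_normal_density y * (y * f y))"
      unfolding set_integrable_def using I1 I2 by simp
    show "(((\<lambda>y. std_normal_density y * f y) \<circ> real_of_ereal) \<longlongrightarrow> 0) (at_right (-\<infinity>))"
      using lim[of at_bot] unfolding at_right_MInf by (simp add: filterlim_filtermap comp_def)
    show "(((\<lambda>y. std_normal_density y * f y) \<circ> real_of_ereal) \<longlongrightarrow> 0) (at_left \<infinity>)"
      using lim[of at_top] unfolding at_left_PInf by (simp add: filterlim_filtermap comp_def)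
    show "isCont (\<lambda>y. std_normal_density y * f' y - std_normal_density y * (y * f y)) x" for x
      using c cf unfolding std_normal_density_def
      by (intro continuous_intros) (auto simp: continuous_on_eq_continuous_at)
  qed (auto intro!: has_real_derivative_iff_has_vector_derivative[THEN iffD1] D)
  then have "(\<integral>y. std_normal_density y * f' y - std_normal_density y * (y * f y) \<partial>lborel) = 0"
    by (simp add: interval_integral_to_infinity_eq interval_lebesgue_integral_def set_lebesgue_integral_def)
  then have "(\<integral>y. std_normal_density y * f' y \<partial>lborel) = (\<integral>y. std_normal_density y * (y * f y) \<partial>lborel)"
    using I1 I2 by simp
  then show "(\<integral>y. y * f y \<partial>N01) = (\<integral>y. f' y \<partial>N01)"
    by (simp add: integral_density)
  show "integrable N01 (\<lambda>y. y * f y)" "integrable N01 f'"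
    using I1 I2 by (auto simp: integrable_density)
qed


lemma gauss_stein:
  fixes f f' :: "('i \<Rightarrow> real) \<Rightarrow> real"
  assumes J: "finite J" "p \<in> J"
    and d: "\<And>g y. ((\<lambda>y. f (g(p := y))) has_real_derivative f' (g(p := y))) (at y)"
    and c: "\<And>g. continuous_on UNIV (\<lambda>y. f' (g(p := y)))"
    and b: "\<And>g. \<exists>C. \<forall>y. \<bar>f (g(p := y))\<bar> \<le> C * (1 + \<bar>y\<bar>^3) \<and> \<bar>f' (g(p := y))\<bar> \<le> C * (1 + \<bar>y\<bar>^3)"
    and i: "integrable (gauss J) (\<lambda>g. g p * f g)" "integrable (gauss J) f'"
  shows "(\<integral>g. g p * f g \<partial>gauss J) = (\<integral>g. f' g \<partial>gauss J)"
proof -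
  interpret product_sigma_finite "\<lambda>_::'i. N01" by (rule product_sigma_finite_N01)
  define K where "K = J - {p}"
  have K: "finite K" "p \<notin> K" "J = insert p K" using J by (auto simp: K_def)
  have "(\<integral>g. g p * f g \<partial>gauss J) = (\<integral>g. (\<integral>y. y * f (g(p := y)) \<partial>N01) \<partial>gauss K)"
    using i(1) unfolding K(3) by (subst product_integral_insert[OF K(1,2)]) auto
  also have "\<dots> = (\<integral>g. (\<integral>y. f' (g(p := y)) \<partial>N01) \<partial>gauss K)"
  proof (rule Bochner_Integration.integral_cong[OF refl])
    fix g :: "'i \<Rightarrow> real"
    obtain C where C: "\<And>y. \<bar>f (g(p := y))\<bar> \<le> C * (1 + \<bar>y\<bar>^3)" "\<And>y. \<bar>f' (g(p := y))\<bar> \<le> C * (1 + \<bar>y\<bar>^3)"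
      using b[of g] by blast
    show "(\<integral>y. y * f (g(p := y)) \<partial>N01) = (\<integral>y. f' (g(p := y)) \<partial>N01)"
      by (rule N01_stein(1)[OF d c C])
  qed
  also have "\<dots> = (\<integral>g. f' g \<partial>gauss J)"
    using i(2) unfolding K(3) by (subst product_integral_insert[OF K(1,2)]) auto
  finally show ?thesis .
qed

lemma gauss_component:
  assumes "p \<in> J"
  shows "distr (gauss J) N01 (\<lambda>g. g p) = N01"
  using assms by (intro distr_PiM_component prob_space_N01)

lemma gauss_moment:
  assumes "p \<in> J"
  shows "integrable (gauss J) (\<lambda>g. g p ^ k)" "(\<integral>g. g p ^ k \<partial>gauss J) = (\<integral>x. x ^ k \<partial>N01)"
proof -
  have m: "(\<lambda>g. g p) \<in> measurable (gauss J) N01" using assms by measurable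
  have "integrable (distr (gauss J) N01 (\<lambda>g. g p)) (\<lambda>x. x ^ k)"
    unfolding gauss_component[OF assms] by (rule integrable_std_normal_distribution_moment)
  then show "integrable (gauss J) (\<lambda>g. g p ^ k)"
    by (subst (asm) integrable_distr_eq[OF m]) auto
  have "(\<integral>x. x ^ k \<partial>distr (gauss J) N01 (\<lambda>g. g p)) = (\<integral>g. g p ^ k \<partial>gauss J)"
    by (rule integral_distr[OF m]) auto
  then show "(\<integral>g. g p ^ k \<partial>gauss J) = (\<integral>x. x ^ k \<partial>N01)"
    unfolding gauss_component[OF assms] ..
qed

lemma abs_mult4_le: "\<bar>a * b * c * d\<bar> \<le> a^4 + b^4 + c^4 + d^4" for a b c d :: real
proof -
  have 1: "\<bar>x * y\<bar> \<le> (x\<^sup>2 + y\<^sup>2) / 2" for x y :: real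
    using zero_le_power2[of "\<bar>x\<bar> - \<bar>y\<bar>"] by (simp add: power2_diff abs_mult)
  have "\<bar>(a * b) * (c * d)\<bar> \<le> ((a * b)\<^sup>2 + (c * d)\<^sup>2) / 2" by (rule 1)
  moreover have "(a * b)\<^sup>2 \<le> (a^4 + b^4) / 2" "(c * d)\<^sup>2 \<le> (c^4 + d^4) / 2"
    using 1[of "a\<^sup>2" "b\<^sup>2"] 1[of "c\<^sup>2" "d\<^sup>2"] by (auto simp: power_mult_distrib)
  moreover have "0 \<le> a^4 + b^4 + c^4 + d^4" by simp
  ultimately show ?thesis by (simp add: mult.assoc)
qed

lemma gauss_integrable_mult4:
  assumes "p \<in> J" "q \<in> J" "r \<in> J" "s \<in> J"
  shows "integrable (gauss J) (\<lambda>g. g p * g q * g r * g s)"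
proof (rule Bochner_Integration.integrable_bound)
  show "integrable (gauss J) (\<lambda>g. g p ^ 4 + g q ^ 4 + g r ^ 4 + g s ^ 4)"
    by (intro Bochner_Integration.integrable_add gauss_moment assms)
  show "AE g in gauss J. norm (g p * g q * g r * g s) \<le> norm (g p ^ 4 + g q ^ 4 + g r ^ 4 + g s ^ 4)"
    unfolding real_norm_def
    by (intro AE_I2) (rule order_trans[OF abs_mult4_le abs_ge_self])
qed (use assms in measurable)

lemma gauss_integrable_mult2:
  assumes "p \<in> J" "q \<in> J"
  shows "integrable (gauss J) (\<lambda>g. g p * g q)"
proof (rule Bochner_Integration.integrable_bound)
  show "integrable (gauss J) (\<lambda>g. g p ^ 2 + g q ^ 2)"
    by (intro Bochner_Integration.integrable_add gauss_moment assms)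
  show "AE g in gauss J. norm (g p * g q) \<le> norm (g p ^ 2 + g q ^ 2)"
  proof (intro AE_I2)
    fix g :: "'a \<Rightarrow> real"
    show "norm (g p * g q) \<le> norm (g p ^ 2 + g q ^ 2)"
      using sum_squares_bound[of "\<bar>g p\<bar>" "\<bar>g q\<bar>"] mult_nonneg_nonneg[of "\<bar>g p\<bar>" "\<bar>g q\<bar>"]
      by (simp add: abs_mult del: mult_nonneg_nonneg zero_le_mult_iff)
  qed
qed (use assms in measurable)

lemma upd_bound: "\<bar>(g(p := y)) q\<bar> \<le> (1 + \<bar>g q\<bar>) * (1 + \<bar>y\<bar>)" for y :: real
  by (auto simp: algebra_simps)

text \<open>Turns products of the linear bounds from \<open>upd_bound\<close> into the cubic growth
  condition of \<open>gauss_stein\<close>.\<close>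

lemma cube_bound: "(1 + \<bar>y\<bar>)^3 \<le> 4 * (1 + \<bar>y\<bar>^3)" for y :: real
proof -
  have "4 * (1 + \<bar>y\<bar>^3) - (1 + \<bar>y\<bar>)^3 = 3 * (1 + \<bar>y\<bar>) * (1 - \<bar>y\<bar>)^2"
    by (simp add: power2_eq_square power3_eq_cube algebra_simps)
  moreover have "0 \<le> 3 * (1 + \<bar>y\<bar>) * (1 - \<bar>y\<bar>)^2" by simp
  ultimately show ?thesis by linarith
qed

lemma gauss_expect_mult2:
  assumes J: "finite J" "p \<in> J" "q \<in> J"
  shows "(\<integral>g. g p * g q \<partial>gauss J) = of_bool (p = q)"
proof -
  interpret prob_space "gauss J" by (rule prob_space_gauss)
  have "(\<integral>g. g p * g q \<partial>gauss J) = (\<integral>g. of_bool (p = q) \<partial>gauss J)"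
  proof (rule gauss_stein[OF J(1,2)])
    fix g :: "'a \<Rightarrow> real" and y
    show "((\<lambda>y. (g(p := y)) q) has_real_derivative of_bool (p = q)) (at y)"
      by (cases "p = q") (auto intro!: derivative_eq_intros)
    show "\<exists>C. \<forall>y. \<bar>(g(p := y)) q\<bar> \<le> C * (1 + \<bar>y\<bar>^3) \<and> \<bar>of_bool (p = q)\<bar> \<le> C * (1 + \<bar>y\<bar>^3)"
    proof (intro exI allI conjI)
      fix y :: real
      have *: "1 + \<bar>y\<bar> \<le> 4 * (1 + \<bar>y\<bar>^3)"
        using cube_bound[of y] power_increasing[of 1 3 "1 + \<bar>y\<bar>"] by simp
      show "\<bar>(g(p := y)) q\<bar> \<le> ((1 + \<bar>g q\<bar>) * 4) * (1 + \<bar>y\<bar>^3)"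
        unfolding mult.assoc by (rule order_trans[OF upd_bound]) (intro mult_left_mono *, simp)
      have "1 * 1 \<le> ((1 + \<bar>g q\<bar>) * 4) * (1 + \<bar>y\<bar>^3)" by (intro mult_mono) auto
      then show "\<bar>of_bool (p = q)\<bar> \<le> ((1 + \<bar>g q\<bar>) * 4) * (1 + \<bar>y\<bar>^3)"
        by (auto simp: of_bool_def)
    qed
  qed (use J gauss_integrable_mult2 in auto)
  then show ?thesis by (simp add: prob_space)
qed

text \<open>Wick's formula: Stein's identity in the coordinate \<open>p\<close> pairs it with each
  of the other three in turn and leaves second moments.\<close>

lemma gauss_expect_mult4:
  assumes J: "finite J" "p \<in> J" "q \<in> J" "r \<in> J" "s \<in> J"
  shows "(\<integral>g. g p * g q * g r * g s \<partial>gauss J) =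
    of_bool (p = q) * of_bool (r = s) + of_bool (p = r) * of_bool (q = s) + of_bool (p = s) * of_bool (q = r)"
proof -
  define f' :: "('a \<Rightarrow> real) \<Rightarrow> real"
    where "f' g = of_bool (p = q) * (g r * g s) + of_bool (p = r) * (g q * g s) + of_bool (p = s) * (g q * g r)" for g
  have "(\<integral>g. g p * (g q * g r * g s) \<partial>gauss J) = (\<integral>g. f' g \<partial>gauss J)"
  proof (rule gauss_stein[OF J(1,2)])
    fix g :: "'a \<Rightarrow> real" and y
    have d: "((\<lambda>y. (g(p := y)) q) has_real_derivative of_bool (p = q)) (at y)" for q
      by (cases "p = q") (auto intro!: derivative_eq_intros)
    show "((\<lambda>y. (g(p := y)) q * (g(p := y)) r * (g(p := y)) s) has_real_derivative f' (g(p := y))) (at y)"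
      unfolding f'_def
      by (rule DERIV_cong[OF DERIV_mult[OF DERIV_mult[OF d d] d]]) (simp add: algebra_simps)
    have cc: "continuous_on UNIV (\<lambda>y. (g(p := y)) q)" for q
      by (cases "p = q") (auto intro!: continuous_intros)
    show "continuous_on UNIV (\<lambda>y. f' (g(p := y)))"
      unfolding f'_def by (intro continuous_intros cc)
    show "\<exists>C. \<forall>y. \<bar>(g(p := y)) q * (g(p := y)) r * (g(p := y)) s\<bar> \<le> C * (1 + \<bar>y\<bar>^3) \<and>
                \<bar>f' (g(p := y))\<bar> \<le> C * (1 + \<bar>y\<bar>^3)"
    proof (intro exI allI conjI)
      fix y :: real
      \<comment> \<open>\<open>a\<close> dominates the factor of each of the three coordinates, so
        \<open>B\<close> bounds all of them after the update; \<open>1 \<le> B\<close> lets squares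
        be absorbed into cubes.\<close>
      define a where "a = (1 + \<bar>g q\<bar> + \<bar>g r\<bar> + \<bar>g s\<bar>)"
      define B where "B = a * (1 + \<bar>y\<bar>)"
      have a1: "1 \<le> a" by (simp add: a_def)
      have B1: "1 \<le> B" unfolding B_def using mult_mono[of 1 a 1 "1 + \<bar>y\<bar>"] a1 by simp
      have le: "\<bar>(g(p := y)) q\<bar> \<le> B" "\<bar>(g(p := y)) r\<bar> \<le> B" "\<bar>(g(p := y)) s\<bar> \<le> B"
        unfolding B_def a_def by (rule order_trans[OF upd_bound], intro mult_right_mono, simp, simp)+
      have B2: "B\<^sup>2 \<le> B^3" using B1 by (intro power_increasing) auto
      have B3: "B^3 \<le> 4 * a^3 * (1 + \<bar>y\<bar>^3)"
        using mult_left_mono[OF cube_bound[of y], of "a^3"] a1 unfolding B_def power_mult_distrib by simp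
      have "\<bar>(g(p := y)) q * (g(p := y)) r * (g(p := y)) s\<bar> \<le> B * B * B"
        unfolding abs_mult by (intro mult_mono le mult_nonneg_nonneg) (use B1 in auto)
      also have "\<dots> = B^3" by (simp add: power3_eq_cube)
      also have "B^3 \<le> 12 * a^3 * (1 + \<bar>y\<bar>^3)"
      proof -
        have "0 \<le> a^3 * (1 + \<bar>y\<bar>^3)" using a1 by (intro mult_nonneg_nonneg) auto
        then show ?thesis using B3 by linarith
      qed
      finally show "\<bar>(g(p := y)) q * (g(p := y)) r * (g(p := y)) s\<bar> \<le> (12 * a^3) * (1 + \<bar>y\<bar>^3)" .
      have two: "\<bar>of_bool b * ((g(p := y)) u * (g(p := y)) v)\<bar> \<le> B\<^sup>2"
        if "\<bar>(g(p := y)) u\<bar> \<le> B" "\<bar>(g(p := y)) v\<bar> \<le> B" for b u v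
      proof -
        have "\<bar>(g(p := y)) u * (g(p := y)) v\<bar> \<le> B * B"
          unfolding abs_mult by (intro mult_mono that) (use B1 in auto)
        then show ?thesis by (auto simp: of_bool_def power2_eq_square abs_mult simp del: fun_upd_apply)
      qed
      have "\<bar>f' (g(p := y))\<bar> \<le> B\<^sup>2 + B\<^sup>2 + B\<^sup>2"
        unfolding f'_def
        by (rule order_trans[OF abs_triangle_ineq], rule add_mono[OF order_trans[OF abs_triangle_ineq]])
           (intro add_mono two le)+
      also have "\<dots> \<le> 3 * B^3" using B2 by simp
      also have "\<dots> \<le> (12 * a^3) * (1 + \<bar>y\<bar>^3)" using B3 by simp
      finally show "\<bar>f' (g(p := y))\<bar> \<le> (12 * a^3) * (1 + \<bar>y\<bar>^3)" .
    qed
    show "integrable (gauss J) (\<lambda>g. g p * (g q * g r * g s))"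
      using gauss_integrable_mult4[OF J(2-5)] by (simp add: mult.assoc)
    show "integrable (gauss J) f'"
      unfolding f'_def using J by (intro Bochner_Integration.integrable_add integrable_mult_right gauss_integrable_mult2)
  qed
  also have "\<dots> = of_bool (p = q) * of_bool (r = s) + of_bool (p = r) * of_bool (q = s) + of_bool (p = s) * of_bool (q = r)"
    unfolding f'_def using J by (simp add: gauss_integrable_mult2 gauss_expect_mult2)
  finally show ?thesis by (simp add: mult.assoc)
qed

text \<open>Centring removes the pairing of \<open>a\<close> with \<open>b\<close> and of
  \<open>c\<close> with \<open>d\<close> from Wick's formula, so only the two cross pairings
  survive.\<close>

lemma gauss_expect_centered_mult:
  assumes J: "finite J" "a \<in> J" "b \<in> J" "c \<in> J" "d \<in> J"
  shows "integrable (gauss J) (\<lambda>g. (g a * g b - of_bool (a = b)) * (g c * g d - of_bool (c = d)))"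
    "(\<integral>g. (g a * g b - of_bool (a = b)) * (g c * g d - of_bool (c = d)) \<partial>gauss J)
      = of_bool (a = c \<and> b = d) + of_bool (a = d \<and> b = c)"
proof -
  interpret prob_space "gauss J" by (rule prob_space_gauss)
  have XX: "(g a * g b - of_bool (a = b)) * (g c * g d - of_bool (c = d)) = g a * g b * g c * g d
      - of_bool (a = b) * (g c * g d) - of_bool (c = d) * (g a * g b) + of_bool (a = b) * of_bool (c = d)" for g :: "'a \<Rightarrow> real"
    by (simp only: algebra_simps)
  note i = gauss_integrable_mult4[OF J(2-5)] gauss_integrable_mult2[OF J(2,3)] gauss_integrable_mult2[OF J(4,5)]
  show "integrable (gauss J) (\<lambda>g. (g a * g b - of_bool (a = b)) * (g c * g d - of_bool (c = d)))"
    unfolding XX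
    by (intro Bochner_Integration.integrable_add Bochner_Integration.integrable_diff integrable_mult_right i integrable_const)
  have "(\<integral>g. (g a * g b - of_bool (a = b)) * (g c * g d - of_bool (c = d)) \<partial>gauss J)
    = (\<integral>g. g a * g b * g c * g d \<partial>gauss J) - of_bool (a = b) * (\<integral>g. g c * g d \<partial>gauss J)
      - of_bool (c = d) * (\<integral>g. g a * g b \<partial>gauss J) + of_bool (a = b) * of_bool (c = d)"
    unfolding XX
    by (simp only: Bochner_Integration.integral_add Bochner_Integration.integral_diff integral_mult_right i integrable_const
        Bochner_Integration.integrable_add Bochner_Integration.integrable_diff integrable_mult_right prob_space lebesgue_integral_const) simp
  then show "(\<integral>g. (g a * g b - of_bool (a = b)) * (g c * g d - of_bool (c = d)) \<partial>gauss J)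
      = of_bool (a = c \<and> b = d) + of_bool (a = d \<and> b = c)"
    unfolding gauss_expect_mult4[OF J] gauss_expect_mult2[OF J(1,4,5)] gauss_expect_mult2[OF J(1-3)]
    by (simp add: of_bool_conj)
qed

text \<open>Centred products at \<open>(j, k)\<close> and \<open>(l, m)\<close> are uncorrelated
  unless the index pairs agree up to order. The second moment is therefore the sum of the squares of
  \<open>A j k\<close> plus that of the products of \<open>A j k\<close> and \<open>A k j\<close>,
  at most twice the squared Frobenius norm. The injection \<open>e\<close> lets \<open>S\<close> sit
  anywhere among the coordinates, such as along a matrix row.\<close>

lemma gauss_quadratic_form:
  fixes A :: "'s \<Rightarrow> 's \<Rightarrow> real" and e :: "'s \<Rightarrow> 'i"
  assumes J: "finite J" "finite S" "inj_on e S" "e ` S \<subseteq> J"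
  defines "Q \<equiv> \<lambda>g :: 'i \<Rightarrow> real. \<Sum>j\<in>S. \<Sum>k\<in>S. A j k * (g (e j) * g (e k) - of_bool (j = k))"
  shows "integrable (gauss J) (\<lambda>g. (Q g)\<^sup>2)"
    "(\<integral>g. (Q g)\<^sup>2 \<partial>gauss J) \<le> 2 * (\<Sum>j\<in>S. \<Sum>k\<in>S. (A j k)\<^sup>2)"
proof -
  interpret prob_space "gauss J" by (rule prob_space_gauss)
  have eJ: "e j \<in> J" if "j \<in> S" for j using that J by auto
  have ee: "(e j = e k) = (j = k)" if "j \<in> S" "k \<in> S" for j k using that J by (auto dest: inj_onD)
  define P where "P = S \<times> S"
  define X where "X = (\<lambda>x (g :: 'i \<Rightarrow> real). g (e (fst x)) * g (e (snd x)) - of_bool (fst x = snd x))"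
  have fP: "finite P" using J by (simp add: P_def)
  have Q: "Q g = (\<Sum>x\<in>P. A (fst x) (snd x) * X x g)" for g
    unfolding Q_def P_def X_def sum.cartesian_product by (simp add: case_prod_unfold)
  have sq: "(Q g)\<^sup>2 = (\<Sum>x\<in>P. \<Sum>y\<in>P. A (fst x) (snd x) * A (fst y) (snd y) * (X x g * X y g))" for g
    unfolding Q power2_eq_square sum_product by (simp add: algebra_simps)
  have XE: "integrable (gauss J) (\<lambda>g. X x g * X y g)"
    "(\<integral>g. X x g * X y g \<partial>gauss J) = of_bool (x = y) + of_bool (x = prod.swap y)" if "x \<in> P" "y \<in> P" for x y
  proof -
    obtain j k l m where xy: "x = (j, k)" "y = (l, m)" by (metis prod.collapse)
    then have m: "j \<in> S" "k \<in> S" "l \<in> S" "m \<in> S" using that by (auto simp: P_def)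
    note * = gauss_expect_centered_mult[OF J(1), of "e j" "e k" "e l" "e m", OF eJ eJ eJ eJ, OF m]
    show "integrable (gauss J) (\<lambda>g. X x g * X y g)"
      using *(1) by (simp add: X_def xy ee m)
    show "(\<integral>g. X x g * X y g \<partial>gauss J) = of_bool (x = y) + of_bool (x = prod.swap y)"
      using *(2) by (simp add: X_def xy ee m)
  qed
  show "integrable (gauss J) (\<lambda>g. (Q g)\<^sup>2)"
    unfolding sq by (intro Bochner_Integration.integrable_sum integrable_mult_right XE)
  have "(\<integral>g. (Q g)\<^sup>2 \<partial>gauss J) = (\<Sum>x\<in>P. \<Sum>y\<in>P. A (fst x) (snd x) * A (fst y) (snd y) * (of_bool (x = y) + of_bool (x = prod.swap y)))"
    unfolding sq by (simp add: XE)
  also have "\<dots> = (\<Sum>x\<in>P. A (fst x) (snd x) * A (fst x) (snd x) + A (fst x) (snd x) * A (snd x) (fst x))"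
  proof (rule sum.cong[OF refl])
    fix x assume x: "x \<in> P"
    have sw: "(x = prod.swap y) = (prod.swap x = y)" for y by (metis swap_swap)
    from x have sx: "prod.swap x \<in> P" by (auto simp: P_def)
    have "(\<Sum>y\<in>P. A (fst x) (snd x) * A (fst y) (snd y) * (of_bool (x = y) + of_bool (x = prod.swap y)))
        = (\<Sum>y\<in>P. if x = y then A (fst x) (snd x) * A (fst y) (snd y) else 0)
        + (\<Sum>y\<in>P. if prod.swap x = y then A (fst x) (snd x) * A (fst y) (snd y) else 0)"
      unfolding sum.distrib[symmetric] by (intro sum.cong refl) (simp add: of_bool_def sw)
    also have "\<dots> = A (fst x) (snd x) * A (fst x) (snd x) + A (fst x) (snd x) * A (snd x) (fst x)"
      using x sx fP by (simp add: sum.delta')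
    finally show "(\<Sum>y\<in>P. A (fst x) (snd x) * A (fst y) (snd y) * (of_bool (x = y) + of_bool (x = prod.swap y)))
       = A (fst x) (snd x) * A (fst x) (snd x) + A (fst x) (snd x) * A (snd x) (fst x)" .
  qed
  also have "\<dots> \<le> (\<Sum>x\<in>P. (A (fst x) (snd x))\<^sup>2 + ((A (fst x) (snd x))\<^sup>2 + (A (snd x) (fst x))\<^sup>2) / 2)"
  proof (rule sum_mono)
    fix x
    show "A (fst x) (snd x) * A (fst x) (snd x) + A (fst x) (snd x) * A (snd x) (fst x)
      \<le> (A (fst x) (snd x))\<^sup>2 + ((A (fst x) (snd x))\<^sup>2 + (A (snd x) (fst x))\<^sup>2) / 2"
      using sum_squares_bound[of "A (fst x) (snd x)" "A (snd x) (fst x)"] by (simp add: power2_eq_square field_simps)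
  qed
  also have "\<dots> = (\<Sum>x\<in>P. 3/2 * (A (fst x) (snd x))\<^sup>2 + 1/2 * (A (snd x) (fst x))\<^sup>2)"
    by (intro sum.cong refl) (simp add: field_simps)
  also have "\<dots> = 3/2 * (\<Sum>x\<in>P. (A (fst x) (snd x))\<^sup>2) + 1/2 * (\<Sum>x\<in>P. (A (snd x) (fst x))\<^sup>2)"
    by (simp only: sum.distrib sum_distrib_left)
  also have "(\<Sum>x\<in>P. (A (snd x) (fst x))\<^sup>2) = (\<Sum>x\<in>P. (A (fst x) (snd x))\<^sup>2)"
    by (rule sum.reindex_bij_witness[of _ prod.swap prod.swap]) (auto simp: P_def)
  finally show "(\<integral>g. (Q g)\<^sup>2 \<partial>gauss J) \<le> 2 * (\<Sum>j\<in>S. \<Sum>k\<in>S. (A j k)\<^sup>2)"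
    unfolding P_def sum.cartesian_product by (simp add: case_prod_unfold)
qed

text \<open>For the fourth moment, each of the three Wick pairings contributes the square of the
  variance.\<close>

lemma gauss_linear_form:
  fixes c :: "'s \<Rightarrow> real" and e :: "'s \<Rightarrow> 'i"
  assumes J: "finite J" "finite S" "inj_on e S" "e ` S \<subseteq> J"
  shows "integrable (gauss J) (\<lambda>g. (\<Sum>j\<in>S. c j * g (e j))\<^sup>2)"
    "(\<integral>g. (\<Sum>j\<in>S. c j * g (e j))\<^sup>2 \<partial>gauss J) = (\<Sum>j\<in>S. (c j)\<^sup>2)"
    "integrable (gauss J) (\<lambda>g. (\<Sum>j\<in>S. c j * g (e j)) ^ 4)"
    "(\<integral>g. (\<Sum>j\<in>S. c j * g (e j)) ^ 4 \<partial>gauss J) = 3 * (\<Sum>j\<in>S. (c j)\<^sup>2)\<^sup>2"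
proof -
  have eJ: "e j \<in> J" if "j \<in> S" for j using that J by auto
  have ee: "(e j = e k) = (j = k)" if "j \<in> S" "k \<in> S" for j k using that J by (auto dest: inj_onD)
  have sq: "(\<Sum>j\<in>S. c j * g (e j))\<^sup>2 = (\<Sum>j\<in>S. \<Sum>k\<in>S. c j * c k * (g (e j) * g (e k)))" for g :: "'i \<Rightarrow> real"
    unfolding power2_eq_square sum_product by (simp add: algebra_simps)
  have q: "(\<Sum>j\<in>S. c j * g (e j)) ^ 4 = (\<Sum>j\<in>S. \<Sum>k\<in>S. \<Sum>l\<in>S. \<Sum>m\<in>S. c j * c k * (c l * c m) * (g (e j) * g (e k) * g (e l) * g (e m)))" for g :: "'i \<Rightarrow> real"
  proof -
    have "(\<Sum>j\<in>S. c j * g (e j)) ^ 4 = (\<Sum>j\<in>S. c j * g (e j))\<^sup>2 * (\<Sum>j\<in>S. c j * g (e j))\<^sup>2"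
      by (simp add: power2_eq_square numeral_eq_Suc)
    also have "\<dots> = (\<Sum>j\<in>S. \<Sum>k\<in>S. \<Sum>l\<in>S. \<Sum>m\<in>S. c j * c k * (c l * c m) * (g (e j) * g (e k) * g (e l) * g (e m)))"
    proof -
      define T where "T = (\<Sum>j\<in>S. c j * g (e j))\<^sup>2"
      have "T * T = (\<Sum>j\<in>S. \<Sum>k\<in>S. c j * c k * (g (e j) * g (e k)) * T)"
        unfolding T_def by (subst (1) sq) (simp only: sum_distrib_right)
      also have "\<dots> = (\<Sum>j\<in>S. \<Sum>k\<in>S. \<Sum>l\<in>S. \<Sum>m\<in>S. c j * c k * (c l * c m) * (g (e j) * g (e k) * g (e l) * g (e m)))"
        unfolding T_def sq by (simp only: sum_distrib_left) (simp only: mult_ac)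
      finally show ?thesis unfolding T_def .
    qed
    finally show ?thesis .
  qed
  show "integrable (gauss J) (\<lambda>g. (\<Sum>j\<in>S. c j * g (e j))\<^sup>2)"
    unfolding sq by (intro Bochner_Integration.integrable_sum integrable_mult_right gauss_integrable_mult2 eJ)
  show "(\<integral>g. (\<Sum>j\<in>S. c j * g (e j))\<^sup>2 \<partial>gauss J) = (\<Sum>j\<in>S. (c j)\<^sup>2)"
    unfolding sq using J(1,2)
    by (simp add: gauss_integrable_mult2 eJ gauss_expect_mult2 ee of_bool_def if_distrib[where f="(*) _"] power2_eq_square cong: if_cong)
  show "integrable (gauss J) (\<lambda>g. (\<Sum>j\<in>S. c j * g (e j)) ^ 4)"
    unfolding q by (intro Bochner_Integration.integrable_sum integrable_mult_right gauss_integrable_mult4 eJ)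
  have "(\<integral>g. (\<Sum>j\<in>S. c j * g (e j)) ^ 4 \<partial>gauss J) = (\<Sum>j\<in>S. \<Sum>k\<in>S. \<Sum>l\<in>S. \<Sum>m\<in>S. c j * c k * (c l * c m) *
    (of_bool (j = k) * of_bool (l = m) + of_bool (j = l) * of_bool (k = m) + of_bool (j = m) * of_bool (k = l)))"
    unfolding q by (simp add: gauss_integrable_mult4 eJ gauss_expect_mult4[OF J(1)] ee)
  also have "\<dots> = (\<Sum>j\<in>S. \<Sum>k\<in>S. \<Sum>l\<in>S. \<Sum>m\<in>S. c j * c k * (c l * c m) * (of_bool (j = k) * of_bool (l = m)))
      + (\<Sum>j\<in>S. \<Sum>k\<in>S. \<Sum>l\<in>S. \<Sum>m\<in>S. c j * c k * (c l * c m) * (of_bool (j = l) * of_bool (k = m)))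
      + (\<Sum>j\<in>S. \<Sum>k\<in>S. \<Sum>l\<in>S. \<Sum>m\<in>S. c j * c k * (c l * c m) * (of_bool (j = m) * of_bool (k = l)))"
    by (simp add: distrib_left sum.distrib)
  also have "(\<Sum>j\<in>S. \<Sum>k\<in>S. \<Sum>l\<in>S. \<Sum>m\<in>S. c j * c k * (c l * c m) * (of_bool (j = k) * of_bool (l = m))) = (\<Sum>j\<in>S. (c j)\<^sup>2)\<^sup>2"
  proof -
    have "(\<Sum>j\<in>S. (c j)\<^sup>2) = (\<Sum>l\<in>S. \<Sum>m\<in>S. c l * c m * of_bool (l = m))"
      using J(2) by (simp add: of_bool_def if_distrib[where f="(*) _"] power2_eq_square cong: if_cong)
    moreover define T where "T = (\<Sum>j\<in>S. (c j)\<^sup>2)"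
    ultimately have T: "T = (\<Sum>l\<in>S. \<Sum>m\<in>S. c l * c m * of_bool (l = m))" by simp
    have "(\<Sum>j\<in>S. \<Sum>k\<in>S. \<Sum>l\<in>S. \<Sum>m\<in>S. c j * c k * (c l * c m) * (of_bool (j = k) * of_bool (l = m)))
        = (\<Sum>j\<in>S. \<Sum>k\<in>S. c j * c k * of_bool (j = k) * T)"
      unfolding T by (simp add: sum_distrib_left algebra_simps)
    also have "\<dots> = T * T"
      by (subst (2) T) (simp add: sum_distrib_right)
    finally show ?thesis unfolding T_def by (simp add: power2_eq_square)
  qed
  also have "(\<Sum>j\<in>S. \<Sum>k\<in>S. \<Sum>l\<in>S. \<Sum>m\<in>S. c j * c k * (c l * c m) * (of_bool (j = l) * of_bool (k = m))) = (\<Sum>j\<in>S. (c j)\<^sup>2)\<^sup>2"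
    using J(2) by (simp add: of_bool_def if_distrib[where f="(*) _"] if_distrib[where f="\<lambda>x. x * _"] power2_eq_square sum_product algebra_simps cong: if_cong)
  also have "(\<Sum>j\<in>S. \<Sum>k\<in>S. \<Sum>l\<in>S. \<Sum>m\<in>S. c j * c k * (c l * c m) * (of_bool (j = m) * of_bool (k = l))) = (\<Sum>j\<in>S. (c j)\<^sup>2)\<^sup>2"
  proof -
    have "(\<Sum>l\<in>S. \<Sum>m\<in>S. c j * c k * (c l * c m) * (of_bool (j = m) * of_bool (k = l)))
        = (c j)\<^sup>2 * (c k)\<^sup>2" if "j \<in> S" "k \<in> S" for j k
    proof -
      have "(\<Sum>l\<in>S. c k * c l * of_bool (k = l)) * (\<Sum>m\<in>S. c j * c m * of_bool (j = m)) = (c j)\<^sup>2 * (c k)\<^sup>2"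
        using J(2) that by (simp add: of_bool_def if_distrib[where f="(*) _"] power2_eq_square cong: if_cong)
      then show ?thesis unfolding sum_product by (simp add: algebra_simps)
    qed
    then show ?thesis by (simp add: power2_eq_square sum_product)
  qed
  finally show "(\<integral>g. (\<Sum>j\<in>S. c j * g (e j)) ^ 4 \<partial>gauss J) = 3 * (\<Sum>j\<in>S. (c j)\<^sup>2)\<^sup>2" by simp
qed

section \<open>Sign symmetry of the Gaussian measure\<close>

lemma N01_uminus: "distr N01 N01 uminus = N01"
proof -
  have "distr N01 N01 uminus = distr (density lborel (\<lambda>x. ennreal (std_normal_density (- x)))) borel uminus"
    by (intro distr_cong) (auto simp: std_normal_density_def)
  also have "\<dots> = density (distr lborel borel uminus) (\<lambda>x. ennreal (std_normal_density x))"
    by (subst density_distr) auto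
  also have "\<dots> = N01" by (simp add: lborel_distr_uminus)
  finally show ?thesis .
qed

text \<open>These sign changes preserve the measure and drive two symmetry arguments: removing the
  auxiliary variable \<xi> after Slepian's inequality, and decorrelating the off-diagonal resolvent
  entries.\<close>

definition flip :: "'i set \<Rightarrow> ('i \<Rightarrow> real) \<Rightarrow> 'i \<Rightarrow> real" where
  "flip F g = (\<lambda>p. if p \<in> F then - g p else g p)"

lemma flip_measurable: "F \<subseteq> J \<Longrightarrow> flip F \<in> measurable (gauss J) (gauss J)"
  unfolding flip_def
  by (rule measurable_PiM_single') (auto simp: space_PiM PiE_def extensional_def)

text \<open>The preimage of a rectangle is a rectangle with some sides mirrored, each marginal is
  symmetric, and rectangles determine the product measure.\<close>

lemma gauss_flip:
  fixes J :: "'i set"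
  assumes J: "finite J" "F \<subseteq> J"
  shows "distr (gauss J) (gauss J) (flip F) = gauss J"
proof -
  interpret product_sigma_finite "\<lambda>_::'i. N01" by (rule product_sigma_finite_N01)
  show ?thesis
  proof (rule PiM_eqI[OF J(1)])
    fix A :: "'i \<Rightarrow> real set"
    assume A: "\<And>i. i \<in> J \<Longrightarrow> A i \<in> sets N01"
    define A' where "A' = (\<lambda>i. if i \<in> F then uminus -` A i else A i)"
    have A': "A' i \<in> sets N01" "emeasure N01 (A' i) = emeasure N01 (A i)" if "i \<in> J" for i
    proof -
      have [measurable]: "A i \<in> sets borel" using A[OF that] by simp
      show "A' i \<in> sets N01"
        using measurable_sets[of uminus borel borel "A i"] by (simp add: A'_def)
      have "emeasure N01 (uminus -` A i) = emeasure (distr N01 N01 uminus) (A i)"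
        by (subst emeasure_distr) auto
      then show "emeasure N01 (A' i) = emeasure N01 (A i)"
        by (simp add: A'_def N01_uminus)
    qed
    have "emeasure (distr (gauss J) (gauss J) (flip F)) (Pi\<^sub>E J A)
        = emeasure (gauss J) (flip F -` Pi\<^sub>E J A \<inter> space (gauss J))"
      using A J by (intro emeasure_distr flip_measurable sets_PiM_I_finite) auto
    also have "flip F -` Pi\<^sub>E J A \<inter> space (gauss J) = Pi\<^sub>E J A'"
      using J by (auto simp: space_PiM PiE_def extensional_def flip_def A'_def Pi_iff split: if_splits)
    also have "emeasure (gauss J) (Pi\<^sub>E J A') = (\<Prod>i\<in>J. emeasure N01 (A i))"
      using A' by (subst emeasure_PiM[OF J(1)]) (auto intro!: prod.cong)
    finally show "emeasure (distr (gauss J) (gauss J) (flip F)) (Pi\<^sub>E J A) = (\<Prod>i\<in>J. emeasure N01 (A i))" .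
  qed simp
qed

lemma gauss_flip_integral:
  fixes f :: "('i \<Rightarrow> real) \<Rightarrow> 'b::{banach, second_countable_topology}"
  assumes "finite J" "F \<subseteq> J" "f \<in> borel_measurable (gauss J)"
  shows "(\<integral>g. f (flip F g) \<partial>gauss J) = (\<integral>g. f g \<partial>gauss J)"
  by (subst (2) gauss_flip[OF assms(1,2), symmetric])
     (rule integral_distr[symmetric, OF flip_measurable[OF assms(2)] assms(3)])

lemma gauss_restrict:
  fixes J :: "'i set"
  assumes "finite J" "I \<subseteq> J"
  shows "gauss I = distr (gauss J) (gauss I) (\<lambda>g. restrict g I)"
proof -
  interpret product_prob_space "\<lambda>_::'i. N01" J by (rule product_prob_space_N01)
  show ?thesis using assms by (intro distr_restrict) auto
qed

section \<open>Lipschitz functions of a Gaussian vector\<close>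

text \<open>Resolvent entries and SDP values are not given by explicit formulas, so their
  measurability comes from Lipschitz bounds. Such a bound gives continuity in the product topology,
  whose Borel sets form the product sigma-algebra for a countable index type.\<close>

lemma lipschitz_measurable:
  fixes f :: "('i::countable \<Rightarrow> real) \<Rightarrow> 'b::real_normed_vector"
  assumes J: "finite J" and L: "\<And>g h. norm (f g - f h) \<le> (\<Sum>p\<in>J. c p * \<bar>g p - h p\<bar>)"
  shows "f \<in> borel_measurable (gauss J)"
proof -
  have "(f \<longlongrightarrow> f g) (at g)" for g
  proof (rule LIM_zero_cancel, rule Lim_null_comparison)
    show "\<forall>\<^sub>F h in at g. norm (f h - f g) \<le> (\<Sum>p\<in>J. c p * \<bar>h p - g p\<bar>)"
      using L by (intro always_eventually) auto
    have t: "((\<lambda>h. h p) \<longlongrightarrow> g p) (at g)" for p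
      using continuous_on_product_coordinates[of p] by (auto simp: continuous_on_def)
    have "((\<lambda>h. \<Sum>p\<in>J. c p * \<bar>h p - g p\<bar>) \<longlongrightarrow> (\<Sum>p\<in>J. c p * \<bar>g p - g p\<bar>)) (at g)"
      by (intro tendsto_intros t)
    then show "((\<lambda>h. \<Sum>p\<in>J. c p * \<bar>h p - g p\<bar>) \<longlongrightarrow> 0) (at g)" by simp
  qed
  then have "continuous_on UNIV f" by (auto simp: continuous_on_def)
  then have m: "f \<in> borel_measurable (Pi\<^sub>M UNIV (\<lambda>_. borel))"
    unfolding measurable_cong_sets[OF sets_PiM_equal_borel refl]
    by (rule borel_measurable_continuous_onI)
  define e where "e = (\<lambda>(g::'i \<Rightarrow> real) p. if p \<in> J then g p else 0)"
  have e: "e \<in> measurable (gauss J) (Pi\<^sub>M UNIV (\<lambda>_. borel))"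
    unfolding e_def proof (rule measurable_PiM_single')
    fix p
    show "(\<lambda>\<omega>. if p \<in> J then \<omega> p else 0) \<in> borel_measurable (gauss J)"
      by (cases "p \<in> J") auto
  qed (auto simp: space_PiM)
  have "(\<lambda>g. f (e g)) \<in> borel_measurable (gauss J)"
    by (rule measurable_compose[OF e m])
  \<comment> \<open>The bound only sees coordinates in \<open>J\<close>, where \<open>e g\<close>
    and \<open>g\<close> agree, so filling the others with 0 changes nothing.\<close>
  moreover have "f (e g) = f g" for g
    using L[of "e g" g] by (auto simp: e_def)
  ultimately show ?thesis by simp
qed

text \<open>Comparison with the value at 0 and Cauchy-Schwarz bound the square by a quadratic
  polynomial in the coordinates.\<close>

lemma gauss_lipschitz_square_integrable:
  fixes f :: "('i::countable \<Rightarrow> real) \<Rightarrow> real"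
  assumes J: "finite J" and L: "\<And>g h. \<bar>f g - f h\<bar> \<le> (\<Sum>p\<in>J. c p * \<bar>g p - h p\<bar>)"
  shows "integrable (gauss J) f" "integrable (gauss J) (\<lambda>g. (f g)\<^sup>2)"
proof -
  interpret prob_space "gauss J" by (rule prob_space_gauss)
  have [measurable]: "f \<in> borel_measurable (gauss J)"
    using L by (intro lipschitz_measurable[OF J]) auto
  show 2: "integrable (gauss J) (\<lambda>g. (f g)\<^sup>2)"
  proof (rule Bochner_Integration.integrable_bound)
    show "integrable (gauss J) (\<lambda>g. 2 * (f (\<lambda>_. 0))\<^sup>2 + 2 * ((\<Sum>p\<in>J. (c p)\<^sup>2 * (g p)\<^sup>2) * real (card J)))"
      by (intro Bochner_Integration.integrable_add integrable_mult_right integrable_mult_left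
          Bochner_Integration.integrable_sum gauss_moment integrable_const)
    show "AE g in gauss J. norm ((f g)\<^sup>2) \<le> norm (2 * (f (\<lambda>_. 0))\<^sup>2 + 2 * ((\<Sum>p\<in>J. (c p)\<^sup>2 * (g p)\<^sup>2) * real (card J)))"
    proof (rule AE_I2)
      fix g :: "'i \<Rightarrow> real"
      define a where "a = f (\<lambda>_. 0)"
      define s where "s = (\<Sum>p\<in>J. c p * \<bar>g p\<bar>)"
      have "\<bar>f g - a\<bar> \<le> s" using L[of g "\<lambda>_. 0"] by (simp add: a_def s_def)
      then have "(f g - a)\<^sup>2 \<le> s\<^sup>2" by (simp add: abs_le_square_iff[symmetric])
      moreover have "(f g)\<^sup>2 \<le> 2 * a\<^sup>2 + 2 * (f g - a)\<^sup>2"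
        using zero_le_power2[of "f g - 2 * a"] by (simp add: power2_eq_square algebra_simps)
      moreover have "s\<^sup>2 \<le> (\<Sum>p\<in>J. (c p * \<bar>g p\<bar>)\<^sup>2) * real (card J)"
        unfolding s_def by (rule sum_squared_le_sum_of_squares)
      ultimately have "(f g)\<^sup>2 \<le> 2 * a\<^sup>2 + 2 * ((\<Sum>p\<in>J. (c p)\<^sup>2 * (g p)\<^sup>2) * real (card J))"
        by (simp add: power_mult_distrib)
      then show "norm ((f g)\<^sup>2) \<le> norm (2 * (f (\<lambda>_. 0))\<^sup>2 + 2 * ((\<Sum>p\<in>J. (c p)\<^sup>2 * (g p)\<^sup>2) * real (card J)))"
        unfolding a_def[symmetric] by simp
    qed
  qed simp
  show "integrable (gauss J) f"
    by (rule square_integrable_imp_integrable[OF _ 2]) simp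
qed

text \<open>Efron--Stein in its simplest form: integrating out one coordinate costs at most the squared
  Lipschitz constant in that coordinate and preserves the other constants.\<close>

lemma gauss_lipschitz_variance:
  fixes f :: "('i::countable \<Rightarrow> real) \<Rightarrow> real"
  assumes J: "finite J" and c: "\<And>p. 0 \<le> c p"
    and L: "\<And>g h. \<bar>f g - f h\<bar> \<le> (\<Sum>p\<in>J. c p * \<bar>g p - h p\<bar>)"
  shows "(\<integral>g. (f g)\<^sup>2 \<partial>gauss J) - (\<integral>g. f g \<partial>gauss J)\<^sup>2 \<le> (\<Sum>p\<in>J. (c p)\<^sup>2)"
  using J L
proof (induction J arbitrary: f rule: finite_induct)
  case empty
  interpret prob_space "gauss ({} :: 'i set)" by (rule prob_space_gauss)
  have "f g = f (\<lambda>_. 0)" for g using empty[of g "\<lambda>_. 0"] by simp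
  then have "(\<integral>g. (f g)\<^sup>2 \<partial>gauss {}) = (\<integral>g. (f (\<lambda>_. 0))\<^sup>2 \<partial>gauss ({} :: 'i set))"
    "(\<integral>g. f g \<partial>gauss {}) = (\<integral>g. f (\<lambda>_. 0) \<partial>gauss ({} :: 'i set))"
    by (metis (no_types))+
  then show ?case by (simp add: prob_space)
next
  case (insert p K f)
  interpret product_sigma_finite "\<lambda>_::'i. N01" by (rule product_sigma_finite_N01)
  interpret K: prob_space "gauss K" by (rule prob_space_gauss)
  have fin: "finite (insert p K)" using insert by simp
  note sqi = gauss_lipschitz_square_integrable[OF fin insert.prems]
  have Ly: "\<bar>f (x(p := y)) - f (x(p := z))\<bar> \<le> c p * \<bar>y - z\<bar>" for x y z
  proof -
    have "(\<Sum>q\<in>insert p K. c q * \<bar>(x(p := y)) q - (x(p := z)) q\<bar>) = c p * \<bar>y - z\<bar> + (\<Sum>q\<in>K. 0)"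
      unfolding sum.insert[OF insert.hyps] using insert.hyps by (auto intro!: sum.neutral)
    then show ?thesis using insert.prems[of "x(p := y)" "x(p := z)"] by (simp del: fun_upd_apply)
  qed
  have Lx: "\<bar>f (x(p := y)) - f (x'(p := y))\<bar> \<le> (\<Sum>q\<in>K. c q * \<bar>x q - x' q\<bar>)" for x x' y
  proof -
    have "(\<Sum>q\<in>insert p K. c q * \<bar>(x(p := y)) q - (x'(p := y)) q\<bar>) = (\<Sum>q\<in>K. c q * \<bar>x q - x' q\<bar>)"
      unfolding sum.insert[OF insert.hyps] using insert.hyps by (auto intro!: sum.cong)
    then show ?thesis using insert.prems[of "x(p := y)" "x'(p := y)"] by (simp del: fun_upd_apply)
  qed
  have cy: "continuous_on UNIV (\<lambda>y. f (x(p := y)))" for x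
  proof -
    have "((\<lambda>y. f (x(p := y))) \<longlongrightarrow> f (x(p := z))) (at z)" for z
    proof (rule LIM_zero_cancel, rule Lim_null_comparison)
      show "\<forall>\<^sub>F y in at z. norm (f (x(p := y)) - f (x(p := z))) \<le> c p * \<bar>y - z\<bar>"
        using Ly by (intro always_eventually) auto
      have "((\<lambda>y. c p * \<bar>y - z\<bar>) \<longlongrightarrow> c p * \<bar>z - z\<bar>) (at z)" by (intro tendsto_intros)
      then show "((\<lambda>y. c p * \<bar>y - z\<bar>) \<longlongrightarrow> 0) (at z)" by simp
    qed
    then show ?thesis by (auto simp: continuous_on_def)
  qed
  have my[measurable]: "(\<lambda>y. f (x(p := y))) \<in> borel_measurable borel" for x
    by (rule borel_measurable_continuous_onI[OF cy])
  have i2: "integrable N01 (\<lambda>y. (f (x(p := y)))\<^sup>2)" for x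
  proof (rule Bochner_Integration.integrable_bound)
    show "integrable N01 (\<lambda>y. 2 * (f (x(p := 0)))\<^sup>2 + 2 * ((c p)\<^sup>2 * y\<^sup>2))"
      by (intro Bochner_Integration.integrable_add integrable_mult_right integrable_std_normal_distribution_moment)
         (rule N01.integrable_const)
    show "AE y in N01. norm ((f (x(p := y)))\<^sup>2) \<le> norm (2 * (f (x(p := 0)))\<^sup>2 + 2 * ((c p)\<^sup>2 * y\<^sup>2))"
    proof (rule AE_I2)
      fix y
      define a where "a = f (x(p := 0))" define b where "b = f (x(p := y))"
      have "\<bar>b - a\<bar> \<le> \<bar>c p * y\<bar>" using Ly[of x y 0] c[of p] by (simp add: a_def b_def abs_mult)
      then have "(b - a)\<^sup>2 \<le> (c p * y)\<^sup>2" by (simp only: abs_le_square_iff)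
      moreover have "b\<^sup>2 \<le> 2 * a\<^sup>2 + 2 * (b - a)\<^sup>2"
        using zero_le_power2[of "b - 2 * a"] by (simp add: power2_eq_square algebra_simps)
      ultimately show "norm ((f (x(p := y)))\<^sup>2) \<le> norm (2 * (f (x(p := 0)))\<^sup>2 + 2 * ((c p)\<^sup>2 * y\<^sup>2))"
        unfolding a_def[symmetric] b_def[symmetric] by (simp add: power_mult_distrib)
    qed
  qed simp
  have i1: "integrable N01 (\<lambda>y. f (x(p := y)))" for x
    by (rule N01.square_integrable_imp_integrable[OF _ i2]) simp
  define m where "m = (\<lambda>x. \<integral>y. f (x(p := y)) \<partial>N01)"
  have Lm: "\<bar>m x - m x'\<bar> \<le> (\<Sum>q\<in>K. c q * \<bar>x q - x' q\<bar>)" for x x'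
  proof -
    have "\<bar>m x - m x'\<bar> = \<bar>\<integral>y. f (x(p := y)) - f (x'(p := y)) \<partial>N01\<bar>"
      unfolding m_def by (simp add: i1)
    also have "\<dots> \<le> (\<integral>y. (\<Sum>q\<in>K. c q * \<bar>x q - x' q\<bar>) \<partial>N01)"
      using Lx by (intro order_trans[OF integral_abs_bound] integral_mono integrable_abs Bochner_Integration.integrable_diff i1 N01.integrable_const) auto
    finally show ?thesis using N01.prob_space by simp
  qed
  note mi = gauss_lipschitz_square_integrable[OF insert.hyps(1) Lm]
  have var: "(\<integral>y. (f (x(p := y)))\<^sup>2 \<partial>N01) \<le> (m x)\<^sup>2 + (c p)\<^sup>2" for x
  proof -
    \<comment> \<open>The variance in \<open>y\<close> is at most the second moment about any
      constant; centring at the value for \<open>y = 0\<close> makes the Lipschitz bound directly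
      applicable.\<close>
    define a where "a = f (x(p := 0))"
    have "(\<integral>y. (f (x(p := y)) - a)\<^sup>2 \<partial>N01) \<le> (\<integral>y. (c p)\<^sup>2 * y\<^sup>2 \<partial>N01)"
    proof (rule integral_mono)
      show "integrable N01 (\<lambda>y. (f (x(p := y)) - a)\<^sup>2)"
        unfolding power2_diff
        by (intro Bochner_Integration.integrable_add Bochner_Integration.integrable_diff integrable_mult_left integrable_mult_right i1 i2 N01.integrable_const)
      show "integrable N01 (\<lambda>y. (c p)\<^sup>2 * y\<^sup>2)" by (intro integrable_mult_right integrable_std_normal_distribution_moment)
      fix y
      have "\<bar>f (x(p := y)) - a\<bar> \<le> \<bar>c p * y\<bar>" using Ly[of x y 0] c[of p] by (simp add: a_def abs_mult)
      then have "(f (x(p := y)) - a)\<^sup>2 \<le> (c p * y)\<^sup>2" by (simp only: abs_le_square_iff)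
      then show "(f (x(p := y)) - a)\<^sup>2 \<le> (c p)\<^sup>2 * y\<^sup>2" by (simp add: power_mult_distrib)
    qed
    also have "\<dots> = (c p)\<^sup>2"
      using std_normal_distribution_even_moments(1)[of 1] by simp
    finally have 1: "(\<integral>y. (f (x(p := y)) - a)\<^sup>2 \<partial>N01) \<le> (c p)\<^sup>2" .
    have "(\<integral>y. (f (x(p := y)) - a)\<^sup>2 \<partial>N01) = (\<integral>y. (f (x(p := y)))\<^sup>2 \<partial>N01) + a\<^sup>2 - 2 * m x * a"
      unfolding power2_diff m_def
      using N01.prob_space by (simp add: i1 i2)
    then show ?thesis using 1 zero_le_power2[of "m x - a"] by (simp add: power2_diff)
  qed
  have "(\<integral>g. (f g)\<^sup>2 \<partial>gauss (insert p K)) = (\<integral>x. (\<integral>y. (f (x(p := y)))\<^sup>2 \<partial>N01) \<partial>gauss K)"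
    by (rule product_integral_insert[OF insert.hyps sqi(2)])
  also have "\<dots> \<le> (\<integral>x. (m x)\<^sup>2 + (c p)\<^sup>2 \<partial>gauss K)"
  proof (rule integral_mono_AE')
    show "integrable (gauss K) (\<lambda>x. (m x)\<^sup>2 + (c p)\<^sup>2)" using mi by simp
  qed (use var in \<open>auto intro!: AE_I2\<close>)
  also have "\<dots> = (\<integral>x. (m x)\<^sup>2 \<partial>gauss K) + (c p)\<^sup>2"
    using mi by (simp add: K.prob_space)
  finally have A: "(\<integral>g. (f g)\<^sup>2 \<partial>gauss (insert p K)) \<le> (\<integral>x. (m x)\<^sup>2 \<partial>gauss K) + (c p)\<^sup>2" .
  have B: "(\<integral>g. f g \<partial>gauss (insert p K)) = (\<integral>x. m x \<partial>gauss K)"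
    unfolding m_def by (rule product_integral_insert[OF insert.hyps sqi(1)])
  have "(\<integral>x. (m x)\<^sup>2 \<partial>gauss K) - (\<integral>x. m x \<partial>gauss K)\<^sup>2 \<le> (\<Sum>p\<in>K. (c p)\<^sup>2)"
    by (rule insert.IH[OF Lm])
  then show ?case using A B insert.hyps by simp
qed

section \<open>Slepian's inequality\<close>

definition lin_form :: "'i set \<Rightarrow> ('i \<Rightarrow> real) \<Rightarrow> ('i \<Rightarrow> real) \<Rightarrow> real" where
  "lin_form J v g = (\<Sum>p\<in>J. v p * g p)"

lemma lin_form_measurable[measurable]: "lin_form J v \<in> borel_measurable (gauss J)"
  unfolding lin_form_def by measurable

lemma lin_form_upd:
  assumes "finite J" "p \<in> J"
  shows "lin_form J v (g(p := y)) = v p * y + lin_form (J - {p}) v g"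
  using assms by (auto simp: lin_form_def sum.remove[of J p] intro!: sum.cong)

text \<open>For large \<beta>, \<open>exp (- exp_sum \<beta> J T b v g)\<close> is a smooth version
  of the indicator that no \<open>t\<close> exceeds its threshold \<open>b t\<close>. Slepian's
  inequality is proved for this function and then transferred to the event.\<close>

definition exp_sum :: "real \<Rightarrow> 'i set \<Rightarrow> 't set \<Rightarrow> ('t \<Rightarrow> real) \<Rightarrow> ('t \<Rightarrow> 'i \<Rightarrow> real) \<Rightarrow> ('i \<Rightarrow> real) \<Rightarrow> real" where
  "exp_sum \<beta> J T b v g = (\<Sum>t\<in>T. exp (\<beta> * (lin_form J (v t) g - b t)))"

lemma exp_sum_measurable[measurable]: "exp_sum \<beta> J T b v \<in> borel_measurable (gauss J)"
  unfolding exp_sum_def by measurable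

lemma exp_sum_nonneg: "0 \<le> exp_sum \<beta> J T b v g"
  unfolding exp_sum_def by (intro sum_nonneg) auto

lemma exp_sum_ge: "finite T \<Longrightarrow> t \<in> T \<Longrightarrow> exp (\<beta> * (lin_form J (v t) g - b t)) \<le> exp_sum \<beta> J T b v g"
  unfolding exp_sum_def by (intro member_le_sum) auto

text \<open>Multiplying one or two of the exponentials by
  \<open>exp (- exp_sum \<beta> J T b v g)\<close> leaves a bounded function, so the integrals in
  the interpolation exist without estimating exponential moments.\<close>

lemma mult_exp_minus_le: "0 \<le> (s::real) \<Longrightarrow> s * exp (- s) \<le> 1" "0 \<le> s \<Longrightarrow> s * s * exp (- s) \<le> 2"
proof -
  assume s: "0 \<le> s"
  have "s \<le> exp s" using exp_ge_add_one_self[of s] by linarith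
  then show "s * exp (- s) \<le> 1" by (simp add: exp_minus field_simps)
  have "s * s \<le> 2 * exp s" using exp_lower_Taylor_quadratic[OF s] s by (simp add: power2_eq_square)
  then show "s * s * exp (- s) \<le> 2" by (simp add: exp_minus field_simps)
qed

text \<open>Gaussian integration by parts for one exponential times \<open>F\<close>.
  Differentiating the exponential gives the single term, differentiating \<open>F\<close> gives the
  sum over \<open>u\<close>.\<close>

lemma exp_sum_stein:
  fixes v :: "'t \<Rightarrow> 'i \<Rightarrow> real" and b :: "'t \<Rightarrow> real" and \<beta> :: real
  assumes J: "finite J" "p \<in> J" and T: "finite T" "t \<in> T"
  defines "e \<equiv> \<lambda>t g. exp (\<beta> * (lin_form J (v t) g - b t))"
    and "F \<equiv> \<lambda>g. exp (- exp_sum \<beta> J T b v g)"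
  shows "(\<integral>g. g p * (e t g * F g) \<partial>gauss J)
      = \<beta> * v t p * (\<integral>g. e t g * F g \<partial>gauss J) - (\<Sum>u\<in>T. \<beta> * v u p * (\<integral>g. e t g * e u g * F g \<partial>gauss J))"
    "integrable (gauss J) (\<lambda>g. g p * (e t g * F g))"
    "integrable (gauss J) (\<lambda>g. e t g * F g)"
    "u \<in> T \<Longrightarrow> integrable (gauss J) (\<lambda>g. e t g * e u g * F g)"
proof -
  interpret prob_space "gauss J" by (rule prob_space_gauss)
  have e0: "0 \<le> e t g" for t g by (simp add: e_def)
  have eS: "e u g \<le> exp_sum \<beta> J T b v g" if "u \<in> T" for u g
    unfolding e_def using exp_sum_ge[OF T(1) that] .
  have h1: "e u g * F g \<le> 1" if "u \<in> T" for u g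
  proof -
    have "e u g * F g \<le> exp_sum \<beta> J T b v g * F g"
      by (intro mult_right_mono eS that) (simp add: F_def)
    also have "\<dots> \<le> 1" unfolding F_def by (rule mult_exp_minus_le(1)[OF exp_sum_nonneg])
    finally show ?thesis .
  qed
  have h2: "e t g * e u g * F g \<le> 2" if "u \<in> T" for u g
  proof -
    have "e t g * e u g * F g \<le> exp_sum \<beta> J T b v g * exp_sum \<beta> J T b v g * F g"
      by (intro mult_right_mono mult_mono eS that T e0 exp_sum_nonneg) (simp add: F_def)
    also have "\<dots> \<le> 2" unfolding F_def by (rule mult_exp_minus_le(2)[OF exp_sum_nonneg])
    finally show ?thesis .
  qed
  have F0: "0 \<le> F g" for g by (simp add: F_def)
  have [measurable]: "e t \<in> borel_measurable (gauss J)" "F \<in> borel_measurable (gauss J)" for t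
    unfolding e_def F_def by measurable
  have a1: "\<bar>e t g * F g\<bar> \<le> 1" for g
    using h1[OF T(2), of g] mult_nonneg_nonneg[OF e0[of t g] F0[of g]] by linarith
  show i1: "integrable (gauss J) (\<lambda>g. e t g * F g)"
    by (rule integrable_const_bound[where B=1]) (use a1 in auto)
  have a2: "\<bar>e t g * e u g * F g\<bar> \<le> 2" if "u \<in> T" for u g
    using h2[OF that, of g] mult_nonneg_nonneg[OF mult_nonneg_nonneg[OF e0[of t g] e0[of u g]] F0[of g]] by linarith
  show i2: "integrable (gauss J) (\<lambda>g. e t g * e u g * F g)" if "u \<in> T" for u
    by (rule integrable_const_bound[where B=2]) (use a2[OF that] in auto)
  show i3: "integrable (gauss J) (\<lambda>g. g p * (e t g * F g))"
  proof (rule Bochner_Integration.integrable_bound)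
    show "integrable (gauss J) (\<lambda>g. g p)" using gauss_moment(1)[OF J(2), of 1] by simp
    show "AE g in gauss J. norm (g p * (e t g * F g)) \<le> norm (g p)"
    proof (rule AE_I2)
      fix g :: "'i \<Rightarrow> real"
      have "\<bar>g p\<bar> * \<bar>e t g * F g\<bar> \<le> \<bar>g p\<bar> * 1" by (intro mult_left_mono a1) auto
      then show "norm (g p * (e t g * F g)) \<le> norm (g p)" by (simp add: abs_mult)
    qed
  qed (use J in measurable)
  define f' where "f' = (\<lambda>g. \<beta> * v t p * (e t g * F g) - (\<Sum>u\<in>T. \<beta> * v u p * (e t g * e u g * F g)))"
  have if': "integrable (gauss J) f'"
    unfolding f'_def
    by (intro Bochner_Integration.integrable_diff integrable_mult_right Bochner_Integration.integrable_sum i1 i2)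
  have "(\<integral>g. g p * (e t g * F g) \<partial>gauss J) = (\<integral>g. f' g \<partial>gauss J)"
  proof (rule gauss_stein[OF J _ _ _ i3 if'])
    fix g :: "'i \<Rightarrow> real" and y :: real
    have de: "((\<lambda>y. e u (g(p := y))) has_real_derivative \<beta> * v u p * e u (g(p := y))) (at y)" for u y
      unfolding e_def lin_form_upd[OF J] by (auto intro!: derivative_eq_intros)
    have eF: "F h = exp (- (\<Sum>u\<in>T. e u h))" for h by (simp add: F_def exp_sum_def e_def)
    have dF: "((\<lambda>y. F (g(p := y))) has_real_derivative - (\<Sum>u\<in>T. \<beta> * v u p * e u (g(p := y))) * F (g(p := y))) (at y)" for y
      unfolding eF by (rule derivative_eq_intros refl de | simp)+
    show "((\<lambda>y. e t (g(p := y)) * F (g(p := y))) has_real_derivative f' (g(p := y))) (at y)"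
      unfolding f'_def
      by (rule DERIV_cong[OF DERIV_mult[OF de dF]])
         (simp add: sum_distrib_left sum_distrib_right sum_negf algebra_simps)
    have ce: "continuous_on UNIV (\<lambda>y. e u (g(p := y)))" "continuous_on UNIV (\<lambda>y. F (g(p := y)))" for u
      using de dF by (auto intro!: DERIV_continuous_on)
    show "continuous_on UNIV (\<lambda>y. f' (g(p := y)))"
      unfolding f'_def by (intro continuous_intros ce)
    define C where "C = 1 + \<bar>\<beta> * v t p\<bar> + (\<Sum>u\<in>T. \<bar>\<beta> * v u p\<bar> * 2)"
    have C: "1 \<le> C" unfolding C_def by (simp add: sum_nonneg)
    have CC: "C \<le> C * (1 + \<bar>y\<bar>^3)" for y :: real using C by simp
    have b': "\<bar>f' h\<bar> \<le> C" for h
    proof -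
      have "\<bar>f' h\<bar> \<le> \<bar>\<beta> * v t p * (e t h * F h)\<bar> + \<bar>\<Sum>u\<in>T. \<beta> * v u p * (e t h * e u h * F h)\<bar>"
        unfolding f'_def by (rule abs_triangle_ineq4)
      also have "\<dots> \<le> \<bar>\<beta> * v t p\<bar> * 1 + (\<Sum>u\<in>T. \<bar>\<beta> * v u p\<bar> * 2)"
        unfolding abs_mult[of "\<beta> * v t p"]
      proof (intro add_mono mult_left_mono a1 order_trans[OF sum_abs] sum_mono)
        fix u assume u: "u \<in> T"
        show "\<bar>\<beta> * v u p * (e t h * e u h * F h)\<bar> \<le> \<bar>\<beta> * v u p\<bar> * 2"
          unfolding abs_mult[of "\<beta> * v u p"] by (intro mult_left_mono a2 u) simp
      qed simp
      also have "\<dots> \<le> C" by (simp add: C_def)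
      finally show ?thesis .
    qed
    show "\<exists>C. \<forall>y. \<bar>e t (g(p := y)) * F (g(p := y))\<bar> \<le> C * (1 + \<bar>y\<bar>^3) \<and> \<bar>f' (g(p := y))\<bar> \<le> C * (1 + \<bar>y\<bar>^3)"
      by (intro exI[of _ C] allI conjI order_trans[OF a1] order_trans[OF b'] CC order_trans[OF C CC])
  qed
  also have "\<dots> = \<beta> * v t p * (\<integral>g. e t g * F g \<partial>gauss J) - (\<Sum>u\<in>T. \<beta> * v u p * (\<integral>g. e t g * e u g * F g \<partial>gauss J))"
    unfolding f'_def by (simp add: i1 i2 Bochner_Integration.integral_diff Bochner_Integration.integrable_sum)
  finally show "(\<integral>g. g p * (e t g * F g) \<partial>gauss J)
      = \<beta> * v t p * (\<integral>g. e t g * F g \<partial>gauss J) - (\<Sum>u\<in>T. \<beta> * v u p * (\<integral>g. e t g * e u g * F g \<partial>gauss J))" .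
qed

text \<open>Rotation from the process \<open>a\<close> at angle 0 to \<open>c\<close> at angle pi/2;
  \<open>orth\<close> makes the two independent on one space. Equal variances kill the terms of the
  derivative that contain one exponential, and the covariance comparison gives the remaining terms a
  sign.\<close>

lemma slepian_exp:
  fixes a c :: "'t \<Rightarrow> 'i \<Rightarrow> real" and b :: "'t \<Rightarrow> real" and \<beta> :: real
  assumes J: "finite J" and T: "finite T"
    and orth: "\<And>t u. t \<in> T \<Longrightarrow> u \<in> T \<Longrightarrow> (\<Sum>p\<in>J. a t p * c u p) = 0"
    and diag: "\<And>t. t \<in> T \<Longrightarrow> (\<Sum>p\<in>J. a t p * a t p) = (\<Sum>p\<in>J. c t p * c t p)"
    and off: "\<And>t u. t \<in> T \<Longrightarrow> u \<in> T \<Longrightarrow> (\<Sum>p\<in>J. c t p * c u p) \<le> (\<Sum>p\<in>J. a t p * a u p)"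
  shows "(\<integral>g. exp (- exp_sum \<beta> J T b c g) \<partial>gauss J) \<le> (\<integral>g. exp (- exp_sum \<beta> J T b a g) \<partial>gauss J)"
proof -
  interpret P: prob_space "gauss J" by (rule prob_space_gauss)
  interpret pair_sigma_finite "gauss J" lborel ..
  define V where "V = (\<lambda>\<theta> t p. cos \<theta> * a t p + sin \<theta> * c t p)"
  define V' where "V' = (\<lambda>\<theta> t p. - sin \<theta> * a t p + cos \<theta> * c t p)"
  define e where "e = (\<lambda>\<theta> t g. exp (\<beta> * (lin_form J (V \<theta> t) g - b t)))"
  define F where "F = (\<lambda>\<theta> g. exp (- exp_sum \<beta> J T b (V \<theta>) g))"
  define D where "D = (\<lambda>\<theta> g. - (\<Sum>t\<in>T. \<beta> * (lin_form J (V' \<theta> t) g * (e \<theta> t g * F \<theta> g))))"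
  have lV: "lin_form J (V \<theta> t) g = cos \<theta> * lin_form J (a t) g + sin \<theta> * lin_form J (c t) g" for \<theta> t g
    by (simp add: lin_form_def V_def sum.distrib sum_distrib_left algebra_simps)
  have lV': "lin_form J (V' \<theta> t) g = - sin \<theta> * lin_form J (a t) g + cos \<theta> * lin_form J (c t) g" for \<theta> t g
    by (simp add: lin_form_def V'_def sum.distrib sum_distrib_left sum_subtractf sum_negf algebra_simps)
  have eF: "F \<theta> g = exp (- (\<Sum>t\<in>T. e \<theta> t g))" for \<theta> g by (simp add: F_def exp_sum_def e_def)
  have de: "((\<lambda>\<theta>. e \<theta> t g) has_real_derivative \<beta> * lin_form J (V' \<theta> t) g * e \<theta> t g) (at \<theta>)" for \<theta> t g
    unfolding e_def lV lV' by (auto intro!: derivative_eq_intros)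
  have dF: "((\<lambda>\<theta>. F \<theta> g) has_real_derivative D \<theta> g) (at \<theta>)" for \<theta> g
  proof -
    have "((\<lambda>\<theta>. F \<theta> g) has_real_derivative - (\<Sum>t\<in>T. \<beta> * lin_form J (V' \<theta> t) g * e \<theta> t g) * F \<theta> g) (at \<theta>)"
      unfolding eF by (rule derivative_eq_intros refl de | simp)+
    also have "- (\<Sum>t\<in>T. \<beta> * lin_form J (V' \<theta> t) g * e \<theta> t g) * F \<theta> g = D \<theta> g"
      by (simp add: D_def sum_distrib_right mult.assoc)
    finally show ?thesis .
  qed
  have cD: "continuous_on UNIV (\<lambda>\<theta>. D \<theta> g)" for g
    unfolding D_def eF e_def lV lV' by (intro continuous_intros)
  define G where "G = (\<lambda>(g, \<theta>). indicator {0..pi/2} \<theta> * D \<theta> g)"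
  \<comment> \<open>An integrable majorant of the angular derivative that does not depend on
    \<theta>, needed to exchange the two integrals.\<close>
  define U where "U = (\<lambda>g. \<Sum>t\<in>T. \<bar>\<beta>\<bar> * (\<bar>lin_form J (a t) g\<bar> + \<bar>lin_form J (c t) g\<bar>))"
  have il: "integrable (gauss J) (lin_form J w)" for w
    unfolding lin_form_def using gauss_moment(1)[of _ J 1]
    by (intro Bochner_Integration.integrable_sum integrable_mult_right) auto
  have iU: "integrable (gauss J) U"
    unfolding U_def
    by (intro Bochner_Integration.integrable_sum integrable_mult_right Bochner_Integration.integrable_add integrable_abs il)
  have U0: "0 \<le> U g" for g unfolding U_def by (intro sum_nonneg) auto
  have DU: "\<bar>D \<theta> g\<bar> \<le> U g" for \<theta> g
  proof -
    have "\<bar>D \<theta> g\<bar> \<le> (\<Sum>t\<in>T. \<bar>\<beta> * (lin_form J (V' \<theta> t) g * (e \<theta> t g * F \<theta> g))\<bar>)"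
      unfolding D_def abs_minus_cancel by (rule sum_abs)
    also have "\<dots> \<le> U g" unfolding U_def
    proof (rule sum_mono)
      fix t assume t: "t \<in> T"
      have "e \<theta> t g * F \<theta> g \<le> exp_sum \<beta> J T b (V \<theta>) g * F \<theta> g"
        unfolding e_def by (intro mult_right_mono exp_sum_ge T t) (simp add: F_def)
      also have "\<dots> \<le> 1" unfolding F_def by (rule mult_exp_minus_le(1)[OF exp_sum_nonneg])
      finally have h: "e \<theta> t g * F \<theta> g \<le> 1" .
      have h0: "0 \<le> e \<theta> t g * F \<theta> g" by (simp add: e_def F_def)
      have l: "\<bar>lin_form J (V' \<theta> t) g\<bar> \<le> \<bar>lin_form J (a t) g\<bar> + \<bar>lin_form J (c t) g\<bar>"
      proof -
        have "\<bar>lin_form J (V' \<theta> t) g\<bar> \<le> \<bar>sin \<theta>\<bar> * \<bar>lin_form J (a t) g\<bar> + \<bar>cos \<theta>\<bar> * \<bar>lin_form J (c t) g\<bar>"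
          unfolding lV' by (rule order_trans[OF abs_triangle_ineq]) (simp add: abs_mult)
        also have "\<dots> \<le> 1 * \<bar>lin_form J (a t) g\<bar> + 1 * \<bar>lin_form J (c t) g\<bar>"
          by (intro add_mono mult_right_mono) auto
        finally show ?thesis by simp
      qed
      have "\<bar>lin_form J (V' \<theta> t) g\<bar> * (e \<theta> t g * F \<theta> g) \<le> (\<bar>lin_form J (a t) g\<bar> + \<bar>lin_form J (c t) g\<bar>) * 1"
        by (intro mult_mono l h h0) auto
      then show "\<bar>\<beta> * (lin_form J (V' \<theta> t) g * (e \<theta> t g * F \<theta> g))\<bar> \<le> \<bar>\<beta>\<bar> * (\<bar>lin_form J (a t) g\<bar> + \<bar>lin_form J (c t) g\<bar>)"
        unfolding abs_mult[of \<beta>] abs_mult[of "lin_form J (V' \<theta> t) g"] abs_of_nonneg[OF h0]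
        by (intro mult_left_mono) auto
    qed
    finally show ?thesis .
  qed
  have mG: "G \<in> borel_measurable (gauss J \<Otimes>\<^sub>M lborel)"
    unfolding G_def D_def eF e_def lV lV' by measurable
  have iW: "integrable (gauss J \<Otimes>\<^sub>M lborel) (\<lambda>(g, \<theta>). indicator {0..pi/2} \<theta> * U g)"
  proof (rule Fubini_integrable)
    show "(\<lambda>(g, \<theta>). indicator {0..pi/2} \<theta> * U g) \<in> borel_measurable (gauss J \<Otimes>\<^sub>M lborel)"
      unfolding U_def by measurable
    have "(\<integral>\<theta>. norm (case (g, \<theta>) of (g, \<theta>) \<Rightarrow> indicator {0..pi/2} \<theta> * U g) \<partial>lborel) = U g * (pi/2)" for g
    proof -
      have "(\<integral>\<theta>. \<bar>indicat_real {0..pi/2} \<theta> * U g\<bar> \<partial>lborel) = (\<integral>\<theta>. indicat_real {0..pi/2} \<theta> * U g \<partial>lborel)"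
        using U0[of g] by (intro Bochner_Integration.integral_cong) (auto simp: abs_mult)
      then show ?thesis by simp
    qed
    then show "integrable (gauss J) (\<lambda>g. \<integral>\<theta>. norm (case (g, \<theta>) of (g, \<theta>) \<Rightarrow> indicator {0..pi/2} \<theta> * U g) \<partial>lborel)"
      using integrable_mult_left[OF iU, of "pi/2"] by (simp only:)
  qed simp
  have iG: "integrable (gauss J \<Otimes>\<^sub>M lborel) G"
  proof (rule Bochner_Integration.integrable_bound[OF iW mG])
    show "AE x in gauss J \<Otimes>\<^sub>M lborel. norm (G x) \<le> norm (case x of (g, \<theta>) \<Rightarrow> indicator {0..pi/2} \<theta> * U g)"
      using DU U0 by (intro AE_I2) (auto simp: G_def abs_mult indicator_def)
  qed
  have FTC: "(\<integral>\<theta>. G (g, \<theta>) \<partial>lborel) = F (pi/2) g - F 0 g" for g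
  proof -
    have "(\<integral>\<theta>. indicator {0..pi/2} \<theta> *\<^sub>R D \<theta> g \<partial>lborel) = F (pi/2) g - F 0 g"
    proof (rule integral_FTC_atLeastAtMost)
      show "continuous_on {0..pi/2} (\<lambda>\<theta>. D \<theta> g)" using cD by (rule continuous_on_subset) auto
      show "((\<lambda>\<theta>. F \<theta> g) has_vector_derivative D x g) (at x within {0..pi/2})" for x
        using dF by (simp add: has_real_derivative_iff_has_vector_derivative[symmetric] has_field_derivative_at_within)
    qed simp
    then show ?thesis by (simp add: G_def)
  qed
  have ED: "(\<integral>g. D \<theta> g \<partial>gauss J) \<le> 0" if \<theta>: "0 \<le> \<theta>" "\<theta> \<le> pi/2" for \<theta>
  proof -
    have st1: "(\<integral>g. g p * (e \<theta> t g * F \<theta> g) \<partial>gauss J)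
      = \<beta> * V \<theta> t p * (\<integral>g. e \<theta> t g * F \<theta> g \<partial>gauss J) - (\<Sum>u\<in>T. \<beta> * V \<theta> u p * (\<integral>g. e \<theta> t g * e \<theta> u g * F \<theta> g \<partial>gauss J))"
      and st2: "integrable (gauss J) (\<lambda>g. g p * (e \<theta> t g * F \<theta> g))" if "p \<in> J" "t \<in> T" for p t
      using exp_sum_stein(1,2)[OF J that(1) T that(2), of \<beta> "V \<theta>" b] by (simp_all add: e_def F_def)
    define H where "H = (\<lambda>t. \<integral>g. e \<theta> t g * F \<theta> g \<partial>gauss J)"
    define H2 where "H2 = (\<lambda>t u. \<integral>g. e \<theta> t g * e \<theta> u g * F \<theta> g \<partial>gauss J)"
    have H2: "0 \<le> H2 t u" for t u unfolding H2_def by (intro integral_nonneg_AE AE_I2) (simp add: e_def F_def)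
    define Cv where "Cv = (\<lambda>t u. \<Sum>p\<in>J. V' \<theta> t p * V \<theta> u p)"
    \<comment> \<open>The covariance of the angular derivative with the process itself; the mixed
      sums vanish by \<open>orth\<close>.\<close>
    have Cv: "Cv t u = sin \<theta> * cos \<theta> * ((\<Sum>p\<in>J. c t p * c u p) - (\<Sum>p\<in>J. a t p * a u p))" if "t \<in> T" "u \<in> T" for t u
    proof -
      have "Cv t u = (\<Sum>p\<in>J. (sin \<theta> * cos \<theta>) * (c t p * c u p) - (sin \<theta> * cos \<theta>) * (a t p * a u p)
          - (sin \<theta> * sin \<theta>) * (a t p * c u p) + (cos \<theta> * cos \<theta>) * (a u p * c t p))"
        unfolding Cv_def V_def V'_def by (intro sum.cong refl) (simp add: algebra_simps)
      also have "\<dots> = (sin \<theta> * cos \<theta>) * (\<Sum>p\<in>J. c t p * c u p) - (sin \<theta> * cos \<theta>) * (\<Sum>p\<in>J. a t p * a u p)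
          - (sin \<theta> * sin \<theta>) * (\<Sum>p\<in>J. a t p * c u p) + (cos \<theta> * cos \<theta>) * (\<Sum>p\<in>J. a u p * c t p)"
        by (simp only: sum.distrib sum_subtractf sum_distrib_left)
      finally show ?thesis using orth that by (simp add: algebra_simps)
    qed
    have Dsum: "D \<theta> g = - (\<Sum>t\<in>T. \<Sum>p\<in>J. \<beta> * V' \<theta> t p * (g p * (e \<theta> t g * F \<theta> g)))" for g
      unfolding D_def lin_form_def by (simp add: sum_distrib_left sum_distrib_right algebra_simps)
    have "(\<integral>g. D \<theta> g \<partial>gauss J) = - (\<Sum>t\<in>T. \<Sum>p\<in>J. \<beta> * V' \<theta> t p * (\<integral>g. g p * (e \<theta> t g * F \<theta> g) \<partial>gauss J))"
      unfolding Dsum by (simp add: st2)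
    also have "\<dots> = - (\<Sum>t\<in>T. \<Sum>p\<in>J. \<beta> * V' \<theta> t p * (\<beta> * V \<theta> t p * H t - (\<Sum>u\<in>T. \<beta> * V \<theta> u p * H2 t u)))"
      unfolding H_def H2_def by (intro arg_cong[where f=uminus] sum.cong refl) (simp add: st1)
    also have "\<dots> = - (\<Sum>t\<in>T. \<beta> * \<beta> * (Cv t t * H t - (\<Sum>u\<in>T. Cv t u * H2 t u)))"
    proof (intro arg_cong[where f=uminus] sum.cong refl)
      fix t
      have "(\<Sum>p\<in>J. \<Sum>u\<in>T. V' \<theta> t p * V \<theta> u p * H2 t u) = (\<Sum>u\<in>T. Cv t u * H2 t u)"
        unfolding Cv_def sum_distrib_right by (rule sum.swap)
      moreover have "(\<Sum>p\<in>J. \<beta> * V' \<theta> t p * (\<beta> * V \<theta> t p * H t - (\<Sum>u\<in>T. \<beta> * V \<theta> u p * H2 t u)))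
        = (\<Sum>p\<in>J. \<beta> * \<beta> * ((V' \<theta> t p * V \<theta> t p) * H t - (\<Sum>u\<in>T. V' \<theta> t p * V \<theta> u p * H2 t u)))"
        by (intro sum.cong refl) (simp add: sum_distrib_left right_diff_distrib mult_ac)
      ultimately show "(\<Sum>p\<in>J. \<beta> * V' \<theta> t p * (\<beta> * V \<theta> t p * H t - (\<Sum>u\<in>T. \<beta> * V \<theta> u p * H2 t u)))
        = \<beta> * \<beta> * (Cv t t * H t - (\<Sum>u\<in>T. Cv t u * H2 t u))"
        by (simp only: sum_distrib_left[symmetric] sum_subtractf sum_distrib_right[symmetric] Cv_def[symmetric])
           (simp add: Cv_def)
    qed
    \<comment> \<open>Equal variances make \<open>Cv t t\<close> zero, so the terms with
      \<open>H\<close> disappear.\<close>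
    also have "\<dots> = (\<Sum>t\<in>T. \<beta> * \<beta> * (\<Sum>u\<in>T. Cv t u * H2 t u))"
      unfolding sum_negf[symmetric] by (intro sum.cong refl) (simp add: Cv diag)
    also have "\<dots> \<le> (\<Sum>t\<in>T. \<beta> * \<beta> * (\<Sum>u\<in>T. 0))"
    proof (intro sum_mono mult_left_mono)
      fix t u assume tu: "t \<in> T" "u \<in> T"
      have "0 \<le> sin \<theta>" "0 \<le> cos \<theta>" using \<theta> by (auto intro: sin_ge_zero cos_ge_zero)
      then have "Cv t u \<le> 0"
        unfolding Cv[OF tu] using off[OF tu] by (intro mult_nonneg_nonpos mult_nonneg_nonneg) auto
      then show "Cv t u * H2 t u \<le> 0" using H2 by (intro mult_nonpos_nonneg)
    qed simp
    finally show ?thesis by simp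
  qed
  have iF: "integrable (gauss J) (F \<theta>)" for \<theta>
    unfolding F_def by (rule P.integrable_const_bound[where B=1]) (auto simp: exp_sum_nonneg)
  have "(\<integral>g. F (pi/2) g - F 0 g \<partial>gauss J) = (\<integral>g. (\<integral>\<theta>. G (g, \<theta>) \<partial>lborel) \<partial>gauss J)"
    by (simp add: FTC)
  also have "\<dots> = (\<integral>\<theta>. (\<integral>g. G (g, \<theta>) \<partial>gauss J) \<partial>lborel)"
    using Fubini_integral[of "\<lambda>g \<theta>. G (g, \<theta>)"] iG by simp
  also have "\<dots> \<le> (\<integral>\<theta>. 0 \<partial>(lborel :: real measure))"
  proof (rule integral_mono_AE')
    show "AE \<theta> in lborel. (\<integral>g. G (g, \<theta>) \<partial>gauss J) \<le> 0"
      using ED by (intro AE_I2) (auto simp: G_def indicator_def)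
  qed auto
  finally have "(\<integral>g. F (pi/2) g - F 0 g \<partial>gauss J) \<le> 0" by simp
  moreover have "F (pi/2) = (\<lambda>g. exp (- exp_sum \<beta> J T b c g))" "F 0 = (\<lambda>g. exp (- exp_sum \<beta> J T b a g))"
    unfolding F_def V_def by simp_all
  ultimately show ?thesis using iF[of 0] iF[of "pi/2"] by simp
qed

text \<open>If some \<open>t\<close> reaches its threshold, then one minus the smoothed indicator is
  at least 1/2, the source of the factor 2. If every value stays \<delta> below its threshold, it is
  at most \<open>card T * exp (- \<beta> * \<delta>)\<close>, which vanishes as \<beta>
  grows.\<close>

lemma slepian:
  fixes a c :: "'t \<Rightarrow> 'i \<Rightarrow> real" and b :: "'t \<Rightarrow> real"
  assumes J: "finite J" and T: "finite T"
    and orth: "\<And>t u. t \<in> T \<Longrightarrow> u \<in> T \<Longrightarrow> (\<Sum>p\<in>J. a t p * c u p) = 0"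
    and diag: "\<And>t. t \<in> T \<Longrightarrow> (\<Sum>p\<in>J. a t p * a t p) = (\<Sum>p\<in>J. c t p * c t p)"
    and off: "\<And>t u. t \<in> T \<Longrightarrow> u \<in> T \<Longrightarrow> (\<Sum>p\<in>J. c t p * c u p) \<le> (\<Sum>p\<in>J. a t p * a u p)"
    and \<delta>: "0 < \<delta>"
  shows "\<P>(g in gauss J. \<exists>t\<in>T. b t \<le> lin_form J (a t) g)
    \<le> 2 * \<P>(g in gauss J. \<exists>t\<in>T. b t - \<delta> < lin_form J (c t) g)"
proof -
  interpret P: prob_space "gauss J" by (rule prob_space_gauss)
  define A where "A = {g \<in> space (gauss J). \<exists>t\<in>T. b t \<le> lin_form J (a t) g}"
  define C where "C = {g \<in> space (gauss J). \<exists>t\<in>T. b t - \<delta> < lin_form J (c t) g}"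
  have [measurable]: "A \<in> sets (gauss J)" "C \<in> sets (gauss J)"
    unfolding A_def C_def using T by measurable
  have i: "integrable (gauss J) (\<lambda>g. 1 - exp (- exp_sum \<beta> J T b v g))" for \<beta> v
    by (intro Bochner_Integration.integrable_diff P.integrable_const P.integrable_const_bound[where B=1])
       (auto simp: exp_sum_nonneg)
  have i': "integrable (gauss J) (\<lambda>g. exp (- exp_sum \<beta> J T b v g))" for \<beta> v
    by (intro P.integrable_const_bound[where B=1]) (auto simp: exp_sum_nonneg)
  have le: "measure (gauss J) A / 2 \<le> measure (gauss J) C + real (card T) * exp (- \<beta> * \<delta>)" if \<beta>: "0 \<le> \<beta>" for \<beta>
  proof -
    have "measure (gauss J) A / 2 = (\<integral>g. indicator A g / 2 \<partial>gauss J)" by simp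
    also have "\<dots> \<le> (\<integral>g. 1 - exp (- exp_sum \<beta> J T b a g) \<partial>gauss J)"
    proof (rule integral_mono[OF _ i])
      fix g assume g: "g \<in> space (gauss J)"
      show "indicator A g / 2 \<le> 1 - exp (- exp_sum \<beta> J T b a g)"
      proof (cases "g \<in> A")
        case True
        then obtain t where t: "t \<in> T" "b t \<le> lin_form J (a t) g" by (auto simp: A_def)
        have "exp 0 \<le> exp (\<beta> * (lin_form J (a t) g - b t))" using t \<beta> by simp
        also have "\<dots> \<le> exp_sum \<beta> J T b a g" by (rule exp_sum_ge[OF T t(1)])
        finally have "exp (- exp_sum \<beta> J T b a g) \<le> exp (-1)" by simp
        also have "exp (-1) \<le> (1/2 :: real)"
          using exp_ge_add_one_self[of "1::real"] by (simp add: exp_minus field_simps)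
        finally show ?thesis using True by simp
      qed (simp add: exp_sum_nonneg)
    qed (intro integrable_divide_zero integrable_real_indicator; simp add: P.emeasure_eq_measure)
    also have "\<dots> \<le> (\<integral>g. 1 - exp (- exp_sum \<beta> J T b c g) \<partial>gauss J)"
      using slepian_exp[OF J T orth diag off, where b=b and \<beta>=\<beta>] by (simp add: i')
    also have "\<dots> \<le> (\<integral>g. indicator C g + real (card T) * exp (- \<beta> * \<delta>) \<partial>gauss J)"
    proof (rule integral_mono[OF i])
      fix g assume g: "g \<in> space (gauss J)"
      show "1 - exp (- exp_sum \<beta> J T b c g) \<le> indicator C g + real (card T) * exp (- \<beta> * \<delta>)"
      proof (cases "g \<in> C")
        case True
        have "0 \<le> real (card T) * exp (- \<beta> * \<delta>)" "0 < exp (- exp_sum \<beta> J T b c g)" by simp_all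
        moreover have "indicator C g = (1 :: real)" using True by simp
        ultimately show ?thesis by linarith
      next
        case False
        have "exp_sum \<beta> J T b c g \<le> (\<Sum>t\<in>T. exp (- \<beta> * \<delta>))"
          unfolding exp_sum_def
        proof (rule sum_mono)
          fix t assume "t \<in> T"
          then have "lin_form J (c t) g - b t \<le> - \<delta>" using False g by (auto simp: C_def not_less)
          then have "\<beta> * (lin_form J (c t) g - b t) \<le> \<beta> * (- \<delta>)" using \<beta> by (rule mult_left_mono)
          then show "exp (\<beta> * (lin_form J (c t) g - b t)) \<le> exp (- \<beta> * \<delta>)" by simp
        qed
        moreover have "1 - exp (- exp_sum \<beta> J T b c g) \<le> exp_sum \<beta> J T b c g"
          using exp_ge_add_one_self[of "- exp_sum \<beta> J T b c g"] by simp
        ultimately show ?thesis using False by simp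
      qed
    qed (intro Bochner_Integration.integrable_add P.integrable_const integrable_real_indicator; simp add: P.emeasure_eq_measure)
    also have "\<dots> = measure (gauss J) C + real (card T) * exp (- \<beta> * \<delta>)"
      by (subst Bochner_Integration.integral_add)
         (auto simp: P.prob_space P.emeasure_eq_measure intro!: integrable_real_indicator)
    finally show ?thesis .
  qed
  have "((\<lambda>\<beta>. measure (gauss J) C + real (card T) * exp (- \<beta> * \<delta>)) \<longlongrightarrow> measure (gauss J) C + real (card T) * 0) at_top"
    using \<delta> by (intro tendsto_intros) real_asymp
  then have "measure (gauss J) A / 2 \<le> measure (gauss J) C + real (card T) * 0"
    by (rule tendsto_lowerbound) (use le in \<open>auto intro!: eventually_mono[OF eventually_ge_at_top[of 0]]\<close>)
  then show ?thesis unfolding A_def C_def by simp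
qed

section \<open>Extreme quadratic forms of the GOE\<close>

definition gidx :: "nat \<Rightarrow> (nat \<times> nat) set" where
  "gidx n = {(i, j). i \<le> j \<and> j < n}"

text \<open>Independent standard normals on the upper triangle are the only randomness;
  \<open>min\<close> and \<open>max\<close> make the matrix symmetric by construction. The factor
  \<open>sqrt 2\<close> on the diagonal makes the covariance of quadratic forms a function of the
  inner product alone.\<close>

definition goe :: "nat \<Rightarrow> (nat \<times> nat \<Rightarrow> real) \<Rightarrow> nat \<Rightarrow> nat \<Rightarrow> real" where
  "goe n g i j = (if i = j then sqrt 2 * g (i, i) else g (min i j, max i j)) / sqrt (real n)"

definition qform :: "nat \<Rightarrow> (nat \<Rightarrow> nat \<Rightarrow> real) \<Rightarrow> (nat \<Rightarrow> real) \<Rightarrow> real" where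
  "qform n A v = (\<Sum>i<n. \<Sum>j<n. A i j * v i * v j)"

lemma finite_gidx: "finite (gidx n)"
  by (rule finite_subset[of _ "{..n} \<times> {..n}"]) (auto simp: gidx_def)

lemma goe_sym: "goe n g i j = goe n g j i"
  by (auto simp: goe_def min.commute max.commute)

text \<open>Passes from sums over the square to sums over the independent coordinates. The induction
  adds the last row and column.\<close>

lemma sum_symmetric:
  fixes f :: "nat \<Rightarrow> nat \<Rightarrow> real"
  assumes "\<And>i j. f i j = f j i"
  shows "(\<Sum>i<n. \<Sum>j<n. f i j) = (\<Sum>(i, j)\<in>gidx n. if i = j then f i j else 2 * f i j)"
proof (induction n)
  case (Suc n)
  have e: "gidx (Suc n) = gidx n \<union> (\<lambda>i. (i, n)) ` {..n}"
    by (auto simp: gidx_def less_Suc_eq)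
  have "(\<Sum>(i, j)\<in>gidx (Suc n). if i = j then f i j else 2 * f i j)
      = (\<Sum>(i, j)\<in>gidx n. if i = j then f i j else 2 * f i j)
        + (\<Sum>(i, j)\<in>(\<lambda>i. (i, n)) ` {..n}. if i = j then f i j else 2 * f i j)"
    unfolding e by (rule sum.union_disjoint[OF finite_gidx]) (auto simp: gidx_def)
  also have "(\<Sum>(i, j)\<in>(\<lambda>i. (i, n)) ` {..n}. if i = j then f i j else 2 * f i j)
      = (\<Sum>i\<le>n. if i = n then f i n else 2 * f i n)"
    by (subst sum.reindex) (auto simp: inj_on_def)
  also have "\<dots> = f n n + 2 * (\<Sum>i<n. f i n)"
    unfolding lessThan_Suc_atMost[symmetric] by (simp add: sum_distrib_left)
  finally have 1: "(\<Sum>(i, j)\<in>gidx (Suc n). if i = j then f i j else 2 * f i j)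
    = (\<Sum>i<n. \<Sum>j<n. f i j) + (f n n + 2 * (\<Sum>i<n. f i n))" by (simp add: Suc.IH)
  have "(\<Sum>j<n. f n j) = (\<Sum>i<n. f i n)" using assms by simp
  then show ?case unfolding 1 by (simp add: sum.distrib)
qed (simp add: gidx_def)

definition qcoef :: "nat \<Rightarrow> (nat \<Rightarrow> real) \<Rightarrow> nat \<times> nat \<Rightarrow> real" where
  "qcoef n x = (\<lambda>(i, j). (if i = j then sqrt 2 * (x i * x j) else 2 * (x i * x j)) / sqrt (real n))"

lemma qform_goe: "qform n (goe n g) x = (\<Sum>p\<in>gidx n. qcoef n x p * g p)"
proof -
  have "qform n (goe n g) x = (\<Sum>(i, j)\<in>gidx n. if i = j then goe n g i j * x i * x j else 2 * (goe n g i j * x i * x j))"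
    unfolding qform_def by (rule sum_symmetric) (simp add: goe_sym mult_ac)
  also have "\<dots> = (\<Sum>p\<in>gidx n. qcoef n x p * g p)"
    by (intro sum.cong refl) (auto simp: qcoef_def goe_def gidx_def min_def max_def)
  finally show ?thesis .
qed

text \<open>The covariance of the quadratic forms at \<open>x\<close> and \<open>y\<close>; the
  diagonal variance 2/n is exactly what completes the square of the inner product.\<close>

lemma qcoef_prod:
  assumes "n > 0"
  shows "(\<Sum>p\<in>gidx n. qcoef n x p * qcoef n y p) = 2 * (\<Sum>i<n. x i * y i)\<^sup>2 / real n"
proof -
  define f where "f = (\<lambda>i j. (x i * y i) * (x j * y j))"
  have "(\<Sum>i<n. x i * y i)\<^sup>2 = (\<Sum>i<n. \<Sum>j<n. f i j)"
    by (simp add: power2_eq_square sum_product f_def)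
  also have "\<dots> = (\<Sum>(i, j)\<in>gidx n. if i = j then f i j else 2 * f i j)"
    by (rule sum_symmetric) (simp add: f_def)
  finally have "2 * (\<Sum>i<n. x i * y i)\<^sup>2 / real n = (\<Sum>p\<in>gidx n. 2 * (case p of (i, j) \<Rightarrow> if i = j then f i j else 2 * f i j) / real n)"
    by (simp add: sum_distrib_left sum_divide_distrib)
  also have "\<dots> = (\<Sum>p\<in>gidx n. qcoef n x p * qcoef n y p)"
  proof (intro sum.cong refl)
    fix p assume "p \<in> gidx n"
    have s: "sqrt (real n) * sqrt (real n) = real n" by simp
    show "2 * (case p of (i, j) \<Rightarrow> if i = j then f i j else 2 * f i j) / real n = qcoef n x p * qcoef n y p"
      using s assms by (cases p) (auto simp: qcoef_def f_def field_simps)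
  qed
  finally show ?thesis ..
qed

text \<open>Splits \<open>x\<close> into its mean, on which \<open>h\<close> acts weakly by
  \<open>h1\<close>, and the rest, of squared norm \<open>1 - t\<close>, to which Cauchy-Schwarz
  applies.\<close>

lemma quadratic_sup_bound:
  fixes h x :: "nat \<Rightarrow> real"
  assumes n: "0 < n" and lam: "lam \<le> 1" and \<delta>: "0 < \<delta>"
    and h2: "(\<Sum>i<n. (h i)\<^sup>2) \<le> real n * (1 + \<delta>)\<^sup>2" and h1: "\<bar>\<Sum>i<n. h i\<bar> \<le> \<delta> * real n"
    and x: "(\<Sum>i<n. (x i)\<^sup>2) = 1"
  shows "2 / sqrt (real n) * (\<Sum>i<n. h i * x i) + lam * (\<Sum>i<n. x i)\<^sup>2 / real n \<le> 2 + 4 * \<delta>"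
proof -
  define m where "m = (\<Sum>i<n. x i) / real n"
  define t where "t = real n * m\<^sup>2"
  have sx: "(\<Sum>i<n. x i) = real n * m" using n by (simp add: m_def)
  have ts: "(\<Sum>i<n. x i)\<^sup>2 / real n = t" using n by (simp add: sx t_def power2_eq_square)
  have "(\<Sum>i<n. (x i - m)\<^sup>2) = (\<Sum>i<n. (x i)\<^sup>2) - 2 * m * (\<Sum>i<n. x i) + real n * m\<^sup>2"
    by (simp add: power2_diff sum.distrib sum_subtractf sum_distrib_left mult_ac)
  also have "\<dots> = 1 - t" unfolding x sx t_def by (simp add: power2_eq_square)
  finally have xm: "(\<Sum>i<n. (x i - m)\<^sup>2) = 1 - t" .
  have t1: "0 \<le> t" "t \<le> 1" using sum_nonneg[of "{..<n}" "\<lambda>i. (x i - m)\<^sup>2"] by (auto simp: xm t_def)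
  have "(\<Sum>i<n. h i * x i) = m * (\<Sum>i<n. h i) + (\<Sum>i<n. h i * (x i - m))"
    by (simp add: sum_distrib_left sum_distrib_right right_diff_distrib sum_subtractf mult_ac)
  moreover have "m * (\<Sum>i<n. h i) \<le> \<delta> * sqrt (real n)"
  proof -
    have "m * (\<Sum>i<n. h i) \<le> \<bar>m\<bar> * \<bar>\<Sum>i<n. h i\<bar>" by (simp add: abs_mult[symmetric])
    also have "\<dots> \<le> \<bar>m\<bar> * (\<delta> * real n)" by (intro mult_left_mono h1) simp
    also have "\<dots> = (\<delta> * sqrt (real n)) * (\<bar>m\<bar> * sqrt (real n))" by (simp add: algebra_simps)
    also have "\<bar>m\<bar> * sqrt (real n) = sqrt t" by (simp add: t_def real_sqrt_mult)
    also have "(\<delta> * sqrt (real n)) * sqrt t \<le> (\<delta> * sqrt (real n)) * 1"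
      using t1 \<delta> by (intro mult_left_mono) auto
    finally show ?thesis by simp
  qed
  moreover have "(\<Sum>i<n. h i * (x i - m)) \<le> sqrt (real n) * (1 + \<delta>) * (1 - t / 2)"
  proof -
    have "(\<Sum>i<n. h i * (x i - m)) \<le> L2_set h {..<n} * L2_set (\<lambda>i. x i - m) {..<n}"
      by (rule order_trans[OF sum_mono[OF abs_ge_self] order_trans[OF _ L2_set_mult_ineq]]) (simp add: abs_mult)
    also have "\<dots> \<le> (sqrt (real n) * (1 + \<delta>)) * sqrt (1 - t)"
    proof (intro mult_mono)
      show "L2_set h {..<n} \<le> sqrt (real n) * (1 + \<delta>)"
        unfolding L2_set_def using real_sqrt_le_mono[OF h2] \<delta> by (simp add: real_sqrt_mult)
      show "L2_set (\<lambda>i. x i - m) {..<n} \<le> sqrt (1 - t)" by (simp add: L2_set_def xm)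
    qed (use \<delta> in \<open>auto simp: L2_set_nonneg\<close>)
    \<comment> \<open>Linearising the square root at 0 leaves, up to \<delta>, \<open>2 - t\<close>
      against the spike term \<open>lam * t\<close>, so \<open>lam \<le> 1\<close> decides.\<close>
    also have "sqrt (1 - t) \<le> 1 - t / 2"
      using t1 by (intro real_le_lsqrt) (auto simp: power2_eq_square algebra_simps)
    finally show ?thesis using \<delta> by (simp add: mult_left_mono)
  qed
  moreover have "sqrt (real n) * (\<delta> + (1 + \<delta>) * (1 - t / 2)) = \<delta> * sqrt (real n) + sqrt (real n) * (1 + \<delta>) * (1 - t / 2)"
    by (simp add: algebra_simps)
  ultimately have "(\<Sum>i<n. h i * x i) \<le> sqrt (real n) * (\<delta> + (1 + \<delta>) * (1 - t / 2))"
    by linarith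
  then have "2 / sqrt (real n) * (\<Sum>i<n. h i * x i) \<le> 2 / sqrt (real n) * (sqrt (real n) * (\<delta> + (1 + \<delta>) * (1 - t / 2)))"
    by (intro mult_left_mono) auto
  also have "\<dots> = 2 * (\<delta> + (1 + \<delta>) * (1 - t / 2))" using n by simp
  finally have "2 / sqrt (real n) * (\<Sum>i<n. h i * x i) \<le> 2 * (\<delta> + (1 + \<delta>) * (1 - t / 2))" .
  moreover have "lam * (\<Sum>i<n. x i)\<^sup>2 / real n \<le> 1 * t"
    using ts mult_right_mono[OF lam t1(1)] by (metis times_divide_eq_right)
  moreover have "0 \<le> \<delta> * t" using \<delta> t1 by simp
  moreover have "2 * (\<delta> + (1 + \<delta>) * (1 - t / 2)) = 2 + 4 * \<delta> - t - \<delta> * t" by (simp add: algebra_simps)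
  ultimately show ?thesis by linarith
qed

text \<open>Pairs with first entry \<open>n\<close> never lie in \<open>gidx n\<close>. The
  coordinates \<open>(n, i)\<close> with \<open>i < n\<close> carry the comparison vector h, and
  \<open>(n, n)\<close> carries the equalising variable \<xi>.\<close>

definition aux :: "nat \<Rightarrow> (nat \<times> nat) set" where
  "aux n = Pair n ` {..n}"

lemma aux_disjoint: "gidx n \<inter> aux n = {}" and finite_aux: "finite (aux n)"
  by (auto simp: aux_def gidx_def)

text \<open>The sum of n centred squares has second moment at most 2n and the sum of the coordinates
  has second moment n. Chebyshev at the levels 2\<delta>n and \<delta>n gives the constant 1/2 + 1,
  rounded up to 2.\<close>

lemma aux_tail:
  assumes n: "0 < n" and \<delta>: "0 < \<delta>" and J: "finite J" "aux n \<subseteq> J"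
  shows "\<P>(g in gauss J. \<not> (\<Sum>i<n. (g (n, i))\<^sup>2) \<le> real n * (1 + \<delta>)\<^sup>2 \<or> \<not> \<bar>\<Sum>i<n. g (n, i)\<bar> \<le> \<delta> * real n)
    \<le> 2 / (\<delta>\<^sup>2 * real n)"
proof -
  interpret P: prob_space "gauss J" by (rule prob_space_gauss)
  have in_J: "(n, i) \<in> J" if "i < n" for i using J that by (auto simp: aux_def)
  define Q where "Q = (\<lambda>g :: nat \<times> nat \<Rightarrow> real. \<Sum>i<n. (g (n, i))\<^sup>2 - 1)"
  define L where "L = (\<lambda>g :: nat \<times> nat \<Rightarrow> real. \<Sum>i<n. g (n, i))"
  have [measurable]: "Q \<in> borel_measurable (gauss J)" "L \<in> borel_measurable (gauss J)"
    unfolding Q_def L_def using in_J by (auto intro!: borel_measurable_sum borel_measurable_diff borel_measurable_power)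
  have e: "inj_on (Pair n) {..<n}" "Pair n ` {..<n} \<subseteq> J" using in_J by (auto simp: inj_on_def)
  have Q: "Q g = (\<Sum>j<n. \<Sum>k<n. of_bool (j = k) * (g (n, j) * g (n, k) - of_bool (j = k)))" for g
    by (simp add: Q_def of_bool_def if_distrib[where f="\<lambda>x. x * _"] power2_eq_square cong: if_cong)
  have iQ: "integrable (gauss J) (\<lambda>g. (Q g)\<^sup>2)" and EQ: "(\<integral>g. (Q g)\<^sup>2 \<partial>gauss J) \<le> 2 * real n"
    using gauss_quadratic_form[OF J(1) finite_lessThan e, of "\<lambda>j k. of_bool (j = k)"]
    unfolding Q by (simp_all add: of_bool_def if_distrib[where f="\<lambda>x. x\<^sup>2"] cong: if_cong)
  have iL: "integrable (gauss J) (\<lambda>g. (L g)\<^sup>2)" and EL: "(\<integral>g. (L g)\<^sup>2 \<partial>gauss J) = real n"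
    using gauss_linear_form(1,2)[OF J(1) finite_lessThan e, of "\<lambda>_. 1"] by (simp_all add: L_def)
  have mk: "\<P>(g in gauss J. r \<le> (X g)\<^sup>2) \<le> (\<integral>g. (X g)\<^sup>2 \<partial>gauss J) / r"
    if "0 < r" "integrable (gauss J) (\<lambda>g. (X g)\<^sup>2)" for X :: "(nat \<times> nat \<Rightarrow> real) \<Rightarrow> real" and r
    by (rule integral_Markov_inequality_measure[OF that(2), of "space (gauss J)"]) (use that in auto)
  have dn: "0 < (\<delta> * real n)\<^sup>2" using n \<delta> by simp
  have "\<P>(g in gauss J. \<not> (\<Sum>i<n. (g (n, i))\<^sup>2) \<le> real n * (1 + \<delta>)\<^sup>2 \<or> \<not> \<bar>\<Sum>i<n. g (n, i)\<bar> \<le> \<delta> * real n)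
    \<le> measure (gauss J) ({g \<in> space (gauss J). (2 * \<delta> * real n)\<^sup>2 \<le> (Q g)\<^sup>2} \<union> {g \<in> space (gauss J). (\<delta> * real n)\<^sup>2 \<le> (L g)\<^sup>2})"
  proof (rule P.finite_measure_mono)
    show "{g \<in> space (gauss J). \<not> (\<Sum>i<n. (g (n, i))\<^sup>2) \<le> real n * (1 + \<delta>)\<^sup>2 \<or> \<not> \<bar>\<Sum>i<n. g (n, i)\<bar> \<le> \<delta> * real n}
      \<subseteq> {g \<in> space (gauss J). (2 * \<delta> * real n)\<^sup>2 \<le> (Q g)\<^sup>2} \<union> {g \<in> space (gauss J). (\<delta> * real n)\<^sup>2 \<le> (L g)\<^sup>2}"
    proof safe
      fix g assume g: "\<not> (\<Sum>i<n. (g (n, i))\<^sup>2) \<le> real n * (1 + \<delta>)\<^sup>2"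
      have "Q g = (\<Sum>i<n. (g (n, i))\<^sup>2) - real n" by (simp add: Q_def sum_subtractf)
      moreover have "real n * (1 + \<delta>)\<^sup>2 - real n \<ge> 2 * \<delta> * real n"
        using \<delta> by (simp add: power2_eq_square algebra_simps)
      ultimately have "2 * \<delta> * real n \<le> Q g" using g by linarith
      then show "(2 * \<delta> * real n)\<^sup>2 \<le> (Q g)\<^sup>2" using \<delta> by (intro power_mono) auto
    next
      fix g assume g: "\<not> \<bar>\<Sum>i<n. g (n, i)\<bar> \<le> \<delta> * real n" "\<not> (\<delta> * real n)\<^sup>2 \<le> (L g)\<^sup>2"
      then show "(2 * \<delta> * real n)\<^sup>2 \<le> (Q g)\<^sup>2"
        using \<delta> by (simp add: abs_le_square_iff[symmetric] L_def)
    qed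
  qed measurable
  also have "\<dots> \<le> \<P>(g in gauss J. (2 * \<delta> * real n)\<^sup>2 \<le> (Q g)\<^sup>2)
      + \<P>(g in gauss J. (\<delta> * real n)\<^sup>2 \<le> (L g)\<^sup>2)"
    by (rule measure_Un_le) measurable
  also have "\<dots> \<le> (2 * real n) / (2 * \<delta> * real n)\<^sup>2 + real n / (\<delta> * real n)\<^sup>2"
  proof (intro add_mono)
    show "\<P>(g in gauss J. (2 * \<delta> * real n)\<^sup>2 \<le> (Q g)\<^sup>2) \<le> (2 * real n) / (2 * \<delta> * real n)\<^sup>2"
      using n \<delta> by (intro order_trans[OF mk[OF _ iQ]] divide_right_mono EQ) auto
    show "\<P>(g in gauss J. (\<delta> * real n)\<^sup>2 \<le> (L g)\<^sup>2) \<le> real n / (\<delta> * real n)\<^sup>2"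
      using mk[OF dn iL] EL by simp
  qed
  also have "\<dots> = 3 / 2 / (\<delta>\<^sup>2 * real n)" using n \<delta> by (simp add: field_simps power2_eq_square)
  also have "\<dots> \<le> 2 / (\<delta>\<^sup>2 * real n)" by (intro divide_right_mono) auto
  finally show ?thesis .
qed

text \<open>The sign \<open>s\<close> lets one lemma treat both W and -W. The constant 8 is the 2 of
  \<open>aux_tail\<close>, doubled by Slepian's inequality and doubled again when \<xi> is removed.
  Of the margin 6\<delta>, \<open>quadratic_sup_bound\<close> takes 4\<delta> and Slepian's slack
  takes \<delta>; the rest makes the contradiction strict.\<close>

lemma goe_max_finite:
  fixes X :: "(nat \<Rightarrow> real) set"
  assumes n: "0 < n" and lam: "lam \<le> 1" and \<delta>: "0 < \<delta>" and s: "s * s = (1 :: real)"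
    and X: "finite X" "\<And>x. x \<in> X \<Longrightarrow> (\<Sum>i<n. (x i)\<^sup>2) = 1"
  defines "J \<equiv> gidx n \<union> aux n"
  shows "\<P>(g in gauss J. \<exists>x\<in>X. 2 + 6 * \<delta> \<le> s * qform n (goe n g) x + lam * (\<Sum>i<n. x i)\<^sup>2 / real n)
    \<le> 8 / (\<delta>\<^sup>2 * real n)"
proof -
  interpret P: prob_space "gauss J" by (rule prob_space_gauss)
  have J: "finite J" by (simp add: J_def finite_gidx finite_aux)
  \<comment> \<open>On unit vectors the process \<open>a\<close> has variance 2/n from the matrix
    and 2/n from \<xi>, matching the 4/n of the process \<open>c\<close>.\<close>
  define a where "a = (\<lambda>x p. if p \<in> gidx n then s * qcoef n x p else if p = (n, n) then sqrt (2 / real n) else 0)"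
  define c where "c = (\<lambda>x (p :: nat \<times> nat). if p \<in> gidx n then 0 else if snd p < n then 2 * x (snd p) / sqrt (real n) else 0)"
  define b where "b = (\<lambda>x. 2 + 6 * \<delta> - lam * (\<Sum>i<n. x i)\<^sup>2 / real n)"
  have sumJ: "(\<Sum>p\<in>J. f p) = (\<Sum>p\<in>gidx n. f p) + (\<Sum>i<n. f (n, i)) + f (n, n)" for f :: "nat \<times> nat \<Rightarrow> real"
  proof -
    have "(\<Sum>p\<in>J. f p) = (\<Sum>p\<in>gidx n. f p) + (\<Sum>p\<in>aux n. f p)"
      unfolding J_def using aux_disjoint by (intro sum.union_disjoint finite_gidx finite_aux)
    also have "(\<Sum>p\<in>aux n. f p) = (\<Sum>i\<le>n. f (n, i))"
      unfolding aux_def by (subst sum.reindex) (auto simp: inj_on_def)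
    finally show ?thesis unfolding lessThan_Suc_atMost[symmetric] by simp
  qed
  have nn: "(n, i) \<notin> gidx n" for i by (simp add: gidx_def)
  have aa: "(\<Sum>p\<in>J. a x p * a y p) = 2 * (\<Sum>i<n. x i * y i)\<^sup>2 / real n + 2 / real n" for x y
  proof -
    have "(\<Sum>p\<in>gidx n. a x p * a y p) = (\<Sum>p\<in>gidx n. qcoef n x p * qcoef n y p)"
    proof (intro sum.cong refl)
      fix p assume "p \<in> gidx n"
      then have "a x p * a y p = (s * s) * (qcoef n x p * qcoef n y p)" by (simp add: a_def)
      then show "a x p * a y p = qcoef n x p * qcoef n y p" using s by simp
    qed
    then show ?thesis unfolding sumJ qcoef_prod[OF n] by (simp add: a_def nn)
  qed
  have cc: "(\<Sum>p\<in>J. c x p * c y p) = 4 * (\<Sum>i<n. x i * y i) / real n" for x y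
  proof -
    have "(\<Sum>i<n. c x (n, i) * c y (n, i)) = (\<Sum>i<n. 4 / real n * (x i * y i))"
      by (intro sum.cong refl) (simp add: c_def nn)
    also have "\<dots> = 4 * (\<Sum>i<n. x i * y i) / real n"
      by (simp add: sum_distrib_left sum_divide_distrib)
    finally show ?thesis unfolding sumJ by (simp add: c_def nn)
  qed
  have xx: "(\<Sum>i<n. x i * x i) = 1" if "x \<in> X" for x using X(2)[OF that] by (simp add: power2_eq_square)
  have sl: "\<P>(g in gauss J. \<exists>x\<in>X. b x \<le> lin_form J (a x) g)
    \<le> 2 * \<P>(g in gauss J. \<exists>x\<in>X. b x - \<delta> < lin_form J (c x) g)"
  proof (rule slepian[OF J X(1) _ _ _ \<delta>])
    fix x y assume xy: "x \<in> X" "y \<in> X"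
    show "(\<Sum>p\<in>J. a x p * c y p) = 0" unfolding sumJ by (simp add: a_def c_def nn)
    show "(\<Sum>p\<in>J. a x p * a x p) = (\<Sum>p\<in>J. c x p * c x p)" unfolding aa cc xx[OF xy(1)] by simp
    define r where "r = (\<Sum>i<n. x i * y i)"
    \<comment> \<open>The covariance gap is 2(r - 1)^2/n, zero when x = y; the variance of \<xi> is
      what turns it into a perfect square.\<close>
    have "4 * r \<le> 2 * r\<^sup>2 + 2" using zero_le_power2[of "r - 1"] by (simp add: power2_diff)
    then have "4 * r / real n \<le> (2 * r\<^sup>2 + 2) / real n" by (intro divide_right_mono) auto
    then show "(\<Sum>p\<in>J. c x p * c y p) \<le> (\<Sum>p\<in>J. a x p * a y p)" unfolding aa cc r_def by (simp add: add_divide_distrib)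
  qed
  have "\<P>(g in gauss J. \<exists>x\<in>X. b x - \<delta> < lin_form J (c x) g)
    \<le> \<P>(g in gauss J. \<not> (\<Sum>i<n. (g (n, i))\<^sup>2) \<le> real n * (1 + \<delta>)\<^sup>2 \<or> \<not> \<bar>\<Sum>i<n. g (n, i)\<bar> \<le> \<delta> * real n)"
  proof (rule P.finite_measure_mono)
    show "{g \<in> space (gauss J). \<exists>x\<in>X. b x - \<delta> < lin_form J (c x) g}
      \<subseteq> {g \<in> space (gauss J). \<not> (\<Sum>i<n. (g (n, i))\<^sup>2) \<le> real n * (1 + \<delta>)\<^sup>2 \<or> \<not> \<bar>\<Sum>i<n. g (n, i)\<bar> \<le> \<delta> * real n}"
    proof safe
      fix g x assume x: "x \<in> X" "b x - \<delta> < lin_form J (c x) g"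
        and l: "\<bar>\<Sum>i<n. g (n, i)\<bar> \<le> \<delta> * real n"
      show "(\<Sum>i<n. (g (n, i))\<^sup>2) \<le> real n * (1 + \<delta>)\<^sup>2 \<Longrightarrow> False"
      proof -
        assume h: "(\<Sum>i<n. (g (n, i))\<^sup>2) \<le> real n * (1 + \<delta>)\<^sup>2"
        from quadratic_sup_bound[OF n lam \<delta> h l X(2)[OF x(1)]]
        have "2 / sqrt (real n) * (\<Sum>i<n. g (n, i) * x i) + lam * (\<Sum>i<n. x i)\<^sup>2 / real n \<le> 2 + 4 * \<delta>" .
        moreover have "lin_form J (c x) g = 2 / sqrt (real n) * (\<Sum>i<n. g (n, i) * x i)"
          unfolding lin_form_def sumJ by (simp add: c_def nn sum_distrib_left mult_ac)
        ultimately show False using x(2) \<delta> by (simp add: b_def)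
      qed
    qed
    have m: "(\<lambda>g. g (n, i)) \<in> borel_measurable (gauss J)" if "i < n" for i
    proof -
      have "(n, i) \<in> J" using that by (auto simp: J_def aux_def)
      then show ?thesis by measurable
    qed
    have [measurable]: "(\<lambda>g. \<Sum>i<n. (g (n, i))\<^sup>2) \<in> borel_measurable (gauss J)" "(\<lambda>g. \<Sum>i<n. g (n, i)) \<in> borel_measurable (gauss J)"
      using m by (auto intro!: borel_measurable_sum borel_measurable_power)
    show "{g \<in> space (gauss J). \<not> (\<Sum>i<n. (g (n, i))\<^sup>2) \<le> real n * (1 + \<delta>)\<^sup>2 \<or> \<not> \<bar>\<Sum>i<n. g (n, i)\<bar> \<le> \<delta> * real n} \<in> sets (gauss J)"
      by measurable
  qed
  also have "\<dots> \<le> 2 / (\<delta>\<^sup>2 * real n)"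
    by (rule aux_tail[OF n \<delta> J]) (simp add: J_def)
  finally have B: "\<P>(g in gauss J. \<exists>x\<in>X. b x \<le> lin_form J (a x) g) \<le> 4 / (\<delta>\<^sup>2 * real n)"
    using sl by simp
  define E where "E = {g \<in> space (gauss J). \<exists>x\<in>X. 2 + 6 * \<delta> \<le> s * qform n (goe n g) x + lam * (\<Sum>i<n. x i)\<^sup>2 / real n}"
  \<comment> \<open>Where \<xi> is nonnegative, adding its term only raises the form, so the
    comparison bound applies. Flipping the sign of \<xi> leaves the matrix alone and maps the other
    half of the event into this one.\<close>
  define Ep where "Ep = {g \<in> E. 0 \<le> g (n, n)}"
  define Em where "Em = {g \<in> E. g (n, n) \<le> 0}"
  have la: "lin_form J (a x) g = s * qform n (goe n g) x + sqrt (2 / real n) * g (n, n)" for x g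
    unfolding lin_form_def sumJ qform_goe by (simp add: a_def nn sum_distrib_left mult_ac)
  have mn[measurable]: "(\<lambda>g. g (n, n)) \<in> borel_measurable (gauss J)"
  proof -
    have "(n, n) \<in> J" by (auto simp: J_def aux_def)
    then show ?thesis by measurable
  qed
  have mq[measurable]: "(\<lambda>g. s * qform n (goe n g) x) \<in> borel_measurable (gauss J)" for x
  proof -
    have "(\<lambda>g. lin_form J (a x) g - sqrt (2 / real n) * g (n, n)) \<in> borel_measurable (gauss J)" by measurable
    then show ?thesis unfolding la by simp
  qed
  have [measurable]: "E \<in> sets (gauss J)" unfolding E_def using X(1) by measurable
  have [measurable]: "Ep \<in> sets (gauss J)" "Em \<in> sets (gauss J)"
  proof -
    have "Ep = E \<inter> {g \<in> space (gauss J). 0 \<le> g (n, n)}" "Em = E \<inter> {g \<in> space (gauss J). g (n, n) \<le> 0}"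
      by (auto simp: Ep_def Em_def E_def)
    then show "Ep \<in> sets (gauss J)" "Em \<in> sets (gauss J)" by simp_all
  qed
  have Ep: "measure (gauss J) Ep \<le> 4 / (\<delta>\<^sup>2 * real n)"
  proof (rule order_trans[OF P.finite_measure_mono B])
    show "Ep \<subseteq> {g \<in> space (gauss J). \<exists>x\<in>X. b x \<le> lin_form J (a x) g}"
      unfolding Ep_def E_def la b_def by (auto intro!: bexI simp: add_increasing2)
  qed (use X(1) in measurable)
  have sub: "{(n, n)} \<subseteq> J" by (auto simp: J_def aux_def)
  have "measure (gauss J) Em = measure (distr (gauss J) (gauss J) (flip {(n, n)})) Em"
    by (simp add: gauss_flip[OF J sub])
  also have "\<dots> = measure (gauss J) (flip {(n, n)} -` Em \<inter> space (gauss J))"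
    by (intro measure_distr flip_measurable sub) measurable
  also have "flip {(n, n)} -` Em \<inter> space (gauss J) \<subseteq> Ep"
  proof
    fix g assume g: "g \<in> flip {(n, n)} -` Em \<inter> space (gauss J)"
    have "goe n (flip {(n, n)} g) i j = goe n g i j" if "i < n" "j < n" for i j
      using that by (auto simp: goe_def flip_def min_def max_def)
    then have "qform n (goe n (flip {(n, n)} g)) x = qform n (goe n g) x" for x
      unfolding qform_def by (intro sum.cong refl) auto
    then show "g \<in> Ep" using g by (auto simp: Ep_def Em_def E_def flip_def)
  qed
  then have "measure (gauss J) (flip {(n, n)} -` Em \<inter> space (gauss J)) \<le> measure (gauss J) Ep"
    by (intro P.finite_measure_mono) auto
  finally have Em: "measure (gauss J) Em \<le> measure (gauss J) Ep" .
  have "measure (gauss J) E \<le> measure (gauss J) (Ep \<union> Em)"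
    by (intro P.finite_measure_mono) (auto simp: Ep_def Em_def)
  also have "\<dots> \<le> measure (gauss J) Ep + measure (gauss J) Em" by (rule measure_Un_le) measurable
  also have "\<dots> \<le> 8 / (\<delta>\<^sup>2 * real n)" using Ep Em by simp
  finally show ?thesis unfolding E_def .
qed

lemma qform_cong: "(\<And>i. i < n \<Longrightarrow> v i = w i) \<Longrightarrow> qform n A v = qform n A w"
  unfolding qform_def by (intro sum.cong) auto

lemma qform_scale: "qform n A (\<lambda>i. r * v i) = r\<^sup>2 * qform n A v"
  unfolding qform_def by (simp add: sum_distrib_left power2_eq_square mult_ac)

lemma qform_Suc: "qform (Suc n) A v = qform n A v + (\<Sum>i<n. (A i n + A n i) * v i) * v n + A n n * (v n)\<^sup>2"
  unfolding qform_def by (simp add: sum.distrib sum_distrib_left sum_distrib_right power2_eq_square algebra_simps)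

lemma qform_measurable:
  assumes "gidx n \<subseteq> J"
  shows "(\<lambda>g. qform n (goe n g) x) \<in> borel_measurable (gauss J)"
proof -
  have [measurable]: "(\<lambda>g. g p) \<in> borel_measurable (gauss J)" if "p \<in> gidx n" for p
  proof -
    have "p \<in> J" using that assms by auto
    then show ?thesis by measurable
  qed
  show ?thesis unfolding qform_goe by measurable
qed

lemma floor_approx: "(\<lambda>k. of_int \<lfloor>real k * v\<rfloor> / real k) \<longlonglongrightarrow> v"
proof (rule LIM_zero_cancel, rule Lim_null_comparison)
  show "\<forall>\<^sub>F k in sequentially. norm (of_int \<lfloor>real k * v\<rfloor> / real k - v) \<le> 1 / real k"
    using eventually_gt_at_top[of 0]
  proof eventually_elim
    case (elim k)
    have "\<bar>of_int \<lfloor>real k * v\<rfloor> - real k * v\<bar> \<le> 1" by linarith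
    then have "\<bar>of_int \<lfloor>real k * v\<rfloor> - real k * v\<bar> / real k \<le> 1 / real k" by (intro divide_right_mono) auto
    moreover have "of_int \<lfloor>real k * v\<rfloor> / real k - v = (of_int \<lfloor>real k * v\<rfloor> - real k * v) / real k"
      using elim by (simp add: diff_divide_distrib)
    ultimately show ?case by simp
  qed
qed real_asymp

lemma qform_const: "qform n (\<lambda>i j. a) v = a * (\<Sum>i<n. v i)\<^sup>2"
  unfolding qform_def power2_eq_square sum_product by (simp add: sum_distrib_left mult.assoc)

lemma qform_add: "qform n (\<lambda>i j. A i j + B i j) v = qform n A v + qform n B v"
  unfolding qform_def by (simp add: distrib_right sum.distrib)

lemma qform_diff: "qform n (\<lambda>i j. A i j - B i j) v = qform n A v - qform n B v"
  unfolding qform_def by (simp add: left_diff_distrib sum_subtractf)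

lemma qform_mult: "qform n (\<lambda>i j. r * A i j) v = r * qform n A v"
  unfolding qform_def by (simp add: sum_distrib_left mult.assoc)

lemma qform_diag: "qform n (\<lambda>i j. c * of_bool (i = j)) v = c * (\<Sum>i<n. (v i)\<^sup>2)"
  unfolding qform_def sum_distrib_left
  by (intro sum.cong refl) (simp add: of_bool_def if_distrib[where f="\<lambda>x. x * _"] if_distrib[where f="(*) _"] power2_eq_square cong: if_cong)

section \<open>Reduction of quadratic form bounds to countably many directions\<close>

text \<open>Both sides are homogeneous of degree two, so the bound passes from integer to rational
  vectors and then by continuity to real ones.\<close>

lemma qform_le_of_int:
  assumes int: "\<And>q :: nat \<Rightarrow> int. qform n A (\<lambda>i. real_of_int (q i)) \<le> c * (\<Sum>i<n. (real_of_int (q i))\<^sup>2)"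
  shows "qform n A v \<le> c * (\<Sum>i<n. (v i)\<^sup>2)"
proof -
  define w where "w = (\<lambda>k i. of_int \<lfloor>real k * v i\<rfloor> / real k)"
  have w: "(\<lambda>k. w k i) \<longlonglongrightarrow> v i" for i unfolding w_def by (rule floor_approx)
  have le: "qform n A (w k) \<le> c * (\<Sum>i<n. (w k i)\<^sup>2)" for k
  proof -
    have wk: "w k = (\<lambda>i. (1 / real k) * real_of_int \<lfloor>real k * v i\<rfloor>)" by (simp add: w_def)
    have "qform n A (w k) = (1 / real k)\<^sup>2 * qform n A (\<lambda>i. real_of_int \<lfloor>real k * v i\<rfloor>)"
      unfolding wk by (rule qform_scale)
    also have "\<dots> \<le> (1 / real k)\<^sup>2 * (c * (\<Sum>i<n. (real_of_int \<lfloor>real k * v i\<rfloor>)\<^sup>2))"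
      by (intro mult_left_mono int) auto
    also have "\<dots> = c * (\<Sum>i<n. (w k i)\<^sup>2)"
      unfolding wk power_mult_distrib by (simp add: sum_distrib_left mult_ac)
    finally show ?thesis .
  qed
  have 1: "(\<lambda>k. qform n A (w k)) \<longlonglongrightarrow> qform n A v"
    unfolding qform_def by (intro tendsto_intros w)
  have 2: "(\<lambda>k. c * (\<Sum>i<n. (w k i)\<^sup>2)) \<longlonglongrightarrow> c * (\<Sum>i<n. (v i)\<^sup>2)"
    by (intro tendsto_intros w)
  show ?thesis by (rule LIMSEQ_le[OF 1 2]) (use le in auto)
qed

definition int_norm :: "nat \<Rightarrow> (nat \<Rightarrow> int) \<Rightarrow> real" where
  "int_norm n q = sqrt (\<Sum>i<n. (real_of_int (q i))\<^sup>2)"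

text \<open>Extensional functions on \<open>{..<n}\<close> keep each set finite, and every nonzero
  integer vector contributes its direction once \<open>k\<close> is large.\<close>

definition int_dirs :: "nat \<Rightarrow> nat \<Rightarrow> (nat \<Rightarrow> real) set" where
  "int_dirs n k = (\<lambda>q i. (1 / int_norm n q) * real_of_int (q i)) `
     {q \<in> {..<n} \<rightarrow>\<^sub>E {- int k..int k}. int_norm n q \<noteq> 0}"

lemma int_norm_sq: "(int_norm n q)\<^sup>2 = (\<Sum>i<n. (real_of_int (q i))\<^sup>2)"
  by (simp add: int_norm_def sum_nonneg)

lemma finite_int_dirs: "finite (int_dirs n k)"
  unfolding int_dirs_def by (intro finite_imageI finite_Collect_conjI disjI1) (simp add: finite_PiE)

lemma int_dirs_unit:
  assumes "x \<in> int_dirs n k"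
  shows "(\<Sum>i<n. (x i)\<^sup>2) = 1"
proof -
  obtain q where q: "int_norm n q \<noteq> 0" "x = (\<lambda>i. (1 / int_norm n q) * real_of_int (q i))"
    using assms by (auto simp: int_dirs_def)
  have "(\<Sum>i<n. (x i)\<^sup>2) = (1 / int_norm n q)\<^sup>2 * (int_norm n q)\<^sup>2"
    unfolding q(2) int_norm_sq by (simp only: power_mult_distrib sum_distrib_left)
  then show ?thesis using q(1) by (simp add: power_divide)
qed

lemma int_dirs_mono: "int_dirs n k \<subseteq> int_dirs n (Suc k)"
proof -
  have "q \<in> {..<n} \<rightarrow>\<^sub>E {- int (Suc k)..int (Suc k)}" if "q \<in> {..<n} \<rightarrow>\<^sub>E {- int k..int k}" for q
    by (rule PiE_mono[THEN subsetD, OF _ that]) auto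
  then show ?thesis unfolding int_dirs_def by (intro image_mono Collect_mono) simp
qed

text \<open>The strict hypothesis is the negation of the bad event for finite sets of directions.
  The zero vector has no direction and is treated apart.\<close>

lemma qform_le_of_int_dirs:
  assumes "\<And>k x. x \<in> int_dirs n k \<Longrightarrow> qform n A x < c"
  shows "qform n A v \<le> c * (\<Sum>i<n. (v i)\<^sup>2)"
proof (rule qform_le_of_int)
  fix q :: "nat \<Rightarrow> int"
  show "qform n A (\<lambda>i. real_of_int (q i)) \<le> c * (\<Sum>i<n. (real_of_int (q i))\<^sup>2)"
  proof (cases "int_norm n q = 0")
    case True
    then have z: "(\<Sum>i<n. (real_of_int (q i))\<^sup>2) = 0" by (simp add: int_norm_def sum_nonneg)
    then have "real_of_int (q i) = 0" if "i < n" for i using that by (simp add: sum_nonneg_eq_0_iff)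
    then have "qform n A (\<lambda>i. real_of_int (q i)) = qform n A (\<lambda>i. 0)" by (intro qform_cong)
    then show ?thesis unfolding z by (simp add: qform_def)
  next
    case False
    define q' where "q' = restrict q {..<n}"
    define k where "k = nat (\<Sum>i<n. \<bar>q i\<bar>)"
    have NN: "int_norm n q' = int_norm n q" by (simp add: int_norm_def q'_def)
    have "q i \<in> {- int k..int k}" if "i < n" for i
    proof -
      have "\<bar>q i\<bar> \<le> int k"
        using that member_le_sum[of i "{..<n}" "\<lambda>i. \<bar>q i\<bar>"] by (simp add: k_def sum_nonneg)
      then have "- int k \<le> q i" "q i \<le> int k" by linarith+
      then show ?thesis by simp
    qed
    then have "q' \<in> {..<n} \<rightarrow>\<^sub>E {- int k..int k}" unfolding q'_def by simp
    then have "(\<lambda>i. (1 / int_norm n q') * real_of_int (q' i)) \<in> int_dirs n k"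
      unfolding int_dirs_def using False NN by (intro image_eqI[OF refl]) simp
    then have "qform n A (\<lambda>i. (1 / int_norm n q') * real_of_int (q' i)) < c" by (rule assms)
    also have "qform n A (\<lambda>i. (1 / int_norm n q') * real_of_int (q' i)) = (1 / int_norm n q)\<^sup>2 * qform n A (\<lambda>i. real_of_int (q' i))"
      unfolding NN by (rule qform_scale)
    also have "qform n A (\<lambda>i. real_of_int (q' i)) = qform n A (\<lambda>i. real_of_int (q i))"
      by (rule qform_cong) (simp add: q'_def)
    finally have "qform n A (\<lambda>i. real_of_int (q i)) < c * (int_norm n q)\<^sup>2"
      using False by (simp add: field_simps)
    then show ?thesis unfolding int_norm_sq by simp
  qed
qed

text \<open>Integer directions make the supremum over the sphere a countable increasing limit of finite
  maxima, so Slepian's inequality applies without a covering argument.\<close>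

lemma goe_max:
  assumes n: "0 < n" and lam: "lam \<le> 1" and \<delta>: "0 < \<delta>" and s: "s * s = (1 :: real)"
  defines "J \<equiv> gidx n \<union> aux n"
  obtains A where "A \<in> sets (gauss J)" "measure (gauss J) A \<le> 8 / (\<delta>\<^sup>2 * real n)"
    "\<And>g v. g \<in> space (gauss J) \<Longrightarrow> g \<notin> A \<Longrightarrow>
      qform n (\<lambda>i j. s * goe n g i j + lam / real n) v \<le> (2 + 6 * \<delta>) * (\<Sum>i<n. (v i)\<^sup>2)"
proof -
  interpret P: prob_space "gauss J" by (rule prob_space_gauss)
  define f where "f = (\<lambda>g x. s * qform n (goe n g) x + lam * (\<Sum>i<n. x i)\<^sup>2 / real n)"
  have f: "f g x = qform n (\<lambda>i j. s * goe n g i j + lam / real n) x" for g x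
    unfolding f_def qform_add qform_mult qform_const by simp
  define E where "E = (\<lambda>k. {g \<in> space (gauss J). \<exists>x\<in>int_dirs n k. 2 + 6 * \<delta> \<le> f g x})"
  have mE: "measure (gauss J) (E k) \<le> 8 / (\<delta>\<^sup>2 * real n)" for k
    unfolding E_def f_def J_def by (rule goe_max_finite[OF n lam \<delta> s finite_int_dirs int_dirs_unit])
  have [measurable]: "(\<lambda>g. f g x) \<in> borel_measurable (gauss J)" for x
    proof -
      have [measurable]: "(\<lambda>g. qform n (goe n g) x) \<in> borel_measurable (gauss J)"
        by (rule qform_measurable) (simp add: J_def)
      show ?thesis unfolding f_def by measurable
    qed
  have sE: "E k \<in> sets (gauss J)" for k unfolding E_def using finite_int_dirs by measurable
  have inc: "incseq E"
  proof (rule incseq_SucI)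
    fix k
    show "E k \<subseteq> E (Suc k)" unfolding E_def using int_dirs_mono[of n k] by blast
  qed
  define A where "A = (\<Union>k. E k)"
  have "(\<lambda>k. measure (gauss J) (E k)) \<longlonglongrightarrow> measure (gauss J) A"
    unfolding A_def using sE inc by (intro P.finite_Lim_measure_incseq) auto
  then have mA: "measure (gauss J) A \<le> 8 / (\<delta>\<^sup>2 * real n)"
    by (rule LIMSEQ_le_const2) (use mE in auto)
  have sA: "A \<in> sets (gauss J)" unfolding A_def using sE by auto
  have good: "qform n (\<lambda>i j. s * goe n g i j + lam / real n) v \<le> (2 + 6 * \<delta>) * (\<Sum>i<n. (v i)\<^sup>2)"
    if g: "g \<in> space (gauss J)" "g \<notin> A" for g v
  proof (rule qform_le_of_int_dirs)
    fix k x assume x: "x \<in> int_dirs n k"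
    have "g \<notin> E k" using g by (auto simp: A_def)
    then show "qform n (\<lambda>i j. s * goe n g i j + lam / real n) x < 2 + 6 * \<delta>"
      using x g(1) unfolding E_def f[symmetric] by (auto simp: not_le)
  qed
  show ?thesis by (rule that[OF sA mA good])
qed

section \<open>Positive semidefinite matrices and the value of the program\<close>

text \<open>Nonnegativity of the trace of a product, by elimination instead of a spectral
  decomposition. A pivot \<open>d > 0\<close> splits X into its Schur complement, padded by zeros,
  plus the rank-one matrix of its last column divided by \<open>d\<close>; a zero pivot forces the
  last column to vanish.\<close>

lemma psd_sum_nonneg:
  fixes A X :: "nat \<Rightarrow> nat \<Rightarrow> real"
  assumes "\<And>v. 0 \<le> qform n A v" "\<And>v. 0 \<le> qform n X v" "\<And>i j. i < n \<Longrightarrow> j < n \<Longrightarrow> X i j = X j i"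
  shows "0 \<le> (\<Sum>i<n. \<Sum>j<n. A i j * X i j)"
  using assms
proof (induction n arbitrary: X)
  case (Suc n X)
  have A: "0 \<le> qform n A v" for v
  proof -
    have "qform n A (v(n := 0)) = qform n A v" by (rule qform_cong) simp
    then show ?thesis using Suc.prems(1)[of "v(n := 0)"] unfolding qform_Suc by simp
  qed
  define x where "x = (\<lambda>i. X i n)"
  define d where "d = X n n"
  have sym: "X n i = x i" if "i < n" for i using Suc.prems(3)[of n i] that by (simp add: x_def)
  have qX: "qform (Suc n) X v = qform n X v + 2 * (\<Sum>i<n. x i * v i) * v n + d * (v n)\<^sup>2" for v
  proof -
    have "(\<Sum>i<n. (X i n + X n i) * v i) = 2 * (\<Sum>i<n. x i * v i)"
      unfolding sum_distrib_left by (intro sum.cong refl) (simp add: sym, simp add: x_def)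
    then show ?thesis unfolding qform_Suc d_def by simp
  qed
  have d0: "0 \<le> d"
    using Suc.prems(2)[of "(\<lambda>_. 0)(n := 1)"] qform_cong[of n "(\<lambda>_. 0)(n := 1)" "\<lambda>_. 0" X] unfolding qX
    by (simp add: qform_def)
  have S: "(\<Sum>i<Suc n. \<Sum>j<Suc n. A i j * X i j) = (\<Sum>i<n. \<Sum>j<n. A i j * X i j) + (\<Sum>i<n. (A i n + A n i) * x i) + A n n * d"
  proof -
    have "(\<Sum>i<n. (A i n + A n i) * x i) = (\<Sum>i<n. A i n * X i n) + (\<Sum>j<n. A n j * X n j)"
      unfolding sum.distrib[symmetric] by (intro sum.cong refl) (simp add: sym, simp add: x_def distrib_right)
    then show ?thesis by (simp add: sum.distrib d_def)
  qed
  show ?case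
  proof (cases "d = 0")
    case True
    \<comment> \<open>With a zero pivot the form is affine in the last coordinate, and an affine
      function bounded below is constant. The value of \<open>t\<close> used below would make the
      form equal to -1.\<close>
    have x0: "x k = 0" if "k < n" for k
    proof (rule ccontr)
      assume k: "x k \<noteq> 0"
      define c where "c = qform n X (\<lambda>i. of_bool (i = k))"
      have "0 \<le> c + 2 * x k * t" for t
      proof -
        have "qform n X ((\<lambda>i. of_bool (i = k))(n := t)) = c"
          unfolding c_def by (rule qform_cong) auto
        moreover have "(\<Sum>i<n. x i * ((\<lambda>i. of_bool (i = k))(n := t)) i) = x k"
          using that by (simp add: of_bool_def if_distrib[where f="(*) _"] cong: if_cong)
        ultimately show ?thesis
          using Suc.prems(2)[of "(\<lambda>i. of_bool (i = k))(n := t)"] unfolding qX by (simp add: True)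
      qed
      from this[of "- (c + 1) / (2 * x k)"] k show False by (simp add: field_simps)
    qed
    have "0 \<le> (\<Sum>i<n. \<Sum>j<n. A i j * X i j)"
    proof (rule Suc.IH[OF A])
      show "0 \<le> qform n X v" for v
      proof -
        have "qform n X (v(n := 0)) = qform n X v" by (rule qform_cong) simp
        then show ?thesis using Suc.prems(2)[of "v(n := 0)"] unfolding qform_Suc by simp
      qed
    qed (use Suc.prems(3) in auto)
    then show ?thesis unfolding S by (simp add: x0 True)
  next
    case False
    then have d: "0 < d" using d0 by simp
    define Y where "Y = (\<lambda>i j. X i j - x i * x j / d)"
    have qY: "qform n Y v = qform n X v - (\<Sum>i<n. x i * v i)\<^sup>2 / d" for v
    proof -
      have "qform n Y v = (\<Sum>i<n. \<Sum>j<n. X i j * v i * v j - (x i * v i) * (x j * v j) / d)"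
        unfolding qform_def Y_def by (intro sum.cong refl) (simp add: algebra_simps)
      then show ?thesis
        unfolding qform_def power2_eq_square sum_product by (simp add: sum_subtractf sum_divide_distrib)
    qed
    have "0 \<le> (\<Sum>i<n. \<Sum>j<n. A i j * Y i j)"
    proof (rule Suc.IH[OF A])
      fix v
      \<comment> \<open>\<open>- r / d\<close> minimises the form over the last coordinate; the
        minimum is the form of the Schur complement.\<close>
      define r where "r = (\<Sum>i<n. x i * v i)"
      have "qform n X (v(n := - r / d)) = qform n X v" by (rule qform_cong) auto
      moreover have "(\<Sum>i<n. x i * (v(n := - r / d)) i) = r" by (simp add: r_def)
      ultimately have "0 \<le> qform n X v + 2 * r * (- r / d) + d * (- r / d)\<^sup>2"
        using Suc.prems(2)[of "v(n := - r / d)"] unfolding qX by simp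
      also have "\<dots> = qform n X v - r\<^sup>2 / d" using d by (simp add: power2_eq_square field_simps)
      finally show "0 \<le> qform n Y v" unfolding qY r_def .
    qed (use Suc.prems(3) in \<open>auto simp: Y_def\<close>)
    \<comment> \<open>The rank-one part pairs with A as the form of A at the last column of
      X.\<close>
    moreover have "0 \<le> qform (Suc n) A (x(n := d)) / d" using Suc.prems(1) d by simp
    moreover have "qform (Suc n) A (x(n := d)) = qform n A x + (\<Sum>i<n. (A i n + A n i) * x i) * d + A n n * d\<^sup>2"
      using qform_cong[of n "x(n := d)" x A] by (simp add: qform_Suc)
    moreover have "(\<Sum>i<n. \<Sum>j<n. A i j * Y i j) = (\<Sum>i<n. \<Sum>j<n. A i j * X i j) - qform n A x / d"
    proof -
      have "(\<Sum>i<n. \<Sum>j<n. A i j * Y i j) = (\<Sum>i<n. \<Sum>j<n. A i j * X i j - A i j * x i * x j / d)"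
        unfolding Y_def by (intro sum.cong refl) (simp add: algebra_simps)
      then show ?thesis unfolding qform_def by (simp add: sum_subtractf sum_divide_distrib)
    qed
    moreover have "(qform n A x + (\<Sum>i<n. (A i n + A n i) * x i) * d + A n n * d\<^sup>2) / d
        = qform n A x / d + (\<Sum>i<n. (A i n + A n i) * x i) + A n n * d"
      using d by (simp add: add_divide_distrib power2_eq_square)
    ultimately have "0 \<le> qform n A x / d + (\<Sum>i<n. (A i n + A n i) * x i) + A n n * d"
      "0 \<le> (\<Sum>i<n. \<Sum>j<n. A i j * X i j) - qform n A x / d" by (simp_all only:)
    then show ?thesis unfolding S by linarith
  qed
qed simp

lemma trace_mult:
  assumes "A \<in> carrier_mat n n" "X \<in> carrier_mat n n"
  shows "mat_trace (A * X) = (\<Sum>i<n. \<Sum>j<n. A $$ (i, j) * X $$ (j, i))"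
  using assms by (auto simp: mat_trace_def scalar_prod_def lessThan_atLeast0)

lemma elliptopeD:
  assumes "X \<in> elliptope n"
  shows "X \<in> carrier_mat n n" "\<And>i. i < n \<Longrightarrow> X $$ (i, i) = 1" "0 \<le> qform n (\<lambda>i j. X $$ (i, j)) v"
proof -
  show X: "X \<in> carrier_mat n n" and "\<And>i. i < n \<Longrightarrow> X $$ (i, i) = 1" using assms by (auto simp: elliptope_def psd_mat_def)
  have "0 \<le> scalar_prod (Matrix.vec n v) (mult_mat_vec X (Matrix.vec n v))"
    using assms by (auto simp: elliptope_def psd_mat_def)
  also have "\<dots> = qform n (\<lambda>i j. X $$ (i, j)) v"
    by (subst quadratic_form_eq[OF X]) (auto simp: qform_def mult_ac intro!: sum.cong)
  finally show "0 \<le> qform n (\<lambda>i j. X $$ (i, j)) v" .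
qed

text \<open>Weak duality: \<open>c\<close> times the identity minus A is positive semidefinite, and
  every feasible X has trace n.\<close>

lemma sdp_le:
  assumes A: "A \<in> carrier_mat n n" and c: "\<And>v. qform n (\<lambda>i j. A $$ (i, j)) v \<le> c * (\<Sum>i<n. (v i)\<^sup>2)"
  shows "sdp A \<le> c * real n"
proof -
  obtain X where X: "X \<in> elliptope n" "sdp A = mat_trace (A * X)" using sdp_is_max[OF A] by auto
  note XD = elliptopeD[OF X(1)]
  have "0 \<le> (\<Sum>i<n. \<Sum>j<n. (c * of_bool (i = j) - A $$ (i, j)) * X $$ (i, j))"
  proof (rule psd_sum_nonneg[OF _ XD(3)])
    fix v
    have "qform n (\<lambda>i j. c * of_bool (i = j) - A $$ (i, j)) v = c * (\<Sum>i<n. (v i)\<^sup>2) - qform n (\<lambda>i j. A $$ (i, j)) v"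
      unfolding qform_diff qform_diag ..
    then show "0 \<le> qform n (\<lambda>i j. c * of_bool (i = j) - A $$ (i, j)) v" using c[of v] by simp
  qed (use elliptope_symmetric[OF X(1)] in auto)
  also have "\<dots> = (\<Sum>i<n. c * X $$ (i, i)) - (\<Sum>i<n. \<Sum>j<n. A $$ (i, j) * X $$ (i, j))"
    by (simp add: left_diff_distrib sum_subtractf of_bool_def if_distrib[where f="\<lambda>x. x * _"] if_distrib[where f="(*) _"] cong: if_cong)
  also have "(\<Sum>i<n. c * X $$ (i, i)) = c * real n" using XD(2) by simp
  also have "(\<Sum>i<n. \<Sum>j<n. A $$ (i, j) * X $$ (i, j)) = sdp A"
    unfolding X(2) trace_mult[OF A XD(1)] by (intro sum.cong refl) (use elliptope_symmetric[OF X(1)] in auto)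
  finally show ?thesis by simp
qed

lemma sdp_ge:
  assumes A: "A \<in> carrier_mat n n" and x: "\<And>i j. i < n \<Longrightarrow> j < n \<Longrightarrow> x i j = x j i" "\<And>i. i < n \<Longrightarrow> x i i = 1"
    "\<And>v. 0 \<le> qform n x v"
  shows "(\<Sum>i<n. \<Sum>j<n. A $$ (i, j) * x i j) \<le> sdp A"
proof -
  define X where "X = Matrix.mat n n (\<lambda>(i, j). x i j)"
  have C: "X \<in> carrier_mat n n" by (simp add: X_def)
  have "X \<in> elliptope n"
  proof -
    have "0 \<le> scalar_prod v (mult_mat_vec X v)" if "v \<in> carrier_vec n" for v
    proof -
      have "scalar_prod v (mult_mat_vec X v) = qform n x (\<lambda>i. vec_index v i)"
        by (subst quadratic_form_eq[OF C that]) (auto simp: qform_def X_def mult_ac intro!: sum.cong)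
      then show ?thesis using x(3) by simp
    qed
    moreover have "transpose_mat X = X" using x(1) by (auto simp: X_def intro!: eq_matI)
    ultimately show ?thesis using C x(2) by (auto simp: elliptope_def psd_mat_def X_def)
  qed
  then have "mat_trace (A * X) \<le> sdp A" using sdp_is_max[OF A] by auto
  also have "mat_trace (A * X) = (\<Sum>i<n. \<Sum>j<n. A $$ (i, j) * x i j)"
    unfolding trace_mult[OF A C] by (intro sum.cong refl) (use x(1) in \<open>auto simp: X_def\<close>)
  finally show ?thesis .
qed

text \<open>A maximiser X for A is also feasible for B, and its entries are at most 1 in absolute
  value.\<close>

lemma sdp_diff_le:
  assumes A: "A \<in> carrier_mat n n" "B \<in> carrier_mat n n"
  shows "sdp A - sdp B \<le> (\<Sum>i<n. \<Sum>j<n. \<bar>A $$ (i, j) - B $$ (i, j)\<bar>)"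
proof -
  obtain X where X: "X \<in> elliptope n" "sdp A = mat_trace (A * X)" using sdp_is_max[OF A(1)] by auto
  have "mat_trace (B * X) \<le> sdp B" using sdp_is_max[OF A(2)] X(1) by auto
  then have "sdp A - sdp B \<le> mat_trace (A * X) - mat_trace (B * X)" using X by simp
  also have "\<dots> = (\<Sum>i<n. \<Sum>j<n. (A $$ (i, j) - B $$ (i, j)) * X $$ (j, i))"
    unfolding trace_mult[OF A(1) elliptopeD(1)[OF X(1)]] trace_mult[OF A(2) elliptopeD(1)[OF X(1)]]
    by (simp add: sum_subtractf left_diff_distrib)
  also have "\<dots> \<le> (\<Sum>i<n. \<Sum>j<n. \<bar>A $$ (i, j) - B $$ (i, j)\<bar>)"
  proof (intro sum_mono)
    fix i j assume ij: "i \<in> {..<n}" "j \<in> {..<n}"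
    have "(A $$ (i, j) - B $$ (i, j)) * X $$ (j, i) \<le> \<bar>A $$ (i, j) - B $$ (i, j)\<bar> * \<bar>X $$ (j, i)\<bar>"
      by (simp add: abs_mult[symmetric])
    also have "\<dots> \<le> \<bar>A $$ (i, j) - B $$ (i, j)\<bar> * 1"
      using elliptope_entry_bound[OF X(1)] ij by (intro mult_left_mono) auto
    finally show "(A $$ (i, j) - B $$ (i, j)) * X $$ (j, i) \<le> \<bar>A $$ (i, j) - B $$ (i, j)\<bar>" by simp
  qed
  finally show ?thesis .
qed

section \<open>Resolvents of symmetric matrices\<close>

text \<open>States entrywise that G is a two-sided inverse of W - z on the indices below
  \<open>n\<close>. Using functions in place of matrices keeps row and column manipulations at the
  level of finite sums.\<close>

definition is_res :: "nat \<Rightarrow> (nat \<Rightarrow> nat \<Rightarrow> real) \<Rightarrow> complex \<Rightarrow> (nat \<Rightarrow> nat \<Rightarrow> complex) \<Rightarrow> bool" where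
  "is_res n W z G \<longleftrightarrow> (\<forall>i<n. \<forall>j<n. (\<Sum>k<n. of_real (W i k) * G k j) = z * G i j + of_bool (i = j)) \<and>
     (\<forall>i<n. \<forall>j<n. (\<Sum>k<n. G i k * of_real (W k j)) = z * G i j + of_bool (i = j))"

text \<open>The choice is determined on indices below \<open>n\<close>, by
  \<open>is_res_unique\<close>; elsewhere the values are arbitrary.\<close>

definition resolvent :: "nat \<Rightarrow> (nat \<Rightarrow> nat \<Rightarrow> real) \<Rightarrow> complex \<Rightarrow> nat \<Rightarrow> nat \<Rightarrow> complex" where
  "resolvent n W z = (SOME G. is_res n W z G)"

text \<open>If (W - z) y = 0, then the Hermitian form of W at y equals z times the squared norm of
  y. Symmetry makes that form real, so a nonreal z forces y = 0, and an injective square matrix is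
  invertible.\<close>

lemma is_res_exists:
  assumes sym: "\<And>i j. i < n \<Longrightarrow> j < n \<Longrightarrow> W i j = W j i" and z: "Im z \<noteq> 0"
  shows "\<exists>G. is_res n W z G"
proof -
  define M where "M = Matrix.mat n n (\<lambda>(i, j). complex_of_real (W i j) - z * of_bool (i = j))"
  have M: "M \<in> carrier_mat n n" by (simp add: M_def)
  have "det M \<noteq> 0"
  proof
    assume "det M = 0"
    then obtain v where v: "v \<in> carrier_vec n" "v \<noteq> 0\<^sub>v n" "M *\<^sub>v v = 0\<^sub>v n"
      using det_0_iff_vec_prod_zero_field[OF M] by blast
    define y where "y = (\<lambda>i. vec_index v i)"
    have My: "(\<Sum>j<n. complex_of_real (W i j) * y j) = z * y i" if i: "i < n" for i
    proof -
      have "vec_index (M *\<^sub>v v) i = 0" using v(3) i by simp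
      moreover have "vec_index (M *\<^sub>v v) i = (\<Sum>j<n. (complex_of_real (W i j) - z * of_bool (i = j)) * y j)"
        using i v(1) by (auto simp: M_def y_def scalar_prod_def lessThan_atLeast0)
      ultimately have "(\<Sum>j<n. complex_of_real (W i j) * y j) - (\<Sum>j<n. z * of_bool (i = j) * y j) = 0"
        by (simp add: left_diff_distrib sum_subtractf)
      moreover have "(\<Sum>j<n. z * of_bool (i = j) * y j) = z * y i"
        using i by (simp add: of_bool_def if_distrib[where f="\<lambda>x. x * _"] if_distrib[where f="(*) _"] cong: if_cong)
      ultimately show ?thesis by simp
    qed
    define q where "q = (\<Sum>i<n. \<Sum>j<n. complex_of_real (W i j) * (cnj (y i) * y j))"
    have "cnj q = (\<Sum>i<n. \<Sum>j<n. complex_of_real (W i j) * (y i * cnj (y j)))" by (simp add: q_def)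
    also have "\<dots> = (\<Sum>j<n. \<Sum>i<n. complex_of_real (W i j) * (y i * cnj (y j)))" by (rule sum.swap)
    also have "\<dots> = q" unfolding q_def using sym by (intro sum.cong refl) (simp add: mult_ac)
    finally have "Im q = 0" by (simp add: complex_eq_iff)
    moreover have "q = z * of_real (\<Sum>i<n. (cmod (y i))\<^sup>2)"
    proof -
      have "q = (\<Sum>i<n. cnj (y i) * (\<Sum>j<n. complex_of_real (W i j) * y j))"
        unfolding q_def by (simp add: sum_distrib_left mult_ac)
      also have "\<dots> = (\<Sum>i<n. z * of_real ((cmod (y i))\<^sup>2))"
      proof (intro sum.cong refl)
        fix i assume "i \<in> {..<n}"
        then have "cnj (y i) * (\<Sum>j<n. complex_of_real (W i j) * y j) = z * (y i * cnj (y i))" by (simp add: My)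
        then show "cnj (y i) * (\<Sum>j<n. complex_of_real (W i j) * y j) = z * of_real ((cmod (y i))\<^sup>2)"
          by (simp only: complex_norm_square)
      qed
      finally show ?thesis by (simp add: sum_distrib_left)
    qed
    ultimately have "(\<Sum>i<n. (cmod (y i))\<^sup>2) = 0" using z by simp
    then have "y i = 0" if "i < n" for i using that by (simp add: sum_nonneg_eq_0_iff)
    then have "v = 0\<^sub>v n" using v(1) by (intro eq_vecI) (auto simp: y_def)
    then show False using v(2) by simp
  qed
  then obtain B where B: "B \<in> carrier_mat n n" "B * M = 1\<^sub>m n" "M * B = 1\<^sub>m n"
    using det_non_zero_imp_unit[OF M, of "()"] by (auto simp: Units_def ring_mat_def)
  define G where "G = (\<lambda>i j. B $$ (i, j))"
  have "is_res n W z G"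
    unfolding is_res_def
  proof (intro conjI allI impI)
    fix i j assume ij: "i < n" "j < n"
    have "(M * B) $$ (i, j) = (\<Sum>k<n. (complex_of_real (W i k) - z * of_bool (i = k)) * G k j)"
      using ij B(1) by (auto simp: M_def G_def scalar_prod_def lessThan_atLeast0)
    also have "\<dots> = (\<Sum>k<n. complex_of_real (W i k) * G k j) - z * G i j"
      using ij by (simp add: left_diff_distrib sum_subtractf of_bool_def if_distrib[where f="\<lambda>x. x * _"] if_distrib[where f="(*) _"] cong: if_cong)
    finally show "(\<Sum>k<n. complex_of_real (W i k) * G k j) = z * G i j + of_bool (i = j)"
      using B(3) ij by (simp add: of_bool_def split: if_splits)
    have "(B * M) $$ (i, j) = (\<Sum>k<n. G i k * (complex_of_real (W k j) - z * of_bool (k = j)))"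
      using ij B(1) by (auto simp: M_def G_def scalar_prod_def lessThan_atLeast0)
    also have "\<dots> = (\<Sum>k<n. G i k * complex_of_real (W k j)) - z * G i j"
      using ij by (simp add: right_diff_distrib sum_subtractf of_bool_def if_distrib[where f="\<lambda>x. x * _"] if_distrib[where f="(*) _"] cong: if_cong)
    finally show "(\<Sum>k<n. G i k * complex_of_real (W k j)) = z * G i j + of_bool (i = j)"
      using B(2) ij by (simp add: of_bool_def split: if_splits)
  qed
  then show ?thesis by blast
qed

lemma is_res_resolvent:
  assumes "\<And>i j. i < n \<Longrightarrow> j < n \<Longrightarrow> W i j = W j i" "Im z \<noteq> 0"
  shows "is_res n W z (resolvent n W z)"
  unfolding resolvent_def using is_res_exists[OF assms] by (rule someI_ex)

lemma res_left: "is_res n W z G \<Longrightarrow> i < n \<Longrightarrow> j < n \<Longrightarrow> (\<Sum>k<n. of_real (W i k) * G k j) = z * G i j + of_bool (i = j)"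
  and res_right: "is_res n W z G \<Longrightarrow> i < n \<Longrightarrow> j < n \<Longrightarrow> (\<Sum>k<n. G i k * of_real (W k j)) = z * G i j + of_bool (i = j)"
  by (auto simp: is_res_def)

text \<open>Evaluates G W G' by the equation of G and G W' G' by that of G'. Varying only z yields
  the Ward identity, varying only W the Lipschitz bound and the Schur formulas, and varying neither
  yields uniqueness.\<close>

lemma resolvent_identity:
  assumes G: "is_res n W z G" and G': "is_res n W' z' G'" and ij: "i < n" "j < n"
  shows "G i j - G' i j = (z - z') * (\<Sum>k<n. G i k * G' k j) - (\<Sum>k<n. \<Sum>l<n. G i k * of_real (W k l - W' k l) * G' l j)"
proof -
  have d: "(\<Sum>l<n. of_bool (i = l) * f l) = f i" "(\<Sum>l<n. f l * of_bool (l = j)) = f j" for f :: "nat \<Rightarrow> complex"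
    using ij by (simp_all add: of_bool_def if_distrib[where f="\<lambda>x. x * _"] if_distrib[where f="(*) _"] cong: if_cong)
  have "(\<Sum>k<n. \<Sum>l<n. G i k * of_real (W k l) * G' l j) = (\<Sum>l<n. (\<Sum>k<n. G i k * of_real (W k l)) * G' l j)"
    unfolding sum_distrib_right by (rule sum.swap)
  also have "\<dots> = (\<Sum>l<n. z * (G i l * G' l j) + of_bool (i = l) * G' l j)"
    using res_right[OF G] ij by (intro sum.cong refl) (simp add: algebra_simps)
  also have "\<dots> = z * (\<Sum>k<n. G i k * G' k j) + G' i j"
    unfolding sum.distrib d by (simp add: sum_distrib_left)
  finally have 1: "(\<Sum>k<n. \<Sum>l<n. G i k * of_real (W k l) * G' l j) = z * (\<Sum>k<n. G i k * G' k j) + G' i j" .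
  have "(\<Sum>k<n. \<Sum>l<n. G i k * of_real (W' k l) * G' l j) = (\<Sum>k<n. G i k * (\<Sum>l<n. of_real (W' k l) * G' l j))"
    unfolding sum_distrib_left by (simp only: mult.assoc)
  also have "\<dots> = (\<Sum>k<n. z' * (G i k * G' k j) + G i k * of_bool (k = j))"
    using res_left[OF G'] ij by (intro sum.cong refl) (simp add: algebra_simps)
  also have "\<dots> = z' * (\<Sum>k<n. G i k * G' k j) + G i j"
    unfolding sum.distrib d by (simp add: sum_distrib_left)
  finally have 2: "(\<Sum>k<n. \<Sum>l<n. G i k * of_real (W' k l) * G' l j) = z' * (\<Sum>k<n. G i k * G' k j) + G i j" .
  have "(\<Sum>k<n. \<Sum>l<n. G i k * of_real (W k l - W' k l) * G' l j)
    = (\<Sum>k<n. \<Sum>l<n. G i k * of_real (W k l) * G' l j) - (\<Sum>k<n. \<Sum>l<n. G i k * of_real (W' k l) * G' l j)"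
    unfolding sum_subtractf[symmetric] by (intro sum.cong refl) (simp add: algebra_simps)
  then show ?thesis unfolding 1 2 by (simp add: algebra_simps)
qed

lemma is_res_unique:
  assumes "is_res n W z G" "is_res n W z G'" "i < n" "j < n"
  shows "G i j = G' i j"
  using resolvent_identity[OF assms] by simp

lemma is_res_cnj:
  assumes "is_res n W z G"
  shows "is_res n W (cnj z) (\<lambda>i j. cnj (G i j))"
  unfolding is_res_def
proof (intro conjI allI impI)
  fix i j assume ij: "i < n" "j < n"
  show "(\<Sum>k<n. of_real (W i k) * cnj (G k j)) = cnj z * cnj (G i j) + of_bool (i = j)"
    using arg_cong[OF res_left[OF assms ij], of cnj] by (simp add: of_bool_def)
  show "(\<Sum>k<n. cnj (G i k) * of_real (W k j)) = cnj z * cnj (G i j) + of_bool (i = j)"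
    using arg_cong[OF res_right[OF assms ij], of cnj] by (simp add: of_bool_def)
qed

lemma is_res_transpose:
  assumes G: "is_res n W z G" and sym: "\<And>i j. i < n \<Longrightarrow> j < n \<Longrightarrow> W i j = W j i"
  shows "is_res n W z (\<lambda>i j. G j i)"
  unfolding is_res_def
proof (intro conjI allI impI)
  fix i j assume ij: "i < n" "j < n"
  have "(\<Sum>k<n. of_real (W i k) * G j k) = (\<Sum>k<n. G j k * of_real (W k i))"
    using sym ij by (intro sum.cong refl) (simp add: mult_ac)
  then show "(\<Sum>k<n. of_real (W i k) * G j k) = z * G j i + of_bool (i = j)"
    using res_right[OF G ij(2,1)] by (simp add: of_bool_def)
  have "(\<Sum>k<n. G k i * of_real (W k j)) = (\<Sum>k<n. of_real (W j k) * G k i)"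
    using sym ij by (intro sum.cong refl) (simp add: mult_ac)
  then show "(\<Sum>k<n. G k i * of_real (W k j)) = z * G j i + of_bool (i = j)"
    using res_left[OF G ij(2,1)] by (simp add: of_bool_def)
qed

locale sym_resolvent =
  fixes n :: nat and W :: "nat \<Rightarrow> nat \<Rightarrow> real" and z :: complex and G :: "nat \<Rightarrow> nat \<Rightarrow> complex"
  assumes G: "is_res n W z G" and sym: "\<And>i j. i < n \<Longrightarrow> j < n \<Longrightarrow> W i j = W j i" and z: "0 < Im z"
begin

lemma G_sym: "i < n \<Longrightarrow> j < n \<Longrightarrow> G i j = G j i"
  using is_res_unique[OF G is_res_transpose[OF G sym]] by simp

text \<open>The resolvent identity between z and its conjugate, since conjugating the entries of G
  gives the resolvent at the conjugate point.\<close>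

lemma ward: "i < n \<Longrightarrow> j < n \<Longrightarrow> of_real (Im (G i j)) = of_real (Im z) * (\<Sum>k<n. G i k * cnj (G k j))"
proof -
  assume ij: "i < n" "j < n"
  have "G i j - cnj (G i j) = (z - cnj z) * (\<Sum>k<n. G i k * cnj (G k j))"
    using resolvent_identity[OF G is_res_cnj[OF G] ij] by simp
  then have "2 * \<i> * of_real (Im (G i j)) = 2 * \<i> * (of_real (Im z) * (\<Sum>k<n. G i k * cnj (G k j)))"
    unfolding complex_diff_cnj by (simp add: mult_ac)
  then show ?thesis by simp
qed

lemma ward_diag: "i < n \<Longrightarrow> Im (G i i) = Im z * (\<Sum>k<n. (cmod (G i k))\<^sup>2)"
proof -
  assume i: "i < n"
  have "complex_of_real (Im (G i i)) = of_real (Im z) * (\<Sum>k<n. G i k * cnj (G k i))" by (rule ward[OF i i])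
  also have "(\<Sum>k<n. G i k * cnj (G k i)) = (\<Sum>k<n. of_real ((cmod (G i k))\<^sup>2))"
    using G_sym i by (intro sum.cong refl) (simp add: complex_norm_square del: of_real_power)
  finally have "complex_of_real (Im (G i i)) = complex_of_real (Im z * (\<Sum>k<n. (cmod (G i k))\<^sup>2))" by simp
  then show ?thesis by (simp only: of_real_eq_iff)
qed

lemma Im_G_nonneg: "i < n \<Longrightarrow> 0 \<le> Im (G i i)"
  unfolding ward_diag using z by (intro mult_nonneg_nonneg sum_nonneg) auto

lemma cmod_sq_le: "i < n \<Longrightarrow> (cmod (G i i))\<^sup>2 \<le> Im (G i i) / Im z"
proof -
  assume i: "i < n"
  have "(cmod (G i i))\<^sup>2 \<le> (\<Sum>k<n. (cmod (G i k))\<^sup>2)" using i by (intro member_le_sum) auto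
  then show ?thesis using z unfolding ward_diag[OF i] by simp
qed

lemma G_bound_diag: "i < n \<Longrightarrow> cmod (G i i) \<le> 1 / Im z"
proof -
  assume i: "i < n"
  have "(cmod (G i i))\<^sup>2 \<le> cmod (G i i) / Im z"
  proof (rule order_trans[OF cmod_sq_le[OF i]], rule divide_right_mono)
    show "Im (G i i) \<le> cmod (G i i)" using abs_Im_le_cmod[of "G i i"] by linarith
  qed (use z in simp)
  then have *: "cmod (G i i) * cmod (G i i) \<le> cmod (G i i) * (1 / Im z)" by (simp add: power2_eq_square)
  show ?thesis
  proof (cases "G i i = 0")
    case False
    then show ?thesis using mult_left_le_imp_le[OF *] by simp
  qed (use z in simp)
qed

lemma G_row_bound: "i < n \<Longrightarrow> (\<Sum>k<n. (cmod (G i k))\<^sup>2) \<le> 1 / (Im z)\<^sup>2"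
proof -
  assume i: "i < n"
  have "Im z * (\<Sum>k<n. (cmod (G i k))\<^sup>2) \<le> 1 / Im z"
    using G_bound_diag[OF i] abs_Im_le_cmod[of "G i i"] unfolding ward_diag[OF i, symmetric] by linarith
  then show ?thesis using z by (simp add: field_simps power2_eq_square)
qed

lemma G_bound: "i < n \<Longrightarrow> j < n \<Longrightarrow> cmod (G i j) \<le> 1 / Im z"
proof -
  assume ij: "i < n" "j < n"
  have "(cmod (G i j))\<^sup>2 \<le> (\<Sum>k<n. (cmod (G i k))\<^sup>2)" using ij by (intro member_le_sum) auto
  also have "\<dots> \<le> (1 / Im z)\<^sup>2" using G_row_bound[OF ij(1)] by (simp add: power_divide)
  finally show ?thesis by (rule power2_le_imp_le) (use z in simp)
qed

text \<open>A vanishing imaginary part would make the whole row \<open>i\<close> of G vanish by the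
  Ward identity, which is impossible for an invertible matrix.\<close>

lemma G_diag_pos: "i < n \<Longrightarrow> 0 < Im (G i i)"
proof (rule ccontr)
  assume i: "i < n" and "\<not> 0 < Im (G i i)"
  then have "Im (G i i) = 0" using Im_G_nonneg[OF i] by simp
  then have "(\<Sum>k<n. (cmod (G i k))\<^sup>2) = 0" unfolding ward_diag[OF i] using z by simp
  then have "G i k = 0" if "k < n" for k using that by (simp add: sum_nonneg_eq_0_iff)
  then show False using res_right[OF G i i] i by simp
qed

text \<open>The Ward identity summed against \<open>x\<close>. It exhibits Im G as a Gram form,
  whence its positive semidefiniteness, and leads to the operator norm bound 1/Im z.\<close>

lemma G_apply_norm:
  fixes x :: "nat \<Rightarrow> real"
  shows "Im z * (\<Sum>i<n. (cmod (\<Sum>j<n. G i j * of_real (x j)))\<^sup>2) = Im (\<Sum>i<n. of_real (x i) * (\<Sum>j<n. G i j * of_real (x j)))"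
    "Im (\<Sum>i<n. of_real (x i) * (\<Sum>j<n. G i j * of_real (x j))) = qform n (\<lambda>i j. Im (G i j)) x"
proof -
  have "complex_of_real (\<Sum>i<n. (cmod (\<Sum>j<n. G i j * of_real (x j)))\<^sup>2)
      = (\<Sum>i<n. (\<Sum>j<n. G i j * of_real (x j)) * cnj (\<Sum>k<n. G i k * of_real (x k)))"
    unfolding of_real_sum by (intro sum.cong refl) (simp add: complex_norm_square del: of_real_power cnj_sum)
  also have "\<dots> = (\<Sum>i<n. \<Sum>j<n. \<Sum>k<n. of_real (x j * x k) * (G i j * cnj (G i k)))"
    by (simp add: sum_product mult_ac)
  also have "\<dots> = (\<Sum>j<n. \<Sum>k<n. \<Sum>i<n. of_real (x j * x k) * (G i j * cnj (G i k)))"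
    by (subst sum.swap) (rule sum.cong[OF refl], rule sum.swap)
  also have "\<dots> = (\<Sum>j<n. \<Sum>k<n. of_real (x j * x k) * (\<Sum>i<n. G j i * cnj (G i k)))"
    unfolding sum_distrib_left using G_sym by (intro sum.cong refl) auto
  finally have A: "complex_of_real (\<Sum>i<n. (cmod (\<Sum>j<n. G i j * of_real (x j)))\<^sup>2)
      = (\<Sum>j<n. \<Sum>k<n. of_real (x j * x k) * (\<Sum>i<n. G j i * cnj (G i k)))" .
  have "complex_of_real (Im z * (\<Sum>i<n. (cmod (\<Sum>j<n. G i j * of_real (x j)))\<^sup>2))
      = (\<Sum>j<n. \<Sum>k<n. of_real (x j * x k) * (of_real (Im z) * (\<Sum>i<n. G j i * cnj (G i k))))"
    unfolding of_real_mult[of "Im z"] A by (simp add: sum_distrib_left mult_ac)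
  also have "\<dots> = (\<Sum>j<n. \<Sum>k<n. of_real (x j * x k) * of_real (Im (G j k)))"
    by (intro sum.cong refl) (simp add: ward)
  also have "\<dots> = complex_of_real (qform n (\<lambda>i j. Im (G i j)) x)"
    unfolding qform_def of_real_sum by (intro sum.cong refl) simp
  finally have B: "Im z * (\<Sum>i<n. (cmod (\<Sum>j<n. G i j * of_real (x j)))\<^sup>2) = qform n (\<lambda>i j. Im (G i j)) x"
    by (simp only: of_real_eq_iff)
  show C: "Im (\<Sum>i<n. of_real (x i) * (\<Sum>j<n. G i j * of_real (x j))) = qform n (\<lambda>i j. Im (G i j)) x"
    unfolding qform_def by (simp add: sum_distrib_left mult_ac)
  show "Im z * (\<Sum>i<n. (cmod (\<Sum>j<n. G i j * of_real (x j)))\<^sup>2) = Im (\<Sum>i<n. of_real (x i) * (\<Sum>j<n. G i j * of_real (x j)))"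
    unfolding B C ..
qed

lemma Im_G_psd: "0 \<le> qform n (\<lambda>i j. Im (G i j)) x"
  unfolding G_apply_norm(2)[symmetric] G_apply_norm(1)[symmetric] using z by (intro mult_nonneg_nonneg sum_nonneg) auto

text \<open>With \<open>a\<close> and \<open>b\<close> the norms of x and G x, Im z times b^2 is the
  imaginary part of a bilinear expression that Cauchy-Schwarz bounds by a b; one factor b
  cancels.\<close>

lemma G_apply_bound:
  fixes x :: "nat \<Rightarrow> real"
  shows "(\<Sum>i<n. (cmod (\<Sum>j<n. G i j * of_real (x j)))\<^sup>2) \<le> (\<Sum>i<n. (x i)\<^sup>2) / (Im z)\<^sup>2"
proof -
  define y where "y = (\<lambda>i. \<Sum>j<n. G i j * of_real (x j))"
  define a where "a = L2_set x {..<n}"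
  define b where "b = L2_set (\<lambda>i. cmod (y i)) {..<n}"
  have a2: "a\<^sup>2 = (\<Sum>i<n. (x i)\<^sup>2)" and b2: "b\<^sup>2 = (\<Sum>i<n. (cmod (y i))\<^sup>2)"
    by (simp_all add: a_def b_def L2_set_def sum_nonneg)
  have "Im z * b\<^sup>2 = Im (\<Sum>i<n. of_real (x i) * y i)" unfolding b2 y_def by (rule G_apply_norm(1))
  also have "\<dots> \<le> (\<Sum>i<n. \<bar>x i\<bar> * \<bar>cmod (y i)\<bar>)"
    unfolding Im_sum
  proof (rule sum_mono)
    fix i
    have "Im (of_real (x i) * y i) \<le> cmod (of_real (x i) * y i)" using abs_Im_le_cmod[of "of_real (x i) * y i"] by linarith
    then show "Im (of_real (x i) * y i) \<le> \<bar>x i\<bar> * \<bar>cmod (y i)\<bar>" by (simp add: norm_mult)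
  qed
  also have "\<dots> \<le> a * b" unfolding a_def b_def by (rule L2_set_mult_ineq)
  finally have "Im z * b * b \<le> a * b" by (simp add: power2_eq_square mult.assoc)
  then have *: "(Im z * b) * b \<le> a * b" by (simp add: mult.assoc)
  have "0 \<le> a" "0 \<le> b" by (simp_all add: a_def b_def L2_set_nonneg)
  then have "Im z * b \<le> a"
    using mult_right_le_imp_le[OF *] by (cases "b = 0") auto
  then have "(Im z * b)\<^sup>2 \<le> a\<^sup>2" using z L2_set_nonneg[of "\<lambda>i. cmod (y i)" "{..<n}"]
    by (intro power_mono) (auto simp: b_def)
  then have "b\<^sup>2 \<le> a\<^sup>2 / (Im z)\<^sup>2" using z by (simp add: field_simps power_mult_distrib)
  then show ?thesis unfolding a2 b2 y_def .
qed

lemma res_apply: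
  fixes x :: "nat \<Rightarrow> real"
  assumes "i < n"
  shows "(\<Sum>k<n. of_real (W i k) * (\<Sum>j<n. G k j * of_real (x j))) = z * (\<Sum>j<n. G i j * of_real (x j)) + of_real (x i)"
proof -
  have "(\<Sum>k<n. of_real (W i k) * (\<Sum>j<n. G k j * of_real (x j))) = (\<Sum>j<n. (\<Sum>k<n. of_real (W i k) * G k j) * of_real (x j))"
    by (simp add: sum_distrib_left sum_distrib_right mult.assoc) (rule sum.swap)
  also have "\<dots> = (\<Sum>j<n. z * (G i j * of_real (x j)) + of_bool (i = j) * of_real (x j))"
    using assms by (intro sum.cong refl) (simp only: res_left[OF G] lessThan_iff distrib_right mult.assoc)
  also have "\<dots> = z * (\<Sum>j<n. G i j * of_real (x j)) + of_real (x i)"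
    using assms by (simp add: sum.distrib sum_distrib_left of_bool_def if_distrib[where f="\<lambda>x. x * _"] cong: if_cong)
  finally show ?thesis .
qed

end

text \<open>With equal z only the perturbation term of the resolvent identity remains, and each
  resolvent entry is at most 1/Im z in modulus.\<close>

lemma resolvent_lipschitz:
  assumes "sym_resolvent n W z G" "sym_resolvent n W' z G'" "i < n" "j < n"
  shows "cmod (G i j - G' i j) \<le> (\<Sum>k<n. \<Sum>l<n. \<bar>W k l - W' k l\<bar>) / (Im z)\<^sup>2"
proof -
  interpret G: sym_resolvent n W z G by fact
  interpret G': sym_resolvent n W' z G' by fact
  have "cmod (G i j - G' i j) = cmod (\<Sum>k<n. \<Sum>l<n. G i k * of_real (W k l - W' k l) * G' l j)"
    using resolvent_identity[OF G.G G'.G assms(3,4)] by simp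
  also have "\<dots> \<le> (\<Sum>k<n. \<Sum>l<n. (1 / Im z) * \<bar>W k l - W' k l\<bar> * (1 / Im z))"
  proof (intro order_trans[OF norm_sum] sum_mono)
    fix k l assume kl: "k \<in> {..<n}" "l \<in> {..<n}"
    have "cmod (G i k) \<le> 1 / Im z" "cmod (G' l j) \<le> 1 / Im z"
      using kl assms(3,4) G.G_bound G'.G_bound by auto
    then show "cmod (G i k * of_real (W k l - W' k l) * G' l j) \<le> 1 / Im z * \<bar>W k l - W' k l\<bar> * (1 / Im z)"
      unfolding norm_mult norm_of_real using G.z by (intro mult_mono) auto
  qed
  also have "\<dots> = (\<Sum>k<n. \<Sum>l<n. \<bar>W k l - W' k l\<bar>) / (Im z)\<^sup>2"
    by (simp add: sum_divide_distrib power2_eq_square)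
  finally show ?thesis .
qed

section \<open>Schur complement formulas\<close>

text \<open>Row and column \<open>i\<close> are set to zero instead of deleted, so H keeps the
  dimension \<open>n\<close>. It decouples: \<open>H i i\<close> is -1/z, the other entries of row
  \<open>i\<close> vanish, and the remaining block is the resolvent of the true minor.\<close>

locale schur = G: sym_resolvent n W z G + H: sym_resolvent n "\<lambda>k l. if k = i \<or> l = i then 0 else W k l" z H
  for n W z G H i +
  assumes i: "i < n"
begin

lemma H_zero: "k < n \<Longrightarrow> k \<noteq> i \<Longrightarrow> H i k = 0"
proof -
  assume k: "k < n" "k \<noteq> i"
  have "z * H i k = 0" using res_left[OF H.G i k(1)] k(2) by simp
  then show ?thesis using G.z by auto
qed

text \<open>The perturbation lives on row and column \<open>i\<close>; its column part meets a zero
  entry of row \<open>i\<close> of H, so a single term survives in the resolvent identity.\<close>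

lemma G_off:
  assumes kl: "k < n" "l < n" "l \<noteq> i"
  shows "G k l = H k l - G k i * (\<Sum>b\<in>{..<n} - {i}. of_real (W i b) * H b l)"
proof -
  have "(\<Sum>a<n. \<Sum>b<n. G k a * of_real (W a b - (if a = i \<or> b = i then 0 else W a b)) * H b l)
      = (\<Sum>a<n. if a = i then G k i * (\<Sum>b\<in>{..<n} - {i}. of_real (W i b) * H b l) else 0)"
  proof (intro sum.cong refl)
    fix a assume a: "a \<in> {..<n}"
    have Hi: "H i l = 0" using H_zero kl by simp
    show "(\<Sum>b<n. G k a * of_real (W a b - (if a = i \<or> b = i then 0 else W a b)) * H b l)
      = (if a = i then G k i * (\<Sum>b\<in>{..<n} - {i}. of_real (W i b) * H b l) else 0)"
    proof (cases "a = i")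
      case True
      then have "(\<Sum>b<n. G k a * of_real (W a b - (if a = i \<or> b = i then 0 else W a b)) * H b l) = (\<Sum>b<n. G k i * (of_real (W i b) * H b l))"
        by (simp add: mult.assoc)
      also have "\<dots> = (\<Sum>b\<in>{..<n} - {i}. G k i * (of_real (W i b) * H b l))"
        using i Hi by (simp add: sum.remove[of "{..<n}" i])
      finally show ?thesis using True by (simp add: sum_distrib_left)
    next
      case False
      then have "(\<Sum>b<n. G k a * of_real (W a b - (if a = i \<or> b = i then 0 else W a b)) * H b l) = (\<Sum>b<n. 0)"
        using Hi by (intro sum.cong refl) auto
      then show ?thesis using False by simp
    qed
  qed
  also have "\<dots> = G k i * (\<Sum>b\<in>{..<n} - {i}. of_real (W i b) * H b l)" using i by simp
  finally show ?thesis using resolvent_identity[OF G.G H.G kl(1,2)] by (simp add: algebra_simps)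
qed

lemma G_row:
  assumes l: "l < n" "l \<noteq> i"
  shows "G i l = - (G i i * (\<Sum>b\<in>{..<n} - {i}. of_real (W i b) * H b l))"
  using G_off[OF i l] H_zero[OF l] by simp

lemma G_diag_neq0: "G i i \<noteq> 0"
  using G.G_diag_pos[OF i] by auto

text \<open>The diagonal entry at \<open>i\<close> of the resolvent equation, with the off-diagonal
  entries of G replaced through \<open>G_row\<close>.\<close>

lemma schur_complement:
  "G i i * (of_real (W i i) - z - (\<Sum>k\<in>{..<n} - {i}. \<Sum>l\<in>{..<n} - {i}. of_real (W i k * W i l) * H k l)) = 1"
proof -
  have "(\<Sum>k<n. of_real (W i k) * G k i) = z * G i i + 1" using res_left[OF G.G i i] by simp
  also have "(\<Sum>k<n. of_real (W i k) * G k i) = of_real (W i i) * G i i + (\<Sum>k\<in>{..<n} - {i}. of_real (W i k) * G i k)"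
    using i G.G_sym by (simp add: sum.remove[of "{..<n}" i])
  also have "(\<Sum>k\<in>{..<n} - {i}. of_real (W i k) * G i k)
    = - (G i i * (\<Sum>k\<in>{..<n} - {i}. \<Sum>l\<in>{..<n} - {i}. of_real (W i k * W i l) * H k l))"
  proof -
    have "(\<Sum>k\<in>{..<n} - {i}. of_real (W i k) * G i k) = (\<Sum>k\<in>{..<n} - {i}. - (G i i * (\<Sum>b\<in>{..<n} - {i}. of_real (W i b * W i k) * H b k)))"
      by (intro sum.cong refl) (simp add: G_row sum_distrib_left mult_ac)
    also have "\<dots> = - (G i i * (\<Sum>k\<in>{..<n} - {i}. \<Sum>b\<in>{..<n} - {i}. of_real (W i b * W i k) * H b k))"
      by (simp only: sum_negf sum_distrib_left)
    also have "(\<Sum>k\<in>{..<n} - {i}. \<Sum>b\<in>{..<n} - {i}. of_real (W i b * W i k) * H b k)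
        = (\<Sum>k\<in>{..<n} - {i}. \<Sum>l\<in>{..<n} - {i}. of_real (W i k * W i l) * H k l)"
      by (rule sum.swap)
    finally show ?thesis .
  qed
  finally show ?thesis by (simp add: algebra_simps)
qed

text \<open>Each remaining diagonal entry changes by \<open>G i k * G i k / G i i\<close>. By the
  Ward identity the moduli of these changes sum to at most 1/Im z, and the entry
  \<open>G i i\<close> itself accounts for another 1/Im z.\<close>

lemma trace_minor:
  "cmod ((\<Sum>k<n. G k k) - (\<Sum>k\<in>{..<n} - {i}. H k k)) \<le> 2 / Im z"
proof -
  have e: "G k k - H k k = G i k * G i k / G i i" if "k \<in> {..<n} - {i}" for k
  proof -
    define s where "s = (\<Sum>b\<in>{..<n} - {i}. of_real (W i b) * H b k)"
    have "G k k = H k k - G i k * s" using G_off[of k k] that G.G_sym[of k i] i by (simp add: s_def)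
    moreover have "G i k = - (G i i * s)" using G_row[of k] that by (simp add: s_def)
    ultimately show ?thesis using G_diag_neq0 by (simp add: field_simps)
  qed
  have "(\<Sum>k<n. G k k) - (\<Sum>k\<in>{..<n} - {i}. H k k) = G i i + (\<Sum>k\<in>{..<n} - {i}. G k k - H k k)"
    using i by (simp add: sum.remove[of "{..<n}" i] sum_subtractf)
  also have "cmod \<dots> \<le> 1 / Im z + (\<Sum>k\<in>{..<n} - {i}. (cmod (G i k))\<^sup>2 / cmod (G i i))"
    by (intro norm_triangle_mono G.G_bound_diag i order_trans[OF norm_sum] sum_mono)
       (simp add: e norm_divide norm_mult power2_eq_square)
  also have "(\<Sum>k\<in>{..<n} - {i}. (cmod (G i k))\<^sup>2 / cmod (G i i)) \<le> (\<Sum>k<n. (cmod (G i k))\<^sup>2) / cmod (G i i)"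
    unfolding sum_divide_distrib by (intro sum_mono2) auto
  also have "\<dots> = Im (G i i) / Im z / cmod (G i i)"
    using G.ward_diag[OF i] G.z by simp
  also have "\<dots> \<le> 1 / Im z"
  proof -
    have "Im (G i i) / cmod (G i i) \<le> 1" using G_diag_neq0 abs_Im_le_cmod[of "G i i"] by (simp add: divide_le_eq)
    then have "Im (G i i) / cmod (G i i) / Im z \<le> 1 / Im z" using G.z by (intro divide_right_mono) auto
    then show ?thesis by (simp add: mult.commute)
  qed
  finally show ?thesis by simp
qed

text \<open>Writes an entry of G applied to the all-ones vector through a linear form in row
  \<open>i\<close> of W whose coefficients come from H and thus do not involve that row.\<close>

lemma row_sum:
  "(\<Sum>l<n. G i l) = G i i * (1 - (\<Sum>b\<in>{..<n} - {i}. of_real (W i b) * (\<Sum>l\<in>{..<n} - {i}. H b l)))"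
proof -
  have "(\<Sum>l<n. G i l) = G i i + (\<Sum>l\<in>{..<n} - {i}. G i l)" using i by (simp add: sum.remove[of "{..<n}" i])
  also have "(\<Sum>l\<in>{..<n} - {i}. G i l) = - (G i i * (\<Sum>l\<in>{..<n} - {i}. \<Sum>b\<in>{..<n} - {i}. of_real (W i b) * H b l))"
    unfolding sum_distrib_left[of "G i i"] sum_negf[symmetric] by (intro sum.cong refl) (simp add: G_row sum_distrib_left sum_negf)
  also have "(\<Sum>l\<in>{..<n} - {i}. \<Sum>b\<in>{..<n} - {i}. of_real (W i b) * H b l)
      = (\<Sum>b\<in>{..<n} - {i}. of_real (W i b) * (\<Sum>l\<in>{..<n} - {i}. H b l))"
    by (subst sum.swap) (simp add: sum_distrib_left)
  finally show ?thesis by (simp add: algebra_simps)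
qed

end

section \<open>A feasible point built from resolvents\<close>

text \<open>At z = 2 + i\<eta> the equation reads (m + 1)^2 = i\<eta>(1 - (m + 1)), so m + 1 is
  close to the square root of i\<eta>. Both its modulus and its imaginary part are of order
  \<open>sqrt \<eta>\<close>; the constants 1/4 and 2 leave room around the limits.\<close>

lemma semicircle_root:
  assumes \<eta>: "0 < \<eta>" "\<eta> \<le> 1/16"
  obtains m where "m\<^sup>2 + Complex 2 \<eta> * m + 1 = 0" "sqrt \<eta> / 4 \<le> Im m" "cmod (m + 1) \<le> 2 * sqrt \<eta>"
proof -
  define z where "z = Complex 2 \<eta>"
  define a where "a = (- z + csqrt (z\<^sup>2 - 4)) / 2"
  define b where "b = - z - a"
  have qa: "a\<^sup>2 + z * a + 1 = 0"
  proof -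
    have "2 * a = - z + csqrt (z\<^sup>2 - 4)" unfolding a_def by simp
    then have "2 * a + z = csqrt (z\<^sup>2 - 4)" by simp
    then have "(2 * a + z)\<^sup>2 = z\<^sup>2 - 4" by simp
    moreover have "(2 * a + z)\<^sup>2 = 4 * (a\<^sup>2 + z * a + 1) + (z\<^sup>2 - 4)" by (simp add: power2_eq_square algebra_simps)
    ultimately have "4 * (a\<^sup>2 + z * a + 1) = 0" by simp
    then show ?thesis by (simp only: mult_eq_0_iff) simp
  qed
  have qb: "b\<^sup>2 + z * b + 1 = 0" using qa by (simp add: b_def power2_eq_square algebra_simps)
  have ab: "a * b = 1"
  proof -
    have "a * b = 1 - (a\<^sup>2 + z * a + 1)" by (simp add: b_def power2_eq_square algebra_simps)
    then show ?thesis unfolding qa by simp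
  qed
  have ImIm: "Im a + Im b = - \<eta>" by (simp add: b_def z_def)
  \<comment> \<open>The two roots have product 1, so their imaginary parts have opposite signs;
    these sum to -\<eta>, so the roots are not both real.\<close>
  have "\<exists>m. m\<^sup>2 + z * m + 1 = 0 \<and> 0 < Im m"
  proof (cases "0 < Im a")
    case False
    have "Im b * (cmod a)\<^sup>2 = - Im a"
    proof -
      have "b * of_real ((cmod a)\<^sup>2) = (a * b) * cnj a" by (simp only: complex_norm_square mult_ac)
      then have "b * of_real ((cmod a)\<^sup>2) = cnj a" using ab by simp
      then have "Im (b * of_real ((cmod a)\<^sup>2)) = - Im a" by simp
      then show ?thesis by simp
    qed
    moreover have "Im a \<noteq> 0"
    proof
      assume "Im a = 0"
      moreover have "a \<noteq> 0" using ab by auto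
      ultimately have "Im b = 0" using \<open>Im b * (cmod a)\<^sup>2 = - Im a\<close> by simp
      then show False using ImIm \<open>Im a = 0\<close> \<eta> by simp
    qed
    ultimately have "0 < Im b * (cmod a)\<^sup>2" using False by simp
    then have "0 < Im b" by (simp add: zero_less_mult_iff)
    then show ?thesis using qb by blast
  qed (use qa in blast)
  then obtain m where m: "m\<^sup>2 + z * m + 1 = 0" "0 < Im m" by blast
  define x y where "x = Re m + 1" and "y = Im m"
  define r where "r = sqrt \<eta>"
  have r: "0 < r" "r \<le> 1/4" "r * r = \<eta>" using \<eta> real_sqrt_le_mono[OF \<eta>(2)] by (simp_all add: r_def real_sqrt_divide)
  have m_xy: "m = Complex (x - 1) y" by (simp add: x_def y_def complex_eq_iff)
  \<comment> \<open>Real and imaginary parts of the equation in the shifted variable m + 1 = x +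
    iy.\<close>
  have re: "x * x = y * y + \<eta> * y" and im: "2 * x * y + \<eta> * x = \<eta>"
    using m(1) unfolding m_xy z_def by (simp_all add: complex_eq_iff power2_eq_square algebra_simps)
  have y0: "0 < y" using m(2) by (simp add: y_def)
  have x0: "0 < x"
  proof (rule ccontr)
    assume "\<not> 0 < x"
    then have "x * (2 * y + \<eta>) \<le> 0" using y0 \<eta> by (intro mult_nonpos_nonneg) auto
    then show False using im \<eta> by (simp add: algebra_simps)
  qed
  \<comment> \<open>If y were small, the real part of the equation would make x small as well, and
    then the imaginary part could not reach \<eta>.\<close>
  have y: "r / 4 \<le> y"
  proof (rule ccontr)
    assume "\<not> r / 4 \<le> y"
    then have yr: "y < r / 4" by simp
    have "y * y \<le> r / 4 * (r / 4)" using yr y0 r by (intro mult_mono) auto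
    moreover have "\<eta> * y \<le> \<eta> * (1/16)" using yr r \<eta> by (intro mult_left_mono) auto
    ultimately have "x * x \<le> 1/8 * (r * r)" using re r(3) by simp
    also have "\<dots> \<le> (2 * r / 5) * (2 * r / 5)" using mult_pos_pos[OF r(1) r(1)] by simp
    finally have x: "x \<le> 2 * r / 5" using r by (intro power2_le_imp_le[of x "2 * r / 5"]) (auto simp: power2_eq_square)
    have "2 * x * y \<le> 2 * (2 * r / 5) * (r / 4)" using x yr x0 y0 r by (intro mult_mono) auto
    moreover have "\<eta> * x \<le> \<eta> * (1/10)" using x r \<eta> by (intro mult_left_mono) auto
    moreover have "2 * (2 * r / 5) * (r / 4) = \<eta> / 5" using r(3) by simp
    ultimately show False using im \<eta> by linarith
  qed
  have c: "cmod (m + 1) \<le> 2 * r"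
  proof (rule ccontr)
    define t where "t = cmod (m + 1)"
    assume "\<not> cmod (m + 1) \<le> 2 * r"
    then have t: "2 * r < t" by (simp add: t_def)
    have "(m + 1)\<^sup>2 = \<i> * of_real \<eta> * (1 - (m + 1))"
    proof -
      have "z = 2 + \<i> * of_real \<eta>" by (simp add: z_def complex_eq_iff)
      then have "(m + 1)\<^sup>2 - \<i> * of_real \<eta> * (1 - (m + 1)) = m\<^sup>2 + z * m + 1" by (simp add: power2_eq_square algebra_simps)
      then have "(m + 1)\<^sup>2 - \<i> * of_real \<eta> * (1 - (m + 1)) = 0" unfolding m(1) .
      then show ?thesis by (simp only: right_minus_eq)
    qed
    then have "t\<^sup>2 = \<eta> * cmod (1 - (m + 1))"
      using \<eta> unfolding t_def norm_power[symmetric] by (simp only: norm_mult norm_of_real) simp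
    also have "\<dots> \<le> \<eta> * (1 + t)" unfolding t_def using \<eta> norm_triangle_ineq4[of 1 "m + 1"] by (intro mult_left_mono) auto
    finally have 1: "t * (t - \<eta>) \<le> \<eta>" by (simp add: power2_eq_square algebra_simps)
    have "r * r \<le> r * 1" using r by (intro mult_left_mono) auto
    then have "\<eta> \<le> r" using r by simp
    then have "2 * r * r \<le> t * (t - \<eta>)" using t r by (intro mult_mono) auto
    then show False using 1 r \<eta> by simp
  qed
  show ?thesis by (rule that[of m]) (use m(1) y c in \<open>simp_all add: z_def y_def r_def\<close>)
qed

text \<open>The residual factors as \<open>(s - m) * (s + z + m)\<close>, and the second factor has
  imaginary part at least Im z because s and m lie in the closed upper half plane.\<close>

lemma semicircle_stable:
  assumes m: "m\<^sup>2 + z * m + 1 = 0" "0 \<le> Im m" and s: "0 \<le> Im s" and z: "0 < Im z"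
  shows "cmod (s - m) \<le> cmod (1 + s * (z + s)) / Im z"
proof -
  have "1 + s * (z + s) = (s - m) * (s + z + m)"
  proof -
    have "(s - m) * (s + z + m) = s * (z + s) - (m\<^sup>2 + z * m)" by (simp add: power2_eq_square algebra_simps)
    also have "m\<^sup>2 + z * m = -1" using m(1) by (simp add: add_eq_0_iff2)
    finally show ?thesis by simp
  qed
  then have "cmod (1 + s * (z + s)) = cmod (s - m) * cmod (s + z + m)" by (simp add: norm_mult)
  moreover have "Im z \<le> cmod (s + z + m)" using abs_Im_le_cmod[of "s + z + m"] m s by simp
  ultimately have "cmod (s - m) * Im z \<le> cmod (1 + s * (z + s))" by (simp add: mult_left_mono)
  then show ?thesis using z by (simp add: field_simps)
qed

text \<open>Here D is a diagonal entry before normalisation: \<open>a\<close>, meant to be close to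
  1, comes from Im G, and \<open>f\<close> is the modulus of an entry of \<phi>. Both errors are
  expressed by \<open>(a - 1)\<^sup>2\<close> and \<alpha>^4, quantities that can be made small
  against the gain of order \<alpha>^2.\<close>

lemma normalisation_error:
  fixes a f \<alpha> :: real
  assumes \<alpha>: "0 \<le> \<alpha>" "\<alpha> \<le> 1" and f: "0 \<le> f" and a: "0 \<le> a" and D: "D = a + \<alpha>\<^sup>2 * f\<^sup>2" "0 < D"
  shows "(sqrt D - 1)\<^sup>2 \<le> 2 * (a - 1)\<^sup>2 + 2 * (\<alpha>^4 * f^4)"
    "\<alpha>\<^sup>2 * (f * \<bar>1 / sqrt D - 1\<bar>) \<le> 5 * (a - 1)\<^sup>2 + 7 * (\<alpha>^4 * (1 + f^4))"
proof -
  define s where "s = sqrt D"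
  have s: "0 < s" "s * s = D" using D(2) by (simp_all add: s_def)
  have sD: "\<bar>s - 1\<bar> \<le> \<bar>D - 1\<bar>"
  proof -
    have "D - 1 = (s - 1) * (s + 1)" using s by (simp add: algebra_simps)
    then have "\<bar>D - 1\<bar> = \<bar>s - 1\<bar> * (s + 1)" using s by (simp add: abs_mult)
    moreover have "\<bar>s - 1\<bar> * 1 \<le> \<bar>s - 1\<bar> * (s + 1)" using s by (intro mult_left_mono) auto
    ultimately show ?thesis by simp
  qed
  define u where "u = \<alpha>\<^sup>2 * f\<^sup>2"
  have u2: "u\<^sup>2 = \<alpha>^4 * f^4" by (simp add: u_def power_mult_distrib)
  have "(D - 1)\<^sup>2 + (a - 1 - u)\<^sup>2 = 2 * (a - 1)\<^sup>2 + 2 * u\<^sup>2"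
    unfolding D(1) u_def[symmetric] by (simp add: power2_eq_square algebra_simps)
  then have D2: "(D - 1)\<^sup>2 \<le> 2 * (a - 1)\<^sup>2 + 2 * (\<alpha>^4 * f^4)"
    unfolding u2[symmetric] using zero_le_power2[of "a - 1 - u"] by linarith
  have "(s - 1)\<^sup>2 \<le> (D - 1)\<^sup>2" using sD by (simp only: abs_le_square_iff)
  then show "(sqrt D - 1)\<^sup>2 \<le> 2 * (a - 1)\<^sup>2 + 2 * (\<alpha>^4 * f^4)" using D2 by (simp add: s_def)
  have main: "\<alpha>\<^sup>2 * (f * \<bar>1 / s - 1\<bar>) \<le> 2 * (\<alpha>\<^sup>2 * f * \<bar>D - 1\<bar>) + 2 * (D - 1)\<^sup>2"
  proof (cases "1/4 \<le> D")
    case True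
    have "1/2 \<le> s"
    proof (rule ccontr)
      assume "\<not> 1/2 \<le> s"
      then have "s * s < 1/2 * (1/2)" using s by (intro mult_strict_mono) auto
      then show False using True s by simp
    qed
    have "\<bar>1 / s - 1\<bar> = \<bar>s - 1\<bar> / s" using s by (simp add: field_simps abs_divide[symmetric] abs_minus_commute)
    also have "\<dots> \<le> 2 * \<bar>D - 1\<bar>"
    proof -
      have "\<bar>s - 1\<bar> * 1 \<le> \<bar>D - 1\<bar> * (2 * s)" using sD \<open>1/2 \<le> s\<close> by (intro mult_mono) auto
      then show ?thesis using s by (simp add: divide_le_eq mult_ac)
    qed
    finally have "\<alpha>\<^sup>2 * f * \<bar>1 / s - 1\<bar> \<le> \<alpha>\<^sup>2 * f * (2 * \<bar>D - 1\<bar>)" using f by (intro mult_left_mono) auto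
    then show ?thesis by (simp add: mult_ac add_increasing2)
  next
    \<comment> \<open>Near D = 0 the factor \<open>1 / s\<close> is unbounded, but
      \<open>\<alpha> * f \<le> s\<close> cancels it, and the remaining constant is absorbed because
      \<open>(D - 1)\<^sup>2\<close> exceeds 9/16.\<close>
    case False
    have "s < 1"
    proof (rule ccontr)
      assume "\<not> s < 1"
      then have "1 * 1 \<le> s * s" by (intro mult_mono) auto
      then show False using False s by simp
    qed
    have "(\<alpha> * f)\<^sup>2 \<le> s\<^sup>2" unfolding power2_eq_square[of s] s(2) D(1) power_mult_distrib using a by simp
    then have af: "\<alpha> * f \<le> s" by (rule power2_le_imp_le) (use s in simp)
    have "\<bar>1 / s - 1\<bar> \<le> 1 / s"
    proof -
      have "1 \<le> 1 / s" using \<open>s < 1\<close> s(1) by (simp add: le_divide_eq)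
      then show ?thesis by linarith
    qed
    then have "(\<alpha> * (\<alpha> * f)) * \<bar>1 / s - 1\<bar> \<le> (\<alpha> * s) * (1 / s)"
      using af \<alpha> f s by (intro mult_mono mult_left_mono) auto
    also have "\<dots> \<le> 1" using s \<alpha> by simp
    also have "1 \<le> 2 * (D - 1)\<^sup>2"
    proof -
      have "(3/4)\<^sup>2 \<le> (1 - D)\<^sup>2" using False by (intro power_mono) auto
      then show ?thesis by (simp add: power2_eq_square algebra_simps)
    qed
    finally have "\<alpha>\<^sup>2 * (f * \<bar>1 / s - 1\<bar>) \<le> 2 * (D - 1)\<^sup>2" by (simp add: power2_eq_square mult.assoc)
    moreover have "0 \<le> \<alpha>\<^sup>2 * f * \<bar>D - 1\<bar>" using f by simp
    ultimately show ?thesis by linarith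
  qed
  have "\<alpha>\<^sup>2 * f * \<bar>D - 1\<bar> \<le> \<alpha>\<^sup>2 * f * (\<bar>a - 1\<bar> + \<alpha>\<^sup>2 * f\<^sup>2)"
    using f abs_triangle_ineq[of "a - 1" "\<alpha>\<^sup>2 * f\<^sup>2"] unfolding D(1) by (intro mult_left_mono) (auto simp: algebra_simps)
  also have "\<dots> = (\<alpha>\<^sup>2 * f) * \<bar>a - 1\<bar> + \<alpha>^4 * f^3" by (simp add: algebra_simps power2_eq_square numeral_eq_Suc)
  finally have 1: "\<alpha>\<^sup>2 * f * \<bar>D - 1\<bar> \<le> (\<alpha>\<^sup>2 * f) * \<bar>a - 1\<bar> + \<alpha>^4 * f^3" .
  have 2: "2 * ((\<alpha>\<^sup>2 * f) * \<bar>a - 1\<bar>) \<le> \<alpha>^4 * f\<^sup>2 + (a - 1)\<^sup>2"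
    using sum_squares_bound[of "\<alpha>\<^sup>2 * f" "\<bar>a - 1\<bar>"] by (simp add: power_mult_distrib mult_ac)
  have f2: "f\<^sup>2 \<le> 1 + f^4" and f3: "f^3 \<le> 1 + f^4"
  proof (cases "f \<le> 1", goal_cases)
    case 1
    then have "f\<^sup>2 \<le> 1" using f by (simp add: power_le_one)
    moreover have "0 \<le> f^4" by simp
    ultimately show ?case by linarith
  next
    case 2
    then have "f\<^sup>2 \<le> f^4" by (intro power_increasing) auto
    then show ?case by simp
  next
    case 3
    show ?case
    proof (cases "f \<le> 1")
      case True
      then have "f^3 \<le> 1" using f by (simp add: power_le_one)
      moreover have "0 \<le> f^4" by simp
      ultimately show ?thesis by linarith
    next
      case False
      then have "f^3 \<le> f^4" by (intro power_increasing) auto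
      then show ?thesis by simp
    qed
  qed
  have 3: "\<alpha>^4 * f\<^sup>2 \<le> \<alpha>^4 * (1 + f^4)" "\<alpha>^4 * f^3 \<le> \<alpha>^4 * (1 + f^4)" "\<alpha>^4 * f^4 \<le> \<alpha>^4 * (1 + f^4)"
    using f2 f3 by (intro mult_left_mono; simp)+
  \<comment> \<open>The counts are 5 = 1 + 4 for \<open>(a - 1)\<^sup>2\<close>, and 7 = 1 + 2 + 4
    for the \<alpha>^4 terms with the second, third and fourth power of \<open>f\<close>.\<close>
  show "\<alpha>\<^sup>2 * (f * \<bar>1 / sqrt D - 1\<bar>) \<le> 5 * (a - 1)\<^sup>2 + 7 * (\<alpha>^4 * (1 + f^4))"
    using main 1 2 3 D2 unfolding s_def[symmetric] by linarith
qed

lemma qform_weighted: "qform n (\<lambda>i j. p i * p j * X i j) v = qform n X (\<lambda>i. p i * v i)"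
  unfolding qform_def by (simp add: mult_ac)

text \<open>With \<open>p = 1 - r\<close>, the product \<open>r i * r j\<close> is
  \<open>1 - p i - p j + p i * p j\<close>. The part linear in p involves only row sums of the
  entrywise product of W and X; the quadratic part is bounded below by
  \<open>psd_sum_nonneg\<close>, as W + K is positive semidefinite.\<close>

lemma sum_rescaled_ge:
  assumes W: "\<And>i j. i < n \<Longrightarrow> j < n \<Longrightarrow> W i j = W j i" and K: "\<And>v. - K * (\<Sum>i<n. (v i)\<^sup>2) \<le> qform n W v"
    and X: "\<And>i j. i < n \<Longrightarrow> j < n \<Longrightarrow> X i j = X j i" "\<And>v. 0 \<le> qform n X v"
  shows "(\<Sum>i<n. (2 * r i - 1) * (\<Sum>j<n. W i j * X i j)) - K * (\<Sum>i<n. (1 - r i)\<^sup>2 * X i i)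
    \<le> (\<Sum>i<n. \<Sum>j<n. W i j * (r i * r j * X i j))"
proof -
  define p where "p = (\<lambda>i. 1 - r i)"
  have "0 \<le> (\<Sum>i<n. \<Sum>j<n. (W i j + K * of_bool (i = j)) * (p i * p j * X i j))"
  proof (rule psd_sum_nonneg)
    show "0 \<le> qform n (\<lambda>i j. W i j + K * of_bool (i = j)) v" for v
      unfolding qform_add qform_diag using K[of v] by simp
    show "0 \<le> qform n (\<lambda>i j. p i * p j * X i j) v" for v unfolding qform_weighted by (rule X)
  qed (use X(1) in \<open>auto simp: mult_ac\<close>)
  also have "\<dots> = (\<Sum>i<n. \<Sum>j<n. W i j * (p i * p j * X i j)) + K * (\<Sum>i<n. (p i)\<^sup>2 * X i i)"
  proof -
    have "(\<Sum>j<n. K * of_bool (i = j) * (p i * p j * X i j)) = K * ((p i)\<^sup>2 * X i i)" if "i < n" for i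
      using that by (simp add: of_bool_def if_distrib[where f="\<lambda>x. x * _"] if_distrib[where f="(*) _"] power2_eq_square mult_ac cong: if_cong)
    then show ?thesis by (simp add: distrib_right sum.distrib sum_distrib_left)
  qed
  finally have 1: "- K * (\<Sum>i<n. (p i)\<^sup>2 * X i i) \<le> (\<Sum>i<n. \<Sum>j<n. W i j * (p i * p j * X i j))" by simp
  define b where "b = (\<lambda>i. \<Sum>j<n. W i j * X i j)"
  have sw: "(\<Sum>i<n. \<Sum>j<n. W i j * X i j * p j) = (\<Sum>i<n. p i * b i)"
  proof -
    have "(\<Sum>i<n. \<Sum>j<n. W i j * X i j * p j) = (\<Sum>j<n. \<Sum>i<n. W i j * X i j * p j)" by (rule sum.swap)
    also have "\<dots> = (\<Sum>j<n. \<Sum>i<n. p j * (W j i * X j i))" using W X(1) by (intro sum.cong refl) simp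
    finally show ?thesis by (simp add: b_def sum_distrib_left)
  qed
  have "(\<Sum>i<n. \<Sum>j<n. W i j * (r i * r j * X i j))
      = (\<Sum>i<n. \<Sum>j<n. W i j * X i j - p i * (W i j * X i j) - W i j * X i j * p j + W i j * (p i * p j * X i j))"
    unfolding p_def by (intro sum.cong refl) (simp add: algebra_simps)
  also have "\<dots> = (\<Sum>i<n. b i) - (\<Sum>i<n. p i * b i) - (\<Sum>i<n. p i * b i) + (\<Sum>i<n. \<Sum>j<n. W i j * (p i * p j * X i j))"
    by (simp only: sum.distrib sum_subtractf sw) (simp add: b_def sum_distrib_left)
  also have "(\<Sum>i<n. b i) - (\<Sum>i<n. p i * b i) - (\<Sum>i<n. p i * b i) = (\<Sum>i<n. (2 * r i - 1) * b i)"
    unfolding sum_subtractf[symmetric] by (intro sum.cong refl) (simp add: p_def algebra_simps)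
  finally show ?thesis using 1 unfolding b_def p_def by linarith
qed

text \<open>\<open>d\<close> is the target value of the diagonal of Im G and \<open>A\<close> the
  squared deviation from it; \<open>P\<close> pays for the renormalisation caused by \<phi>. The
  term with \<open>sqrt (\<eta> / d)\<close> is the contribution of Re G, and the bound W \<ge> -3
  controls the second-order effect of rescaling. Keeping \<eta> and \<eta>' independent allows
  \<eta> to shrink after \<phi> is fixed.\<close>

lemma sdp_lower_bound:
  fixes \<phi> :: "nat \<Rightarrow> complex"
  assumes n: "0 < n" and res: "sym_resolvent n W (Complex 2 \<eta>) G" and d: "0 < d"
    and K: "\<And>v. - 3 * (\<Sum>i<n. (v i)\<^sup>2) \<le> qform n W v"
    and \<phi>: "\<And>i. i < n \<Longrightarrow> (\<Sum>k<n. of_real (W i k) * \<phi> k) = Complex 2 \<eta>' * \<phi> i + 1"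
    and \<alpha>: "0 \<le> \<alpha>" "\<alpha> \<le> 1" and lam: "0 \<le> lam" and \<tau>: "sqrt (\<eta> / d) \<le> 1"
    and B: "B \<in> carrier_mat n n" "\<And>i j. i < n \<Longrightarrow> j < n \<Longrightarrow> B $$ (i, j) = lam / real n + W i j"
  defines "A \<equiv> \<Sum>i<n. (Im (G i i) / d - 1)\<^sup>2" and "P \<equiv> \<Sum>i<n. (cmod (\<phi> i))^4"
    and "q \<equiv> (\<Sum>i<n. \<phi> i) / of_nat n"
  shows "2 * real n - 4 * sqrt (\<eta> / d) * real n + \<alpha>\<^sup>2 * real n * (Re q + lam * (cmod q)\<^sup>2)
      - (26 + 14 * (lam * cmod q)) * (A + \<alpha>^4 * (real n + P)) \<le> sdp B"
proof -
  interpret sym_resolvent n W "Complex 2 \<eta>" G by (rule res)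
  have \<eta>: "0 < \<eta>" using z by simp
  define X where "X = (\<lambda>i j. Im (G i j) / d + \<alpha>\<^sup>2 * Re (\<phi> i * cnj (\<phi> j)))"
  define a where "a = (\<lambda>i. Im (G i i) / d)"
  define f where "f = (\<lambda>i. cmod (\<phi> i))"
  define D where "D = (\<lambda>i. a i + \<alpha>\<^sup>2 * (f i)\<^sup>2)"
  define s where "s = (\<lambda>i. sqrt (D i))"
  define r where "r = (\<lambda>i. 1 / s i)"
  define e where "e = (\<lambda>i. f i * \<bar>1 / s i - 1\<bar>)"
  define t where "t = sqrt (\<eta> / d)"
  have t: "0 \<le> t" "t \<le> 1" "t * t = \<eta> / d" using \<eta> d \<tau> by (simp_all add: t_def)
  have a0: "0 < a i" if "i < n" for i using G_diag_pos[OF that] d by (simp add: a_def)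
  have D0: "0 < D i" "a i \<le> D i" if "i < n" for i using a0[OF that] by (simp_all add: D_def add_pos_nonneg)
  have XD: "X i i = D i" for i
    by (simp add: X_def D_def a_def f_def cmod_power2 power2_eq_square[of "Re _"] power2_eq_square[of "Im _"])
  have s0: "0 < s i" "s i * s i = D i" if "i < n" for i using D0[OF that] by (simp_all add: s_def)
  have Xsym: "X i j = X j i" if "i < n" "j < n" for i j using G_sym that by (simp add: X_def mult_ac)
  have qY: "qform n (\<lambda>i j. Re (\<phi> i * cnj (\<phi> j))) v = (cmod (\<Sum>i<n. of_real (v i) * \<phi> i))\<^sup>2" for v
  proof -
    have "complex_of_real ((cmod (\<Sum>i<n. of_real (v i) * \<phi> i))\<^sup>2) = (\<Sum>i<n. \<Sum>j<n. (of_real (v i) * \<phi> i) * cnj (of_real (v j) * \<phi> j))"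
      by (simp only: complex_norm_square cnj_sum sum_product)
    from arg_cong[OF this, of Re] have "(cmod (\<Sum>i<n. of_real (v i) * \<phi> i))\<^sup>2 = Re (\<Sum>i<n. \<Sum>j<n. (of_real (v i) * \<phi> i) * cnj (of_real (v j) * \<phi> j))"
      by (simp only: Re_complex_of_real)
    also have "\<dots> = qform n (\<lambda>i j. Re (\<phi> i * cnj (\<phi> j))) v"
      unfolding qform_def Re_sum by (intro sum.cong refl) (simp add: algebra_simps)
    finally show ?thesis ..
  qed
  have qX: "qform n X v = qform n (\<lambda>i j. Im (G i j)) v / d + \<alpha>\<^sup>2 * (cmod (\<Sum>i<n. of_real (v i) * \<phi> i))\<^sup>2" for v
  proof -
    have "qform n X v = qform n (\<lambda>i j. (1 / d) * Im (G i j)) v + qform n (\<lambda>i j. \<alpha>\<^sup>2 * Re (\<phi> i * cnj (\<phi> j))) v"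
      unfolding qform_add[symmetric] X_def by simp
    then show ?thesis unfolding qform_mult qY by simp
  qed
  have Xpsd: "0 \<le> qform n X v" for v unfolding qX using Im_G_psd d by simp
  \<comment> \<open>Exact row sums from the resolvent equations. Both spectral parameters have real
    part 2, so the two main contributions combine to \<open>2 * D i\<close>.\<close>
  have row: "(\<Sum>j<n. W i j * X i j) = 2 * D i + \<alpha>\<^sup>2 * Re (\<phi> i) + (\<eta> / d) * Re (G i i)" if i: "i < n" for i
  proof -
    have "(\<Sum>j<n. W i j * Im (G i j)) = Im (\<Sum>j<n. of_real (W i j) * G j i)"
      unfolding Im_sum using G_sym i by (intro sum.cong refl) simp
    also have "\<dots> = 2 * Im (G i i) + \<eta> * Re (G i i)" unfolding res_left[OF G i i] by simp
    finally have 1: "(\<Sum>j<n. W i j * Im (G i j)) = 2 * Im (G i i) + \<eta> * Re (G i i)" .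
    have "(\<Sum>j<n. W i j * Re (\<phi> i * cnj (\<phi> j))) = Re (cnj (\<phi> i) * (\<Sum>j<n. of_real (W i j) * \<phi> j))"
      unfolding sum_distrib_left Re_sum by (intro sum.cong refl) (simp add: algebra_simps)
    also have "\<dots> = 2 * (f i)\<^sup>2 + Re (\<phi> i)"
      unfolding \<phi>[OF i] f_def cmod_power2 by (simp add: power2_eq_square algebra_simps)
    finally have 2: "(\<Sum>j<n. W i j * Re (\<phi> i * cnj (\<phi> j))) = 2 * (f i)\<^sup>2 + Re (\<phi> i)" .
    have "(\<Sum>j<n. W i j * X i j) = (\<Sum>j<n. W i j * Im (G i j)) / d + \<alpha>\<^sup>2 * (\<Sum>j<n. W i j * Re (\<phi> i * cnj (\<phi> j)))"
      by (simp add: X_def distrib_left sum.distrib sum_distrib_left sum_divide_distrib mult_ac)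
    then show ?thesis unfolding 1 2 D_def a_def using d by (simp add: field_simps)
  qed
  define x where "x = (\<lambda>i j. r i * r j * X i j)"
  have le: "(\<Sum>i<n. \<Sum>j<n. B $$ (i, j) * x i j) \<le> sdp B"
  proof (rule sdp_ge[OF B(1)])
    show "x i i = 1" if "i < n" for i
      unfolding x_def r_def XD s0(2)[OF that, symmetric] using s0(1)[OF that] by simp
    show "0 \<le> qform n x v" for v unfolding x_def qform_weighted by (rule Xpsd)
  qed (simp add: x_def Xsym mult_ac)
  have split: "(\<Sum>i<n. \<Sum>j<n. B $$ (i, j) * x i j) = (lam / real n) * qform n X r + (\<Sum>i<n. \<Sum>j<n. W i j * x i j)"
  proof -
    have "(\<Sum>i<n. \<Sum>j<n. B $$ (i, j) * x i j) = (\<Sum>i<n. \<Sum>j<n. (lam / real n) * (X i j * r i * r j) + W i j * x i j)"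
      by (intro sum.cong refl) (simp add: B x_def algebra_simps)
    then show ?thesis unfolding qform_def by (simp only: sum.distrib sum_distrib_left)
  qed
  define E where "E = (\<Sum>i<n. e i)"
  have E0: "0 \<le> E" unfolding E_def e_def f_def by (intro sum_nonneg) auto
  \<comment> \<open>The Im G part of X contributes nonnegatively to the spike term and is dropped.
    Replacing the weights \<open>r\<close> by 1 in the sum of the entries of \<phi> costs at most
    \<open>E\<close>.\<close>
  have lamterm: "lam * \<alpha>\<^sup>2 * (real n * (cmod q)\<^sup>2 - 2 * cmod q * E) \<le> (lam / real n) * qform n X r"
  proof -
    have "real n * cmod q - E \<le> cmod (\<Sum>i<n. of_real (r i) * \<phi> i)"
    proof -
      have "(\<Sum>i<n. \<phi> i) = of_nat n * q" using n by (simp add: q_def)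
      then have "real n * cmod q = cmod (\<Sum>i<n. \<phi> i)" by (simp add: norm_mult)
      also have "(\<Sum>i<n. \<phi> i) = (\<Sum>i<n. of_real (r i) * \<phi> i) - (\<Sum>i<n. of_real (r i - 1) * \<phi> i)"
        unfolding sum_subtractf[symmetric] by (intro sum.cong refl) (simp add: algebra_simps)
      also have "cmod \<dots> \<le> cmod (\<Sum>i<n. of_real (r i) * \<phi> i) + cmod (\<Sum>i<n. of_real (r i - 1) * \<phi> i)"
        by (rule norm_triangle_ineq4)
      also have "cmod (\<Sum>i<n. of_real (r i - 1) * \<phi> i) \<le> E"
        unfolding E_def e_def f_def r_def by (intro order_trans[OF norm_sum] sum_mono) (simp add: norm_mult mult.commute del: of_real_diff)
      finally show ?thesis by simp
    qed
    moreover have "u\<^sup>2 - 2 * u * v \<le> w\<^sup>2" if "u - v \<le> w" "0 \<le> u" "0 \<le> v" "0 \<le> w" for u v w :: real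
    proof (cases "v \<le> u")
      case True
      then have "(u - v)\<^sup>2 \<le> w\<^sup>2" using that by (intro power_mono) auto
      then show ?thesis using zero_le_power2[of v] unfolding power2_diff by linarith
    next
      case False
      then have "u * u \<le> u * v" using that by (intro mult_left_mono) auto
      moreover have "0 \<le> u * v" using that by simp
      ultimately have "u\<^sup>2 - 2 * u * v \<le> 0" by (simp add: power2_eq_square)
      also have "0 \<le> w\<^sup>2" by simp
      finally show ?thesis .
    qed
    ultimately have "(real n * cmod q)\<^sup>2 - 2 * (real n * cmod q) * E \<le> (cmod (\<Sum>i<n. of_real (r i) * \<phi> i))\<^sup>2"
      using E0 by simp
    then have "(lam / real n * \<alpha>\<^sup>2) * ((real n * cmod q)\<^sup>2 - 2 * (real n * cmod q) * E) \<le> (lam / real n * \<alpha>\<^sup>2) * (cmod (\<Sum>i<n. of_real (r i) * \<phi> i))\<^sup>2"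
      using lam by (intro mult_left_mono) auto
    also have "\<dots> \<le> (lam / real n) * qform n X r"
      unfolding qX using lam Im_G_psd d by (simp add: distrib_left mult.assoc)
    finally have "(lam / real n * \<alpha>\<^sup>2) * ((real n * cmod q)\<^sup>2 - 2 * (real n * cmod q) * E) \<le> (lam / real n) * qform n X r" .
    moreover have "(lam / real n * \<alpha>\<^sup>2) * ((real n * cmod q)\<^sup>2 - 2 * (real n * cmod q) * E)
      = lam * \<alpha>\<^sup>2 * (real n * (cmod q)\<^sup>2 - 2 * cmod q * E)"
      using n by (simp add: power2_eq_square right_diff_distrib)
    ultimately show ?thesis by simp
  qed
  have Wterm: "(\<Sum>i<n. (2 * r i - 1) * (\<Sum>j<n. W i j * X i j)) - 3 * (\<Sum>i<n. (1 - r i)\<^sup>2 * X i i) \<le> (\<Sum>i<n. \<Sum>j<n. W i j * x i j)"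
    unfolding x_def by (rule sum_rescaled_ge[OF sym K Xsym Xpsd])
  \<comment> \<open>The coefficient 6 collects 2 from \<open>(2 * r i - 1) * (2 * D i)\<close>, 3
    from the lower bound on W and 1 from the Re G term.\<close>
  have pt: "2 - 6 * (s i - 1)\<^sup>2 - 4 * t + \<alpha>\<^sup>2 * Re (\<phi> i) - 2 * \<alpha>\<^sup>2 * e i
      \<le> (2 * r i - 1) * (\<Sum>j<n. W i j * X i j) - 3 * ((1 - r i)\<^sup>2 * X i i)" if i: "i < n" for i
  proof -
    define S where "S = s i"
    have S: "0 < S" "S * S = D i" using s0[OF i] by (simp_all add: S_def)
    have 1: "(2 * r i - 1) * (2 * D i) = 2 - 2 * (S - 1)\<^sup>2"
      unfolding S(2)[symmetric] r_def S_def[symmetric] using S(1) by (simp add: field_simps power2_eq_square)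
    have 2: "(1 - r i)\<^sup>2 * X i i = (S - 1)\<^sup>2"
      unfolding XD S(2)[symmetric] r_def S_def[symmetric] using S(1) by (simp add: field_simps power2_eq_square)
    have 3: "\<alpha>\<^sup>2 * Re (\<phi> i) - 2 * \<alpha>\<^sup>2 * e i \<le> (2 * r i - 1) * (\<alpha>\<^sup>2 * Re (\<phi> i))"
    proof -
      have "\<bar>Re (\<phi> i)\<bar> * \<bar>r i - 1\<bar> \<le> f i * \<bar>r i - 1\<bar>" unfolding f_def by (intro mult_right_mono abs_Re_le_cmod) simp
      then have "- e i \<le> Re (\<phi> i) * (r i - 1)" unfolding e_def r_def[symmetric] abs_mult[symmetric]
        using abs_ge_minus_self[of "Re (\<phi> i) * (r i - 1)"] by (simp add: r_def)
      then have "\<alpha>\<^sup>2 * (2 * (- e i)) \<le> \<alpha>\<^sup>2 * (2 * (Re (\<phi> i) * (r i - 1)))" by (intro mult_left_mono) auto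
      then show ?thesis by (simp add: algebra_simps)
    qed
    \<comment> \<open>The Ward bound makes the square of \<open>Re (G i i)\<close> at most
      \<open>Im (G i i) / \<eta>\<close>, hence
      \<open>\<bar>(\<eta> / d) * Re (G i i)\<bar> \<le> t * S\<close>. After multiplication by
      \<open>\<bar>2 * r i - 1\<bar>\<close> the right side becomes
      \<open>t * \<bar>2 - S\<bar>\<close>.\<close>
    have 4: "- t * (4 + (S - 1)\<^sup>2) \<le> (2 * r i - 1) * ((\<eta> / d) * Re (G i i))"
    proof -
      have "(Re (G i i))\<^sup>2 \<le> (cmod (G i i))\<^sup>2" by (simp add: cmod_power2)
      also have "\<dots> \<le> Im (G i i) / \<eta>" using cmod_sq_le[OF i] by simp
      finally have "(\<eta> / d)\<^sup>2 * (Re (G i i))\<^sup>2 \<le> (\<eta> / d)\<^sup>2 * (Im (G i i) / \<eta>)" by (intro mult_left_mono) auto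
      then have "(t * t * Re (G i i))\<^sup>2 \<le> (\<eta> / d)\<^sup>2 * (Im (G i i) / \<eta>)" unfolding t(3) power_mult_distrib .
      also have "\<dots> = t * t * a i" unfolding t(3) a_def using \<eta> d by (simp add: field_simps power2_eq_square)
      also have "\<dots> \<le> t * t * (S * S)" unfolding S(2) using D0[OF i] t(1) by (intro mult_left_mono) auto
      finally have "(t * t * Re (G i i))\<^sup>2 \<le> (t * S)\<^sup>2" by (simp add: power2_eq_square mult_ac)
      then have "\<bar>t * t * Re (G i i)\<bar> \<le> t * S" using S t abs_le_square_iff[of "t * t * Re (G i i)" "t * S"] by (simp add: abs_mult)
      then have "\<bar>2 * r i - 1\<bar> * \<bar>t * t * Re (G i i)\<bar> \<le> \<bar>2 * r i - 1\<bar> * (t * S)" by (intro mult_left_mono) auto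
      also have "\<dots> = t * \<bar>2 - S\<bar>"
      proof -
        have "\<bar>2 * r i - 1\<bar> * S = \<bar>(2 * r i - 1) * S\<bar>" using S(1) by (simp add: abs_mult)
        also have "(2 * r i - 1) * S = 2 - S" using S(1) by (simp add: r_def S_def[symmetric] field_simps)
        finally show ?thesis by (simp add: mult_ac)
      qed
      also have "\<dots> \<le> t * (4 + (S - 1)\<^sup>2)"
      proof (intro mult_left_mono t)
        have "S \<le> 2 + (S - 1)\<^sup>2" using zero_le_power2[of "S - 3/2"] by (simp add: power2_eq_square algebra_simps)
        then show "\<bar>2 - S\<bar> \<le> 4 + (S - 1)\<^sup>2" using S(1) by (simp add: abs_le_iff)
      qed
      finally have "\<bar>(2 * r i - 1) * (t * t * Re (G i i))\<bar> \<le> t * (4 + (S - 1)\<^sup>2)" by (simp add: abs_mult)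
      then show ?thesis unfolding t(3) abs_le_iff by simp
    qed
    have "t * (S - 1)\<^sup>2 \<le> 1 * (S - 1)\<^sup>2" using t by (intro mult_right_mono) auto
    then have e4: "- 4 * t - (S - 1)\<^sup>2 \<le> (2 * r i - 1) * ((\<eta> / d) * Re (G i i))" using 4 by (simp add: distrib_left)
    have "(2 * r i - 1) * (\<Sum>j<n. W i j * X i j) = (2 * r i - 1) * (2 * D i) + (2 * r i - 1) * (\<alpha>\<^sup>2 * Re (\<phi> i)) + (2 * r i - 1) * ((\<eta> / d) * Re (G i i))"
      unfolding row[OF i] by (simp add: distrib_left)
    then show ?thesis unfolding 2 1 S_def[symmetric] using 3 e4 by linarith
  qed
  have "(\<Sum>i<n. 2 - 6 * (s i - 1)\<^sup>2 - 4 * t + \<alpha>\<^sup>2 * Re (\<phi> i) - 2 * \<alpha>\<^sup>2 * e i)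
      \<le> (\<Sum>i<n. (2 * r i - 1) * (\<Sum>j<n. W i j * X i j) - 3 * ((1 - r i)\<^sup>2 * X i i))"
    by (rule sum_mono) (use pt in simp)
  also have "\<dots> \<le> (\<Sum>i<n. \<Sum>j<n. W i j * x i j)"
    using Wterm by (simp add: sum_subtractf sum_distrib_left)
  finally have "(\<Sum>i<n. 2 - 6 * (s i - 1)\<^sup>2 - 4 * t + \<alpha>\<^sup>2 * Re (\<phi> i) - 2 * \<alpha>\<^sup>2 * e i) \<le> (\<Sum>i<n. \<Sum>j<n. W i j * x i j)" .
  moreover have "(\<Sum>i<n. 2 - 6 * (s i - 1)\<^sup>2 - 4 * t + \<alpha>\<^sup>2 * Re (\<phi> i) - 2 * \<alpha>\<^sup>2 * e i)
      = 2 * real n - 6 * (\<Sum>i<n. (s i - 1)\<^sup>2) - 4 * t * real n + \<alpha>\<^sup>2 * (real n * Re q) - 2 * \<alpha>\<^sup>2 * E"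
  proof -
    have "real n * Re q = (\<Sum>i<n. Re (\<phi> i))" using n by (simp add: q_def)
    moreover have "(\<Sum>i<n. 2 * \<alpha>\<^sup>2 * e i) = 2 * \<alpha>\<^sup>2 * E" by (simp only: E_def sum_distrib_left)
    moreover have "(\<Sum>i<n. \<alpha>\<^sup>2 * Re (\<phi> i)) = \<alpha>\<^sup>2 * (\<Sum>i<n. Re (\<phi> i))" "(\<Sum>i<n. 6 * (s i - 1)\<^sup>2) = 6 * (\<Sum>i<n. (s i - 1)\<^sup>2)"
      by (simp_all only: sum_distrib_left)
    ultimately show ?thesis unfolding sum.distrib sum_subtractf by simp
  qed
  ultimately have tot: "2 * real n - 6 * (\<Sum>i<n. (s i - 1)\<^sup>2) - 4 * t * real n + \<alpha>\<^sup>2 * (real n * Re q) - 2 * \<alpha>\<^sup>2 * E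
      + lam * \<alpha>\<^sup>2 * (real n * (cmod q)\<^sup>2 - 2 * cmod q * E) \<le> sdp B"
    using le lamterm unfolding split by linarith
  have err1: "(\<Sum>i<n. (s i - 1)\<^sup>2) \<le> 2 * A + 2 * (\<alpha>^4 * (real n + P))"
  proof -
    have "(\<Sum>i<n. (s i - 1)\<^sup>2) \<le> (\<Sum>i<n. 2 * (a i - 1)\<^sup>2 + 2 * (\<alpha>^4 * (f i)^4))"
    proof (rule sum_mono)
      fix i assume "i \<in> {..<n}"
      then have i: "i < n" by simp
      show "(s i - 1)\<^sup>2 \<le> 2 * (a i - 1)\<^sup>2 + 2 * (\<alpha>^4 * (f i)^4)"
        unfolding s_def by (rule normalisation_error(1)[OF \<alpha>]) (use a0[OF i] D0[OF i] in \<open>auto simp: f_def D_def\<close>)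
    qed
    also have "\<dots> = 2 * A + 2 * (\<alpha>^4 * P)"
      by (simp add: A_def P_def a_def f_def sum.distrib sum_distrib_left)
    also have "\<dots> \<le> 2 * A + 2 * (\<alpha>^4 * (real n + P))" by (simp add: mult_left_mono)
    finally show ?thesis .
  qed
  have err2: "\<alpha>\<^sup>2 * E \<le> 7 * (A + \<alpha>^4 * (real n + P))"
  proof -
    have "\<alpha>\<^sup>2 * E = (\<Sum>i<n. \<alpha>\<^sup>2 * e i)" by (simp add: E_def sum_distrib_left)
    also have "\<dots> \<le> (\<Sum>i<n. 5 * (a i - 1)\<^sup>2 + 7 * (\<alpha>^4 * (1 + (f i)^4)))"
    proof (rule sum_mono)
      fix i assume "i \<in> {..<n}"
      then have i: "i < n" by simp
      show "\<alpha>\<^sup>2 * e i \<le> 5 * (a i - 1)\<^sup>2 + 7 * (\<alpha>^4 * (1 + (f i)^4))"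
        unfolding s_def e_def by (rule normalisation_error(2)[OF \<alpha>]) (use a0[OF i] D0[OF i] in \<open>auto simp: f_def D_def\<close>)
    qed
    also have "\<dots> = 5 * A + 7 * (\<alpha>^4 * (real n + P))"
      by (simp add: A_def P_def a_def f_def sum.distrib sum_distrib_left distrib_left)
    also have "\<dots> \<le> 7 * (A + \<alpha>^4 * (real n + P))" unfolding distrib_left[of 7] by (simp add: A_def sum_nonneg)
    finally show ?thesis .
  qed
  have "lam * cmod q * (\<alpha>\<^sup>2 * E) \<le> lam * cmod q * (7 * (A + \<alpha>^4 * (real n + P)))"
    using lam by (intro mult_left_mono err2) auto
  moreover define R where "R = A + \<alpha>^4 * (real n + P)"
  moreover define L where "L = lam * cmod q"
  moreover have "lam * \<alpha>\<^sup>2 * (real n * (cmod q)\<^sup>2 - 2 * cmod q * E) = \<alpha>\<^sup>2 * real n * (lam * (cmod q)\<^sup>2) - 2 * (lam * cmod q * (\<alpha>\<^sup>2 * E))"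
    by (simp add: algebra_simps)
  \<comment> \<open>26 is 12 + 14: six times the 2 of \<open>err1\<close> plus twice the 7 of
    \<open>err2\<close>. The other 14 is again twice the 7 of \<open>err2\<close>.\<close>
  ultimately show ?thesis using tot err1 err2 unfolding t_def[symmetric]
    by (simp add: distrib_left distrib_right)
qed

section \<open>Resolvents of the GOE\<close>

lemma gauss_cond_bound:
  fixes f :: "('i \<Rightarrow> real) \<Rightarrow> real"
  assumes J: "finite J" "R \<subseteq> J" and f[measurable]: "f \<in> borel_measurable (gauss J)" and f0: "\<And>g. 0 \<le> f g" and c: "0 \<le> c"
    and b: "\<And>x. integrable (gauss R) (\<lambda>y. f (merge (J - R) R (x, y)))" "\<And>x. (\<integral>y. f (merge (J - R) R (x, y)) \<partial>gauss R) \<le> c"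
  shows "integrable (gauss J) f" "(\<integral>g. f g \<partial>gauss J) \<le> c"
proof -
  interpret product_sigma_finite "\<lambda>_::'i. N01" by (rule product_sigma_finite_N01)
  interpret P: prob_space "gauss (J - R)" by (rule prob_space_gauss)
  have e: "(J - R) \<union> R = J" using J by auto
  have fe: "f \<in> borel_measurable (gauss ((J - R) \<union> R))" unfolding e by (rule f)
  have "(\<integral>\<^sup>+g. ennreal (f g) \<partial>gauss ((J - R) \<union> R)) = (\<integral>\<^sup>+x. (\<integral>\<^sup>+y. ennreal (f (merge (J - R) R (x, y))) \<partial>gauss R) \<partial>gauss (J - R))"
    using J fe by (intro product_nn_integral_fold) (auto intro: finite_subset)
  also have "\<dots> \<le> (\<integral>\<^sup>+x. ennreal c \<partial>gauss (J - R))"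
  proof (rule nn_integral_mono)
    fix x :: "'i \<Rightarrow> real"
    have "(\<integral>\<^sup>+y. ennreal (f (merge (J - R) R (x, y))) \<partial>gauss R) = ennreal (\<integral>y. f (merge (J - R) R (x, y)) \<partial>gauss R)"
      by (rule nn_integral_eq_integral[OF b(1)]) (simp add: f0)
    then show "(\<integral>\<^sup>+y. ennreal (f (merge (J - R) R (x, y))) \<partial>gauss R) \<le> ennreal c"
      using b(2)[of x] by (simp add: ennreal_leI)
  qed
  also have "\<dots> = ennreal c" by (simp add: P.emeasure_space_1)
  finally have nn: "(\<integral>\<^sup>+g. ennreal (f g) \<partial>gauss J) \<le> ennreal c" unfolding e .
  show i: "integrable (gauss J) f"
  proof (rule integrableI_bounded[OF f])
    have "(\<integral>\<^sup>+g. ennreal (norm (f g)) \<partial>gauss J) \<le> ennreal c" using nn by (simp add: f0)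
    then show "(\<integral>\<^sup>+g. ennreal (norm (f g)) \<partial>gauss J) < \<infinity>" by (simp add: le_less_trans)
  qed
  show "(\<integral>g. f g \<partial>gauss J) \<le> c"
    using nn nn_integral_eq_integral[OF i] f0 c by (simp add: ennreal_le_iff)
qed

lemma gauss_quadratic_form_complex:
  fixes A :: "'s \<Rightarrow> 's \<Rightarrow> complex" and e :: "'s \<Rightarrow> 'i"
  assumes J: "finite J" "finite S" "inj_on e S" "e ` S \<subseteq> J"
  defines "Q \<equiv> \<lambda>g :: 'i \<Rightarrow> real. \<Sum>j\<in>S. \<Sum>k\<in>S. A j k * of_real (g (e j) * g (e k) - of_bool (j = k))"
  shows "integrable (gauss J) (\<lambda>g. (cmod (Q g))\<^sup>2)"
    "(\<integral>g. (cmod (Q g))\<^sup>2 \<partial>gauss J) \<le> 2 * (\<Sum>j\<in>S. \<Sum>k\<in>S. (cmod (A j k))\<^sup>2)"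
proof -
  have eq: "(cmod (Q g))\<^sup>2 = (\<Sum>j\<in>S. \<Sum>k\<in>S. Re (A j k) * (g (e j) * g (e k) - of_bool (j = k)))\<^sup>2
      + (\<Sum>j\<in>S. \<Sum>k\<in>S. Im (A j k) * (g (e j) * g (e k) - of_bool (j = k)))\<^sup>2" for g
    unfolding cmod_power2 Q_def by (simp del: of_real_diff of_real_mult)
  note r = gauss_quadratic_form[OF J, of "\<lambda>j k. Re (A j k)"] gauss_quadratic_form[OF J, of "\<lambda>j k. Im (A j k)"]
  show "integrable (gauss J) (\<lambda>g. (cmod (Q g))\<^sup>2)" unfolding eq by (intro Bochner_Integration.integrable_add r)
  have "(\<integral>g. (cmod (Q g))\<^sup>2 \<partial>gauss J) \<le> 2 * (\<Sum>j\<in>S. \<Sum>k\<in>S. (Re (A j k))\<^sup>2) + 2 * (\<Sum>j\<in>S. \<Sum>k\<in>S. (Im (A j k))\<^sup>2)"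
    unfolding eq using r by simp
  also have "\<dots> = 2 * (\<Sum>j\<in>S. \<Sum>k\<in>S. (cmod (A j k))\<^sup>2)" by (simp add: cmod_power2 sum.distrib)
  finally show "(\<integral>g. (cmod (Q g))\<^sup>2 \<partial>gauss J) \<le> 2 * (\<Sum>j\<in>S. \<Sum>k\<in>S. (cmod (A j k))\<^sup>2)" .
qed

text \<open>Real and imaginary part are real Gaussian forms, each with fourth moment 3 times its
  squared variance; 6 is this 3 times the 2 lost in separating them.\<close>

lemma gauss_linear_form_complex:
  fixes c :: "'s \<Rightarrow> complex" and e :: "'s \<Rightarrow> 'i"
  assumes J: "finite J" "finite S" "inj_on e S" "e ` S \<subseteq> J"
  defines "L \<equiv> \<lambda>g :: 'i \<Rightarrow> real. \<Sum>j\<in>S. c j * of_real (g (e j))"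
  shows "integrable (gauss J) (\<lambda>g. (cmod (L g))^4)"
    "(\<integral>g. (cmod (L g))^4 \<partial>gauss J) \<le> 6 * (\<Sum>j\<in>S. (cmod (c j))\<^sup>2)\<^sup>2"
proof -
  define a where "a = (\<lambda>g :: 'i \<Rightarrow> real. \<Sum>j\<in>S. Re (c j) * g (e j))"
  define b where "b = (\<lambda>g :: 'i \<Rightarrow> real. \<Sum>j\<in>S. Im (c j) * g (e j))"
  have ra: "integrable (gauss J) (\<lambda>g. (a g)^4)" "(\<integral>g. (a g)^4 \<partial>gauss J) = 3 * (\<Sum>j\<in>S. (Re (c j))\<^sup>2)\<^sup>2"
    unfolding a_def by (rule gauss_linear_form(3,4)[OF J])+
  have rb: "integrable (gauss J) (\<lambda>g. (b g)^4)" "(\<integral>g. (b g)^4 \<partial>gauss J) = 3 * (\<Sum>j\<in>S. (Im (c j))\<^sup>2)\<^sup>2"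
    unfolding b_def by (rule gauss_linear_form(3,4)[OF J])+
  have eq: "(cmod (L g))^4 = ((a g)\<^sup>2 + (b g)\<^sup>2)\<^sup>2" for g
  proof -
    have "(cmod (L g))^4 = ((cmod (L g))\<^sup>2)\<^sup>2" by simp
    also have "(cmod (L g))\<^sup>2 = (a g)\<^sup>2 + (b g)\<^sup>2" unfolding cmod_power2 L_def a_def b_def by simp
    finally show ?thesis .
  qed
  have le: "(cmod (L g))^4 \<le> 2 * (a g)^4 + 2 * (b g)^4" for g
  proof -
    have "(a g)^4 = ((a g)\<^sup>2)\<^sup>2" "(b g)^4 = ((b g)\<^sup>2)\<^sup>2" by simp_all
    then show ?thesis unfolding eq using zero_le_power2[of "(a g)\<^sup>2 - (b g)\<^sup>2"] unfolding power2_diff power2_sum by linarith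
  qed
  have i: "integrable (gauss J) (\<lambda>g. 2 * (a g)^4 + 2 * (b g)^4)" using ra rb by simp
  have m: "(\<lambda>g. (cmod (L g))^4) \<in> borel_measurable (gauss J)"
  proof -
    have [measurable]: "(\<lambda>g. g (e j)) \<in> borel_measurable (gauss J)" if "j \<in> S" for j
    proof -
      have "e j \<in> J" using J that by auto
      then show ?thesis by measurable
    qed
    show ?thesis unfolding L_def by measurable
  qed
  show il: "integrable (gauss J) (\<lambda>g. (cmod (L g))^4)"
  proof (rule Bochner_Integration.integrable_bound[OF i m])
    show "AE g in gauss J. norm ((cmod (L g))^4) \<le> norm (2 * (a g)^4 + 2 * (b g)^4)"
      by (rule AE_I2) (use le in \<open>simp add: order_trans[OF _ abs_ge_self]\<close>)
  qed
  define u where "u = (\<Sum>j\<in>S. (Re (c j))\<^sup>2)"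
  define v where "v = (\<Sum>j\<in>S. (Im (c j))\<^sup>2)"
  have "(\<integral>g. (cmod (L g))^4 \<partial>gauss J) \<le> (\<integral>g. 2 * (a g)^4 + 2 * (b g)^4 \<partial>gauss J)"
    by (rule integral_mono[OF il i le])
  also have "\<dots> = 6 * (u\<^sup>2 + v\<^sup>2)" using ra rb by (simp add: u_def v_def)
  also have "\<dots> \<le> 6 * (u + v)\<^sup>2"
    using mult_nonneg_nonneg[of u v] by (simp add: power2_sum u_def v_def sum_nonneg)
  also have "u + v = (\<Sum>j\<in>S. (cmod (c j))\<^sup>2)" by (simp add: u_def v_def cmod_power2 sum.distrib)
  finally show "(\<integral>g. (cmod (L g))^4 \<partial>gauss J) \<le> 6 * (\<Sum>j\<in>S. (cmod (c j))\<^sup>2)\<^sup>2" .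
qed

text \<open>Off-diagonal coordinates enter twice with weight \<open>1 / sqrt (real n)\<close>;
  diagonal ones enter once with the factor \<open>sqrt 2\<close>, which is at most 2.\<close>

lemma goe_diff:
  "(\<Sum>i<n. \<Sum>j<n. \<bar>goe n g i j - goe n h i j\<bar>) \<le> (\<Sum>p\<in>gidx n. 2 / sqrt (real n) * \<bar>g p - h p\<bar>)"
proof -
  have "(\<Sum>i<n. \<Sum>j<n. \<bar>goe n g i j - goe n h i j\<bar>)
    = (\<Sum>(i, j)\<in>gidx n. if i = j then \<bar>goe n g i j - goe n h i j\<bar> else 2 * \<bar>goe n g i j - goe n h i j\<bar>)"
    by (rule sum_symmetric) (simp add: goe_sym)
  also have "\<dots> \<le> (\<Sum>p\<in>gidx n. 2 / sqrt (real n) * \<bar>g p - h p\<bar>)"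
  proof (rule sum_mono, clarify)
    fix i j assume ij: "(i, j) \<in> gidx n"
    show "(if i = j then \<bar>goe n g i j - goe n h i j\<bar> else 2 * \<bar>goe n g i j - goe n h i j\<bar>) \<le> 2 / sqrt (real n) * \<bar>g (i, j) - h (i, j)\<bar>"
    proof (cases "i = j")
      case True
      have "sqrt 2 \<le> sqrt 4" by (rule real_sqrt_le_mono) simp
      then have s2: "sqrt 2 \<le> 2" by simp
      have "goe n g i j - goe n h i j = sqrt 2 / sqrt (real n) * (g (i, j) - h (i, j))"
        using True by (simp add: goe_def right_diff_distrib diff_divide_distrib)
      then have "\<bar>goe n g i j - goe n h i j\<bar> = sqrt 2 / sqrt (real n) * \<bar>g (i, j) - h (i, j)\<bar>" by (simp add: abs_mult)
      also have "\<dots> \<le> 2 / sqrt (real n) * \<bar>g (i, j) - h (i, j)\<bar>"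
        using s2 by (intro mult_right_mono divide_right_mono) auto
      finally show ?thesis using True by simp
    next
      case False
      then have "goe n g i j - goe n h i j = (g (i, j) - h (i, j)) / sqrt (real n)"
        using ij by (simp add: goe_def gidx_def diff_divide_distrib min_def max_def)
      then show ?thesis using False by (simp add: abs_divide)
    qed
  qed
  finally show ?thesis .
qed

definition goe_res :: "nat \<Rightarrow> complex \<Rightarrow> (nat \<times> nat \<Rightarrow> real) \<Rightarrow> nat \<Rightarrow> nat \<Rightarrow> complex" where
  "goe_res n z g = resolvent n (goe n g) z"

definition goe_minor :: "nat \<Rightarrow> nat \<Rightarrow> (nat \<times> nat \<Rightarrow> real) \<Rightarrow> nat \<Rightarrow> nat \<Rightarrow> real" where
  "goe_minor n i g = (\<lambda>k l. if k = i \<or> l = i then 0 else goe n g k l)"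

definition minor_res :: "nat \<Rightarrow> complex \<Rightarrow> nat \<Rightarrow> (nat \<times> nat \<Rightarrow> real) \<Rightarrow> nat \<Rightarrow> nat \<Rightarrow> complex" where
  "minor_res n z i g = resolvent n (goe_minor n i g) z"

lemma sym_resolvent_goe: "0 < Im z \<Longrightarrow> sym_resolvent n (goe n g) z (goe_res n z g)"
  unfolding goe_res_def by unfold_locales (auto intro!: is_res_resolvent goe_sym)

lemma sym_resolvent_minor: "0 < Im z \<Longrightarrow> sym_resolvent n (goe_minor n i g) z (minor_res n z i g)"
  unfolding minor_res_def by unfold_locales (auto intro!: is_res_resolvent simp: goe_minor_def goe_sym)

lemma schur_goe: "0 < Im z \<Longrightarrow> i < n \<Longrightarrow> schur n (goe n g) z (goe_res n z g) (minor_res n z i g) i"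
  using sym_resolvent_goe[of z n g] sym_resolvent_minor[of z n i g]
  by (intro schur.intro schur_axioms.intro) (simp_all add: goe_minor_def)

lemma goe_res_measurable:
  assumes z: "0 < Im z" and J: "finite J" "gidx n \<subseteq> J" and ij: "i < n" "j < n"
  shows "(\<lambda>g. goe_res n z g i j) \<in> borel_measurable (gauss J)"
proof (rule lipschitz_measurable[OF J(1)])
  fix g h :: "nat \<times> nat \<Rightarrow> real"
  have "norm (goe_res n z g i j - goe_res n z h i j) \<le> (\<Sum>k<n. \<Sum>l<n. \<bar>goe n g k l - goe n h k l\<bar>) / (Im z)\<^sup>2"
    by (rule resolvent_lipschitz[OF sym_resolvent_goe[OF z] sym_resolvent_goe[OF z] ij])
  also have "\<dots> \<le> (\<Sum>p\<in>gidx n. 2 / sqrt (real n) * \<bar>g p - h p\<bar>) / (Im z)\<^sup>2"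
    by (intro divide_right_mono goe_diff) simp
  also have "\<dots> \<le> (\<Sum>p\<in>J. 2 / sqrt (real n) * \<bar>g p - h p\<bar>) / (Im z)\<^sup>2"
    by (intro divide_right_mono sum_mono2 J) auto
  finally show "norm (goe_res n z g i j - goe_res n z h i j) \<le> (\<Sum>p\<in>J. (2 / sqrt (real n) / (Im z)\<^sup>2) * \<bar>g p - h p\<bar>)"
    by (simp add: sum_divide_distrib)
qed

lemma minor_res_measurable:
  assumes z: "0 < Im z" and J: "finite J" "gidx n \<subseteq> J" and ij: "k < n" "l < n"
  shows "(\<lambda>g. minor_res n z i g k l) \<in> borel_measurable (gauss J)"
proof (rule lipschitz_measurable[OF J(1)])
  fix g h :: "nat \<times> nat \<Rightarrow> real"
  have "norm (minor_res n z i g k l - minor_res n z i h k l) \<le> (\<Sum>k<n. \<Sum>l<n. \<bar>goe_minor n i g k l - goe_minor n i h k l\<bar>) / (Im z)\<^sup>2"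
    by (rule resolvent_lipschitz[OF sym_resolvent_minor[OF z] sym_resolvent_minor[OF z] ij])
  also have "\<dots> \<le> (\<Sum>k<n. \<Sum>l<n. \<bar>goe n g k l - goe n h k l\<bar>) / (Im z)\<^sup>2"
    by (intro divide_right_mono sum_mono) (auto simp: goe_minor_def)
  also have "\<dots> \<le> (\<Sum>p\<in>gidx n. 2 / sqrt (real n) * \<bar>g p - h p\<bar>) / (Im z)\<^sup>2"
    by (intro divide_right_mono goe_diff) simp
  also have "\<dots> \<le> (\<Sum>p\<in>J. 2 / sqrt (real n) * \<bar>g p - h p\<bar>) / (Im z)\<^sup>2"
    by (intro divide_right_mono sum_mono2 J) auto
  finally show "norm (minor_res n z i g k l - minor_res n z i h k l) \<le> (\<Sum>p\<in>J. (2 / sqrt (real n) / (Im z)\<^sup>2) * \<bar>g p - h p\<bar>)"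
    by (simp add: sum_divide_distrib)
qed


definition row_coord :: "nat \<Rightarrow> nat \<Rightarrow> nat \<times> nat" where
  "row_coord i k = (min i k, max i k)"

lemma row_coord_inj: "inj_on (row_coord i) S"
  by (auto simp: inj_on_def row_coord_def min_def max_def split: if_splits)

lemma row_coord_gidx: "i < n \<Longrightarrow> k < n \<Longrightarrow> row_coord i k \<in> gidx n"
  by (auto simp: row_coord_def gidx_def)

lemma goe_row: "k \<noteq> i \<Longrightarrow> goe n g i k = g (row_coord i k) / sqrt (real n)"
  by (auto simp: goe_def row_coord_def)

text \<open>The minor does not read row \<open>i\<close>, so its resolvent stays frozen while that
  row is integrated; the zero function is a placeholder for the row.\<close>

lemma minor_res_merge:
  assumes "R = row_coord i ` ({..<n} - {i})"
  shows "minor_res n z i (merge (J - R) R (x, y)) = minor_res n z i (merge (J - R) R (x, \<lambda>_. 0))"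
proof -
  have "goe_minor n i (merge (J - R) R (x, y)) = goe_minor n i (merge (J - R) R (x, \<lambda>_. 0))"
  proof (intro ext)
    fix k l
    have "(min k l, max k l) \<notin> R" "(k, k) \<notin> R" if "k \<noteq> i" "l \<noteq> i"
      using that unfolding assms by (auto simp: row_coord_def min_def max_def split: if_splits)
    then show "goe_minor n i (merge (J - R) R (x, y)) k l = goe_minor n i (merge (J - R) R (x, \<lambda>_. 0)) k l"
      by (auto simp: goe_minor_def goe_def merge_def)
  qed
  then show ?thesis by (simp add: minor_res_def)
qed

text \<open>Given the minor, the difference is 1/n times a centred quadratic form in the independent
  row \<open>i\<close>. Its second moment is at most twice the squared Frobenius norm of the minor
  resolvent, itself at most \<open>real n / (Im z)\<^sup>2\<close>.\<close>

lemma minor_quadratic_bound: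
  assumes z: "0 < Im z" and J: "finite J" "gidx n \<subseteq> J" and i: "i < n"
  defines "S \<equiv> {..<n} - {i}"
  defines "f \<equiv> \<lambda>g. (cmod ((\<Sum>k\<in>S. \<Sum>l\<in>S. of_real (goe n g i k * goe n g i l) * minor_res n z i g k l)
      - (\<Sum>k\<in>S. minor_res n z i g k k) / of_nat n))\<^sup>2"
  shows "integrable (gauss J) f" "(\<integral>g. f g \<partial>gauss J) \<le> 2 / (real n * (Im z)\<^sup>2)"
proof -
  define R where "R = row_coord i ` S"
  have n: "0 < n" using i by simp
  have fS: "finite S" by (simp add: S_def)
  have RJ: "R \<subseteq> J" unfolding R_def by (intro image_subsetI subsetD[OF J(2)] row_coord_gidx[OF i]) (simp add: S_def)
  have f_eq: "f g = (1 / real n)\<^sup>2 * (cmod (\<Sum>k\<in>S. \<Sum>l\<in>S. minor_res n z i g k l * of_real (g (row_coord i k) * g (row_coord i l) - of_bool (k = l))))\<^sup>2" for g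
  proof -
    have ob: "complex_of_real (of_bool b) = of_bool b" for b by (simp add: of_bool_def)
    have d: "(\<Sum>l\<in>S. H * of_bool (k = l)) = H" if "k \<in> S" for k and H :: complex
      using that fS by (simp add: of_bool_def if_distrib[where f="(*) _"] cong: if_cong)
    have "(\<Sum>k\<in>S. \<Sum>l\<in>S. of_real (goe n g i k * goe n g i l) * minor_res n z i g k l) - (\<Sum>k\<in>S. minor_res n z i g k k) / of_nat n
       = (\<Sum>k\<in>S. \<Sum>l\<in>S. of_real (1 / real n) * (minor_res n z i g k l * of_real (g (row_coord i k) * g (row_coord i l) - of_bool (k = l))))"
    proof -
      have "(\<Sum>k\<in>S. minor_res n z i g k k) / of_nat n = (\<Sum>k\<in>S. \<Sum>l\<in>S. of_real (1 / real n) * (minor_res n z i g k l * of_bool (k = l)))"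
        unfolding sum_divide_distrib
      proof (rule sum.cong[OF refl])
        fix k assume k: "k \<in> S"
        have "(\<Sum>l\<in>S. of_real (1 / real n) * (minor_res n z i g k l * of_bool (k = l))) = (\<Sum>l\<in>S. (of_real (1 / real n) * minor_res n z i g k k) * of_bool (k = l))"
          by (intro sum.cong refl) auto
        also have "\<dots> = of_real (1 / real n) * minor_res n z i g k k" by (rule d[OF k])
        finally show "minor_res n z i g k k / of_nat n = (\<Sum>l\<in>S. of_real (1 / real n) * (minor_res n z i g k l * of_bool (k = l)))" by simp
      qed
      moreover have "of_real (goe n g i k * goe n g i l) * minor_res n z i g k l
          = of_real (1 / real n) * (minor_res n z i g k l * of_real (g (row_coord i k) * g (row_coord i l)))" if "k \<in> S" "l \<in> S" for k l
      proof -
        have "goe n g i k * goe n g i l = (1 / real n) * (g (row_coord i k) * g (row_coord i l))"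
          using that n by (simp add: S_def goe_row)
        then show ?thesis by (simp only: of_real_mult mult_ac)
      qed
      ultimately show ?thesis
        by (simp only: sum_subtractf[symmetric])
           (intro sum.cong refl; simp only: of_real_diff right_diff_distrib ob)
    qed
    also have "\<dots> = of_real (1 / real n) * (\<Sum>k\<in>S. \<Sum>l\<in>S. minor_res n z i g k l * of_real (g (row_coord i k) * g (row_coord i l) - of_bool (k = l)))"
      by (simp only: sum_distrib_left)
    finally show ?thesis unfolding f_def by (simp only: norm_mult norm_of_real power_mult_distrib) simp
  qed
  have meas: "f \<in> borel_measurable (gauss J)"
  proof -
    have [measurable]: "(\<lambda>g. minor_res n z i g k l) \<in> borel_measurable (gauss J)" "(\<lambda>g. g (row_coord i k)) \<in> borel_measurable (gauss J)"
      if "k \<in> S" "l \<in> S" for k l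
    proof -
      show "(\<lambda>g. minor_res n z i g k l) \<in> borel_measurable (gauss J)"
        using that by (intro minor_res_measurable z J) (auto simp: S_def)
      have "row_coord i k \<in> J" using RJ that by (auto simp: R_def)
      then show "(\<lambda>g. g (row_coord i k)) \<in> borel_measurable (gauss J)" by measurable
    qed
    show ?thesis unfolding f_eq by measurable
  qed
  have inner: "integrable (gauss R) (\<lambda>y. f (merge (J - R) R (x, y))) \<and> (\<integral>y. f (merge (J - R) R (x, y)) \<partial>gauss R) \<le> 2 / (real n * (Im z)\<^sup>2)" for x
  proof -
    define A where "A = minor_res n z i (merge (J - R) R (x, \<lambda>_. 0))"
    have mA: "minor_res n z i (merge (J - R) R (x, y)) = A" for y
      unfolding A_def by (rule minor_res_merge) (simp add: R_def S_def)
    have my: "merge (J - R) R (x, y) (row_coord i k) = y (row_coord i k)" if "k \<in> S" for y k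
      using that by (auto simp: merge_def R_def)
    interpret A: sym_resolvent n "goe_minor n i (merge (J - R) R (x, \<lambda>_. 0))" z A
      unfolding A_def by (rule sym_resolvent_minor[OF z])
    have fm: "f (merge (J - R) R (x, y)) = (1 / real n)\<^sup>2 * (cmod (\<Sum>k\<in>S. \<Sum>l\<in>S. A k l * of_real (y (row_coord i k) * y (row_coord i l) - of_bool (k = l))))\<^sup>2" for y
      unfolding f_eq mA using my by (intro arg_cong2[where f="(*)"] refl arg_cong[where f="\<lambda>x. (cmod x)\<^sup>2"] sum.cong) simp
    note q = gauss_quadratic_form_complex[OF _ fS row_coord_inj, of R i A]
    have fR: "finite R" by (simp add: R_def fS)
    have RS: "row_coord i ` S \<subseteq> R" by (simp add: R_def)
    have "(\<Sum>k\<in>S. \<Sum>l\<in>S. (cmod (A k l))\<^sup>2) \<le> (\<Sum>k<n. \<Sum>l<n. (cmod (A k l))\<^sup>2)"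
    proof -
      have "(\<Sum>k\<in>S. \<Sum>l\<in>S. (cmod (A k l))\<^sup>2) \<le> (\<Sum>k\<in>S. \<Sum>l<n. (cmod (A k l))\<^sup>2)"
        by (intro sum_mono sum_mono2) (auto simp: S_def)
      also have "\<dots> \<le> (\<Sum>k<n. \<Sum>l<n. (cmod (A k l))\<^sup>2)" by (intro sum_mono2) (auto simp: S_def intro: sum_nonneg)
      finally show ?thesis .
    qed
    also have "\<dots> \<le> (\<Sum>k<n. 1 / (Im z)\<^sup>2)" by (intro sum_mono A.G_row_bound) simp
    finally have b: "(\<Sum>k\<in>S. \<Sum>l\<in>S. (cmod (A k l))\<^sup>2) \<le> real n / (Im z)\<^sup>2" by simp
    have "(\<integral>y. f (merge (J - R) R (x, y)) \<partial>gauss R) \<le> (1 / real n)\<^sup>2 * (2 * (\<Sum>k\<in>S. \<Sum>l\<in>S. (cmod (A k l))\<^sup>2))"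
      unfolding fm using q(2)[OF fR RS] by (simp only: integral_mult_right_zero) (intro mult_left_mono; simp)
    also have "\<dots> \<le> (1 / real n)\<^sup>2 * (2 * (real n / (Im z)\<^sup>2))" by (intro mult_left_mono b) auto
    also have "\<dots> = 2 / (real n * (Im z)\<^sup>2)" using n by (simp add: power2_eq_square)
    finally show ?thesis unfolding fm using q(1)[OF fR RS] by (intro conjI integrable_mult_right)
  qed
  have c0: "0 \<le> 2 / (real n * (Im z)\<^sup>2)" by simp
  have f0: "0 \<le> f g" for g by (simp add: f_def)
  show "integrable (gauss J) f" "(\<integral>g. f g \<partial>gauss J) \<le> 2 / (real n * (Im z)\<^sup>2)"
    using gauss_cond_bound[OF J(1) RJ meas f0 c0] inner by blast+
qed

text \<open>Given the minor, this is a Gaussian linear form whose coefficients are row sums of the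
  minor resolvent. The operator norm bound, applied to the indicator of the indices other than
  \<open>i\<close>, makes their squared norm at most \<open>real n / (Im z)\<^sup>2\<close>.\<close>

lemma minor_linear_bound:
  assumes z: "0 < Im z" and J: "finite J" "gidx n \<subseteq> J" and i: "i < n"
  defines "S \<equiv> {..<n} - {i}"
  defines "f \<equiv> \<lambda>g. (cmod (\<Sum>b\<in>S. of_real (goe n g i b) * (\<Sum>l\<in>S. minor_res n z i g b l)))^4"
  shows "integrable (gauss J) f" "(\<integral>g. f g \<partial>gauss J) \<le> 6 / (Im z)^4"
proof -
  define R where "R = row_coord i ` S"
  have n: "0 < n" using i by simp
  have fS: "finite S" by (simp add: S_def)
  have RJ: "R \<subseteq> J" unfolding R_def by (intro image_subsetI subsetD[OF J(2)] row_coord_gidx[OF i]) (simp add: S_def)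
  have f_eq: "f g = (1 / sqrt (real n))^4 * (cmod (\<Sum>b\<in>S. (\<Sum>l\<in>S. minor_res n z i g b l) * of_real (g (row_coord i b))))^4" for g
  proof -
    have "(\<Sum>b\<in>S. of_real (goe n g i b) * (\<Sum>l\<in>S. minor_res n z i g b l))
       = (\<Sum>b\<in>S. of_real (1 / sqrt (real n)) * ((\<Sum>l\<in>S. minor_res n z i g b l) * of_real (g (row_coord i b))))"
      by (intro sum.cong refl) (simp add: S_def goe_row)
    also have "\<dots> = of_real (1 / sqrt (real n)) * (\<Sum>b\<in>S. (\<Sum>l\<in>S. minor_res n z i g b l) * of_real (g (row_coord i b)))"
      by (simp only: sum_distrib_left)
    finally show ?thesis unfolding f_def by (simp only: norm_mult norm_of_real power_mult_distrib) simp
  qed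
  have meas: "f \<in> borel_measurable (gauss J)"
  proof -
    have [measurable]: "(\<lambda>g. minor_res n z i g k l) \<in> borel_measurable (gauss J)" "(\<lambda>g. g (row_coord i k)) \<in> borel_measurable (gauss J)"
      if "k \<in> S" "l \<in> S" for k l
    proof -
      show "(\<lambda>g. minor_res n z i g k l) \<in> borel_measurable (gauss J)"
        using that by (intro minor_res_measurable z J) (auto simp: S_def)
      have "row_coord i k \<in> J" using RJ that by (auto simp: R_def)
      then show "(\<lambda>g. g (row_coord i k)) \<in> borel_measurable (gauss J)" by measurable
    qed
    show ?thesis unfolding f_eq by measurable
  qed
  have inner: "integrable (gauss R) (\<lambda>y. f (merge (J - R) R (x, y))) \<and> (\<integral>y. f (merge (J - R) R (x, y)) \<partial>gauss R) \<le> 6 / (Im z)^4" for x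
  proof -
    define A where "A = minor_res n z i (merge (J - R) R (x, \<lambda>_. 0))"
    have mA: "minor_res n z i (merge (J - R) R (x, y)) = A" for y
      unfolding A_def by (rule minor_res_merge) (simp add: R_def S_def)
    have my: "merge (J - R) R (x, y) (row_coord i k) = y (row_coord i k)" if "k \<in> S" for y k
      using that by (auto simp: merge_def R_def)
    interpret A: sym_resolvent n "goe_minor n i (merge (J - R) R (x, \<lambda>_. 0))" z A
      unfolding A_def by (rule sym_resolvent_minor[OF z])
    define c where "c = (\<lambda>b. \<Sum>l\<in>S. A b l)"
    have fm: "f (merge (J - R) R (x, y)) = (1 / sqrt (real n))^4 * (cmod (\<Sum>b\<in>S. c b * of_real (y (row_coord i b))))^4" for y
      unfolding f_eq mA c_def using my by (intro arg_cong2[where f="(*)"] refl arg_cong[where f="\<lambda>x. (cmod x)^4"] sum.cong) simp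
    have fR: "finite R" by (simp add: R_def fS)
    have RS: "row_coord i ` S \<subseteq> R" by (simp add: R_def)
    note q = gauss_linear_form_complex[OF fR fS row_coord_inj RS, of c]
    have "(\<Sum>b\<in>S. (cmod (c b))\<^sup>2) \<le> (\<Sum>b<n. (cmod (\<Sum>l<n. A b l * of_real (of_bool (l \<noteq> i))))\<^sup>2)"
    proof -
      have "(\<Sum>l<n. A b l * of_real (of_bool (l \<noteq> i))) = c b" for b
        unfolding c_def S_def using i by (simp add: sum.remove[of "{..<n}" i])
      then show ?thesis by (simp only:) (intro sum_mono2; auto simp: S_def)
    qed
    also have "\<dots> \<le> (\<Sum>l<n. (of_bool (l \<noteq> i))\<^sup>2) / (Im z)\<^sup>2" by (rule A.G_apply_bound)
    also have "\<dots> \<le> (\<Sum>l<n. 1) / (Im z)\<^sup>2" by (intro divide_right_mono sum_mono) auto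
    finally have b: "(\<Sum>b\<in>S. (cmod (c b))\<^sup>2) \<le> real n / (Im z)\<^sup>2" by simp
    have sq: "(1 / sqrt (real n))^4 = 1 / (real n)\<^sup>2"
    proof -
      have e4: "x^4 = (x\<^sup>2)\<^sup>2" for x :: real by simp
      show ?thesis unfolding power_divide e4 by simp
    qed
    have "(\<integral>y. f (merge (J - R) R (x, y)) \<partial>gauss R) \<le> (1 / sqrt (real n))^4 * (6 * (\<Sum>b\<in>S. (cmod (c b))\<^sup>2)\<^sup>2)"
      unfolding fm using q(2) by (simp only: integral_mult_right_zero) (intro mult_left_mono; simp)
    also have "\<dots> \<le> (1 / sqrt (real n))^4 * (6 * (real n / (Im z)\<^sup>2)\<^sup>2)"
      by (intro mult_left_mono power_mono b) (auto intro: sum_nonneg)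
    also have "\<dots> = 6 / (Im z)^4" unfolding sq using n by (simp add: power_divide)
    finally show ?thesis unfolding fm using q(1) by (intro conjI integrable_mult_right)
  qed
  have c0: "0 \<le> 6 / (Im z)^4" using z by simp
  have f0: "0 \<le> f g" for g by (simp add: f_def)
  show "integrable (gauss J) f" "(\<integral>g. f g \<partial>gauss J) \<le> 6 / (Im z)^4"
    using gauss_cond_bound[OF J(1) RJ meas f0 c0] inner by blast+
qed

section \<open>The self-consistent equation and the resolvent applied to the all-ones vector\<close>

text \<open>The Stieltjes transform of the empirical spectral distribution.\<close>

definition goe_s :: "nat \<Rightarrow> complex \<Rightarrow> (nat \<times> nat \<Rightarrow> real) \<Rightarrow> complex" where
  "goe_s n z g = (\<Sum>i<n. goe_res n z g i i) / of_nat n"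

definition goe_phi :: "nat \<Rightarrow> complex \<Rightarrow> (nat \<times> nat \<Rightarrow> real) \<Rightarrow> nat \<Rightarrow> complex" where
  "goe_phi n z g i = (\<Sum>l<n. goe_res n z g i l)"

definition goe_q :: "nat \<Rightarrow> complex \<Rightarrow> (nat \<times> nat \<Rightarrow> real) \<Rightarrow> complex" where
  "goe_q n z g = (\<Sum>i<n. goe_phi n z g i) / of_nat n"

text \<open>The residual of the fixed point equation \<open>G i i = -1 / (z + s)\<close>, which the
  Schur complement suggests when fluctuations are ignored.\<close>

definition self_consistency :: "nat \<Rightarrow> complex \<Rightarrow> (nat \<times> nat \<Rightarrow> real) \<Rightarrow> nat \<Rightarrow> complex" where
  "self_consistency n z g i = 1 + goe_res n z g i i * (z + goe_s n z g)"

lemma sum3_square_le: "(a + b + c)\<^sup>2 \<le> 3 * (a\<^sup>2 + b\<^sup>2 + c\<^sup>2)" for a b c :: real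
proof -
  have "0 \<le> (a - b)\<^sup>2 + (a - c)\<^sup>2 + (b - c)\<^sup>2" by simp
  then show ?thesis by (simp add: power2_eq_square algebra_simps)
qed

text \<open>The Schur complement leaves three errors: the diagonal entry of W, the fluctuation
  \<open>Q - t\<close> of the quadratic form, and the difference \<open>s - t\<close> between the
  normalised traces of the resolvent and of its minor.\<close>

lemma self_consistency_pointwise:
  assumes z: "0 < Im z" and i: "i < n"
  defines "S \<equiv> {..<n} - {i}"
  shows "(cmod (self_consistency n z g i))\<^sup>2 \<le> 3 / (Im z)\<^sup>2 * ((goe n g i i)\<^sup>2
    + (cmod ((\<Sum>k\<in>S. \<Sum>l\<in>S. of_real (goe n g i k * goe n g i l) * minor_res n z i g k l) - (\<Sum>k\<in>S. minor_res n z i g k k) / of_nat n))\<^sup>2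
    + 4 / (real n * (Im z)\<^sup>2))"
proof -
  interpret schur n "goe n g" z "goe_res n z g" "minor_res n z i g" i by (rule schur_goe[OF z i])
  have n: "1 \<le> real n" using i by simp
  define Q where "Q = (\<Sum>k\<in>S. \<Sum>l\<in>S. of_real (goe n g i k * goe n g i l) * minor_res n z i g k l)"
  define t where "t = (\<Sum>k\<in>S. minor_res n z i g k k) / of_nat n"
  define s where "s = goe_s n z g"
  define w where "w = goe n g i i"
  have "goe_res n z g i i * (of_real w - z - Q) = 1" unfolding w_def Q_def S_def by (rule schur_complement)
  then have "self_consistency n z g i = goe_res n z g i i * (of_real w - z - Q) + goe_res n z g i i * (z + s)"
    by (simp add: self_consistency_def s_def)
  also have "\<dots> = goe_res n z g i i * (of_real w - (Q - t) + (s - t))" by (simp add: algebra_simps)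
  finally have "cmod (self_consistency n z g i) = cmod (goe_res n z g i i) * cmod (of_real w - (Q - t) + (s - t))"
    by (simp add: norm_mult)
  also have "\<dots> \<le> (1 / Im z) * (\<bar>w\<bar> + cmod (Q - t) + cmod (s - t))"
  proof (intro mult_mono G.G_bound_diag i)
    show "cmod (of_real w - (Q - t) + (s - t)) \<le> \<bar>w\<bar> + cmod (Q - t) + cmod (s - t)"
      by (rule order_trans[OF norm_triangle_ineq add_right_mono[OF order_trans[OF norm_triangle_ineq4]]]) simp
  qed (use z in auto)
  finally have "(cmod (self_consistency n z g i))\<^sup>2 \<le> ((1 / Im z) * (\<bar>w\<bar> + cmod (Q - t) + cmod (s - t)))\<^sup>2"
    by (intro power_mono) auto
  also have "\<dots> \<le> (1 / Im z)\<^sup>2 * (3 * (\<bar>w\<bar>\<^sup>2 + (cmod (Q - t))\<^sup>2 + (cmod (s - t))\<^sup>2))"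
    unfolding power_mult_distrib by (intro mult_left_mono sum3_square_le) auto
  also have "\<dots> \<le> (1 / Im z)\<^sup>2 * (3 * (w\<^sup>2 + (cmod (Q - t))\<^sup>2 + 4 / (real n * (Im z)\<^sup>2)))"
  proof (intro mult_left_mono add_mono)
    have "s - t = ((\<Sum>k<n. goe_res n z g k k) - (\<Sum>k\<in>S. minor_res n z i g k k)) / of_nat n"
      by (simp add: s_def t_def goe_s_def diff_divide_distrib)
    then have "cmod (s - t) = cmod ((\<Sum>k<n. goe_res n z g k k) - (\<Sum>k\<in>S. minor_res n z i g k k)) / real n"
      by (simp add: norm_divide)
    also have "\<dots> \<le> (2 / Im z) / real n" unfolding S_def by (intro divide_right_mono trace_minor) simp
    finally have "(cmod (s - t))\<^sup>2 \<le> ((2 / Im z) / real n)\<^sup>2" by (intro power_mono) auto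
    also have "\<dots> = 4 / (Im z)\<^sup>2 / (real n * real n)" by (simp add: power_divide power2_eq_square)
    also have "\<dots> \<le> 4 / (Im z)\<^sup>2 / (real n * 1)"
      using n by (intro divide_left_mono mult_left_mono) auto
    finally show "(cmod (s - t))\<^sup>2 \<le> 4 / (real n * (Im z)\<^sup>2)" by (simp add: mult.commute)
  qed auto
  also have "\<dots> = 3 / (Im z)\<^sup>2 * (w\<^sup>2 + (cmod (Q - t))\<^sup>2 + 4 / (real n * (Im z)\<^sup>2))" by (simp add: power_divide)
  finally show ?thesis unfolding Q_def t_def w_def .
qed

lemma goe_s_measurable:
  assumes "0 < Im z" "finite J" "gidx n \<subseteq> J"
  shows "goe_s n z \<in> borel_measurable (gauss J)"
proof -
  have [measurable]: "(\<lambda>g. goe_res n z g i j) \<in> borel_measurable (gauss J)" if "i < n" "j < n" for i j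
    using assms that by (rule goe_res_measurable)
  have "(\<lambda>g. (\<Sum>i<n. goe_res n z g i i) / of_nat n) \<in> borel_measurable (gauss J)" by measurable
  then show ?thesis by (simp add: goe_s_def[abs_def])
qed

lemma goe_phi_measurable:
  assumes "0 < Im z" "finite J" "gidx n \<subseteq> J" "i < n"
  shows "(\<lambda>g. goe_phi n z g i) \<in> borel_measurable (gauss J)"
proof -
  have [measurable]: "(\<lambda>g. goe_res n z g i j) \<in> borel_measurable (gauss J)" if "j < n" for j
    using assms that by (intro goe_res_measurable)
  show ?thesis unfolding goe_phi_def by measurable
qed

lemma self_consistency_measurable:
  assumes "0 < Im z" "finite J" "gidx n \<subseteq> J" "i < n"
  shows "(\<lambda>g. self_consistency n z g i) \<in> borel_measurable (gauss J)"
proof -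
  have [measurable]: "(\<lambda>g. goe_res n z g i i) \<in> borel_measurable (gauss J)" "goe_s n z \<in> borel_measurable (gauss J)"
    using assms by (auto intro: goe_res_measurable goe_s_measurable)
  show ?thesis unfolding self_consistency_def by measurable
qed

text \<open>Each index contributes order 1/n, so the sum over all indices stays bounded. The
  constant 18 is 3 times 2 + 4, the 2 from the quadratic form and the 4 from the trace
  comparison.\<close>

lemma expect_self_consistency:
  assumes z: "0 < Im z" and J: "finite J" "gidx n \<subseteq> J"
  shows "integrable (gauss J) (\<lambda>g. \<Sum>i<n. (cmod (self_consistency n z g i))\<^sup>2)"
    "(\<integral>g. (\<Sum>i<n. (cmod (self_consistency n z g i))\<^sup>2) \<partial>gauss J) \<le> 6 / (Im z)\<^sup>2 + 18 / (Im z)^4"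
proof -
  interpret P: prob_space "gauss J" by (rule prob_space_gauss)
  have one: "integrable (gauss J) (\<lambda>g. (cmod (self_consistency n z g i))\<^sup>2) \<and>
    (\<integral>g. (cmod (self_consistency n z g i))\<^sup>2 \<partial>gauss J) \<le> (6 / (Im z)\<^sup>2 + 18 / (Im z)^4) / real n" if i: "i < n" for i
  proof -
    define S where "S = {..<n} - {i}"
    define f where "f = (\<lambda>g. (cmod ((\<Sum>k\<in>S. \<Sum>l\<in>S. of_real (goe n g i k * goe n g i l) * minor_res n z i g k l)
      - (\<Sum>k\<in>S. minor_res n z i g k k) / of_nat n))\<^sup>2)"
    have n: "0 < real n" using i by simp
    have iJ: "(i, i) \<in> J" using J(2) i by (auto simp: gidx_def)
    note f = minor_quadratic_bound[OF z J i, folded S_def, folded f_def]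
    have w: "(goe n g i i)\<^sup>2 = 2 / real n * (g (i, i) ^ 2)" for g
      using n by (simp add: goe_def power_divide power_mult_distrib)
    have iw: "integrable (gauss J) (\<lambda>g. (goe n g i i)\<^sup>2)" unfolding w by (intro integrable_mult_right gauss_moment iJ)
    have Ew: "(\<integral>g. (goe n g i i)\<^sup>2 \<partial>gauss J) = 2 / real n"
      unfolding w using gauss_moment(2)[OF iJ, of 2] std_normal_distribution_even_moments(1)[of 1] by simp
    define b where "b = (\<lambda>g. 3 / (Im z)\<^sup>2 * ((goe n g i i)\<^sup>2 + f g + 4 / (real n * (Im z)\<^sup>2)))"
    have ib: "integrable (gauss J) b"
      unfolding b_def by (intro integrable_mult_right Bochner_Integration.integrable_add iw f P.integrable_const)
    have le: "(cmod (self_consistency n z g i))\<^sup>2 \<le> b g" for g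
      unfolding b_def f_def S_def by (rule self_consistency_pointwise[OF z i])
    have int: "integrable (gauss J) (\<lambda>g. (cmod (self_consistency n z g i))\<^sup>2)"
    proof (rule Bochner_Integration.integrable_bound[OF ib])
      show "(\<lambda>g. (cmod (self_consistency n z g i))\<^sup>2) \<in> borel_measurable (gauss J)"
        using self_consistency_measurable[OF z J i] by measurable
      show "AE g in gauss J. norm ((cmod (self_consistency n z g i))\<^sup>2) \<le> norm (b g)"
        by (rule AE_I2) (use le in \<open>simp add: order_trans[OF _ abs_ge_self]\<close>)
    qed
    have "(\<integral>g. (cmod (self_consistency n z g i))\<^sup>2 \<partial>gauss J) \<le> (\<integral>g. b g \<partial>gauss J)"
      by (rule integral_mono[OF int ib le])
    also have "\<dots> = 3 / (Im z)\<^sup>2 * (2 / real n + (\<integral>g. f g \<partial>gauss J) + 4 / (real n * (Im z)\<^sup>2))"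
      unfolding b_def using iw f Ew by (simp add: P.prob_space)
    also have "\<dots> \<le> 3 / (Im z)\<^sup>2 * (2 / real n + 2 / (real n * (Im z)\<^sup>2) + 4 / (real n * (Im z)\<^sup>2))"
      using f(2) by (intro mult_left_mono add_mono) auto
    also have "\<dots> = (6 / (Im z)\<^sup>2 + 18 / (Im z)^4) / real n"
      using n z by (simp add: field_simps power2_eq_square power4_eq_xxxx)
    finally show ?thesis using int by blast
  qed
  show "integrable (gauss J) (\<lambda>g. \<Sum>i<n. (cmod (self_consistency n z g i))\<^sup>2)"
    using one by (intro Bochner_Integration.integrable_sum) simp
  have "(\<integral>g. (\<Sum>i<n. (cmod (self_consistency n z g i))\<^sup>2) \<partial>gauss J) = (\<Sum>i<n. (\<integral>g. (cmod (self_consistency n z g i))\<^sup>2 \<partial>gauss J))"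
    using one by (intro Bochner_Integration.integral_sum) simp
  also have "\<dots> \<le> (\<Sum>i<n. (6 / (Im z)\<^sup>2 + 18 / (Im z)^4) / real n)"
    using one by (intro sum_mono) simp
  also have "\<dots> \<le> 6 / (Im z)\<^sup>2 + 18 / (Im z)^4" by simp
  finally show "(\<integral>g. (\<Sum>i<n. (cmod (self_consistency n z g i))\<^sup>2) \<partial>gauss J) \<le> 6 / (Im z)\<^sup>2 + 18 / (Im z)^4" .
qed

text \<open>The fourth power is the one charged for renormalising the diagonal. By
  \<open>row_sum\<close> an entry of \<phi> is a bounded factor times 1 minus a linear form in
  Gaussians that are independent of the coefficients.\<close>

lemma expect_phi:
  assumes z: "0 < Im z" and J: "finite J" "gidx n \<subseteq> J"
  shows "integrable (gauss J) (\<lambda>g. \<Sum>i<n. (cmod (goe_phi n z g i))^4)"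
    "(\<integral>g. (\<Sum>i<n. (cmod (goe_phi n z g i))^4) \<partial>gauss J) \<le> real n * (8 / (Im z)^4 * (1 + 6 / (Im z)^4))"
proof -
  interpret P: prob_space "gauss J" by (rule prob_space_gauss)
  have one: "integrable (gauss J) (\<lambda>g. (cmod (goe_phi n z g i))^4) \<and>
    (\<integral>g. (cmod (goe_phi n z g i))^4 \<partial>gauss J) \<le> 8 / (Im z)^4 * (1 + 6 / (Im z)^4)" if i: "i < n" for i
  proof -
    define S where "S = {..<n} - {i}"
    define L where "L = (\<lambda>g. \<Sum>b\<in>S. of_real (goe n g i b) * (\<Sum>l\<in>S. minor_res n z i g b l))"
    have f: "integrable (gauss J) (\<lambda>g. (cmod (L g))^4)" "(\<integral>g. (cmod (L g))^4 \<partial>gauss J) \<le> 6 / (Im z)^4"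
      unfolding L_def S_def by (rule minor_linear_bound[OF z J i])+
    have le: "(cmod (goe_phi n z g i))^4 \<le> 8 / (Im z)^4 * (1 + (cmod (L g))^4)" for g
    proof -
      interpret schur n "goe n g" z "goe_res n z g" "minor_res n z i g" i by (rule schur_goe[OF z i])
      have "goe_phi n z g i = goe_res n z g i i * (1 - L g)"
        unfolding goe_phi_def L_def S_def by (rule row_sum)
      then have "cmod (goe_phi n z g i) \<le> (1 / Im z) * (1 + cmod (L g))"
        using norm_triangle_ineq4[of 1 "L g"] z
        by (simp only: norm_mult) (intro mult_mono G.G_bound_diag i; simp)
      then have "(cmod (goe_phi n z g i))^4 \<le> ((1 / Im z) * (1 + cmod (L g)))^4" by (intro power_mono) auto
      also have "\<dots> = 1 / (Im z)^4 * (1 + cmod (L g))^4" by (simp add: power_mult_distrib power_divide)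
      also have "(1 + cmod (L g))^4 \<le> 8 * (1 + (cmod (L g))^4)"
      proof -
        define x where "x = cmod (L g)"
        have e4: "y^4 = (y\<^sup>2)\<^sup>2" for y :: real by simp
        have "(1 + x)\<^sup>2 \<le> 2 * (1 + x\<^sup>2)" using zero_le_power2[of "1 - x"] by (simp add: power2_eq_square algebra_simps)
        then have "((1 + x)\<^sup>2)\<^sup>2 \<le> (2 * (1 + x\<^sup>2))\<^sup>2" by (intro power_mono) auto
        also have "\<dots> \<le> 8 * (1 + (x\<^sup>2)\<^sup>2)" using zero_le_power2[of "1 - x\<^sup>2"] by (simp add: power2_eq_square algebra_simps)
        finally show ?thesis unfolding e4 x_def .
      qed
      finally show ?thesis using z by (simp add: mult_left_mono divide_right_mono)
    qed
    have ib: "integrable (gauss J) (\<lambda>g. 8 / (Im z)^4 * (1 + (cmod (L g))^4))"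
      by (intro integrable_mult_right Bochner_Integration.integrable_add f P.integrable_const)
    have int: "integrable (gauss J) (\<lambda>g. (cmod (goe_phi n z g i))^4)"
    proof (rule Bochner_Integration.integrable_bound[OF ib])
      show "(\<lambda>g. (cmod (goe_phi n z g i))^4) \<in> borel_measurable (gauss J)"
        using goe_phi_measurable[OF z J i] by measurable
      show "AE g in gauss J. norm ((cmod (goe_phi n z g i))^4) \<le> norm (8 / (Im z)^4 * (1 + (cmod (L g))^4))"
        by (rule AE_I2) (use order_trans[OF le abs_ge_self] in simp)
    qed
    have "(\<integral>g. (cmod (goe_phi n z g i))^4 \<partial>gauss J) \<le> (\<integral>g. 8 / (Im z)^4 * (1 + (cmod (L g))^4) \<partial>gauss J)"
      by (rule integral_mono[OF int ib le])
    also have "\<dots> = 8 / (Im z)^4 * (1 + (\<integral>g. (cmod (L g))^4 \<partial>gauss J))"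
      using f by (simp add: P.prob_space)
    also have "\<dots> \<le> 8 / (Im z)^4 * (1 + 6 / (Im z)^4)" using f(2) z by (intro mult_left_mono add_mono) auto
    finally show ?thesis using int by blast
  qed
  show "integrable (gauss J) (\<lambda>g. \<Sum>i<n. (cmod (goe_phi n z g i))^4)"
    using one by (intro Bochner_Integration.integrable_sum) simp
  have "(\<integral>g. (\<Sum>i<n. (cmod (goe_phi n z g i))^4) \<partial>gauss J) = (\<Sum>i<n. (\<integral>g. (cmod (goe_phi n z g i))^4 \<partial>gauss J))"
    using one by (intro Bochner_Integration.integral_sum) simp
  also have "\<dots> \<le> (\<Sum>i<n. 8 / (Im z)^4 * (1 + 6 / (Im z)^4))"
    using one by (intro sum_mono) simp
  finally show "(\<integral>g. (\<Sum>i<n. (cmod (goe_phi n z g i))^4) \<partial>gauss J) \<le> real n * (8 / (Im z)^4 * (1 + 6 / (Im z)^4))" by simp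
qed

text \<open>Negating the coordinates of row and column \<open>a\<close> conjugates the matrix by a diagonal sign matrix.\<close>

definition row_flip :: "nat \<Rightarrow> nat \<Rightarrow> (nat \<times> nat) set" where
  "row_flip n a = {p \<in> gidx n. (fst p = a) \<noteq> (snd p = a)}"

text \<open>Conjugating the resolvent by the sign matrix solves the resolvent equations of the
  conjugated matrix, and uniqueness identifies the two.\<close>

lemma goe_res_flip:
  assumes z: "0 < Im z" and ij: "i < n" "j < n"
  shows "goe_res n z (flip (row_flip n a) g) i j = (if i = a then -1 else 1) * (if j = a then -1 else 1) * goe_res n z g i j"
proof -
  define e :: "nat \<Rightarrow> real" where "e = (\<lambda>i. if i = a then -1 else 1)"
  have e2: "e k * e k = 1" for k by (simp add: e_def)
  interpret G: sym_resolvent n "goe n g" z "goe_res n z g" by (rule sym_resolvent_goe[OF z])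
  interpret F: sym_resolvent n "goe n (flip (row_flip n a) g)" z "goe_res n z (flip (row_flip n a) g)" by (rule sym_resolvent_goe[OF z])
  have W: "goe n (flip (row_flip n a) g) k l = e k * e l * goe n g k l" if "k < n" "l < n" for k l
    using that by (auto simp: goe_def flip_def row_flip_def gidx_def e_def min_def max_def)
  have ec: "complex_of_real (e k * e k) = 1" for k by (simp add: e_def)
  have "is_res n (goe n (flip (row_flip n a) g)) z (\<lambda>i j. of_real (e i * e j) * goe_res n z g i j)"
    unfolding is_res_def
  proof (intro conjI allI impI)
    fix i j assume ij: "i < n" "j < n"
    have "(\<Sum>k<n. of_real (goe n (flip (row_flip n a) g) i k) * (of_real (e k * e j) * goe_res n z g k j))
        = (\<Sum>k<n. of_real (e i * e j) * (of_real (goe n g i k) * goe_res n z g k j))"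
    proof (intro sum.cong refl)
      fix k assume "k \<in> {..<n}"
      then have "goe n (flip (row_flip n a) g) i k * (e k * e j) = (e k * e k) * (e i * e j) * goe n g i k"
        using ij by (simp only: W lessThan_iff mult_ac)
      then have "goe n (flip (row_flip n a) g) i k * (e k * e j) = (e i * e j) * goe n g i k" unfolding e2 by simp
      then have "complex_of_real (goe n (flip (row_flip n a) g) i k) * of_real (e k * e j) = of_real (e i * e j) * of_real (goe n g i k)"
        by (simp only: of_real_mult[symmetric])
      then show "of_real (goe n (flip (row_flip n a) g) i k) * (of_real (e k * e j) * goe_res n z g k j)
        = of_real (e i * e j) * (of_real (goe n g i k) * goe_res n z g k j)"
        by (simp only: mult.assoc[symmetric])
    qed
    also have "\<dots> = of_real (e i * e j) * (z * goe_res n z g i j + of_bool (i = j))"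
      unfolding sum_distrib_left[symmetric] res_left[OF G.G ij] ..
    also have "\<dots> = z * (of_real (e i * e j) * goe_res n z g i j) + of_bool (i = j)"
      by (cases "i = j") (simp_all add: distrib_left ec del: of_real_mult)
    finally show "(\<Sum>k<n. of_real (goe n (flip (row_flip n a) g) i k) * (of_real (e k * e j) * goe_res n z g k j))
      = z * (of_real (e i * e j) * goe_res n z g i j) + of_bool (i = j)" .
    have "(\<Sum>k<n. of_real (e i * e k) * goe_res n z g i k * of_real (goe n (flip (row_flip n a) g) k j))
        = (\<Sum>k<n. of_real (e i * e j) * (goe_res n z g i k * of_real (goe n g k j)))"
    proof (intro sum.cong refl)
      fix k assume "k \<in> {..<n}"
      then have "(e i * e k) * goe n (flip (row_flip n a) g) k j = (e k * e k) * (e i * e j) * goe n g k j"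
        using ij by (simp only: W lessThan_iff mult_ac)
      then have "(e i * e k) * goe n (flip (row_flip n a) g) k j = (e i * e j) * goe n g k j" unfolding e2 by simp
      then have "complex_of_real (e i * e k) * of_real (goe n (flip (row_flip n a) g) k j) = of_real (e i * e j) * of_real (goe n g k j)"
        by (simp only: of_real_mult[symmetric])
      then show "of_real (e i * e k) * goe_res n z g i k * of_real (goe n (flip (row_flip n a) g) k j)
        = of_real (e i * e j) * (goe_res n z g i k * of_real (goe n g k j))"
        by (simp only: mult.assoc[symmetric] mult.commute[of _ "goe_res n z g i k"]) (simp only: mult.assoc)
    qed
    also have "\<dots> = of_real (e i * e j) * (z * goe_res n z g i j + of_bool (i = j))"
      unfolding sum_distrib_left[symmetric] res_right[OF G.G ij] ..
    also have "\<dots> = z * (of_real (e i * e j) * goe_res n z g i j) + of_bool (i = j)"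
      by (cases "i = j") (simp_all add: distrib_left ec del: of_real_mult)
    finally show "(\<Sum>k<n. of_real (e i * e k) * goe_res n z g i k * of_real (goe n (flip (row_flip n a) g) k j))
      = z * (of_real (e i * e j) * goe_res n z g i j) + of_bool (i = j)" .
  qed
  then have "goe_res n z (flip (row_flip n a) g) i j = of_real (e i * e j) * goe_res n z g i j"
    by (rule is_res_unique[OF F.G _ ij])
  then show ?thesis by (simp add: e_def)
qed

text \<open>Sign symmetry makes off-diagonal resolvent entries uncorrelated unless they belong to
  the same unordered index pair. The second moment of their sum is then at most twice the expected
  sum of squares, hence linear in n.\<close>

lemma expect_q:
  assumes z: "0 < Im z" and J: "finite J" "gidx n \<subseteq> J" and n: "0 < n"
  shows "integrable (gauss J) (\<lambda>g. (cmod (goe_q n z g - goe_s n z g))\<^sup>2)"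
    "(\<integral>g. (cmod (goe_q n z g - goe_s n z g))\<^sup>2 \<partial>gauss J) \<le> 2 / (real n * (Im z)\<^sup>2)"
proof -
  interpret P: prob_space "gauss J" by (rule prob_space_gauss)
  define T where "T = {x \<in> {..<n} \<times> {..<n}. fst x \<noteq> snd x}"
  define G where "G = (\<lambda>x g. goe_res n z g (fst x) (snd x))"
  have fT: "finite T" by (simp add: T_def)
  have GB: "cmod (G x g) \<le> 1 / Im z" if "x \<in> T" for x g
  proof -
    interpret sym_resolvent n "goe n g" z "goe_res n z g" by (rule sym_resolvent_goe[OF z])
    show ?thesis using that by (auto simp: G_def T_def intro: G_bound)
  qed
  have Gm[measurable]: "G x \<in> borel_measurable (gauss J)" if "x \<in> T" for x
    using goe_res_measurable[OF z J, of "fst x" "snd x"] that by (auto simp: G_def[abs_def] T_def)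
  define C where "C = (\<lambda>x y g. Re (G x g) * Re (G y g) + Im (G x g) * Im (G y g))"
  have C_self: "C x x g = (cmod (G x g))\<^sup>2" for x g
    unfolding C_def cmod_power2 by (simp add: power2_eq_square)
  have Cm: "C x y \<in> borel_measurable (gauss J)" if "x \<in> T" "y \<in> T" for x y
    unfolding C_def[abs_def] using that by measurable
  define I where "I = (\<lambda>x y. \<integral>g. C x y g \<partial>gauss J)"
  have iG: "integrable (gauss J) (C x y)" if "x \<in> T" "y \<in> T" for x y
  proof (rule P.integrable_const_bound[where B="1 / Im z * (1 / Im z)"])
    show "AE g in gauss J. norm (C x y g) \<le> 1 / Im z * (1 / Im z)"
    proof (rule AE_I2)
      fix g
      have "C x y g = Re (G x g * cnj (G y g))" by (simp add: C_def)
      then have "norm (C x y g) \<le> cmod (G x g * cnj (G y g))" using abs_Re_le_cmod[of "G x g * cnj (G y g)"] by simp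
      also have "\<dots> = cmod (G x g) * cmod (G y g)" by (simp add: norm_mult)
      also have "\<dots> \<le> 1 / Im z * (1 / Im z)" using GB that z by (intro mult_mono) auto
      finally show "norm (C x y g) \<le> 1 / Im z * (1 / Im z)" .
    qed
  qed (rule Cm[OF that])
  have zero: "I x y = 0" if xy: "x \<in> T" "y \<in> T" and ne: "y \<noteq> x" "y \<noteq> prod.swap x" for x y
  proof -
    obtain j k l m where x: "x = (j, k)" and y: "y = (l, m)" by (metis prod.collapse)
    have b: "j < n" "k < n" "l < n" "m < n" "j \<noteq> k" "l \<noteq> m" using xy by (auto simp: T_def x y)
    \<comment> \<open>The two index pairs differ as sets, so some index of the first is missing from
      the second; flipping its row changes the sign of one factor only.\<close>
    define a where "a = (if j \<in> {l, m} then k else j)"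
    have a: "a \<in> {j, k}" "a \<notin> {l, m}" using b ne by (auto simp: a_def x y)
    have F: "row_flip n a \<subseteq> J" using J(2) by (auto simp: row_flip_def)
    have fx: "G x (flip (row_flip n a) g) = - G x g" "G y (flip (row_flip n a) g) = G y g" for g
      unfolding G_def x y using a b by (auto simp: goe_res_flip[OF z])
    have "I x y = (\<integral>g. C x y (flip (row_flip n a) g) \<partial>gauss J)"
      unfolding I_def by (rule gauss_flip_integral[OF J(1) F Cm[OF xy], symmetric])
    also have "\<dots> = (\<integral>g. - C x y g \<partial>gauss J)" by (simp add: C_def fx)
    also have "\<dots> = - I x y" by (simp add: I_def)
    finally show ?thesis by simp
  qed
  have diff: "goe_q n z g - goe_s n z g = (\<Sum>x\<in>T. G x g) / of_nat n" for g
  proof -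
    have "(\<Sum>i<n. goe_phi n z g i) = (\<Sum>x\<in>{..<n} \<times> {..<n}. G x g)"
      unfolding goe_phi_def G_def sum.cartesian_product by (simp add: case_prod_unfold)
    also have "\<dots> = (\<Sum>x\<in>T. G x g) + (\<Sum>x\<in>(\<lambda>i. (i, i)) ` {..<n}. G x g)"
    proof -
      have "{..<n} \<times> {..<n} = T \<union> (\<lambda>i. (i, i)) ` {..<n}" by (auto simp: T_def)
      moreover have "T \<inter> (\<lambda>i. (i, i)) ` {..<n} = {}" by (auto simp: T_def)
      ultimately show ?thesis by (simp add: sum.union_disjoint fT)
    qed
    also have "(\<Sum>x\<in>(\<lambda>i. (i, i)) ` {..<n}. G x g) = (\<Sum>i<n. goe_res n z g i i)"
      by (subst sum.reindex) (auto simp: inj_on_def G_def)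
    finally show ?thesis by (simp add: goe_q_def goe_s_def diff_divide_distrib[symmetric])
  qed
  have eq: "(cmod (goe_q n z g - goe_s n z g))\<^sup>2 = (1 / real n)\<^sup>2 * (\<Sum>x\<in>T. \<Sum>y\<in>T. C x y g)" for g
  proof -
    have "complex_of_real ((cmod (\<Sum>x\<in>T. G x g))\<^sup>2) = (\<Sum>x\<in>T. \<Sum>y\<in>T. G x g * cnj (G y g))"
      by (simp only: complex_norm_square cnj_sum sum_product)
    from arg_cong[OF this, of Re] have "(cmod (\<Sum>x\<in>T. G x g))\<^sup>2 = (\<Sum>x\<in>T. \<Sum>y\<in>T. C x y g)"
      by (simp only: Re_complex_of_real Re_sum) (simp add: C_def)
    then show ?thesis unfolding diff norm_divide by (simp add: power_divide)
  qed
  show "integrable (gauss J) (\<lambda>g. (cmod (goe_q n z g - goe_s n z g))\<^sup>2)"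
    unfolding eq by (intro integrable_mult_right Bochner_Integration.integrable_sum iG)
  have "(\<integral>g. (cmod (goe_q n z g - goe_s n z g))\<^sup>2 \<partial>gauss J) = (1 / real n)\<^sup>2 * (\<Sum>x\<in>T. \<Sum>y\<in>T. I x y)"
    unfolding eq I_def by (simp add: iG)
  also have "(\<Sum>x\<in>T. \<Sum>y\<in>T. I x y) \<le> (\<Sum>x\<in>T. 2 * (\<integral>g. (cmod (G x g))\<^sup>2 \<partial>gauss J))"
  proof (rule sum_mono)
    fix x assume x: "x \<in> T"
    have sx: "prod.swap x \<in> T" "prod.swap x \<noteq> x" using x by (auto simp: T_def prod_eq_iff)
    have "(\<Sum>y\<in>T. I x y) = (\<Sum>y\<in>{x, prod.swap x}. I x y)"
      using x sx fT by (intro sum.mono_neutral_right) (auto intro: zero)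
    also have "\<dots> = I x x + I x (prod.swap x)" using sx by simp
    also have "I x x = (\<integral>g. (cmod (G x g))\<^sup>2 \<partial>gauss J)"
      unfolding I_def by (simp only: C_self[symmetric])
    also have "I x (prod.swap x) = (\<integral>g. (cmod (G x g))\<^sup>2 \<partial>gauss J)"
    proof -
      have "G (prod.swap x) g = G x g" for g
      proof -
        interpret sym_resolvent n "goe n g" z "goe_res n z g" by (rule sym_resolvent_goe[OF z])
        show ?thesis using x by (auto simp: G_def T_def intro: G_sym)
      qed
      then have "C x (prod.swap x) = C x x" by (simp add: C_def fun_eq_iff)
      then show ?thesis unfolding I_def by (simp only: C_self[symmetric])
    qed
    finally show "(\<Sum>y\<in>T. I x y) \<le> 2 * (\<integral>g. (cmod (G x g))\<^sup>2 \<partial>gauss J)" by simp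
  qed
  also have "\<dots> \<le> 2 * (real n / (Im z)\<^sup>2)"
  proof -
    have i2: "integrable (gauss J) (\<lambda>g. (cmod (G x g))\<^sup>2)" if "x \<in> T" for x
      unfolding C_self[symmetric] by (rule iG[OF that that])
    have "(\<Sum>x\<in>T. 2 * (\<integral>g. (cmod (G x g))\<^sup>2 \<partial>gauss J)) = 2 * (\<integral>g. (\<Sum>x\<in>T. (cmod (G x g))\<^sup>2) \<partial>gauss J)"
      using i2 by (simp add: sum_distrib_left)
    also have "(\<integral>g. (\<Sum>x\<in>T. (cmod (G x g))\<^sup>2) \<partial>gauss J) \<le> (\<integral>g. real n / (Im z)\<^sup>2 \<partial>gauss J)"
    proof (rule integral_mono)
      show "integrable (gauss J) (\<lambda>g. \<Sum>x\<in>T. (cmod (G x g))\<^sup>2)" using i2 by (intro Bochner_Integration.integrable_sum)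
      fix g
      interpret sym_resolvent n "goe n g" z "goe_res n z g" by (rule sym_resolvent_goe[OF z])
      have "(\<Sum>x\<in>T. (cmod (G x g))\<^sup>2) \<le> (\<Sum>x\<in>{..<n} \<times> {..<n}. (cmod (G x g))\<^sup>2)"
        by (intro sum_mono2) (auto simp: T_def)
      also have "\<dots> = (\<Sum>i<n. \<Sum>j<n. (cmod (goe_res n z g i j))\<^sup>2)"
        unfolding G_def sum.cartesian_product by (simp add: case_prod_unfold)
      also have "\<dots> \<le> (\<Sum>i<n. 1 / (Im z)\<^sup>2)" by (intro sum_mono G_row_bound) simp
      finally show "(\<Sum>x\<in>T. (cmod (G x g))\<^sup>2) \<le> real n / (Im z)\<^sup>2" by simp
    qed simp
    finally show ?thesis by (simp add: P.prob_space)
  qed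
  finally have "(\<integral>g. (cmod (goe_q n z g - goe_s n z g))\<^sup>2 \<partial>gauss J) \<le> (1 / real n)\<^sup>2 * (2 * (real n / (Im z)\<^sup>2))"
    by (simp add: mult_left_mono)
  also have "\<dots> = 2 / (real n * (Im z)\<^sup>2)" using n by (simp add: power2_eq_square)
  finally show "(\<integral>g. (cmod (goe_q n z g - goe_s n z g))\<^sup>2 \<partial>gauss J) \<le> 2 / (real n * (Im z)\<^sup>2)" .
qed

section \<open>Concentration and conclusion\<close>

text \<open>The matrix reads \<open>gidx n\<close>; the auxiliary coordinates belong to the space
  because the event from \<open>goe_max\<close> is measurable only with respect to both.\<close>

definition goe_coords :: "nat \<Rightarrow> (nat \<times> nat) set" where
  "goe_coords n = gidx n \<union> aux n"

lemma goe_coords: "finite (goe_coords n)" "gidx n \<subseteq> goe_coords n"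
  by (auto simp: goe_coords_def finite_gidx finite_aux)

abbreviation "goe_space n \<equiv> gauss (goe_coords n)"

definition goe_mat :: "real \<Rightarrow> nat \<Rightarrow> (nat \<times> nat \<Rightarrow> real) \<Rightarrow> real mat" where
  "goe_mat lam n g = Matrix.mat n n (\<lambda>(i, j). lam / real n + goe n g i j)"

definition sdp_val :: "real \<Rightarrow> nat \<Rightarrow> (nat \<times> nat \<Rightarrow> real) \<Rightarrow> real" where
  "sdp_val lam n g = sdp (goe_mat lam n g) / real n"

lemma goe_mat_carrier: "goe_mat lam n g \<in> carrier_mat n n"
  by (simp add: goe_mat_def)

lemma goe_mat_index: "i < n \<Longrightarrow> j < n \<Longrightarrow> goe_mat lam n g $$ (i, j) = lam / real n + goe n g i j"
  by (simp add: goe_mat_def)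

text \<open>In the standard normal coordinates the constant is 2 n^(-3/2). Fewer than n^2 + 1
  coordinates carry it, so the squared constants sum to order 1/n.\<close>

lemma sdp_val_lipschitz:
  "\<bar>sdp_val lam n g - sdp_val lam n h\<bar> \<le> (\<Sum>p\<in>goe_coords n. (if p \<in> gidx n then 2 / (real n * sqrt (real n)) else 0) * \<bar>g p - h p\<bar>)"
proof -
  have *: "sdp (goe_mat lam n g) - sdp (goe_mat lam n h) \<le> (\<Sum>p\<in>gidx n. 2 / sqrt (real n) * \<bar>g p - h p\<bar>)" for g h
  proof -
    have "sdp (goe_mat lam n g) - sdp (goe_mat lam n h) \<le> (\<Sum>i<n. \<Sum>j<n. \<bar>goe_mat lam n g $$ (i, j) - goe_mat lam n h $$ (i, j)\<bar>)"
      by (rule sdp_diff_le[OF goe_mat_carrier goe_mat_carrier])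
    also have "\<dots> = (\<Sum>i<n. \<Sum>j<n. \<bar>goe n g i j - goe n h i j\<bar>)"
      by (intro sum.cong refl) (simp add: goe_mat_index)
    also have "\<dots> \<le> (\<Sum>p\<in>gidx n. 2 / sqrt (real n) * \<bar>g p - h p\<bar>)" by (rule goe_diff)
    finally show ?thesis .
  qed
  have "\<bar>sdp (goe_mat lam n g) - sdp (goe_mat lam n h)\<bar> \<le> (\<Sum>p\<in>gidx n. 2 / sqrt (real n) * \<bar>g p - h p\<bar>)"
    using *[of g h] *[of h g] by (simp add: abs_le_iff abs_minus_commute)
  then have "\<bar>sdp (goe_mat lam n g) - sdp (goe_mat lam n h)\<bar> / real n \<le> (\<Sum>p\<in>gidx n. 2 / sqrt (real n) * \<bar>g p - h p\<bar>) / real n"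
    by (rule divide_right_mono) simp
  also have "\<dots> = (\<Sum>p\<in>gidx n. (if p \<in> gidx n then 2 / (real n * sqrt (real n)) else 0) * \<bar>g p - h p\<bar>)"
    unfolding sum_divide_distrib by (intro sum.cong refl) (simp add: mult.commute)
  also have "\<dots> = (\<Sum>p\<in>goe_coords n. (if p \<in> gidx n then 2 / (real n * sqrt (real n)) else 0) * \<bar>g p - h p\<bar>)"
    by (rule sum.mono_neutral_left) (auto simp: goe_coords)
  finally show ?thesis by (simp add: sdp_val_def abs_divide diff_divide_distrib[symmetric])
qed

lemma sdp_val_measurable[measurable]: "sdp_val lam n \<in> borel_measurable (goe_space n)"
  using sdp_val_lipschitz by (intro lipschitz_measurable[OF goe_coords(1)]) auto

lemma sdp_val_concentration:
  assumes n: "0 < n" and \<epsilon>: "0 < \<epsilon>"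
  shows "\<P>(g in goe_space n. \<epsilon> \<le> \<bar>sdp_val lam n g - (\<integral>g. sdp_val lam n g \<partial>goe_space n)\<bar>) \<le> 4 / (real n * \<epsilon>\<^sup>2)"
proof -
  interpret P: prob_space "goe_space n" by (rule prob_space_gauss)
  note i = gauss_lipschitz_square_integrable[OF goe_coords(1) sdp_val_lipschitz[of lam n]]
  have "\<P>(g in goe_space n. \<epsilon> \<le> \<bar>sdp_val lam n g - (\<integral>g. sdp_val lam n g \<partial>goe_space n)\<bar>) \<le> P.variance (sdp_val lam n) / \<epsilon>\<^sup>2"
    by (rule P.Chebyshev_inequality) (use i \<epsilon> in auto)
  also have "P.variance (sdp_val lam n) = (\<integral>g. (sdp_val lam n g)\<^sup>2 \<partial>goe_space n) - (\<integral>g. sdp_val lam n g \<partial>goe_space n)\<^sup>2"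
    by (rule P.variance_eq[OF i])
  also have "\<dots> \<le> (\<Sum>p\<in>goe_coords n. (if p \<in> gidx n then 2 / (real n * sqrt (real n)) else 0)\<^sup>2)"
    by (rule gauss_lipschitz_variance[OF goe_coords(1) _ sdp_val_lipschitz]) auto
  also have "\<dots> = (\<Sum>p\<in>gidx n. (if p \<in> gidx n then 2 / (real n * sqrt (real n)) else 0)\<^sup>2)"
    by (rule sum.mono_neutral_right) (auto simp: goe_coords)
  also have "\<dots> = real (card (gidx n)) * (4 / (real n)^3)"
    using n by (simp add: power_divide power_mult_distrib power2_eq_square power3_eq_cube)
  also have "\<dots> \<le> (real n * real n) * (4 / (real n)^3)"
  proof (rule mult_right_mono)
    have "card (gidx n) \<le> card ({..<n} \<times> {..<n})" by (rule card_mono) (auto simp: gidx_def)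
    then have "card (gidx n) \<le> n * n" by simp
    then show "real (card (gidx n)) \<le> real n * real n" unfolding of_nat_mult[symmetric] by (rule of_nat_mono)
  qed simp
  also have "\<dots> = 4 / real n" using n by (simp add: power3_eq_cube)
  finally show ?thesis by (simp add: divide_right_mono)
qed

lemma tendsto_one_of_bound:
  assumes "\<forall>\<^sub>F n in sequentially. 1 - C / real n \<le> f n" "\<And>n. f n \<le> 1"
  shows "f \<longlonglongrightarrow> 1"
proof (rule tendsto_sandwich[OF assms(1) _ _ tendsto_const])
  show "(\<lambda>n. 1 - C / real n) \<longlonglongrightarrow> 1" by real_asymp
qed (use assms(2) in simp)

text \<open>An event of probability 1/4 cannot be contained in the event of deviating from the mean
  by \<open>\<epsilon> / 2\<close>, whose probability tends to 0. Hence some sample is both at least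
  \<open>a\<close> and close to the mean, which places the mean above
  \<open>a - \<epsilon> / 2\<close> and typical samples above \<open>a - \<epsilon>\<close>.\<close>

lemma sdp_val_boost:
  assumes q: "\<forall>\<^sub>F n in sequentially. 1/4 \<le> \<P>(g in goe_space n. a \<le> sdp_val lam n g)"
    and \<epsilon>: "0 < \<epsilon>"
  shows "(\<lambda>n. \<P>(g in goe_space n. a - \<epsilon> \<le> sdp_val lam n g)) \<longlonglongrightarrow> 1"
proof (rule tendsto_one_of_bound[where C = "16 / \<epsilon>\<^sup>2"])
  have "\<forall>\<^sub>F n in sequentially. 16 / \<epsilon>\<^sup>2 / real n < 1/4"
  proof -
    have "(\<lambda>n. 16 / \<epsilon>\<^sup>2 / real n) \<longlonglongrightarrow> 0" by real_asymp
    then show ?thesis by (rule order_tendstoD) simp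
  qed
  with q show "\<forall>\<^sub>F n in sequentially. 1 - 16 / \<epsilon>\<^sup>2 / real n \<le> \<P>(g in goe_space n. a - \<epsilon> \<le> sdp_val lam n g)"
    using eventually_gt_at_top[of 0]
  proof eventually_elim
    case (elim n)
    interpret P: prob_space "goe_space n" by (rule prob_space_gauss)
    define m where "m = (\<integral>g. sdp_val lam n g \<partial>goe_space n)"
    define bad where "bad = {g \<in> space (goe_space n). \<epsilon> / 2 \<le> \<bar>sdp_val lam n g - m\<bar>}"
    have [measurable]: "bad \<in> sets (goe_space n)" unfolding bad_def by measurable
    have mb: "measure (goe_space n) bad \<le> 16 / \<epsilon>\<^sup>2 / real n"
      unfolding bad_def m_def using sdp_val_concentration[of n "\<epsilon> / 2" lam] elim(3) \<epsilon> by (simp add: power_divide mult.commute)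
    have "\<not> {g \<in> space (goe_space n). a \<le> sdp_val lam n g} \<subseteq> bad"
    proof
      assume "{g \<in> space (goe_space n). a \<le> sdp_val lam n g} \<subseteq> bad"
      then have "\<P>(g in goe_space n. a \<le> sdp_val lam n g) \<le> measure (goe_space n) bad"
        by (rule P.finite_measure_mono) measurable
      then show False using mb elim by linarith
    qed
    then obtain h where h: "a \<le> sdp_val lam n h" "\<not> \<epsilon> / 2 \<le> \<bar>sdp_val lam n h - m\<bar>" by (auto simp: bad_def)
    have "1 - measure (goe_space n) bad = measure (goe_space n) (space (goe_space n) - bad)"
      by (subst P.prob_compl) auto
    also have "\<dots> \<le> \<P>(g in goe_space n. a - \<epsilon> \<le> sdp_val lam n g)"
    proof (rule P.finite_measure_mono)
      show "space (goe_space n) - bad \<subseteq> {g \<in> space (goe_space n). a - \<epsilon> \<le> sdp_val lam n g}"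
      proof safe
        fix g assume g: "g \<in> space (goe_space n)" "g \<notin> bad"
        then have "\<bar>sdp_val lam n g - m\<bar> < \<epsilon> / 2" by (auto simp: bad_def not_le)
        then have 1: "m - \<epsilon> / 2 < sdp_val lam n g" unfolding abs_less_iff by linarith
        have "\<bar>sdp_val lam n h - m\<bar> < \<epsilon> / 2" using h(2) by (simp add: not_le)
        then have "sdp_val lam n h < m + \<epsilon> / 2" unfolding abs_less_iff by linarith
        then show "a - \<epsilon> \<le> sdp_val lam n g" using 1 h(1) by linarith
      qed
    qed measurable
    finally show ?case using mb by simp
  qed
  show "\<P>(g in goe_space n. a - \<epsilon> \<le> sdp_val lam n g) \<le> 1" for n
    by (rule prob_space.prob_le_1[OF prob_space_gauss])
qed

lemma sdp_val_upper:
  assumes lam: "lam \<le> 1" and \<epsilon>: "0 < \<epsilon>"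
  shows "(\<lambda>n. \<P>(g in goe_space n. sdp_val lam n g \<le> 2 + \<epsilon>)) \<longlonglongrightarrow> 1"
proof (rule tendsto_one_of_bound[where C = "8 / (\<epsilon> / 6)\<^sup>2"])
  show "\<forall>\<^sub>F n in sequentially. 1 - 8 / (\<epsilon> / 6)\<^sup>2 / real n \<le> \<P>(g in goe_space n. sdp_val lam n g \<le> 2 + \<epsilon>)"
    using eventually_gt_at_top[of 0]
  proof eventually_elim
    case (elim n)
    interpret P: prob_space "goe_space n" by (rule prob_space_gauss)
    have d: "0 < \<epsilon> / 6" using \<epsilon> by simp
    obtain A where A: "A \<in> sets (goe_space n)" "measure (goe_space n) A \<le> 8 / ((\<epsilon> / 6)\<^sup>2 * real n)"
      "\<And>g v. g \<in> space (goe_space n) \<Longrightarrow> g \<notin> A \<Longrightarrow>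
        qform n (\<lambda>i j. 1 * goe n g i j + lam / real n) v \<le> (2 + 6 * (\<epsilon> / 6)) * (\<Sum>i<n. (v i)\<^sup>2)"
      using goe_max[OF elim lam d, of 1] unfolding goe_coords_def by auto
    have "1 - measure (goe_space n) A = measure (goe_space n) (space (goe_space n) - A)"
      using A(1) by (subst P.prob_compl) auto
    also have "\<dots> \<le> \<P>(g in goe_space n. sdp_val lam n g \<le> 2 + \<epsilon>)"
    proof (rule P.finite_measure_mono)
      show "space (goe_space n) - A \<subseteq> {g \<in> space (goe_space n). sdp_val lam n g \<le> 2 + \<epsilon>}"
      proof safe
        fix g assume g: "g \<in> space (goe_space n)" "g \<notin> A"
        have "sdp (goe_mat lam n g) \<le> (2 + \<epsilon>) * real n"
        proof (rule sdp_le[OF goe_mat_carrier])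
          fix v
          have "qform n (\<lambda>i j. goe_mat lam n g $$ (i, j)) v = qform n (\<lambda>i j. 1 * goe n g i j + lam / real n) v"
            unfolding qform_def by (intro sum.cong refl) (simp add: goe_mat_index)
          then show "qform n (\<lambda>i j. goe_mat lam n g $$ (i, j)) v \<le> (2 + \<epsilon>) * (\<Sum>i<n. (v i)\<^sup>2)"
            using A(3)[OF g, of v] by simp
        qed
        then show "sdp_val lam n g \<le> 2 + \<epsilon>" unfolding sdp_val_def using elim by (simp add: divide_le_eq)
      qed
    qed measurable
    finally show ?case using A(2) by (simp add: mult.commute)
  qed
  show "\<P>(g in goe_space n. sdp_val lam n g \<le> 2 + \<epsilon>) \<le> 1" for n
    by (rule prob_space.prob_le_1[OF prob_space_gauss])
qed

section \<open>A joint good event of probability at least 1/4\<close>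

text \<open>Averaging the residuals gives the residual of the scalar equation at s, so
  Cauchy-Schwarz and \<open>semicircle_stable\<close> bring s close to m. For a single index,
  \<open>m * (z + m) = -1\<close> turns \<open>m - G\<close> into
  \<open>m * (X i + G * (m - s))\<close>, where both terms are under control.\<close>

lemma distance_to_root:
  fixes g :: "nat \<times> nat \<Rightarrow> real"
  assumes z: "0 < Im z" and n: "0 < n" and m: "m\<^sup>2 + z * m + 1 = 0" "0 \<le> Im m" "cmod m \<le> 2"
  defines "U \<equiv> \<Sum>i<n. (cmod (self_consistency n z g i))\<^sup>2"
  shows "real n * (cmod (goe_s n z g - m))\<^sup>2 \<le> U / (Im z)\<^sup>2"
    "(\<Sum>i<n. (cmod (goe_res n z g i i - m))\<^sup>2) \<le> (8 + 8 / (Im z)^4) * U"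
proof -
  interpret sym_resolvent n "goe n g" z "goe_res n z g" by (rule sym_resolvent_goe[OF z])
  define s where "s = goe_s n z g"
  define X where "X = self_consistency n z g"
  have sG: "(\<Sum>i<n. goe_res n z g i i) = of_nat n * s" using n by (simp add: s_def goe_s_def)
  have Xs: "(\<Sum>i<n. X i) = of_nat n * (1 + s * (z + s))"
  proof -
    have "(\<Sum>i<n. X i) = of_nat n + (\<Sum>i<n. goe_res n z g i i) * (z + s)"
      by (simp add: X_def self_consistency_def sum.distrib sum_distrib_right s_def)
    then show ?thesis unfolding sG by (simp add: algebra_simps)
  qed
  have "(cmod (\<Sum>i<n. X i))\<^sup>2 \<le> (\<Sum>i<n. cmod (X i))\<^sup>2" by (intro power_mono norm_sum) simp
  also have "\<dots> \<le> (\<Sum>i<n. (cmod (X i))\<^sup>2) * real (card {..<n})" by (rule sum_squared_le_sum_of_squares)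
  finally have "(real n * cmod (1 + s * (z + s)))\<^sup>2 \<le> U * real n" unfolding Xs by (simp add: norm_mult U_def X_def)
  then have "real n * (real n * (cmod (1 + s * (z + s)))\<^sup>2) \<le> real n * U"
    by (simp only: power_mult_distrib power2_eq_square mult_ac)
  then have nU: "real n * (cmod (1 + s * (z + s)))\<^sup>2 \<le> U"
    by (rule mult_left_le_imp_le) (use n in simp)
  have "0 \<le> Im s"
  proof -
    have "real n * Im s = (\<Sum>i<n. Im (goe_res n z g i i))" using arg_cong[OF sG, of Im] by simp
    also have "0 \<le> \<dots>" by (intro sum_nonneg) (use Im_G_nonneg in simp)
    finally show ?thesis using n by (simp add: zero_le_mult_iff)
  qed
  then have "cmod (s - m) \<le> cmod (1 + s * (z + s)) / Im z" by (rule semicircle_stable[OF m(1,2) _ z])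
  then have "(cmod (s - m))\<^sup>2 \<le> (cmod (1 + s * (z + s)) / Im z)\<^sup>2" by (intro power_mono) auto
  then have sm: "(cmod (s - m))\<^sup>2 \<le> (cmod (1 + s * (z + s)))\<^sup>2 / (Im z)\<^sup>2" by (simp add: power_divide)
  then have "real n * (cmod (s - m))\<^sup>2 \<le> real n * ((cmod (1 + s * (z + s)))\<^sup>2 / (Im z)\<^sup>2)" by (intro mult_left_mono) auto
  also have "\<dots> \<le> U / (Im z)\<^sup>2" using nU by (simp add: divide_right_mono)
  finally show sU: "real n * (cmod (goe_s n z g - m))\<^sup>2 \<le> U / (Im z)\<^sup>2" by (simp add: s_def)
  have "(cmod (goe_res n z g i i - m))\<^sup>2 \<le> 8 * (cmod (X i))\<^sup>2 + 8 / (Im z)\<^sup>2 * (cmod (s - m))\<^sup>2" if i: "i < n" for i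
  proof -
    define G where "G = goe_res n z g i i"
    have "m - G = m * (X i + G * (m - s))"
    proof -
      have "m * (X i + G * (m - s)) = m + G * (m\<^sup>2 + z * m)"
        by (simp add: X_def self_consistency_def G_def s_def power2_eq_square algebra_simps)
      also have "m\<^sup>2 + z * m = -1" using m(1) by (simp add: add_eq_0_iff2)
      finally show ?thesis by simp
    qed
    then have "cmod (G - m) = cmod m * cmod (X i + G * (m - s))" by (metis norm_minus_commute norm_mult)
    also have "\<dots> \<le> 2 * (cmod (X i) + (1 / Im z) * cmod (s - m))"
    proof (intro mult_mono m)
      have "cmod (G * (m - s)) \<le> (1 / Im z) * cmod (s - m)"
        unfolding norm_mult norm_minus_commute[of m s] G_def by (intro mult_right_mono G_bound_diag i) simp
      then show "cmod (X i + G * (m - s)) \<le> cmod (X i) + (1 / Im z) * cmod (s - m)"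
        using norm_triangle_ineq[of "X i" "G * (m - s)"] by simp
    qed auto
    finally have "(cmod (G - m))\<^sup>2 \<le> (2 * (cmod (X i) + (1 / Im z) * cmod (s - m)))\<^sup>2" by (intro power_mono) auto
    also have "\<dots> \<le> 8 * (cmod (X i))\<^sup>2 + 8 * ((1 / Im z) * cmod (s - m))\<^sup>2"
    proof -
      have "(2 * (a + b))\<^sup>2 \<le> 8 * a\<^sup>2 + 8 * b\<^sup>2" for a b :: real
        using zero_le_power2[of "a - b"] by (simp add: power2_eq_square algebra_simps)
      then show ?thesis .
    qed
    finally show ?thesis by (simp add: G_def power_divide power_mult_distrib)
  qed
  then have "(\<Sum>i<n. (cmod (goe_res n z g i i - m))\<^sup>2) \<le> (\<Sum>i<n. 8 * (cmod (X i))\<^sup>2 + 8 / (Im z)\<^sup>2 * (cmod (s - m))\<^sup>2)"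
    by (intro sum_mono) simp
  also have "\<dots> = 8 * U + 8 / (Im z)\<^sup>2 * (real n * (cmod (s - m))\<^sup>2)"
    by (simp add: sum.distrib sum_distrib_left U_def X_def)
  also have "\<dots> \<le> 8 * U + 8 / (Im z)\<^sup>2 * (U / (Im z)\<^sup>2)"
    using sU by (intro add_left_mono mult_left_mono) (auto simp: s_def)
  also have "\<dots> = (8 + 8 / (Im z)^4) * U" by (simp add: distrib_right power4_eq_xxxx power2_eq_square)
  finally show "(\<Sum>i<n. (cmod (goe_res n z g i i - m))\<^sup>2) \<le> (8 + 8 / (Im z)^4) * U" .
qed

text \<open>With the factor 8, four such events cost 1/2 in total; together with 1/4 for the
  spectral bound this leaves 1/4 in \<open>good_event\<close>.\<close>

lemma gauss_markov:
  fixes f :: "('i \<Rightarrow> real) \<Rightarrow> real" and c :: real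
  assumes "integrable (gauss J) f" "\<And>g. 0 \<le> f g" "(\<integral>g. f g \<partial>gauss J) \<le> c" "0 < c"
  shows "\<P>(g in gauss J. 8 * c \<le> f g) \<le> 1/8"
proof -
  have "\<P>(g in gauss J. 8 * c \<le> f g) \<le> (\<integral>g. f g \<partial>gauss J) / (8 * c)"
    by (rule integral_Markov_inequality_measure[OF assms(1), of "space (gauss J)"]) (use assms in auto)
  also have "\<dots> \<le> c / (8 * c)" using assms by (intro divide_right_mono) auto
  finally show ?thesis using assms(4) by simp
qed

definition sc_const :: "real \<Rightarrow> real" where "sc_const \<eta> = 8 * (6 / \<eta>\<^sup>2 + 18 / \<eta>^4)"
definition phi_const :: "real \<Rightarrow> real" where "phi_const \<eta> = 8 * (8 / \<eta>^4 * (1 + 6 / \<eta>^4))"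

text \<open>\<open>\<eta>1\<close> is the scale of the vector \<phi> and \<open>\<eta>2\<close> that
  of Im G. The right-hand sides are 8 times the expectation bounds, so they carry the same order in
  n.\<close>

lemma good_event:
  assumes \<eta>: "0 < \<eta>1" "0 < \<eta>2" and n: "1152 \<le> n"
  obtains E where "E \<in> sets (goe_space n)" "1/4 \<le> measure (goe_space n) E"
    "\<And>g. g \<in> E \<Longrightarrow> (\<Sum>i<n. (cmod (self_consistency n (Complex 2 \<eta>1) g i))\<^sup>2) \<le> sc_const \<eta>1"
    "\<And>g. g \<in> E \<Longrightarrow> (\<Sum>i<n. (cmod (self_consistency n (Complex 2 \<eta>2) g i))\<^sup>2) \<le> sc_const \<eta>2"
    "\<And>g. g \<in> E \<Longrightarrow> (\<Sum>i<n. (cmod (goe_phi n (Complex 2 \<eta>1) g i))^4) \<le> real n * phi_const \<eta>1"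
    "\<And>g. g \<in> E \<Longrightarrow> (cmod (goe_q n (Complex 2 \<eta>1) g - goe_s n (Complex 2 \<eta>1) g))\<^sup>2 \<le> 16 / (real n * \<eta>1\<^sup>2)"
    "\<And>g v. g \<in> E \<Longrightarrow> - 3 * (\<Sum>i<n. (v i)\<^sup>2) \<le> qform n (goe n g) v"
proof -
  let ?M = "goe_space n"
  interpret P: prob_space ?M by (rule prob_space_gauss)
  have n0: "0 < n" using n by simp
  have z: "0 < Im (Complex 2 \<eta>1)" "0 < Im (Complex 2 \<eta>2)" using \<eta> by simp_all
  \<comment> \<open>Sign -1 and spike 0 bound -W from above; \<delta> = 1/6 turns 2 + 6\<delta> into
    3.\<close>
  obtain A where A: "A \<in> sets ?M" "measure ?M A \<le> 8 / ((1/6)\<^sup>2 * real n)"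
    "\<And>g v. g \<in> space ?M \<Longrightarrow> g \<notin> A \<Longrightarrow> qform n (\<lambda>i j. (-1) * goe n g i j + 0 / real n) v \<le> (2 + 6 * (1/6)) * (\<Sum>i<n. (v i)\<^sup>2)"
    using goe_max[OF n0, of 0 "1/6" "-1"] unfolding goe_coords_def by auto
  have mA: "measure ?M A \<le> 1/4"
  proof -
    \<comment> \<open>The left side is 288/n, which is where the threshold 1152 comes from.\<close>
    have "8 / ((1/6)\<^sup>2 * real n) \<le> 1/4" using n by (simp add: power2_eq_square field_simps)
    then show ?thesis using A(2) by simp
  qed
  define f1 where "f1 = (\<lambda>g. \<Sum>i<n. (cmod (self_consistency n (Complex 2 \<eta>1) g i))\<^sup>2)"
  define f2 where "f2 = (\<lambda>g. \<Sum>i<n. (cmod (self_consistency n (Complex 2 \<eta>2) g i))\<^sup>2)"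
  define f3 where "f3 = (\<lambda>g. \<Sum>i<n. (cmod (goe_phi n (Complex 2 \<eta>1) g i))^4)"
  define f4 where "f4 = (\<lambda>g. (cmod (goe_q n (Complex 2 \<eta>1) g - goe_s n (Complex 2 \<eta>1) g))\<^sup>2)"
  have i1: "integrable ?M f1" "(\<integral>g. f1 g \<partial>?M) \<le> 6 / \<eta>1\<^sup>2 + 18 / \<eta>1^4"
    using expect_self_consistency[OF z(1) goe_coords, of n] by (simp_all add: f1_def)
  have i2: "integrable ?M f2" "(\<integral>g. f2 g \<partial>?M) \<le> 6 / \<eta>2\<^sup>2 + 18 / \<eta>2^4"
    using expect_self_consistency[OF z(2) goe_coords, of n] by (simp_all add: f2_def)
  have i3: "integrable ?M f3" "(\<integral>g. f3 g \<partial>?M) \<le> real n * (8 / \<eta>1^4 * (1 + 6 / \<eta>1^4))"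
    using expect_phi[OF z(1) goe_coords, of n] by (simp_all add: f3_def)
  have i4: "integrable ?M f4" "(\<integral>g. f4 g \<partial>?M) \<le> 2 / (real n * \<eta>1\<^sup>2)"
    using expect_q[OF z(1) goe_coords n0] by (simp_all add: f4_def)
  have [measurable]: "f1 \<in> borel_measurable ?M" "f2 \<in> borel_measurable ?M" "f3 \<in> borel_measurable ?M" "f4 \<in> borel_measurable ?M"
    using i1 i2 i3 i4 by (auto intro: borel_measurable_integrable)
  define B1 where "B1 = {g \<in> space ?M. 8 * (6 / \<eta>1\<^sup>2 + 18 / \<eta>1^4) \<le> f1 g}"
  define B2 where "B2 = {g \<in> space ?M. 8 * (6 / \<eta>2\<^sup>2 + 18 / \<eta>2^4) \<le> f2 g}"
  define B3 where "B3 = {g \<in> space ?M. 8 * (real n * (8 / \<eta>1^4 * (1 + 6 / \<eta>1^4))) \<le> f3 g}"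
  define B4 where "B4 = {g \<in> space ?M. 8 * (2 / (real n * \<eta>1\<^sup>2)) \<le> f4 g}"
  have mB: "measure ?M B1 \<le> 1/8" "measure ?M B2 \<le> 1/8" "measure ?M B3 \<le> 1/8" "measure ?M B4 \<le> 1/8"
    unfolding B1_def B2_def B3_def B4_def
  proof -
    show "\<P>(g in ?M. 8 * (6 / \<eta>1\<^sup>2 + 18 / \<eta>1^4) \<le> f1 g) \<le> 1/8"
      by (rule gauss_markov[OF i1(1) _ i1(2)]) (use \<eta> in \<open>auto simp: f1_def intro!: sum_nonneg add_pos_pos\<close>)
    show "\<P>(g in ?M. 8 * (6 / \<eta>2\<^sup>2 + 18 / \<eta>2^4) \<le> f2 g) \<le> 1/8"
      by (rule gauss_markov[OF i2(1) _ i2(2)]) (use \<eta> in \<open>auto simp: f2_def intro!: sum_nonneg add_pos_pos\<close>)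
    show "\<P>(g in ?M. 8 * (real n * (8 / \<eta>1^4 * (1 + 6 / \<eta>1^4))) \<le> f3 g) \<le> 1/8"
    proof (rule gauss_markov[OF i3(1) _ i3(2)])
      show "0 < real n * (8 / \<eta>1^4 * (1 + 6 / \<eta>1^4))"
        using \<eta> n0 by (intro mult_pos_pos add_pos_pos divide_pos_pos zero_less_power) auto
    qed (auto simp: f3_def intro!: sum_nonneg)
    show "\<P>(g in ?M. 8 * (2 / (real n * \<eta>1\<^sup>2)) \<le> f4 g) \<le> 1/8"
      by (rule gauss_markov[OF i4(1) _ i4(2)]) (use \<eta> n0 in \<open>auto simp: f4_def\<close>)
  qed
  have [measurable]: "A \<in> sets ?M" "B1 \<in> sets ?M" "B2 \<in> sets ?M" "B3 \<in> sets ?M" "B4 \<in> sets ?M"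
    unfolding B1_def B2_def B3_def B4_def using A(1) by measurable
  define bad where "bad = A \<union> (B1 \<union> (B2 \<union> (B3 \<union> B4)))"
  have [measurable]: "bad \<in> sets ?M" unfolding bad_def by measurable
  have "measure ?M bad \<le> measure ?M A + (measure ?M B1 + (measure ?M B2 + (measure ?M B3 + measure ?M B4)))"
    unfolding bad_def by (intro order_trans[OF measure_Un_le] add_left_mono) measurable
  then have mbad: "measure ?M bad \<le> 3/4" using mA mB by simp
  define E where "E = space ?M - bad"
  have "measure ?M E = 1 - measure ?M bad" unfolding E_def by (rule P.prob_compl) measurable
  then have mE: "1/4 \<le> measure ?M E" using mbad by simp
  show ?thesis
  proof (rule that[of E])
    show "E \<in> sets ?M" unfolding E_def by measurable
    show "1/4 \<le> measure ?M E" by (rule mE)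
    fix g assume g: "g \<in> E"
    show "(\<Sum>i<n. (cmod (self_consistency n (Complex 2 \<eta>1) g i))\<^sup>2) \<le> sc_const \<eta>1"
      using g by (auto simp: E_def bad_def B1_def f1_def sc_const_def)
    show "(\<Sum>i<n. (cmod (self_consistency n (Complex 2 \<eta>2) g i))\<^sup>2) \<le> sc_const \<eta>2"
      using g by (auto simp: E_def bad_def B2_def f2_def sc_const_def)
    have "f3 g \<le> 8 * (real n * (8 / \<eta>1^4 * (1 + 6 / \<eta>1^4)))" using g by (auto simp: E_def bad_def B3_def)
    then show "(\<Sum>i<n. (cmod (goe_phi n (Complex 2 \<eta>1) g i))^4) \<le> real n * phi_const \<eta>1"
      unfolding f3_def phi_const_def by (simp only: mult.left_commute)
    have "f4 g \<le> 8 * (2 / (real n * \<eta>1\<^sup>2))" using g by (auto simp: E_def bad_def B4_def)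
    then show "(cmod (goe_q n (Complex 2 \<eta>1) g - goe_s n (Complex 2 \<eta>1) g))\<^sup>2 \<le> 16 / (real n * \<eta>1\<^sup>2)"
      unfolding f4_def by simp
    fix v
    have "qform n (\<lambda>i j. (-1) * goe n g i j + 0 / real n) v \<le> (2 + 6 * (1/6)) * (\<Sum>i<n. (v i)\<^sup>2)"
      using g by (intro A(3)) (auto simp: E_def bad_def)
    then show "- 3 * (\<Sum>i<n. (v i)\<^sup>2) \<le> qform n (goe n g) v"
      unfolding qform_add qform_mult by (simp add: qform_def)
  qed
qed

text \<open>Three error budgets: \<tau> for the contribution of Re G, \<kappa> for the mean squared
  deviation of the diagonal of Im G, and a multiple of \<open>sqrt \<eta>1\<close> for the distance
  of q from -1. For fixed parameters the last two hold once n is large.\<close>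

lemma sdp_val_lower_quarter:
  assumes lam: "0 \<le> lam" and \<eta>1: "0 < \<eta>1" "\<eta>1 \<le> 1/36" and \<eta>2: "0 < \<eta>2" "\<eta>2 \<le> 1/16"
    and \<tau>: "4 * sqrt \<eta>2 \<le> \<tau>\<^sup>2" "0 \<le> \<tau>" "\<tau> \<le> 1" and \<alpha>: "0 \<le> \<alpha>" "\<alpha> \<le> 1" and \<kappa>: "0 < \<kappa>"
  shows "\<forall>\<^sub>F n in sequentially. 1/4 \<le> \<P>(g in goe_space n. 2 - 4 * \<tau> + \<alpha>\<^sup>2 * (lam - 1 - (1 + 2 * lam) * (3 * sqrt \<eta>1))
      - (26 + 28 * lam) * (\<kappa> + \<alpha>^4 * (1 + phi_const \<eta>1)) \<le> sdp_val lam n g)"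
proof -
  obtain m1 where m1: "m1\<^sup>2 + Complex 2 \<eta>1 * m1 + 1 = 0" "sqrt \<eta>1 / 4 \<le> Im m1" "cmod (m1 + 1) \<le> 2 * sqrt \<eta>1"
    using semicircle_root[of \<eta>1] \<eta>1 by auto
  obtain m2 where m2: "m2\<^sup>2 + Complex 2 \<eta>2 * m2 + 1 = 0" "sqrt \<eta>2 / 4 \<le> Im m2" "cmod (m2 + 1) \<le> 2 * sqrt \<eta>2"
    using semicircle_root[OF \<eta>2] by auto
  \<comment> \<open>Two of the three \<open>sqrt \<eta>1\<close> cover the distance of
    \<open>m1\<close> from -1; the third covers the random fluctuations for large n.\<close>
  define \<rho> where "\<rho> = 3 * sqrt \<eta>1"
  have s1: "0 < sqrt \<eta>1" "\<rho> \<le> 1/2" using \<eta>1 real_sqrt_le_mono[OF \<eta>1(2)] by (simp_all add: \<rho>_def real_sqrt_divide)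
  have s2: "0 < sqrt \<eta>2" "2 * sqrt \<eta>2 \<le> 1/2" using \<eta>2 real_sqrt_le_mono[OF \<eta>2(2)] by (simp_all add: real_sqrt_divide)
  have bound2: "cmod m \<le> 2" if "cmod (m + 1) \<le> 1" for m
    using norm_triangle_ineq4[of "m + 1" 1] that by simp
  \<comment> \<open>The deterministic approximation to the diagonal of Im G. It is of order
    \<open>sqrt \<eta>2\<close>, so \<open>\<eta>2 / d\<close> is small.\<close>
  define d where "d = Im m2"
  have d: "0 < d" using m2(2) s2(1) unfolding d_def by linarith
  have td: "sqrt (\<eta>2 / d) \<le> \<tau>"
  proof -
    have "\<eta>2 / d \<le> \<eta>2 / (sqrt \<eta>2 / 4)" using m2(2) s2(1) \<eta>2 d unfolding d_def by (intro divide_left_mono mult_pos_pos) auto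
    also have "\<dots> = 4 * (\<eta>2 / sqrt \<eta>2)" by simp
    also have "\<dots> = 4 * sqrt \<eta>2" using \<eta>2 by (simp only: real_div_sqrt)
    also have "\<dots> \<le> \<tau>\<^sup>2" by (rule \<tau>)
    finally show ?thesis using \<tau>(2) by (rule real_le_lsqrt[rotated 1])
  qed
  \<comment> \<open>\<open>C2\<close> will bound \<open>A\<close> on the good event uniformly in n,
    so that \<open>A / real n\<close> eventually drops below \<kappa>.\<close>
  define C2 where "C2 = (8 + 8 / \<eta>2^4) * sc_const \<eta>2 / d\<^sup>2"
  define C1 where "C1 = sqrt (16 / \<eta>1\<^sup>2) + sqrt (sc_const \<eta>1 / \<eta>1\<^sup>2)"
  have sc0: "0 \<le> sc_const \<eta>" if "0 < \<eta>" for \<eta> using that by (simp add: sc_const_def)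
  have "(\<lambda>n. C2 / real n) \<longlonglongrightarrow> 0" by real_asymp
  then have ev2: "\<forall>\<^sub>F n in sequentially. C2 / real n < \<kappa>" using \<kappa> by (rule order_tendstoD)
  have "(\<lambda>n. C1 / sqrt (real n)) \<longlonglongrightarrow> 0" by real_asymp
  then have ev1: "\<forall>\<^sub>F n in sequentially. C1 / sqrt (real n) < sqrt \<eta>1" using s1(1) by (rule order_tendstoD)
  show ?thesis
    using ev1 ev2 eventually_ge_at_top[of 1152]
  proof eventually_elim
    case (elim n)
    interpret P: prob_space "goe_space n" by (rule prob_space_gauss)
    have n: "0 < n" "0 < real n" using elim(3) by simp_all
    obtain E where E: "E \<in> sets (goe_space n)" "1/4 \<le> measure (goe_space n) E"
      "\<And>g. g \<in> E \<Longrightarrow> (\<Sum>i<n. (cmod (self_consistency n (Complex 2 \<eta>1) g i))\<^sup>2) \<le> sc_const \<eta>1"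
      "\<And>g. g \<in> E \<Longrightarrow> (\<Sum>i<n. (cmod (self_consistency n (Complex 2 \<eta>2) g i))\<^sup>2) \<le> sc_const \<eta>2"
      "\<And>g. g \<in> E \<Longrightarrow> (\<Sum>i<n. (cmod (goe_phi n (Complex 2 \<eta>1) g i))^4) \<le> real n * phi_const \<eta>1"
      "\<And>g. g \<in> E \<Longrightarrow> (cmod (goe_q n (Complex 2 \<eta>1) g - goe_s n (Complex 2 \<eta>1) g))\<^sup>2 \<le> 16 / (real n * \<eta>1\<^sup>2)"
      "\<And>g v. g \<in> E \<Longrightarrow> - 3 * (\<Sum>i<n. (v i)\<^sup>2) \<le> qform n (goe n g) v"
      by (rule good_event[OF \<eta>1(1) \<eta>2(1) elim(3)], rule that)
    have good: "2 - 4 * \<tau> + \<alpha>\<^sup>2 * (lam - 1 - (1 + 2 * lam) * (3 * sqrt \<eta>1))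
      - (26 + 28 * lam) * (\<kappa> + \<alpha>^4 * (1 + phi_const \<eta>1)) \<le> sdp_val lam n g" if g: "g \<in> E" for g
    proof -
      define q where "q = goe_q n (Complex 2 \<eta>1) g"
      define A where "A = (\<Sum>i<n. (Im (goe_res n (Complex 2 \<eta>2) g i i) / d - 1)\<^sup>2)"
      define P where "P = (\<Sum>i<n. (cmod (goe_phi n (Complex 2 \<eta>1) g i))^4)"
      have z1: "0 < Im (Complex 2 \<eta>1)" and z2: "0 < Im (Complex 2 \<eta>2)" using \<eta>1 \<eta>2 by simp_all
      interpret R1: sym_resolvent n "goe n g" "Complex 2 \<eta>1" "goe_res n (Complex 2 \<eta>1) g" by (rule sym_resolvent_goe[OF z1])
      have m1': "0 \<le> Im m1" "cmod m1 \<le> 2"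
      proof -
        show "0 \<le> Im m1" using m1(2) s1(1) by linarith
        show "cmod m1 \<le> 2" by (rule bound2) (use m1(3) s1(2)[unfolded \<rho>_def] in linarith)
      qed
      have m2': "0 \<le> Im m2" "cmod m2 \<le> 2"
      proof -
        show "0 \<le> Im m2" using m2(2) s2(1) by linarith
        show "cmod m2 \<le> 2" by (rule bound2) (use m2(3) s2 in linarith)
      qed
      have phi: "(\<Sum>k<n. of_real (goe n g i k) * goe_phi n (Complex 2 \<eta>1) g k) = Complex 2 \<eta>1 * goe_phi n (Complex 2 \<eta>1) g i + 1"
        if "i < n" for i
        using R1.res_apply[OF that, of "\<lambda>_. 1"] by (simp add: goe_phi_def)
      have "2 * real n - 4 * sqrt (\<eta>2 / d) * real n + \<alpha>\<^sup>2 * real n * (Re q + lam * (cmod q)\<^sup>2)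
        - (26 + 14 * (lam * cmod q)) * (A + \<alpha>^4 * (real n + P)) \<le> sdp (goe_mat lam n g)"
        unfolding q_def goe_q_def A_def P_def
        by (rule sdp_lower_bound[OF n(1) sym_resolvent_goe[OF z2] d E(7)[OF g] phi \<alpha> lam order_trans[OF td \<tau>(3)] goe_mat_carrier goe_mat_index])
      then have "(2 * real n - 4 * sqrt (\<eta>2 / d) * real n + \<alpha>\<^sup>2 * real n * (Re q + lam * (cmod q)\<^sup>2)
        - (26 + 14 * (lam * cmod q)) * (A + \<alpha>^4 * (real n + P))) / real n \<le> sdp_val lam n g"
        unfolding sdp_val_def by (rule divide_right_mono) simp
      also have "(2 * real n - 4 * sqrt (\<eta>2 / d) * real n + \<alpha>\<^sup>2 * real n * (Re q + lam * (cmod q)\<^sup>2)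
        - (26 + 14 * (lam * cmod q)) * (A + \<alpha>^4 * (real n + P))) / real n
        = 2 - 4 * sqrt (\<eta>2 / d) + \<alpha>\<^sup>2 * (Re q + lam * (cmod q)\<^sup>2) - (26 + 14 * (lam * cmod q)) * (A / real n + \<alpha>^4 * (1 + P / real n))"
        using n by (simp add: field_simps)
      finally have main: "2 - 4 * sqrt (\<eta>2 / d) + \<alpha>\<^sup>2 * (Re q + lam * (cmod q)\<^sup>2) - (26 + 14 * (lam * cmod q)) * (A / real n + \<alpha>^4 * (1 + P / real n)) \<le> sdp_val lam n g" .
      have Pn: "P / real n \<le> phi_const \<eta>1"
        using E(5)[OF g] n by (simp add: P_def divide_le_eq mult.commute)
      have An: "A / real n \<le> \<kappa>"
      proof -
        have "A \<le> (\<Sum>i<n. (cmod (goe_res n (Complex 2 \<eta>2) g i i - m2))\<^sup>2 / d\<^sup>2)"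
          unfolding A_def
        proof (rule sum_mono)
          fix i
          define x where "x = goe_res n (Complex 2 \<eta>2) g i i"
          have "Im x / d - 1 = Im (x - m2) / d" using d by (simp add: d_def diff_divide_distrib)
          then have "(Im x / d - 1)\<^sup>2 = (Im (x - m2))\<^sup>2 / d\<^sup>2" by (simp add: power_divide)
          also have "\<dots> \<le> (cmod (x - m2))\<^sup>2 / d\<^sup>2" by (intro divide_right_mono) (simp_all add: cmod_power2)
          finally show "(Im (goe_res n (Complex 2 \<eta>2) g i i) / d - 1)\<^sup>2 \<le> (cmod (goe_res n (Complex 2 \<eta>2) g i i - m2))\<^sup>2 / d\<^sup>2"
            unfolding x_def .
        qed
        also have "\<dots> = (\<Sum>i<n. (cmod (goe_res n (Complex 2 \<eta>2) g i i - m2))\<^sup>2) / d\<^sup>2" by (simp add: sum_divide_distrib)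
        also have "\<dots> \<le> (8 + 8 / \<eta>2^4) * (\<Sum>i<n. (cmod (self_consistency n (Complex 2 \<eta>2) g i))\<^sup>2) / d\<^sup>2"
          using distance_to_root(2)[OF z2 n(1) m2(1) m2', of g] by (intro divide_right_mono) auto
        also have "\<dots> \<le> (8 + 8 / \<eta>2^4) * sc_const \<eta>2 / d\<^sup>2"
          using E(4)[OF g] by (intro divide_right_mono mult_left_mono) auto
        finally have "A \<le> C2" by (simp add: C2_def)
        then have "A / real n \<le> C2 / real n" by (intro divide_right_mono) auto
        then show ?thesis using elim(2) by simp
      qed
      have q1: "cmod (q + 1) \<le> \<rho>"
      proof -
        define s where "s = goe_s n (Complex 2 \<eta>1) g"
        have "(cmod (q - s))\<^sup>2 \<le> 16 / \<eta>1\<^sup>2 / real n" using E(6)[OF g] by (simp add: q_def s_def mult.commute)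
        then have "cmod (q - s) \<le> sqrt (16 / \<eta>1\<^sup>2 / real n)" by (rule real_le_rsqrt)
        then have 1: "cmod (q - s) \<le> sqrt (16 / \<eta>1\<^sup>2) / sqrt (real n)" by (simp only: real_sqrt_divide)
        have "real n * (cmod (s - m1))\<^sup>2 \<le> (\<Sum>i<n. (cmod (self_consistency n (Complex 2 \<eta>1) g i))\<^sup>2) / \<eta>1\<^sup>2"
          using distance_to_root(1)[OF z1 n(1) m1(1) m1', of g] by (simp add: s_def)
        also have "\<dots> \<le> sc_const \<eta>1 / \<eta>1\<^sup>2" using E(3)[OF g] by (intro divide_right_mono) auto
        finally have "(cmod (s - m1))\<^sup>2 \<le> sc_const \<eta>1 / \<eta>1\<^sup>2 / real n" using n by (simp only: pos_le_divide_eq mult.commute)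
        then have "cmod (s - m1) \<le> sqrt (sc_const \<eta>1 / \<eta>1\<^sup>2 / real n)" by (rule real_le_rsqrt)
        then have 2: "cmod (s - m1) \<le> sqrt (sc_const \<eta>1 / \<eta>1\<^sup>2) / sqrt (real n)" by (simp only: real_sqrt_divide)
        have "q + 1 = (q - s) + (s - m1) + (m1 + 1)" by simp
        then have "cmod (q + 1) = cmod ((q - s) + (s - m1) + (m1 + 1))" by (rule arg_cong)
        also have "\<dots> \<le> cmod (q - s) + cmod (s - m1) + cmod (m1 + 1)"
          by (intro order_trans[OF norm_triangle_ineq] add_right_mono norm_triangle_ineq)
        also have "\<dots> \<le> C1 / sqrt (real n) + 2 * sqrt \<eta>1" using 1 2 m1(3) by (simp add: C1_def add_divide_distrib)
        also have "\<dots> \<le> \<rho>" using elim(1) by (simp add: \<rho>_def)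
        finally show ?thesis .
      qed
      define x where "x = cmod q"
      have x: "1 - \<rho> \<le> x" "x \<le> 1 + \<rho>"
        using norm_triangle_ineq4[of "q + 1" q] norm_triangle_ineq4[of "q + 1" 1] q1 by (simp_all add: x_def)
      \<comment> \<open>In modulus q is within \<rho> of 1; thus Re q is at least -1 - \<rho> and
        the squared modulus at least 1 - 2\<rho>.\<close>
      have gain: "lam - 1 - (1 + 2 * lam) * \<rho> \<le> Re q + lam * (cmod q)\<^sup>2"
      proof -
        have "- x \<le> Re q" using abs_Re_le_cmod[of q] by (simp add: x_def abs_le_iff)
        moreover have "1 - 2 * \<rho> \<le> x\<^sup>2"
        proof -
          have "(1 - \<rho>)\<^sup>2 \<le> x\<^sup>2" using x s1 by (intro power_mono) auto
          then show ?thesis using zero_le_power2[of \<rho>] unfolding power2_diff one_power2 mult_1_right by linarith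
        qed
        then have "lam * (1 - 2 * \<rho>) \<le> lam * x\<^sup>2" using lam by (rule mult_left_mono)
        ultimately show ?thesis using x(2) unfolding x_def[symmetric] by (simp add: algebra_simps)
      qed
      have "(26 + 14 * (lam * cmod q)) * (A / real n + \<alpha>^4 * (1 + P / real n)) \<le> (26 + 28 * lam) * (\<kappa> + \<alpha>^4 * (1 + phi_const \<eta>1))"
      proof (rule mult_mono)
        \<comment> \<open>The bound 2 on the modulus of q turns the 14 of
          \<open>sdp_lower_bound\<close> into 28.\<close>
        have "lam * cmod q \<le> lam * 2" using x s1 lam unfolding x_def by (intro mult_left_mono) auto
        then show "26 + 14 * (lam * cmod q) \<le> 26 + 28 * lam" by simp
        have "\<alpha>^4 * (1 + P / real n) \<le> \<alpha>^4 * (1 + phi_const \<eta>1)" using Pn by (intro mult_left_mono) auto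
        then show "A / real n + \<alpha>^4 * (1 + P / real n) \<le> \<kappa> + \<alpha>^4 * (1 + phi_const \<eta>1)" using An by linarith
        show "0 \<le> A / real n + \<alpha>^4 * (1 + P / real n)"
          unfolding A_def P_def by (intro add_nonneg_nonneg mult_nonneg_nonneg divide_nonneg_nonneg sum_nonneg) auto
      qed (use lam in auto)
      moreover have "\<alpha>\<^sup>2 * (lam - 1 - (1 + 2 * lam) * \<rho>) \<le> \<alpha>\<^sup>2 * (Re q + lam * (cmod q)\<^sup>2)"
        by (intro mult_left_mono gain) simp
      ultimately show ?thesis using main td unfolding \<rho>_def by linarith
    qed
    have "measure (goe_space n) E \<le> \<P>(g in goe_space n. 2 - 4 * \<tau> + \<alpha>\<^sup>2 * (lam - 1 - (1 + 2 * lam) * (3 * sqrt \<eta>1))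
      - (26 + 28 * lam) * (\<kappa> + \<alpha>^4 * (1 + phi_const \<eta>1)) \<le> sdp_val lam n g)"
    proof (rule P.finite_measure_mono)
      show "E \<subseteq> {g \<in> space (goe_space n).
        2 - 4 * \<tau> + \<alpha>\<^sup>2 * (lam - 1 - (1 + 2 * lam) * (3 * sqrt \<eta>1))
        - (26 + 28 * lam) * (\<kappa> + \<alpha>^4 * (1 + phi_const \<eta>1)) \<le> sdp_val lam n g}"
        using good sets.sets_into_space[OF E(1)] by auto
    qed measurable
    then show ?case using E(2) by linarith
  qed
qed

section \<open>Choice of parameters\<close>

text \<open>This value of \<open>\<eta>2\<close> makes \<open>4 * sqrt \<eta>2\<close> equal to
  \<open>\<tau>\<^sup>2\<close>, the largest allowed in
  \<open>sdp_val_lower_quarter\<close>.\<close>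

lemma small_eta:
  assumes "0 < \<tau>" "\<tau> \<le> (1 :: real)"
  shows "0 < (\<tau>\<^sup>2 / 4)\<^sup>2" "(\<tau>\<^sup>2 / 4)\<^sup>2 \<le> 1/16" "4 * sqrt ((\<tau>\<^sup>2 / 4)\<^sup>2) \<le> \<tau>\<^sup>2"
proof -
  have "\<tau>\<^sup>2 \<le> 1" using assms by (simp add: power_le_one)
  then have "(\<tau>\<^sup>2 / 4)\<^sup>2 \<le> (1 / 4)\<^sup>2" by (intro power_mono) auto
  then show "(\<tau>\<^sup>2 / 4)\<^sup>2 \<le> 1/16" by (simp add: power2_eq_square)
qed (use assms in auto)

text \<open>\<open>\<alpha> = 0\<close> switches off \<phi>, and 1/36 is just an admissible
  \<open>\<eta>1\<close>. The budget \<epsilon> is split evenly between \<tau>, \<kappa> and the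
  boost to probability one.\<close>

lemma sdp_val_lower:
  assumes lam: "0 \<le> lam" and \<epsilon>: "0 < \<epsilon>"
  shows "(\<lambda>n. \<P>(g in goe_space n. 2 - \<epsilon> \<le> sdp_val lam n g)) \<longlonglongrightarrow> 1"
proof -
  define \<tau> where "\<tau> = min 1 (\<epsilon> / 12)"
  have \<tau>: "0 < \<tau>" "\<tau> \<le> 1" "4 * \<tau> \<le> \<epsilon> / 3" using \<epsilon> by (auto simp: \<tau>_def min_def)
  define \<kappa> where "\<kappa> = \<epsilon> / 3 / (26 + 28 * lam)"
  have l: "0 < 26 + 28 * lam" using lam by simp
  have \<kappa>: "0 < \<kappa>" "(26 + 28 * lam) * \<kappa> = \<epsilon> / 3"
  proof -
    show "0 < \<kappa>" using l \<epsilon> by (simp add: \<kappa>_def)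
    have *: "c * (x / c) = x" if "c \<noteq> 0" for c x :: real using that by simp
    show "(26 + 28 * lam) * \<kappa> = \<epsilon> / 3" unfolding \<kappa>_def by (rule *) (use l in linarith)
  qed
  have "\<forall>\<^sub>F n in sequentially. 1/4 \<le> \<P>(g in goe_space n. 2 - 4 * \<tau> + 0\<^sup>2 * (lam - 1 - (1 + 2 * lam) * (3 * sqrt (1/36)))
      - (26 + 28 * lam) * (\<kappa> + 0^4 * (1 + phi_const (1/36))) \<le> sdp_val lam n g)"
    by (rule sdp_val_lower_quarter[OF lam _ _ small_eta(1,2)[OF \<tau>(1,2)] small_eta(3)[OF \<tau>(1,2)]]) (use \<tau> \<kappa> in auto)
  then have "\<forall>\<^sub>F n in sequentially. 1/4 \<le> \<P>(g in goe_space n. 2 - 4 * \<tau> - \<epsilon> / 3 \<le> sdp_val lam n g)"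
    using \<kappa>(2) by simp
  from sdp_val_boost[OF this, of "\<epsilon> / 3"] \<epsilon>
  have *: "(\<lambda>n. \<P>(g in goe_space n. 2 - 4 * \<tau> - \<epsilon> / 3 - \<epsilon> / 3 \<le> sdp_val lam n g)) \<longlonglongrightarrow> 1" by simp
  show ?thesis
  proof (rule tendsto_sandwich[OF _ _ * tendsto_const])
    show "\<forall>\<^sub>F n in sequentially. \<P>(g in goe_space n. 2 - 4 * \<tau> - \<epsilon> / 3 - \<epsilon> / 3 \<le> sdp_val lam n g)
      \<le> \<P>(g in goe_space n. 2 - \<epsilon> \<le> sdp_val lam n g)"
    proof (intro always_eventually allI)
      fix n
      interpret P: prob_space "goe_space n" by (rule prob_space_gauss)
      show "\<P>(g in goe_space n. 2 - 4 * \<tau> - \<epsilon> / 3 - \<epsilon> / 3 \<le> sdp_val lam n g)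
        \<le> \<P>(g in goe_space n. 2 - \<epsilon> \<le> sdp_val lam n g)"
        by (rule P.finite_measure_mono) (use \<tau>(3) in auto)
    qed
    show "\<forall>\<^sub>F n in sequentially. \<P>(g in goe_space n. 2 - \<epsilon> \<le> sdp_val lam n g) \<le> 1"
      by (intro always_eventually allI prob_space.prob_le_1[OF prob_space_gauss])
  qed
qed

text \<open>\<open>\<eta>1\<close> is chosen to bring q close enough to -1 that half of the gain
  \<open>lam - 1\<close> survives. This fixes \<open>phi_const \<eta>1\<close> and with it the bound
  on \<alpha>; the tolerances \<tau> and \<kappa> are then measured against the resulting
  gain.\<close>

lemma sdp_val_supercritical:
  assumes lam: "1 < lam"
  obtains \<Delta> where "0 < \<Delta>"
    "(\<lambda>n. \<P>(g in goe_space n. 2 + \<Delta> \<le> sdp_val lam n g)) \<longlonglongrightarrow> 1"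
proof -
  define \<mu> where "\<mu> = lam - 1"
  have \<mu>: "0 < \<mu>" using lam by (simp add: \<mu>_def)
  define r where "r = min (1/6) (\<mu> / (6 * (1 + 2 * lam)))"
  have r: "0 < r" "r \<le> 1/6"
  proof -
    have "0 < \<mu> / (6 * (1 + 2 * lam))" using \<mu> lam by (intro divide_pos_pos) auto
    then show "0 < r" by (simp only: r_def min_less_iff_conj) simp
    show "r \<le> 1/6" unfolding r_def by (rule min.cobounded1)
  qed
  have r3: "(1 + 2 * lam) * (3 * r) \<le> \<mu> / 2"
  proof -
    have "(1 + 2 * lam) * (3 * r) \<le> (1 + 2 * lam) * (3 * (\<mu> / (6 * (1 + 2 * lam))))"
      using lam by (intro mult_left_mono) (auto simp: r_def)
    also have "\<dots> = \<mu> / 2" using lam by (simp add: field_simps)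
    finally show ?thesis .
  qed
  define \<eta>1 where "\<eta>1 = r\<^sup>2"
  have \<eta>1: "0 < \<eta>1" "\<eta>1 \<le> 1/36" "sqrt \<eta>1 = r"
    using r power_mono[OF r(2), of 2] by (simp_all add: \<eta>1_def power2_eq_square)
  define L where "L = (26 + 28 * lam) * (1 + phi_const \<eta>1)"
  have phi0: "0 \<le> phi_const \<eta>1" using \<eta>1 by (simp add: phi_const_def)
  have L: "0 < L" using lam phi0 by (simp add: L_def)
  define a2 where "a2 = min 1 (\<mu> / (8 * L))"
  define \<alpha> where "\<alpha> = sqrt a2"
  have a2: "0 < a2" "a2 \<le> 1" "L * a2 \<le> \<mu> / 8"
  proof -
    show "0 < a2" "a2 \<le> 1" using \<mu> L by (auto simp: a2_def)
    have "L * a2 \<le> L * (\<mu> / (8 * L))" using L by (intro mult_left_mono) (auto simp: a2_def)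
    then show "L * a2 \<le> \<mu> / 8" using L by simp
  qed
  have \<alpha>: "0 \<le> \<alpha>" "\<alpha> \<le> 1" "\<alpha>\<^sup>2 = a2" "\<alpha>^4 = a2 * a2"
  proof -
    show "0 \<le> \<alpha>" "\<alpha> \<le> 1" using a2 by (simp_all add: \<alpha>_def)
    show *: "\<alpha>\<^sup>2 = a2" using a2 by (simp add: \<alpha>_def)
    have "\<alpha>^4 = \<alpha>\<^sup>2 * \<alpha>\<^sup>2" by (simp add: power2_eq_square power4_eq_xxxx)
    then show "\<alpha>^4 = a2 * a2" unfolding * .
  qed
  \<comment> \<open>The gain is at least 8\<gamma>; the \<alpha>^4 cost takes at most 2\<gamma>, and
    \<tau> and \<kappa> take at most \<gamma> each. Of the 4\<gamma> left, the boost uses one, so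
    \<Delta> is 3\<gamma>.\<close>
  define \<gamma> where "\<gamma> = a2 * \<mu> / 16"
  have \<gamma>: "0 < \<gamma>" using a2 \<mu> by (simp add: \<gamma>_def)
  define \<tau> where "\<tau> = min 1 (\<gamma> / 4)"
  have \<tau>: "0 < \<tau>" "\<tau> \<le> 1" "4 * \<tau> \<le> \<gamma>" using \<gamma> by (auto simp: \<tau>_def min_def)
  have l: "0 < 26 + 28 * lam" using lam by simp
  define \<kappa> where "\<kappa> = \<gamma> / (26 + 28 * lam)"
  have \<kappa>: "0 < \<kappa>" "(26 + 28 * lam) * \<kappa> = \<gamma>" using l \<gamma> by (simp_all add: \<kappa>_def)
  have lam0: "0 \<le> lam" using lam by simp
  have key: "\<forall>\<^sub>F n in sequentially. 1/4 \<le> \<P>(g in goe_space n. 2 - 4 * \<tau> + \<alpha>\<^sup>2 * (lam - 1 - (1 + 2 * lam) * (3 * sqrt \<eta>1))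
      - (26 + 28 * lam) * (\<kappa> + \<alpha>^4 * (1 + phi_const \<eta>1)) \<le> sdp_val lam n g)"
    by (rule sdp_val_lower_quarter[OF lam0 \<eta>1(1,2) small_eta(1,2)[OF \<tau>(1,2)] small_eta(3)[OF \<tau>(1,2)]]) (use \<tau> \<kappa> \<alpha> in auto)
  have val: "2 + 4 * \<gamma> \<le> 2 - 4 * \<tau> + \<alpha>\<^sup>2 * (lam - 1 - (1 + 2 * lam) * (3 * sqrt \<eta>1))
      - (26 + 28 * lam) * (\<kappa> + \<alpha>^4 * (1 + phi_const \<eta>1))"
  proof -
    have "a2 * (\<mu> / 2) \<le> a2 * (lam - 1 - (1 + 2 * lam) * (3 * r))"
      using r3 a2 by (intro mult_left_mono) (auto simp: \<mu>_def)
    moreover have "(26 + 28 * lam) * (\<kappa> + \<alpha>^4 * (1 + phi_const \<eta>1)) = \<gamma> + a2 * (L * a2)"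
      unfolding distrib_left[of "26 + 28 * lam" \<kappa>] \<kappa>(2) \<alpha>(4) L_def by (simp only: mult_ac)
    moreover have "a2 * (L * a2) \<le> a2 * (\<mu> / 8)" using a2 by (intro mult_left_mono) auto
    moreover have "a2 * (\<mu> / 2) = 8 * \<gamma>" "a2 * (\<mu> / 8) = 2 * \<gamma>" by (simp_all add: \<gamma>_def)
    ultimately show ?thesis using \<tau>(3) unfolding \<alpha>(3) \<eta>1(3) by linarith
  qed
  have "\<forall>\<^sub>F n in sequentially. 1/4 \<le> \<P>(g in goe_space n. 2 + 4 * \<gamma> \<le> sdp_val lam n g)"
    using key
  proof eventually_elim
    case (elim n)
    interpret P: prob_space "goe_space n" by (rule prob_space_gauss)
    show ?case
      by (rule order_trans[OF elim], rule P.finite_measure_mono) (use val in auto)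
  qed
  from sdp_val_boost[OF this \<gamma>]
  have "(\<lambda>n. \<P>(g in goe_space n. 2 + 3 * \<gamma> \<le> sdp_val lam n g)) \<longlonglongrightarrow> 1" by (simp add: add_diff_eq[symmetric])
  then show ?thesis using \<gamma> by (intro that[of "3 * \<gamma>"]) auto
qed

section \<open>Transfer to an arbitrary realisation of the ensemble\<close>

text \<open>Standardised entries on the upper triangle are independent standard normals, so their
  joint law is the product measure and SDP(B)/n is distributed as \<open>sdp_val\<close>. A general
  predicate \<open>Q\<close> covers intervals and half-lines at once.\<close>

lemma deformed_goe_transfer:
  assumes n: "0 < n" and B: "deformed_goe lam n M B" and Q: "Measurable.pred borel Q"
  shows "measure M {\<omega> \<in> space M. Q (sdp (B \<omega>) / real n)} = \<P>(g in goe_space n. Q (sdp_val lam n g))"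
proof -
  interpret prob_space M using B by (simp add: deformed_goe_def)
  have I: "{(i, j). i \<le> j \<and> j < n} = gidx n" by (simp add: gidx_def)
  have carr: "B \<omega> \<in> carrier_mat n n" and symB: "transpose_mat (B \<omega>) = B \<omega>" if "\<omega> \<in> space M" for \<omega>
    using B that by (auto simp: deformed_goe_def)
  have ind: "indep_vars (\<lambda>_. borel) (\<lambda>p \<omega>. B \<omega> $$ p) (gidx n)"
    using B unfolding deformed_goe_def I by blast
  define \<sigma> where "\<sigma> = (\<lambda>p :: nat \<times> nat. if fst p = snd p then sqrt (2 / real n) else sqrt (1 / real n))"
  have \<sigma>: "0 < \<sigma> p" for p using n by (simp add: \<sigma>_def)
  define X where "X = (\<lambda>p \<omega>. (B \<omega> $$ p - lam / real n) / \<sigma> p)"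
  have dist: "distributed M lborel (X p) std_normal_density" if p: "p \<in> gidx n" for p
  proof -
    obtain i j where ij: "p = (i, j)" "i \<le> j" "j < n" using p by (auto simp: gidx_def)
    have "distributed M lborel (\<lambda>\<omega>. B \<omega> $$ p) (normal_density (lam / n) (\<sigma> p))"
    proof (cases "i = j")
      case True
      then show ?thesis using B ij by (simp add: deformed_goe_def \<sigma>_def)
    next
      case False
      then show ?thesis using B ij by (simp add: deformed_goe_def \<sigma>_def)
    qed
    then show ?thesis unfolding X_def by (simp only: normal_standard_normal_convert[OF \<sigma>])
  qed
  have indX: "indep_vars (\<lambda>_. borel) X (gidx n)"
    unfolding X_def by (rule indep_vars_compose2[OF ind, of "\<lambda>p x. (x - lam / real n) / \<sigma> p" "\<lambda>_. borel"]) measurable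
  have rv: "random_variable borel (X p)" if "p \<in> gidx n" for p
    using distributed_measurable[OF dist[OF that]] by simp
  have dX: "distr M borel (X p) = N01" if "p \<in> gidx n" for p
  proof -
    have "distr M borel (X p) = distr M lborel (X p)" by (rule distr_cong) auto
    also have "\<dots> = N01" by (rule distributed_distr_eq_density[OF dist[OF that]])
    finally show ?thesis .
  qed
  have ne: "gidx n \<noteq> {}" using n by (auto simp: gidx_def)
  have sets_eq: "sets (\<Pi>\<^sub>M p\<in>gidx n. borel) = sets (gauss (gidx n))" by (rule sets_PiM_cong) auto
  have D: "distr M (gauss (gidx n)) (\<lambda>\<omega>. \<lambda>p\<in>gidx n. X p \<omega>) = gauss (gidx n)"
  proof -
    have "distr M (gauss (gidx n)) (\<lambda>\<omega>. \<lambda>p\<in>gidx n. X p \<omega>) = distr M (\<Pi>\<^sub>M p\<in>gidx n. borel) (\<lambda>\<omega>. \<lambda>p\<in>gidx n. X p \<omega>)"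
      by (rule distr_cong) (simp_all add: sets_eq)
    also have "\<dots> = (\<Pi>\<^sub>M p\<in>gidx n. distr M borel (X p))"
      by (rule iffD1[OF indep_vars_iff_distr_eq_PiM'[where X = X and M' = "\<lambda>_. borel", OF ne rv] indX])
    also have "\<dots> = gauss (gidx n)" by (rule PiM_cong) (simp_all add: dX)
    finally show ?thesis .
  qed
  have mX: "(\<lambda>\<omega>. \<lambda>p\<in>gidx n. X p \<omega>) \<in> measurable M (gauss (gidx n))"
    using rv by (intro measurable_restrict) simp
  have [measurable]: "sdp_val lam n \<in> borel_measurable (gauss (gidx n))"
  proof (rule lipschitz_measurable[OF finite_gidx])
    fix g h :: "nat \<times> nat \<Rightarrow> real"
    have "(\<Sum>p\<in>goe_coords n. (if p \<in> gidx n then 2 / (real n * sqrt (real n)) else 0) * \<bar>g p - h p\<bar>)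
      = (\<Sum>p\<in>gidx n. (if p \<in> gidx n then 2 / (real n * sqrt (real n)) else 0) * \<bar>g p - h p\<bar>)"
      by (rule sum.mono_neutral_right) (auto simp: goe_coords)
    then show "norm (sdp_val lam n g - sdp_val lam n h) \<le> (\<Sum>p\<in>gidx n. (if p \<in> gidx n then 2 / (real n * sqrt (real n)) else 0) * \<bar>g p - h p\<bar>)"
      using sdp_val_lipschitz[of lam n g h] by simp
  qed
  note Q[measurable]
  \<comment> \<open>Only the upper triangle was standardised; the symmetry of B recovers the entries
    below the diagonal.\<close>
  have goe_eq: "goe_mat lam n (\<lambda>p\<in>gidx n. X p \<omega>) = B \<omega>" if \<omega>: "\<omega> \<in> space M" for \<omega>
  proof (rule eq_matI)
    fix i j assume ij: "i < dim_row (B \<omega>)" "j < dim_col (B \<omega>)"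
    then have ij: "i < n" "j < n" using carr[OF \<omega>] by auto
    define p where "p = (min i j, max i j)"
    have p: "p \<in> gidx n" using ij by (auto simp: p_def gidx_def)
    have Bp: "B \<omega> $$ p = B \<omega> $$ (i, j)"
    proof (cases "i \<le> j")
      case False
      have "B \<omega> $$ (j, i) = transpose_mat (B \<omega>) $$ (i, j)" using ij carr[OF \<omega>] by simp
      then show ?thesis using False symB[OF \<omega>] by (simp add: p_def)
    qed (simp add: p_def)
    have "goe n (\<lambda>p\<in>gidx n. X p \<omega>) i j = \<sigma> p * X p \<omega>"
    proof (cases "i = j")
      case True
      then show ?thesis using p by (simp add: goe_def p_def \<sigma>_def real_sqrt_divide)
    next
      case False
      then have "min i j \<noteq> max i j" by auto
      then show ?thesis using p False by (simp add: goe_def p_def \<sigma>_def real_sqrt_divide)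
    qed
    also have "\<dots> = B \<omega> $$ (i, j) - lam / real n" using \<sigma>[of p] by (simp add: X_def Bp)
    finally show "goe_mat lam n (\<lambda>p\<in>gidx n. X p \<omega>) $$ (i, j) = B \<omega> $$ (i, j)"
      using ij by (simp add: goe_mat_index)
  qed (use carr[OF \<omega>] in \<open>auto simp: goe_mat_def\<close>)
  have "measure (gauss (gidx n)) {g \<in> space (gauss (gidx n)). Q (sdp_val lam n g)}
    = measure (distr M (gauss (gidx n)) (\<lambda>\<omega>. \<lambda>p\<in>gidx n. X p \<omega>)) {g \<in> space (gauss (gidx n)). Q (sdp_val lam n g)}"
    by (simp only: D)
  also have "\<dots> = measure M ((\<lambda>\<omega>. \<lambda>p\<in>gidx n. X p \<omega>) -` {g \<in> space (gauss (gidx n)). Q (sdp_val lam n g)} \<inter> space M)"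
    by (rule measure_distr[OF mX]) measurable
  also have "(\<lambda>\<omega>. \<lambda>p\<in>gidx n. X p \<omega>) -` {g \<in> space (gauss (gidx n)). Q (sdp_val lam n g)} \<inter> space M
      = {\<omega> \<in> space M. Q (sdp (B \<omega>) / real n)}"
    using measurable_space[OF mX] goe_eq by (auto simp: sdp_val_def)
  finally have 1: "measure M {\<omega> \<in> space M. Q (sdp (B \<omega>) / real n)} = measure (gauss (gidx n)) {g \<in> space (gauss (gidx n)). Q (sdp_val lam n g)}" ..
  have mr: "(\<lambda>g. restrict g (gidx n)) \<in> measurable (goe_space n) (gauss (gidx n))"
    by (rule measurable_restrict_subset[OF goe_coords(2)])
  \<comment> \<open>The Lipschitz constants vanish off \<open>gidx n\<close>, so dropping the
    auxiliary coordinates does not change the value.\<close>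
  have res: "sdp_val lam n (restrict g (gidx n)) = sdp_val lam n g" for g
  proof -
    have "\<bar>sdp_val lam n (restrict g (gidx n)) - sdp_val lam n g\<bar> \<le> (\<Sum>p\<in>goe_coords n. 0)"
      by (rule order_trans[OF sdp_val_lipschitz]) (intro sum_mono; simp)
    then show ?thesis by simp
  qed
  have "measure (gauss (gidx n)) {g \<in> space (gauss (gidx n)). Q (sdp_val lam n g)}
    = measure (distr (goe_space n) (gauss (gidx n)) (\<lambda>g. restrict g (gidx n))) {g \<in> space (gauss (gidx n)). Q (sdp_val lam n g)}"
    by (simp only: gauss_restrict[OF goe_coords, symmetric])
  also have "\<dots> = measure (goe_space n) ((\<lambda>g. restrict g (gidx n)) -` {g \<in> space (gauss (gidx n)). Q (sdp_val lam n g)} \<inter> space (goe_space n))"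
    by (rule measure_distr[OF mr]) measurable
  also have "(\<lambda>g. restrict g (gidx n)) -` {g \<in> space (gauss (gidx n)). Q (sdp_val lam n g)} \<inter> space (goe_space n)
     = {g \<in> space (goe_space n). Q (sdp_val lam n g)}"
    using measurable_space[OF mr] by (auto simp: res)
  finally show ?thesis unfolding 1 .
qed

theorem theorem3p4:
  fixes lam :: real
  assumes "0 \<le> lam"
  shows "(lam \<le> 1 \<longrightarrow>
      (\<forall>(M :: nat \<Rightarrow> 'a measure) (B :: nat \<Rightarrow> 'a \<Rightarrow> real mat).
        (\<forall>n>0. deformed_goe lam n (M n) (B n)) \<longrightarrow>
        (\<forall>\<epsilon>>0. (\<lambda>n. measure (M n)
            {\<omega> \<in> space (M n). sdp (B n \<omega>) / real n \<in> {2 - \<epsilon> .. 2 + \<epsilon>}}) \<longlonglongrightarrow> 1))) \<and>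
    (lam > 1 \<longrightarrow>
      (\<exists>\<Delta>>0. \<forall>(M :: nat \<Rightarrow> 'a measure) (B :: nat \<Rightarrow> 'a \<Rightarrow> real mat).
        (\<forall>n>0. deformed_goe lam n (M n) (B n)) \<longrightarrow>
        (\<lambda>n. measure (M n)
            {\<omega> \<in> space (M n). sdp (B n \<omega>) / real n \<ge> 2 + \<Delta>}) \<longlonglongrightarrow> 1))"
proof (intro conjI impI allI)
  fix M :: "nat \<Rightarrow> 'a measure" and B :: "nat \<Rightarrow> 'a \<Rightarrow> real mat" and \<epsilon> :: real
  assume lam: "lam \<le> 1" and B: "\<forall>n>0. deformed_goe lam n (M n) (B n)" and \<epsilon>: "0 < \<epsilon>"
  define p where "p = (\<lambda>n. \<P>(g in goe_space n. sdp_val lam n g \<in> {2 - \<epsilon>..2 + \<epsilon>}))"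
  define l where "l = (\<lambda>n. \<P>(g in goe_space n. 2 - \<epsilon> \<le> sdp_val lam n g))"
  define u where "u = (\<lambda>n. \<P>(g in goe_space n. sdp_val lam n g \<le> 2 + \<epsilon>))"
  \<comment> \<open>Inclusion-exclusion: the two one-sided events have probability tending to one,
    hence so does their intersection.\<close>
  have "(\<lambda>n. l n + u n - 1) \<longlonglongrightarrow> 1 + 1 - 1"
    unfolding l_def u_def by (intro tendsto_intros sdp_val_lower[OF assms \<epsilon>] sdp_val_upper[OF lam \<epsilon>])
  then have lu: "(\<lambda>n. l n + u n - 1) \<longlonglongrightarrow> 1" by simp
  have "p \<longlonglongrightarrow> 1"
  proof (rule tendsto_sandwich[OF _ _ lu tendsto_const])
    show "\<forall>\<^sub>F n in sequentially. l n + u n - 1 \<le> p n"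
    proof (intro always_eventually allI)
      fix n
      interpret P: prob_space "goe_space n" by (rule prob_space_gauss)
      define X where "X = {g \<in> space (goe_space n). 2 - \<epsilon> \<le> sdp_val lam n g}"
      define Y where "Y = {g \<in> space (goe_space n). sdp_val lam n g \<le> 2 + \<epsilon>}"
      have [measurable]: "X \<in> sets (goe_space n)" "Y \<in> sets (goe_space n)" unfolding X_def Y_def by measurable
      have "measure (goe_space n) X + measure (goe_space n) Y = measure (goe_space n) (X \<union> Y) + measure (goe_space n) (X \<inter> Y)"
        using P.finite_measure_Union'[of X Y] P.finite_measure_Diff'[of Y X] by (simp add: Int_commute)
      also have "measure (goe_space n) (X \<union> Y) \<le> 1" by (rule P.prob_le_1)
      also have "X \<inter> Y = {g \<in> space (goe_space n). sdp_val lam n g \<in> {2 - \<epsilon>..2 + \<epsilon>}}" by (auto simp: X_def Y_def)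
      finally show "l n + u n - 1 \<le> p n" by (simp add: l_def u_def p_def X_def Y_def)
    qed
    show "\<forall>\<^sub>F n in sequentially. p n \<le> 1"
      unfolding p_def by (intro always_eventually allI prob_space.prob_le_1[OF prob_space_gauss])
  qed
  moreover have "\<forall>\<^sub>F n in sequentially. p n = measure (M n) {\<omega> \<in> space (M n). sdp (B n \<omega>) / real n \<in> {2 - \<epsilon>..2 + \<epsilon>}}"
    using eventually_gt_at_top[of 0]
  proof eventually_elim
    case (elim n)
    show ?case
      unfolding p_def using deformed_goe_transfer[OF elim, of lam "M n" "B n" "\<lambda>x. x \<in> {2 - \<epsilon>..2 + \<epsilon>}"] B elim by simp
  qed
  ultimately show "(\<lambda>n. measure (M n) {\<omega> \<in> space (M n). sdp (B n \<omega>) / real n \<in> {2 - \<epsilon>..2 + \<epsilon>}}) \<longlonglongrightarrow> 1"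
    by (rule Lim_transform_eventually)
next
  assume lam: "1 < lam"
  \<comment> \<open>\<Delta> is obtained on the canonical Gaussian space, before \<open>M\<close>
    and \<open>B\<close> are introduced, so one value serves every realisation.\<close>
  obtain \<Delta> where \<Delta>: "0 < \<Delta>"
    "(\<lambda>n. \<P>(g in goe_space n. 2 + \<Delta> \<le> sdp_val lam n g)) \<longlonglongrightarrow> 1"
    using sdp_val_supercritical[OF lam] .
  have "(\<lambda>n. measure (M n) {\<omega> \<in> space (M n). sdp (B n \<omega>) / real n \<ge> 2 + \<Delta>}) \<longlonglongrightarrow> 1"
    if B: "\<forall>n>0. deformed_goe lam n (M n) (B n)" for M :: "nat \<Rightarrow> 'a measure" and B :: "nat \<Rightarrow> 'a \<Rightarrow> real mat"
  proof (rule Lim_transform_eventually[OF \<Delta>(2)])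
    show "\<forall>\<^sub>F n in sequentially. \<P>(g in goe_space n. 2 + \<Delta> \<le> sdp_val lam n g)
      = measure (M n) {\<omega> \<in> space (M n). sdp (B n \<omega>) / real n \<ge> 2 + \<Delta>}"
      using eventually_gt_at_top[of 0]
    proof eventually_elim
      case (elim n)
      show ?case
        using deformed_goe_transfer[OF elim, of lam "M n" "B n" "\<lambda>x. x \<ge> 2 + \<Delta>"] B elim by simp
    qed
  qed
  then show "\<exists>\<Delta>>0. \<forall>(M :: nat \<Rightarrow> 'a measure) (B :: nat \<Rightarrow> 'a \<Rightarrow> real mat).
        (\<forall>n>0. deformed_goe lam n (M n) (B n)) \<longrightarrow>
        (\<lambda>n. measure (M n) {\<omega> \<in> space (M n). sdp (B n \<omega>) / real n \<ge> 2 + \<Delta>}) \<longlonglongrightarrow> 1"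
    using \<Delta>(1) by blast
qed

end
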